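(* Consider an irreducible absorbing discrete-time Markov chain over a finite state space $S$, and let $Q$ be the matrix of transition probabilities over the $m$ non-absorbing states. Let $\mu_0$ be an arbitrary probability vector over the non-absorbing states and let $T_0\ge 1$. Then there exists a unique quasi-stationary distribution $\mu$ satisfying $$\mu' Q=\lambda\mu',\qquad \mu'\mathbf 1=1,\qquad \mu\ge 0,$$ and the iterates $(\mu_n,T_n)$ of the algorithm described in the context, started from $(\mu_0,T_0)$, converge to the point $\left(\mu,\frac{1}{1-\lambda}\right)$ with probability $1$. Furthermore, if $\lambda_{PV}$ is the principal eigenvalue of $Q$ and the other (non-principal) eigenvalues $\lambda_{NPV}$ of $Q$ satisfy $$\mathrm{Re}\left(\frac{1}{1-\lambda_{NPV}}\right)<\frac12\left(\frac{1}{1-\lambda_{PV}}\right)\qquad\text{for all non-principal eigenvalues }\lambda_{NPV},$$ then $\sqrt n\,(\mu_n-\mu)$ converges in distribution to $N(0,V)$ for some covariance matrix $V$.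
   Context: Setting: a discrete-time Markov chain on a finite state space $S$, with set of transient (non-absorbing) states $\mathcal T\subsetneq S$, $|\mathcal T|=m$ (all absorbing states may be merged into one). $Q$ is the $m\times m$ substochastic matrix of transition probabilities among the states of $\mathcal T$. "Irreducible absorbing" means that $Q$ is irreducible (not necessarily aperiodic) and that the chain can be absorbed (some row sum of $Q$ is less than $1$). A prime denotes transpose, $\mathbf 1$ is the all-ones vector, $\mathbb I$ is an indicator, and inequalities between vectors are entrywise. The principal eigenvalue of $Q$ is its Perron--Frobenius eigenvalue. Algorithm: start from a probability vector $\mu_0$ on $\mathcal T$ and $T_0\ge1$. For each $n\ge 0$, run a copy $(X^{(n+1)}_k)_{k\ge0}$ of the Markov chain with initial distribution $\mu_n$ (conditionally independent of the past given $\mu_n$) until the absorption time $\tau^{(n+1)}=\min\{k\ge0: X^{(n+1)}_k\notin\mathcal T\}$, and set, for $x\in\mathcal T$, $$\mu_{n+1}(x)=\mu_n(x)+\frac1{n+1}\cdot\frac{\sum_{l=0}^{\tau^{(n+1)}-1}\left(\mathbb I(X^{(n+1)}_l=x)-\mu_n(x)\right)}{T_n+\frac{\tau^{(n+1)}}{n+1}},\qquad T_{n+1}=T_n+\frac1{n+2}\left(\tau^{(n+1)}-T_n\right).$$ Equivalently, with $\tau^{(0)}:=T_0$, $T_n=\frac1{n+1}\sum_{j=0}^n\tau^{(j)}$. *)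

theory Defs
  imports "HOL-Probability.Probability"
begin

section \<open>Absorbing chains\<close>

text \<open>
  The finite state space is the disjoint sum \<open>'t + 'a\<close>: the states \<^term>\<open>Inl x\<close> are the transient
  ones and the states \<^term>\<open>Inr a\<close> are absorbing. Both types are nonempty, so the transient states
  form a nonempty proper subset of the state space.
\<close>

definition stochastic_matrix :: "real^'s^'s \<Rightarrow> bool" where
  "stochastic_matrix P \<longleftrightarrow> (\<forall>i j. 0 \<le> P $ i $ j) \<and> (\<forall>i. (\<Sum>j\<in>UNIV. P $ i $ j) = 1)"

definition transient_block :: "real^('t::finite + 'a::finite)^('t + 'a) \<Rightarrow> real^'t^'t" where
  "transient_block P = (\<chi> x y. P $ Inl x $ Inl y)"

text \<open>
  Strong connectivity of the graph of positive entries. The path of length zero is allowed, so every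
  nonnegative \<open>1 \<times> 1\<close> matrix, including the zero matrix, is irreducible.
\<close>

definition irreducible_matrix :: "real^'t^'t \<Rightarrow> bool" where
  "irreducible_matrix Q \<longleftrightarrow> (\<forall>x y. (x, y) \<in> {(i, j). 0 < Q $ i $ j}\<^sup>*)"

definition irreducible_absorbing_chain :: "real^('t::finite + 'a::finite)^('t + 'a) \<Rightarrow> bool" where
  "irreducible_absorbing_chain P \<longleftrightarrow>
     stochastic_matrix P \<and> (\<forall>a. P $ Inr a $ Inr a = 1) \<and>
     irreducible_matrix (transient_block P) \<and>
     (\<exists>x. (\<Sum>y\<in>UNIV. transient_block P $ x $ y) < 1)"

definition prob_vector :: "real^'t \<Rightarrow> bool" where
  "prob_vector \<mu> \<longleftrightarrow> (\<forall>x. 0 \<le> \<mu> $ x) \<and> (\<Sum>x\<in>UNIV. \<mu> $ x) = 1"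

definition quasi_stationary :: "real^'t^'t \<Rightarrow> real^'t \<Rightarrow> real \<Rightarrow> bool" where
  "quasi_stationary Q \<mu> lam \<longleftrightarrow> prob_vector \<mu> \<and> \<mu> v* Q = lam *\<^sub>R \<mu>"

definition complex_eigenvalue :: "real^'t^'t \<Rightarrow> complex \<Rightarrow> bool" where
  "complex_eigenvalue Q z \<longleftrightarrow>
     (\<exists>v::complex^'t. v \<noteq> 0 \<and> map_matrix complex_of_real Q *v v = z *s v)"

text \<open>
  The Perron--Frobenius eigenvalue is the spectral radius. For an irreducible nonnegative matrix it
  is a simple eigenvalue, so the other eigenvalues are exactly those different from it.
\<close>

definition principal_eigenvalue :: "real^'t^'t \<Rightarrow> real" where
  "principal_eigenvalue Q = Max (cmod ` {z. complex_eigenvalue Q z})"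


section \<open>The algorithm\<close>

text \<open>
  On a path that never leaves the transient states the value is an unspecified natural number; for
  irreducible absorbing chains such paths form a null set.
\<close>

definition absorption_time :: "(nat \<Rightarrow> 't + 'a) \<Rightarrow> nat" where
  "absorption_time X = (LEAST k. X k \<notin> range Inl)"

text \<open>The path of the run numbered \<open>j\<close> is \<open>X j\<close>, where \<open>j \<ge> 1\<close>; the entry \<open>X 0\<close> is not used.\<close>

primrec iterate ::
  "(nat \<Rightarrow> nat \<Rightarrow> 't + 'a) \<Rightarrow> real^'t \<Rightarrow> real \<Rightarrow> nat \<Rightarrow> (real^'t) \<times> real" where
  "iterate X \<mu>0 T0 0 = (\<mu>0, T0)"
| "iterate X \<mu>0 T0 (Suc n) =
     (let (\<mu>, T) = iterate X \<mu>0 T0 n; \<tau> = absorption_time (X (Suc n)) in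
       (\<chi> x. \<mu> $ x + 1 / real (n + 1) *
              ((\<Sum>l<\<tau>. (indicator {Inl x} (X (Suc n) l) - \<mu> $ x)) / (T + real \<tau> / real (n + 1))),
        T + 1 / real (n + 2) * (real \<tau> - T)))"

definition past :: "'w measure \<Rightarrow> (nat \<Rightarrow> nat \<Rightarrow> 'w \<Rightarrow> 's) \<Rightarrow> nat \<Rightarrow> 'w measure" where
  "past M X n = sigma (space M) {X j k -` A \<inter> space M | j k A. 1 \<le> j \<and> j \<le> n}"

definition initial_prob :: "real^'t \<Rightarrow> 't + 'a \<Rightarrow> real" where
  "initial_prob \<mu> s = (case s of Inl x \<Rightarrow> \<mu> $ x | Inr _ \<Rightarrow> 0)"

text \<open>
  Conditionally on the past runs, the next run is a Markov chain with transition matrix \<open>P\<close> and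
  initial distribution the current iterate; this is expressed by its finite-dimensional laws.
\<close>

definition algorithm_run ::
  "real^('t::finite + 'a::finite)^('t + 'a) \<Rightarrow> real^'t \<Rightarrow> real \<Rightarrow> 'w measure \<Rightarrow> (nat \<Rightarrow> nat \<Rightarrow> 'w \<Rightarrow> 't + 'a) \<Rightarrow> bool"
where
  "algorithm_run P \<mu>0 T0 M X \<longleftrightarrow>
     prob_space M \<and>
     (\<forall>n\<ge>1. \<forall>k. X n k \<in> measurable M (count_space UNIV)) \<and>
     (\<forall>n k s. AE \<omega> in M.
        real_cond_exp M (past M X n) (indicator {\<omega> \<in> space M. \<forall>i\<le>k. X (Suc n) i \<omega> = s i}) \<omega> =
        initial_prob (fst (iterate (\<lambda>j l. X j l \<omega>) \<mu>0 T0 n)) (s 0) *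
          (\<Prod>i<k. P $ s i $ s (Suc i)))"


section \<open>Convergence in distribution and normal laws\<close>

definition converges_in_distribution ::
  "'w measure \<Rightarrow> (nat \<Rightarrow> 'w \<Rightarrow> 'b::euclidean_space) \<Rightarrow> 'b measure \<Rightarrow> bool" where
  "converges_in_distribution M Y N \<longleftrightarrow>
     (\<forall>n. Y n \<in> borel_measurable M) \<and>
     (\<forall>f::'b \<Rightarrow> real. continuous_on UNIV f \<and> bounded (range f) \<longrightarrow>
        (\<lambda>n. \<integral>x. f x \<partial>distr M borel (Y n)) \<longlonglongrightarrow> (\<integral>x. f x \<partial>N))"

definition covariance_matrix :: "real^'n^'n \<Rightarrow> bool" where
  "covariance_matrix V \<longleftrightarrow> transpose V = V \<and> (\<forall>x. 0 \<le> x \<bullet> (V *v x))"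

definition normal_law :: "real \<Rightarrow> real \<Rightarrow> real measure" where
  "normal_law m v = (if v = 0 then return borel m else density lborel (normal_density m (sqrt v)))"

text \<open>
  The law \<open>N(m, V)\<close>, with \<open>V\<close> possibly singular: every linear functional is normally distributed,
  with the mean and the variance prescribed by \<open>m\<close> and \<open>V\<close>.
\<close>

definition multivariate_normal :: "real^'n \<Rightarrow> real^'n^'n \<Rightarrow> (real^'n) measure \<Rightarrow> bool" where
  "multivariate_normal m V N \<longleftrightarrow>
     prob_space N \<and> sets N = sets borel \<and>
     (\<forall>t. distr N borel (\<lambda>x. t \<bullet> x) = normal_law (t \<bullet> m) (t \<bullet> (V *v t)))"

end

theory Submission
  imports Defs "HOL-Computational_Algebra.Fundamental_Theorem_Algebra"
begin

text \<open>
  Put \<open>S\<^sub>n = (n + 1) T\<^sub>n\<close> and \<open>W\<^sub>n = S\<^sub>n \<mu>\<^sub>n\<close>. A run adds its absorption time to \<open>S\<^sub>n\<close> and its vector of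
  occupation counts to \<open>W\<^sub>n\<close>. Given the past, these counts have mean \<open>\<mu>\<^sub>n G\<close> with \<open>G = (I - Q)\<^sup>-\<^sup>1\<close>, so the
  deviation \<open>d\<^sub>n = S\<^sub>n (\<mu>\<^sub>n - \<mu>)\<close> has the exactly linear drift \<open>d\<^sub>n K / S\<^sub>n\<close>, where
  \<open>K = G (I - 1\<mu>')\<close> has the eigenvalues \<open>0\<close> and \<open>1 / (1 - z)\<close> for the non-principal eigenvalues \<open>z\<close> of \<open>Q\<close>.
  All of them have real part less than \<open>\<gamma> = 1 / (1 - \<lambda>)\<close>, hence \<open>b (xK) x \<le> \<kappa> b x x\<close> for some inner product
  \<open>b\<close> and some \<open>\<kappa> < \<gamma>\<close>. If \<open>u\<close> is the right Perron vector, \<open>W\<^sub>n \<cdot> u\<close> grows at the rate \<open>\<gamma>\<close>, and the Lyapunov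
  function \<open>b d\<^sub>n d\<^sub>n / (W\<^sub>n \<cdot> u)\<^sup>2\<close> of the deviation decreases up to summable errors. This yields
  \<open>\<Sum> V\<^sub>n / n < \<infinity>\<close> for its values \<open>V\<^sub>n\<close>, and they tend to \<open>0\<close> because they vary slowly.

  Under the spectral gap condition \<open>\<kappa> < \<gamma> / 2\<close> can be achieved. Then replacing the random rate \<open>1 / S\<^sub>n\<close> by
  \<open>1 / (\<gamma> (n + 1))\<close> changes the deviation by \<open>o(\<surd>n)\<close> in probability. The characteristic functions of the
  normalised linear recursion satisfy an approximate recursion along the contraction \<open>t \<mapsto> pull n t\<close>, of which
  the Gaussian with the covariance matrix solving a Lyapunov equation is an approximate fixed point.
\<close>

section \<open>Annihilating polynomials and adapted inner products\<close>

text \<open>The growth rate of \<open>S\<close> is not known in advance: its conditional drift, the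
  total mass of \<open>\<mu>\<^sub>n G\<close>, depends on the iterate, so the deviation cannot be
  measured against \<open>S\<close> before convergence is established. The functional
  \<open>W\<^sub>n \<cdot> u\<close> escapes this because \<open>G u = \<gamma> u\<close> makes its
  drift exactly \<open>\<gamma> (W\<^sub>n \<cdot> u) / S\<^sub>n\<close> at every iterate, and
  positivity of \<open>u\<close> keeps it comparable to \<open>S\<close>. The same random factor
  \<open>1 / S\<^sub>n\<close> stands in both drifts, and only the comparison of
  \<open>\<kappa>\<close> with \<open>\<gamma>\<close> is left; the limit of
  \<open>T\<^sub>n\<close> comes afterwards. Only real parts of eigenvalues are compared, so a
  periodic \<open>Q\<close> does no harm.

  In the limit theorem the one-step error of the characteristic functions is only
  \<open>o(1 / n)\<close>, which need not be summable. It is therefore measured relative to a norm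
  of \<open>t\<close>, which every pull-back shrinks. The approximation by the linear recursion
  holds in truncated mean only, because the index from which the random rate is close to its limit
  depends on the path.\<close>

definition inner_form :: "('v::euclidean_space \<Rightarrow> 'v \<Rightarrow> real) \<Rightarrow> bool" where
  "inner_form b \<longleftrightarrow> bilinear b \<and> (\<forall>x y. b x y = b y x) \<and> (\<forall>x. (norm x)\<^sup>2 \<le> b x x)"

primrec matrix_power :: "'a::comm_ring_1^'n^'n \<Rightarrow> nat \<Rightarrow> 'a^'n^'n" where
  "matrix_power A 0 = mat 1"
| "matrix_power A (Suc k) = A ** matrix_power A k"

text \<open>This is the vector \<open>p(A) x\<close>, computed by Horner's rule.\<close>

definition poly_action :: "complex^'n^'n \<Rightarrow> complex poly \<Rightarrow> complex^'n \<Rightarrow> complex^'n" where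
  "poly_action A p = fold_coeffs (\<lambda>a f x. a *s x + A *v f x) p (\<lambda>x. 0)"

lemma poly_action_0 [simp]: "poly_action A 0 x = 0"
  by (simp add: poly_action_def)

lemma poly_action_pCons [simp]: "poly_action A (pCons a p) x = a *s x + A *v poly_action A p x"
proof (cases "p = 0 \<and> a = 0")
  case True
  then show ?thesis by simp
next
  case False
  then show ?thesis
    by (auto simp: poly_action_def fold_coeffs_pCons_not_0_0_eq fold_coeffs_pCons_coeff_not_0_eq)
qed

lemma poly_action_add: "poly_action A (p + q) x = poly_action A p x + poly_action A q x"
  by (induction p q rule: poly_induct2)
     (simp_all add: vector_sadd_rdistrib matrix_vector_right_distrib)

lemma poly_action_smult: "poly_action A (smult c p) x = c *s poly_action A p x"
  by (induction p) (simp_all add: vector_add_ldistrib vector_scalar_commute)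

lemma poly_action_commute: "poly_action A p (A *v x) = A *v poly_action A p x"
  by (induction p) (simp_all add: matrix_vector_right_distrib vector_scalar_commute)

lemma poly_action_linear:
  "poly_action A p (x + y) = poly_action A p x + poly_action A p y"
  "poly_action A p (c *s x) = c *s poly_action A p x"
  "poly_action A p (x - y) = poly_action A p x - poly_action A p y"
  by (induction p)
     (simp_all add: matrix_vector_right_distrib vector_add_ldistrib vector_scalar_commute
        vector_smult_assoc mult.commute matrix_vector_mult_diff_distrib vector_ssub_ldistrib)

lemma poly_action_root_factor:
  "poly_action A ([:-z, 1:] * q) x = A *v poly_action A q x - z *s poly_action A q x"
proof -
  have "[:-z, 1:] * q = smult (-z) q + pCons 0 q" by simp
  then show ?thesis by (simp only: poly_action_add poly_action_smult) (simp add: vector_smult_lneg)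
qed

lemma poly_action_eigenvector:
  assumes "A *v x = z *s x"
  shows "poly_action A p x = poly p z *s x"
proof (induction p)
  case (pCons a p)
  have "A *v (poly p z *s x) = poly p z *s (A *v x)" by (rule vector_scalar_commute)
  with pCons show ?case
    by (simp add: assms vector_sadd_rdistrib vector_smult_assoc mult.commute)
qed simp

lemma poly_action_monom: "poly_action A (monom c k) x = c *s (matrix_power A k *v x)"
  by (induction k) (simp_all add: monom_0 monom_Suc vector_scalar_commute matrix_vector_mul_assoc)

lemma poly_action_sum: "finite I \<Longrightarrow> poly_action A (\<Sum>i\<in>I. f i) x = (\<Sum>i\<in>I. poly_action A (f i) x)"
  by (induction I rule: finite_induct) (simp_all add: poly_action_add)

lemma scaleR_vector_smult: "(c::real) *\<^sub>R (x::complex^'n) = complex_of_real c *s x"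
  unfolding vec_eq_iff vector_scaleR_component vector_smult_component by (simp add: scaleR_conv_of_real)

lemma sum_matrix_vector_mult:
  fixes f :: "'i \<Rightarrow> 'a::comm_ring_1^'n^'m"
  shows "(\<Sum>i\<in>I. f i) *v x = (\<Sum>i\<in>I. f i *v x)"
  by (induction I rule: infinite_finite_induct) (auto simp: matrix_vector_mult_add_rdistrib)

text \<open>Dimension count: one more power of \<open>A\<close> than the real dimension of the space
  of matrices gives a nontrivial real linear relation, whose coefficients are read as a
  polynomial.\<close>

lemma annihilating_poly_exists:
  fixes A :: "complex^'n^'n"
  obtains p where "p \<noteq> 0" "\<And>x. poly_action A p x = 0"
proof -
  let ?N = "DIM(complex^'n^'n)"
  have "\<exists>c::nat\<Rightarrow>real. (\<exists>i\<le>?N. c i \<noteq> 0) \<and> (\<Sum>i\<le>?N. c i *\<^sub>R matrix_power A i) = 0"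
  \<comment> \<open>Linear dependence is a property of sets, so the count needs pairwise distinct
    powers; two equal powers give a relation directly.\<close>
  proof (cases "inj_on (matrix_power A) {..?N}")
    case True
    have "card (matrix_power A ` {..?N}) > ?N"
      using True by (simp add: card_image)
    then have "dependent (matrix_power A ` {..?N})"
      using dependent_biggerset by blast
    then obtain u where u: "(\<Sum>i\<le>?N. u (matrix_power A i) *\<^sub>R matrix_power A i) = 0"
      "\<exists>v\<in>matrix_power A ` {..?N}. u v \<noteq> 0"
      using real_vector.dependent_finite[of "matrix_power A ` {..?N}"]
      unfolding sum.reindex[OF True] o_def by (smt (verit) finite_imageI finite_atMost imageE)
    then show ?thesis by (intro exI[of _ "\<lambda>i. u (matrix_power A i)"]) blast
  next
    case False
    then obtain i j where ij: "i \<le> ?N" "j \<le> ?N" "i \<noteq> j" "matrix_power A i = matrix_power A j"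
      by (auto simp: inj_on_def)
    let ?c = "\<lambda>k. if k = i then 1 else if k = j then -1 else (0::real)"
    have "(\<Sum>k\<le>?N. ?c k *\<^sub>R matrix_power A k) = (\<Sum>k\<in>{i,j}. ?c k *\<^sub>R matrix_power A k)"
      by (rule sum.mono_neutral_right) (use ij in auto)
    also have "\<dots> = 0" using ij by simp
    finally show ?thesis using ij by (intro exI[of _ ?c]) auto
  qed
  then obtain c :: "nat \<Rightarrow> real" and i where c: "i \<le> ?N" "c i \<noteq> 0"
    "(\<Sum>i\<le>?N. c i *\<^sub>R matrix_power A i) = 0" by blast
  let ?p = "\<Sum>i\<le>?N. monom (complex_of_real (c i)) i"
  have "coeff ?p i \<noteq> 0" using c by (simp add: coeff_sum)
  then have "?p \<noteq> 0" by fastforce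
  moreover have "poly_action A ?p x = 0" for x
  proof -
    have *: "complex_of_real r *s (B *v x) = (r *\<^sub>R B) *v x" for r and B :: "complex^'n^'n"
      unfolding vec_eq_iff matrix_vector_mult_def vector_smult_component vector_scaleR_component
      by (simp add: sum_distrib_left scaleR_conv_of_real mult.assoc)
    have "poly_action A ?p x = (\<Sum>i\<le>?N. c i *\<^sub>R matrix_power A i) *v x"
      by (simp only: sum_matrix_vector_mult poly_action_sum finite_atMost poly_action_monom *)
    then show ?thesis by (simp only: c matrix_vector_mult_0)
  qed
  ultimately show ?thesis by (rule that)
qed

text \<open>Minimality of the degree turns roots into eigenvalues: if \<open>p = (X - z) q\<close>,
  the degree of \<open>q\<close> is too small to annihilate, and any nonzero vector
  \<open>q(A) x\<close> is an eigenvector for \<open>z\<close>.\<close>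

lemma minimal_annihilating_poly:
  fixes A :: "complex^'n^'n"
  obtains p where "p \<noteq> 0" "\<And>x. poly_action A p x = 0"
    "\<And>z. poly p z = 0 \<Longrightarrow> \<exists>v. v \<noteq> 0 \<and> A *v v = z *s v"
proof -
  let ?P = "\<lambda>p. p \<noteq> 0 \<and> (\<forall>x. poly_action A p x = 0)"
  obtain p0 where "?P p0"
    by (rule annihilating_poly_exists[of A]) blast
  then have p: "?P (arg_min degree ?P)" by (rule arg_min_natI)
  have min: "degree (arg_min degree ?P) \<le> degree q" if "?P q" for q
    using that by (rule arg_min_nat_le)
  define p where "p = arg_min degree ?P"
  have "\<exists>v. v \<noteq> 0 \<and> A *v v = z *s v" if z: "poly p z = 0" for z
  proof -
    obtain q where q: "p = [:-z, 1:] * q" using z by (metis poly_eq_0_iff_dvd dvdE)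
    have "q \<noteq> 0" using p q by (auto simp: p_def)
    then have "degree p = Suc (degree q)" unfolding q by (subst degree_mult_eq) auto
    then obtain x where x: "poly_action A q x \<noteq> 0"
      using min[of q] \<open>q \<noteq> 0\<close> by (fastforce simp: p_def)
    have "poly_action A p x = 0" using p by (auto simp: p_def)
    then have "A *v poly_action A q x = z *s poly_action A q x"
      unfolding q poly_action_root_factor by simp
    with x show ?thesis by blast
  qed
  with p show ?thesis by (intro that[of p]) (auto simp: p_def)
qed

text \<open>Every eigenvalue is a root of an annihilating polynomial. Finiteness makes the
  \<open>Max\<close> in \<open>principal_eigenvalue\<close> and the maxima of real parts below
  meaningful.\<close>

lemma finite_complex_eigenvalues: "finite {z. complex_eigenvalue (Q::real^'n^'n) z}"
proof -
  obtain p where p: "p \<noteq> 0" "\<And>x. poly_action (map_matrix complex_of_real Q) p x = 0"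
    using annihilating_poly_exists by blast
  have "{z. complex_eigenvalue Q z} \<subseteq> {z. poly p z = 0}"
  proof (clarsimp simp: complex_eigenvalue_def)
    fix z v assume "v \<noteq> 0" "map_matrix complex_of_real Q *v v = z *s v"
    then show "poly p z = 0"
      using p(2)[of v] poly_action_eigenvector[of "map_matrix complex_of_real Q" v z p]
      by (metis vector_mul_eq_0)
  qed
  then show ?thesis using poly_roots_finite[OF p(1)] finite_subset by blast
qed

section \<open>Inner products adapted to a bound on the spectrum\<close>

lemma inner_smult_self: "(z *s y) \<bullet> y = Re z * (norm y)\<^sup>2" for y :: "complex^'n"
proof -
  have "(z *s y) \<bullet> y = (\<Sum>i\<in>UNIV. Re z * (y $ i \<bullet> y $ i))"
    unfolding inner_vec_def by (intro sum.cong) (auto simp: inner_complex_def algebra_simps)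
  also have "\<dots> = Re z * (y \<bullet> y)" by (simp add: inner_vec_def sum_distrib_left)
  finally show ?thesis by (simp add: power2_norm_eq_inner)
qed

lemma linear_smult_complex [simp]: "linear (\<lambda>x::complex^'n. z *s x)"
  by (rule linearI) (simp_all add: vector_add_ldistrib scaleR_vector_smult vector_smult_assoc mult.commute)

text \<open>A replacement for a Jordan form with small off-diagonal entries. For
  \<open>p = (X - z) q\<close> the operator \<open>D = A - z\<close> maps the kernel of
  \<open>p(A)\<close> into that of \<open>q(A)\<close>, where the form from the induction hypothesis
  works. In \<open>A y = z y + D y\<close> the disturbance \<open>D y\<close> is dominated by giving
  \<open>b (D x) (D y)\<close> enough weight. The form lives on the whole space, the inequality only
  on the kernel of \<open>p(A)\<close>.\<close>

lemma stable_form_poly: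
  fixes A :: "complex^'n^'n"
  assumes "p \<noteq> 0" "\<And>z. poly p z = 0 \<Longrightarrow> Re z < \<kappa>"
  shows "\<exists>b. inner_form b \<and> (\<forall>y. poly_action A p y = 0 \<longrightarrow> b (A *v y) y \<le> \<kappa> * b y y)"
  using assms
proof (induction "degree p" arbitrary: p \<kappa>)
  case 0
  then obtain a where a: "p = [:a:]" "a \<noteq> 0" by (metis degree_eq_zeroE pCons_0_0)
  have "inner_form (\<lambda>x y :: complex^'n. x \<bullet> y)"
    by (auto simp: inner_form_def inner_commute power2_norm_eq_inner bilinear_conv_bounded_bilinear bounded_bilinear_inner)
  moreover have "y = 0" if "poly_action A p y = 0" for y
    using that a by (auto simp: vec_eq_iff)
  ultimately show ?case by (intro exI[of _ "(\<bullet>)"]) fastforce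
next
  case (Suc d)
  have "\<not> constant (poly p)" using Suc.hyps constant_degree[of p] by auto
  then obtain z where z: "poly p z = 0" using fundamental_theorem_of_algebra by blast
  then obtain q where q: "p = [:-z, 1:] * q" by (metis poly_eq_0_iff_dvd dvdE)
  have "q \<noteq> 0" using Suc.prems q by auto
  have dq: "d = degree q" using Suc.hyps \<open>q \<noteq> 0\<close> unfolding q by (subst (asm) degree_mult_eq) auto
  define S where "S = insert z {w. poly q w = 0}"
  have "finite S" "S \<noteq> {}" unfolding S_def using poly_roots_finite[OF \<open>q \<noteq> 0\<close>] by auto
  have roots: "Re w < \<kappa>" if "w \<in> S" for w
    using that Suc.prems(2)[of w] z by (auto simp: S_def q)
  \<comment> \<open>Finitely many roots leave room for a bound \<open>\<kappa>1\<close> strictly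
    below \<open>\<kappa>\<close>; the difference \<open>\<epsilon>\<close> pays for the cross term
    created by the new root.\<close>
  have "Max (Re ` S) < \<kappa>" using \<open>finite S\<close> \<open>S \<noteq> {}\<close> roots by auto
  then obtain \<kappa>1 where k1: "Max (Re ` S) < \<kappa>1" "\<kappa>1 < \<kappa>" using dense by blast
  have r1: "Re w < \<kappa>1" if "w \<in> S" for w
    using k1(1) \<open>finite S\<close> that by (meson Max_ge finite_imageI imageI le_less_trans)
  obtain b where b: "inner_form b" "\<And>y. poly_action A q y = 0 \<Longrightarrow> b (A *v y) y \<le> \<kappa>1 * b y y"
    using Suc.hyps(1)[OF dq \<open>q \<noteq> 0\<close>, of \<kappa>1] r1 by (auto simp: S_def)
  have bil: "bilinear b" and sym: "\<And>x y. b x y = b y x" and pos: "\<And>x. (norm x)\<^sup>2 \<le> b x x"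
    using b(1) by (auto simp: inner_form_def)
  define D where "D y = A *v y - z *s y" for y
  have linD: "linear D" unfolding D_def by (intro linear_compose_sub) auto
  define \<epsilon> where "\<epsilon> = \<kappa> - \<kappa>1"
  have e: "\<epsilon> > 0" using k1 by (simp add: \<epsilon>_def)
  \<comment> \<open>Young's inequality leaves \<open>b (D y) (D y) / (4 * \<epsilon>)\<close>. This
    \<open>c\<close> makes it equal to \<open>c * \<epsilon> * b (D y) (D y)\<close>, just the slack
    between \<open>\<kappa>1\<close> and \<open>\<kappa>\<close> in the second summand of
    \<open>b'\<close>.\<close>
  define c where "c = 1 / (4 * \<epsilon>\<^sup>2)"
  have c: "c > 0" using e by (simp add: c_def)
  \<comment> \<open>The Euclidean summand secures the lower bound by \<open>(norm x)\<^sup>2\<close>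
    in \<open>inner_form\<close>, which stands for positive definiteness and frees later comparisons
    with the norm from a constant.\<close>
  define b' where "b' x y = x \<bullet> y + c * b (D x) (D y)" for x y
  have lb: "linear (\<lambda>x. b x y)" "linear (\<lambda>y. b x y)" for x y
    using bil by (auto simp: bilinear_def)
  have "bilinear b'"
    unfolding bilinear_def b'_def
    by (intro conjI allI linearI)
       (simp_all add: linear_add[OF linD] linear_scale[OF linD] linear_add[OF lb(1)] linear_add[OF lb(2)]
         linear_scale[OF lb(1)] linear_scale[OF lb(2)] inner_add_left inner_add_right algebra_simps)
  moreover have "b' x y = b' y x" for x y by (simp add: b'_def inner_commute sym)
  moreover have "(norm x)\<^sup>2 \<le> b' x x" for x
  proof -
    have "0 \<le> b (D x) (D x)" using pos[of "D x"] zero_le_power2[of "norm (D x)"] by linarith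
    then show ?thesis using c by (simp add: b'_def power2_norm_eq_inner)
  qed
  moreover have "b' (A *v y) y \<le> \<kappa> * b' y y" if y: "poly_action A p y = 0" for y
  proof -
    have "poly_action A q (D y) = 0"
      using y unfolding q poly_action_root_factor D_def
      by (simp add: poly_action_linear poly_action_commute)
    then have 1: "b (A *v D y) (D y) \<le> \<kappa>1 * b (D y) (D y)" by (rule b(2))
    have DA: "D (A *v y) = A *v D y"
      by (simp add: D_def matrix_vector_mult_diff_distrib vector_scalar_commute)
    have "(A *v y) \<bullet> y = D y \<bullet> y + Re z * (norm y)\<^sup>2"
      by (simp add: D_def inner_diff_left inner_smult_self)
    also have "D y \<bullet> y \<le> norm (D y) * norm y" by (rule norm_cauchy_schwarz)
    also have "norm (D y) * norm y \<le> \<epsilon> * (norm y)\<^sup>2 + (norm (D y))\<^sup>2 / (4 * \<epsilon>)"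
    proof -
      have "0 \<le> (2 * \<epsilon> * norm y - norm (D y))\<^sup>2 / (4 * \<epsilon>)" using e by simp
      also have "\<dots> = \<epsilon> * (norm y)\<^sup>2 + (norm (D y))\<^sup>2 / (4 * \<epsilon>) - norm (D y) * norm y"
        using e by (simp add: power2_eq_square field_simps)
      finally show ?thesis by simp
    qed
    also have "(norm (D y))\<^sup>2 / (4 * \<epsilon>) \<le> b (D y) (D y) / (4 * \<epsilon>)"
      using pos[of "D y"] e by (intro divide_right_mono) auto
    also have "b (D y) (D y) / (4 * \<epsilon>) = c * \<epsilon> * b (D y) (D y)"
      using e by (simp add: c_def power2_eq_square)
    also have "Re z * (norm y)\<^sup>2 \<le> \<kappa>1 * (norm y)\<^sup>2"
      using r1[of z] by (intro mult_right_mono) (auto simp: S_def)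
    finally have "(A *v y) \<bullet> y \<le> \<kappa> * (norm y)\<^sup>2 + c * \<epsilon> * b (D y) (D y)"
      by (simp add: \<epsilon>_def algebra_simps)
    moreover have "c * b (D (A *v y)) (D y) \<le> c * (\<kappa>1 * b (D y) (D y))"
      unfolding DA using 1 c by (intro mult_left_mono) auto
    ultimately show ?thesis
      by (simp add: b'_def \<epsilon>_def algebra_simps power2_norm_eq_inner)
  qed
  ultimately show ?case unfolding inner_form_def by blast
qed

text \<open>The eigenvalues are complex, so the form is built on complex vectors and pulled back
  along the isometric embedding of the real ones. For a polynomial annihilating every vector the
  restriction to a kernel in \<open>stable_form_poly\<close> is void.\<close>

lemma stable_form:
  fixes K :: "real^'n^'n"
  assumes "\<And>z. complex_eigenvalue K z \<Longrightarrow> Re z < \<kappa>"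
  shows "\<exists>b. inner_form b \<and> (\<forall>x. b (K *v x) x \<le> \<kappa> * b x x)"
proof -
  let ?A = "map_matrix complex_of_real K"
  define c :: "real^'n \<Rightarrow> complex^'n" where "c x = (\<chi> i. complex_of_real (x $ i))" for x
  have linc: "linear c"
    by (rule linearI) (simp_all add: c_def vec_eq_iff vector_scaleR_component, simp add: scaleR_conv_of_real)
  have Kc: "c (K *v x) = ?A *v c x" for x
    by (simp add: c_def vec_eq_iff matrix_vector_mult_def map_matrix_def)
  obtain p where p: "p \<noteq> 0" "\<And>x. poly_action ?A p x = 0"
    "\<And>z. poly p z = 0 \<Longrightarrow> \<exists>v. v \<noteq> 0 \<and> ?A *v v = z *s v"
    using minimal_annihilating_poly by blast
  obtain b where b: "inner_form b" "\<And>y. b (?A *v y) y \<le> \<kappa> * b y y"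
    using stable_form_poly[of p \<kappa> ?A] p assms by (auto simp: complex_eigenvalue_def)
  have lb: "linear (\<lambda>x. b x y)" "linear (\<lambda>y. b x y)" for x y
    using b(1) by (auto simp: bilinear_def inner_form_def)
  have "inner_form (\<lambda>x y. b (c x) (c y))"
    unfolding inner_form_def bilinear_def
  proof (intro conjI allI)
    show "linear (\<lambda>y. b (c x) (c y))" "linear (\<lambda>x. b (c x) (c y))" for x y
      using linear_compose[OF linc lb(1)] linear_compose[OF linc lb(2)] by (auto simp: o_def)
    show "b (c x) (c y) = b (c y) (c x)" for x y using b(1) by (auto simp: inner_form_def)
    have "norm (c x) = norm x" for x by (simp add: c_def norm_vec_def)
    then show "(norm x)\<^sup>2 \<le> b (c x) (c x)" for x using b(1) by (metis inner_form_def)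
  qed
  then show ?thesis
    by (intro exI[of _ "\<lambda>x y. b (c x) (c y)"]) (simp add: Kc b)
qed

text \<open>Lets a bound on the spectrum of \<open>K\<close> serve the row action
  \<open>x v* K\<close>, which is the column action of the transpose.\<close>

lemma complex_eigenvalue_transpose: "complex_eigenvalue (transpose K) z = complex_eigenvalue (K::real^'n^'n) z"
proof -
  have *: "complex_eigenvalue K z \<longleftrightarrow> det (map_matrix complex_of_real K - mat z) = 0" for K :: "real^'n^'n"
  proof -
    let ?A = "map_matrix complex_of_real K"
    have "(?A - mat z) *v v = ?A *v v - z *s v" for v
    proof -
      have "mat z *v v = z *s v"
        by (simp add: vec_eq_iff matrix_vector_mult_def mat_def if_distrib[where f="\<lambda>a. a * _"] cong: if_cong)
      then show ?thesis by (simp add: matrix_vector_mult_diff_rdistrib)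
    qed
    then have "complex_eigenvalue K z \<longleftrightarrow> \<not> (\<forall>v. (?A - mat z) *v v = 0 \<longrightarrow> v = 0)"
      by (auto simp: complex_eigenvalue_def)
    also have "\<dots> \<longleftrightarrow> \<not> invertible (?A - mat z)"
      by (metis matrix_left_invertible_ker invertible_left_inverse)
    finally show ?thesis by (simp add: invertible_det_nz)
  qed
  have "map_matrix complex_of_real (transpose K) - mat z = transpose (map_matrix complex_of_real K - mat z)"
    by (auto simp: vec_eq_iff transpose_def mat_def map_matrix_def)
  then show ?thesis unfolding * by simp
qed

section \<open>Perron--Frobenius vectors of the killed chain\<close>

lemma irreducible_matrix_transpose: "irreducible_matrix (transpose Q) = irreducible_matrix (Q::real^'n^'n)"
proof -
  have "{(i, j). 0 < transpose Q $ i $ j} = {(i, j). 0 < Q $ i $ j}\<inverse>"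
    by (auto simp: transpose_def)
  then show ?thesis
    by (auto simp: irreducible_matrix_def rtrancl_converse)
qed

text \<open>Positivity of one entry spreads along the edges of \<open>Q\<close>: the inflow
  \<open>w $ y * Q $ y $ z\<close> is a lower bound for \<open>l * w $ z\<close>. Only
  \<open>w $ z \<noteq> 0\<close> is drawn from this, whatever the sign of \<open>l\<close>.\<close>

lemma nonneg_eigenvector_pos:
  fixes Q :: "real^'n^'n"
  assumes Q: "\<And>x y. 0 \<le> Q $ x $ y" and irr: "irreducible_matrix Q"
    and w: "\<And>x. 0 \<le> w $ x" "w \<noteq> 0" and eig: "w v* Q = l *\<^sub>R w"
  shows "0 < w $ y"
proof -
  obtain x where "w $ x \<noteq> 0" using w(2) by (auto simp: vec_eq_iff)
  then have x: "0 < w $ x" using w(1)[of x] by simp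
  have "(x, y) \<in> {(i, j). 0 < Q $ i $ j}\<^sup>*" using irr by (simp add: irreducible_matrix_def)
  then show ?thesis
  proof (induction rule: rtrancl_induct)
    case (step y z)
    have "0 < w $ y * Q $ y $ z" using step by simp
    also have "\<dots> \<le> (w v* Q) $ z"
      unfolding vector_matrix_mult_def vec_lambda_beta
      using member_le_sum[of y UNIV "\<lambda>i. w $ i * Q $ i $ z"] Q w by (simp add: mult.commute)
    finally have "0 < l * w $ z" by (simp add: eig)
    then have "w $ z \<noteq> 0" by auto
    with w(1)[of z] show ?case by (simp add: less_le)
  qed (rule x)
qed

lemma compact_convex_prob_vectors:
  "compact {\<mu>::real^'n. prob_vector \<mu>}" "convex {\<mu>::real^'n. prob_vector \<mu>}"
proof -
  have "closed {\<mu>::real^'n. prob_vector \<mu>}"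
    unfolding prob_vector_def
    by (intro closed_Collect_conj closed_Collect_all closed_Collect_le closed_Collect_eq continuous_intros)
  moreover have "norm \<mu> \<le> 1" if "prob_vector \<mu>" for \<mu> :: "real^'n"
    using norm_le_l1_cart[of \<mu>] that by (simp add: prob_vector_def)
  then have "bounded {\<mu>::real^'n. prob_vector \<mu>}" by (auto intro: boundedI)
  ultimately show "compact {\<mu>::real^'n. prob_vector \<mu>}" by (simp add: compact_eq_bounded_closed)
  show "convex {\<mu>::real^'n. prob_vector \<mu>}"
    by (rule convexI) (auto simp: prob_vector_def sum.distrib simp flip: sum_distrib_left)
qed

lemma prob_vector_axis: "prob_vector (axis i 1 :: real^'n)"
  by (auto simp: prob_vector_def axis_def)

lemma nonneg_eigenvector_exists:
  fixes Q :: "real^'n^'n"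
  assumes Q: "\<And>x y. 0 \<le> Q $ x $ y"
  obtains \<mu> l where "prob_vector \<mu>" "\<mu> v* Q = l *\<^sub>R \<mu>" "0 \<le> l"
proof -
  let ?S = "{\<mu>::real^'n. prob_vector \<mu>}"
  define s where "s \<mu> = (\<Sum>x\<in>UNIV. (\<mu> v* Q) $ x)" for \<mu>
  \<comment> \<open>Brouwer's theorem is applied to the normalisation of
    \<open>\<mu> + \<mu>Q\<close>. The summand \<open>\<mu>\<close> keeps the denominator at least 1
    even when \<open>\<mu>Q = 0\<close>, so the map is continuous on the whole simplex.\<close>
  define f where "f \<mu> = (1 / (1 + s \<mu>)) *\<^sub>R (\<mu> + \<mu> v* Q)" for \<mu>
  have nn: "0 \<le> (\<mu> v* Q) $ x" if "prob_vector \<mu>" for \<mu> x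
    unfolding vector_matrix_mult_def using that Q by (auto simp: prob_vector_def intro!: sum_nonneg)
  have s: "0 \<le> s \<mu>" if "prob_vector \<mu>" for \<mu>
    unfolding s_def using nn[OF that] by (intro sum_nonneg) auto
  have cQ: "continuous_on ?S (\<lambda>\<mu>. \<mu> v* Q)"
    unfolding vector_matrix_mult_def by (intro continuous_intros)
  have "continuous_on ?S f"
    unfolding f_def s_def using s unfolding s_def
    by (intro continuous_intros cQ) (force simp: add_nonneg_eq_0_iff)
  moreover have "f \<in> ?S \<rightarrow> ?S"
  proof
    fix \<mu> assume "\<mu> \<in> ?S"
    then have \<mu>: "prob_vector \<mu>" by simp
    have "(\<Sum>x\<in>UNIV. f \<mu> $ x) = (1 / (1 + s \<mu>)) * ((\<Sum>x\<in>UNIV. \<mu> $ x) + s \<mu>)"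
      by (simp add: f_def s_def sum.distrib sum_distrib_left flip: sum_divide_distrib)
    also have "\<dots> = 1" using \<mu> s[OF \<mu>] by (simp add: prob_vector_def)
    finally have "(\<Sum>x\<in>UNIV. f \<mu> $ x) = 1" .
    then show "f \<mu> \<in> ?S"
      using \<mu> s[OF \<mu>] nn[OF \<mu>] by (auto simp: prob_vector_def f_def)
  qed
  moreover have "?S \<noteq> {}" using prob_vector_axis by auto
  ultimately obtain \<mu> where \<mu>: "prob_vector \<mu>" "f \<mu> = \<mu>"
    using brouwer[OF compact_convex_prob_vectors] by (metis mem_Collect_eq)
  have "(1 + s \<mu>) *\<^sub>R f \<mu> = \<mu> + \<mu> v* Q"
    using s[OF \<mu>(1)] by (simp add: f_def)
  then have "\<mu> v* Q = s \<mu> *\<^sub>R \<mu>" using \<mu>(2) by (simp add: algebra_simps)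
  with \<mu>(1) s[OF \<mu>(1)] show ?thesis by (intro that)
qed

lemma prob_vector_nonzero: "prob_vector \<mu> \<Longrightarrow> \<mu> \<noteq> 0"
  by (auto simp: prob_vector_def)

text \<open>Of the row sums only the consequence \<open>lam < 1\<close> is recorded. The right
  eigenvector \<open>u\<close> carries no normalisation; it serves as a positive weight.\<close>

locale killed_chain =
  fixes Q :: "real^'t^'t" and \<mu> u :: "real^'t" and lam :: real
  assumes Q_nonneg: "\<And>x y. 0 \<le> Q $ x $ y"
    and Q_irreducible: "irreducible_matrix Q"
    and mu_pos: "\<And>x. 0 < \<mu> $ x"
    and mu_sum: "(\<Sum>x\<in>UNIV. \<mu> $ x) = 1"
    and mu_Q: "\<mu> v* Q = lam *\<^sub>R \<mu>"
    and u_pos: "\<And>x. 0 < u $ x"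
    and Q_u: "Q *v u = lam *\<^sub>R u"
    and lam_nonneg: "0 \<le> lam" and lam_less_1: "lam < 1"

text \<open>Left and right vectors come from separate fixed points, for \<open>Q\<close> and for its
  transpose; pairing them identifies the two eigenvalues. The total mass of \<open>\<mu>Q\<close> is
  the average of the row sums with weights \<open>\<mu>\<close>, and it is below 1 because the
  deficient row has positive weight.\<close>

lemma killed_chain_exists:
  fixes Q :: "real^'t^'t"
  assumes Q: "\<And>x y. 0 \<le> Q $ x $ y" and irr: "irreducible_matrix Q"
    and le1: "\<And>x. (\<Sum>y\<in>UNIV. Q $ x $ y) \<le> 1" and lt1: "\<exists>x. (\<Sum>y\<in>UNIV. Q $ x $ y) < 1"
  obtains \<mu> u lam where "killed_chain Q \<mu> u lam"
proof -
  obtain \<mu> l where \<mu>: "prob_vector \<mu>" "\<mu> v* Q = l *\<^sub>R \<mu>" "0 \<le> l"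
    using nonneg_eigenvector_exists Q by blast
  obtain u l' where u: "prob_vector u" "u v* transpose Q = l' *\<^sub>R u" "0 \<le> l'"
    using nonneg_eigenvector_exists[of "transpose Q"] Q by (auto simp: transpose_def)
  have \<mu>p: "0 < \<mu> $ x" for x
    by (rule nonneg_eigenvector_pos[OF Q irr _ prob_vector_nonzero[OF \<mu>(1)] \<mu>(2)])
       (use \<mu>(1) in \<open>auto simp: prob_vector_def\<close>)
  have up: "0 < u $ x" for x
    by (rule nonneg_eigenvector_pos[OF _ _ _ prob_vector_nonzero[OF u(1)] u(2)])
       (use u(1) Q irr in \<open>auto simp: prob_vector_def transpose_def irreducible_matrix_transpose[unfolded transpose_def]\<close>)
  have "l * (\<mu> \<bullet> u) = l' * (\<mu> \<bullet> u)"
    using dot_lmul_matrix[of \<mu> Q u] u(2) \<mu>(2) by (simp add: inner_commute)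
  moreover have "\<mu> \<bullet> u > 0"
    unfolding inner_vec_def using \<mu>p up by (intro sum_pos) auto
  ultimately have ll: "l' = l" by simp
  obtain x0 where x0: "(\<Sum>y\<in>UNIV. Q $ x0 $ y) < 1" using lt1 by blast
  have "l = (\<Sum>y\<in>UNIV. (\<mu> v* Q) $ y)" using \<mu> by (simp add: prob_vector_def flip: sum_distrib_left)
  also have "\<dots> = (\<Sum>x\<in>UNIV. \<mu> $ x * (\<Sum>y\<in>UNIV. Q $ x $ y))"
    unfolding vector_matrix_mult_def by (simp add: sum_distrib_left mult.commute) (rule sum.swap)
  also have "\<dots> < (\<Sum>x\<in>UNIV. \<mu> $ x)"
  proof (rule sum_strict_mono_ex1)
    show "\<forall>x\<in>UNIV. \<mu> $ x * (\<Sum>y\<in>UNIV. Q $ x $ y) \<le> \<mu> $ x"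
      using \<mu>p le1 by (auto intro!: mult_left_le less_imp_le)
    show "\<exists>x\<in>UNIV. \<mu> $ x * (\<Sum>y\<in>UNIV. Q $ x $ y) < \<mu> $ x"
      using \<mu>p[of x0] x0 by (intro bexI[of _ x0]) auto
  qed simp
  finally have "l < 1" using \<mu> by (simp add: prob_vector_def)
  then have "killed_chain Q \<mu> u l"
    using Q irr \<mu> u \<mu>p up ll by unfold_locales (auto simp: prob_vector_def)
  then show ?thesis by (rule that)
qed

context killed_chain
begin

lemma mu_prob: "prob_vector \<mu>"
  using mu_pos mu_sum by (auto simp: prob_vector_def intro: less_imp_le)

text \<open>Subtract from \<open>w\<close> the largest multiple of \<open>v\<close> that stays below
  it. The remainder is a nonnegative eigenvector with a zero entry, hence zero by
  \<open>nonneg_eigenvector_pos\<close>.\<close>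

lemma positive_left_eigenvector_multiple:
  fixes w v :: "real^'t" and A :: "real^'t^'t"
  assumes A: "\<And>x y. 0 \<le> A $ x $ y" "irreducible_matrix A"
    and v: "\<And>x. 0 < v $ x" "v v* A = l *\<^sub>R v" and w: "w v* A = l *\<^sub>R w"
  shows "\<exists>c. w = c *\<^sub>R v"
proof -
  define c where "c = Min (range (\<lambda>x. w $ x / v $ x))"
  have "c \<in> range (\<lambda>x. w $ x / v $ x)" unfolding c_def by (intro Min_in) auto
  then obtain x where x: "c = w $ x / v $ x" by auto
  have "0 \<le> (w - c *\<^sub>R v) $ y" for y
  proof -
    have "c \<le> w $ y / v $ y" unfolding c_def by (intro Min_le) auto
    then show ?thesis using v(1)[of y] by (simp add: field_simps)
  qed
  moreover have "(w - c *\<^sub>R v) v* A = l *\<^sub>R (w - c *\<^sub>R v)"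
    using v(2) w by (simp add: vector_matrix_mult_diff_distrib scaleR_vector_matrix_assoc algebra_simps
        scaleR_vector_matrix_assoc[symmetric])
  moreover have "(w - c *\<^sub>R v) $ x = 0" using v(1)[of x] by (simp add: x)
  ultimately have "w - c *\<^sub>R v = 0"
    using nonneg_eigenvector_pos[OF A, of "w - c *\<^sub>R v" l x] by auto
  then show ?thesis by auto
qed

text \<open>Pairing with \<open>u\<close> forces the eigenvalue, after which simplicity and the
  normalisation of the sum fix the vector.\<close>

lemma quasi_stationary_unique:
  assumes "quasi_stationary Q \<nu> \<kappa>"
  shows "\<nu> = \<mu> \<and> \<kappa> = lam"
proof -
  have \<nu>: "\<And>x. 0 \<le> \<nu> $ x" "(\<Sum>x\<in>UNIV. \<nu> $ x) = 1" "\<nu> v* Q = \<kappa> *\<^sub>R \<nu>" "\<nu> \<noteq> 0"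
    using assms prob_vector_nonzero by (auto simp: quasi_stationary_def prob_vector_def)
  have p: "0 < \<nu> $ x" for x
    by (rule nonneg_eigenvector_pos[OF Q_nonneg Q_irreducible \<nu>(1,4,3)])
  have "\<kappa> * (\<nu> \<bullet> u) = lam * (\<nu> \<bullet> u)"
    using dot_lmul_matrix[of \<nu> Q u] \<nu>(3) Q_u by simp
  moreover have "\<nu> \<bullet> u > 0"
    unfolding inner_vec_def using p u_pos by (intro sum_pos) auto
  ultimately have k: "\<kappa> = lam" by simp
  obtain c where c: "\<nu> = c *\<^sub>R \<mu>"
    using positive_left_eigenvector_multiple[OF Q_nonneg Q_irreducible mu_pos mu_Q] \<nu>(3) k by blast
  have "c = 1" using \<nu>(2) mu_sum unfolding c by (simp flip: sum_distrib_left)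
  with c k show ?thesis by simp
qed

lemma right_eigenvector_multiple:
  assumes "Q *v w = lam *\<^sub>R w"
  shows "\<exists>c. w = c *\<^sub>R u"
proof (rule positive_left_eigenvector_multiple[of "transpose Q" _ lam])
  show "0 \<le> transpose Q $ x $ y" for x y by (simp add: transpose_def Q_nonneg)
qed (use Q_irreducible u_pos Q_u assms in \<open>simp_all add: irreducible_matrix_transpose\<close>)

end

section \<open>The Lyapunov matrix equation\<close>

lemma inner_form_bounds:
  assumes "inner_form (b :: 'v::euclidean_space \<Rightarrow> _)"
  obtains C where "C > 0" "\<And>x y. \<bar>b x y\<bar> \<le> C * norm x * norm y"
  using assms bilinear_bounded_pos[of b] by (auto simp: inner_form_def)

lemma inner_form_simps:
  assumes "inner_form b"
  shows "b (x + y) z = b x z + b y z" "b z (x + y) = b z x + b z y"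
    "b (c *\<^sub>R x) z = c * b x z" "b z (c *\<^sub>R x) = c * b z x"
    "b (x - y) z = b x z - b y z" "b z (x - y) = b z x - b z y"
    "b 0 z = 0" "b z 0 = 0"
  using assms unfolding inner_form_def
  by (simp_all add: bilinear_ladd bilinear_radd bilinear_lmul bilinear_rmul bilinear_lsub bilinear_rsub
      bilinear_lzero bilinear_rzero)

lemma inner_form_commute: "inner_form b \<Longrightarrow> b x y = b y x"
  by (simp add: inner_form_def)

lemma inner_form_ge: "inner_form b \<Longrightarrow> (norm x)\<^sup>2 \<le> b x x"
  by (simp add: inner_form_def)

lemma inner_form_nonneg: "inner_form b \<Longrightarrow> 0 \<le> b x x"
  using inner_form_ge[of b x] zero_le_power2[of "norm x"] by linarith

text \<open>The map \<open>V \<mapsto> transpose B ** V + V ** B\<close> is shown injective, hence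
  onto by finite dimension. This is an algebraic stand-in for the integral of
  \<open>exp(sB)' \<Gamma> exp(sB)\<close>: a solution of the homogeneous equation satisfies an
  exact identity involving the Euler step \<open>M = 1 + hB\<close>, and iterating it bounds its
  bilinear form by a multiple of \<open>\<rho>^k\<close> for every \<open>k\<close>.\<close>

lemma lyapunov_solution:
  fixes B \<Gamma> :: "real^'n^'n"
  assumes b: "inner_form b" and e: "\<epsilon> > 0" and stable: "\<And>t. b (B *v t) t \<le> - \<epsilon> * b t t"
  obtains V where "transpose V = V" "\<And>t. 2 * ((B *v t) \<bullet> (V *v t)) = - (t \<bullet> (\<Gamma> *v t))"
proof -
  define L where "L V = transpose B ** V + V ** B" for V :: "real^'n^'n"
  have linL: "linear L"
    unfolding L_def by (rule linearI)
      (simp_all add: vec_eq_iff matrix_matrix_mult_def sum.distrib sum_distrib_left algebra_simps)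
  obtain C1 where C1: "C1 > 0" "\<And>x y. \<bar>b x y\<bar> \<le> C1 * norm x * norm y" using inner_form_bounds[OF b] by blast
  obtain C2 where C2: "C2 > 0" "\<And>x. norm (B *v x) \<le> C2 * norm x"
    using linear_bounded_pos[of "(*v) B"] by auto
  define C where "C = C1 * C2\<^sup>2"
  have C: "C > 0" using C1 C2 by (simp add: C_def)
  have BB: "b (B *v t) (B *v t) \<le> C * b t t" for t
  proof -
    have "b (B *v t) (B *v t) \<le> C1 * norm (B *v t) * norm (B *v t)" using C1(2) abs_le_D1 by blast
    also have "\<dots> \<le> C1 * (C2 * norm t) * (C2 * norm t)"
      using C1 C2 by (intro mult_mono) auto
    also have "\<dots> = C * (norm t)\<^sup>2" by (simp add: C_def power2_eq_square)
    also have "\<dots> \<le> C * b t t" using inner_form_ge[OF b] C by (intro mult_left_mono) auto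
    finally show ?thesis .
  qed
  \<comment> \<open>The contraction factor met below is \<open>1 - 2 h \<epsilon> + 2 h^2 C\<close>;
    this \<open>h\<close> minimises it, with value \<open>1 - h \<epsilon>\<close>.\<close>
  define h where "h = \<epsilon> / (2 * C)"
  have h: "h > 0" using e C by (simp add: h_def)
  define M where "M t = t + h *\<^sub>R (B *v t)" for t
  have MM: "b (M t) (M t) \<le> (1 - 2 * h * \<epsilon> + h\<^sup>2 * C) * b t t" for t
  proof -
    have "b (M t) (M t) = b t t + 2 * h * b (B *v t) t + h\<^sup>2 * b (B *v t) (B *v t)"
      unfolding M_def by (simp add: inner_form_simps[OF b] inner_form_commute[OF b, of t "B *v t"] power2_eq_square algebra_simps)
    also have "\<dots> \<le> b t t + 2 * h * (- \<epsilon> * b t t) + h\<^sup>2 * (C * b t t)"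
      using h by (intro add_mono mult_left_mono BB stable) auto
    finally show ?thesis by (simp add: algebra_simps)
  qed
  define \<rho>1 where "\<rho>1 = 1 - 2 * h * \<epsilon> + h\<^sup>2 * C"
  define \<rho> where "\<rho> = \<rho>1 + h\<^sup>2 * C"
  \<comment> \<open>A negative \<open>\<rho>1\<close> would force \<open>M = 0\<close>, that is
    \<open>h B = -1\<close>. Testing this on one vector gives \<open>h^2 C \<ge> 1\<close> and
    \<open>h \<epsilon> \<le> 1\<close>, against \<open>h \<epsilon> = 2 h^2 C\<close>.\<close>
  have "\<rho>1 \<ge> 0"
  proof (rule ccontr)
    assume "\<not> \<rho>1 \<ge> 0"
    then have "\<rho>1 * b t t \<le> 0" for t using inner_form_nonneg[OF b, of t] by (simp add: mult_nonpos_nonneg)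
    then have "b (M t) (M t) = 0" for t
      using MM[of t] inner_form_nonneg[OF b, of "M t"] unfolding \<rho>1_def by (meson order_antisym order_trans)
    then have M0: "M t = 0" for t using inner_form_ge[OF b, of "M t"] by simp
    let ?t = "axis undefined 1 :: real^'n"
    have "b ?t ?t + h * b (B *v ?t) ?t = b (M ?t) ?t" by (simp add: M_def inner_form_simps[OF b])
    also have "\<dots> = 0" by (simp add: M0 inner_form_simps[OF b])
    finally have 1: "h * b (B *v ?t) ?t = - b ?t ?t" by simp
    have "b ?t ?t + h * b (B *v ?t) ?t + h * b (B *v ?t) ?t + h\<^sup>2 * b (B *v ?t) (B *v ?t) = b (M ?t) (M ?t)"
      unfolding M_def by (simp add: inner_form_simps[OF b] inner_form_commute[OF b, of ?t "B *v ?t"] power2_eq_square algebra_simps)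
    also have "\<dots> = 0" by (simp add: M0 inner_form_simps[OF b])
    finally have 2: "h\<^sup>2 * b (B *v ?t) (B *v ?t) = b ?t ?t" using 1 by simp
    have "h\<^sup>2 * b (B *v ?t) (B *v ?t) \<le> h\<^sup>2 * (C * b ?t ?t)" by (intro mult_left_mono BB) auto
    then have "b ?t ?t \<le> h\<^sup>2 * C * b ?t ?t" using 2 by simp
    moreover have "b ?t ?t > 0" using inner_form_ge[OF b, of ?t] by (simp add: norm_axis_1)
    ultimately have "h\<^sup>2 * C \<ge> 1" by simp
    moreover have "b (B *v ?t) ?t \<le> -\<epsilon> * b ?t ?t" by (rule stable)
    ultimately have "h * \<epsilon> \<le> 1"
    proof -
      have "h * b (B *v ?t) ?t \<le> h * (-\<epsilon> * b ?t ?t)" using h stable by (intro mult_left_mono) auto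
      then have "h * \<epsilon> * b ?t ?t \<le> 1 * b ?t ?t" using 1 by simp
      then show ?thesis using \<open>b ?t ?t > 0\<close> by (simp only: mult_le_cancel_right_pos)
    qed
    have "2 * h * C = \<epsilon>" using C by (simp add: h_def)
    then have "h * \<epsilon> = 2 * (h\<^sup>2 * C)" by (simp add: power2_eq_square flip: \<open>2 * h * C = \<epsilon>\<close>)
    then show False using \<open>h * \<epsilon> \<le> 1\<close> \<open>h\<^sup>2 * C \<ge> 1\<close> by simp
  qed
  have "2 * h * C = \<epsilon>" using C by (simp add: h_def)
  then have "\<rho> = 1 - h * \<epsilon>" by (simp add: \<rho>_def \<rho>1_def power2_eq_square algebra_simps flip: \<open>2 * h * C = \<epsilon>\<close>)
  then have "\<rho> < 1" using h e by simp
  have "\<rho> \<ge> 0" using \<open>\<rho>1 \<ge> 0\<close> C by (simp add: \<rho>_def)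
  define nb where "nb t = sqrt (b t t)" for t
  have nb: "norm t \<le> nb t" for t
    using inner_form_ge[OF b, of t] by (simp add: nb_def real_le_rsqrt)
  have nbM: "nb (M s) * nb (M t) \<le> \<rho>1 * nb s * nb t" for s t
  proof -
    have "nb (M t) \<le> sqrt \<rho>1 * nb t" for t
      unfolding nb_def \<rho>1_def using MM[of t] by (simp flip: real_sqrt_mult)
    then have "nb (M s) * nb (M t) \<le> (sqrt \<rho>1 * nb s) * (sqrt \<rho>1 * nb t)"
      using \<open>\<rho>1 \<ge> 0\<close> by (intro mult_mono) (auto simp: nb_def inner_form_nonneg[OF b])
    also have "\<dots> = (sqrt \<rho>1 * sqrt \<rho>1) * nb s * nb t" by (simp only: mult_ac)
    finally show ?thesis using \<open>\<rho>1 \<ge> 0\<close> by simp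
  qed
  have nbB: "nb (B *v s) * nb (B *v t) \<le> C * nb s * nb t" for s t
  proof -
    have "nb (B *v t) \<le> sqrt C * nb t" for t
      unfolding nb_def using BB[of t] by (simp flip: real_sqrt_mult)
    then have "nb (B *v s) * nb (B *v t) \<le> (sqrt C * nb s) * (sqrt C * nb t)"
      using C by (intro mult_mono) (auto simp: nb_def inner_form_nonneg[OF b])
    also have "\<dots> = (sqrt C * sqrt C) * nb s * nb t" by (simp only: mult_ac)
    finally show ?thesis using C by simp
  qed
  have "V = 0" if "L V = 0" for V
  proof -
    have z: "(B *v s) \<bullet> (V *v t) + s \<bullet> (V *v (B *v t)) = 0" for s t
    proof -
      have "s \<bullet> (L V *v t) = s \<bullet> (transpose B *v (V *v t)) + s \<bullet> (V *v (B *v t))"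
        by (simp only: L_def matrix_vector_mult_add_rdistrib inner_add_right matrix_vector_mul_assoc)
      also have "s \<bullet> (transpose B *v (V *v t)) = (B *v s) \<bullet> (V *v t)"
        by (simp add: dot_lmul_matrix[symmetric] inner_commute)
           (metis dot_lmul_matrix inner_commute)
      finally show ?thesis using that by simp
    qed
    \<comment> \<open>In the expansion of \<open>M s \<bullet> (V *v M t)\<close> the term linear in
      \<open>h\<close> is the homogeneous equation and drops out.\<close>
    have rec: "s \<bullet> (V *v t) = M s \<bullet> (V *v M t) - h\<^sup>2 * ((B *v s) \<bullet> (V *v (B *v t)))" for s t
    proof -
      have "M s \<bullet> (V *v M t) = s \<bullet> (V *v t) + h * ((B *v s) \<bullet> (V *v t) + s \<bullet> (V *v (B *v t)))
         + h\<^sup>2 * ((B *v s) \<bullet> (V *v (B *v t)))"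
        unfolding M_def by (simp add: inner_add_left inner_add_right matrix_vector_right_distrib
          matrix_vector_mult_scaleR power2_eq_square algebra_simps)
      then show ?thesis using z by simp
    qed
    obtain c where c: "c > 0" "\<And>x. norm (V *v x) \<le> c * norm x"
      using linear_bounded_pos[of "(*v) V"] by auto
    have bound: "\<bar>s \<bullet> (V *v t)\<bar> \<le> c * \<rho> ^ k * (nb s * nb t)" for s t k
    proof (induction k arbitrary: s t)
      case 0
      have "\<bar>s \<bullet> (V *v t)\<bar> \<le> norm s * norm (V *v t)" by (rule Cauchy_Schwarz_ineq2)
      also have "\<dots> \<le> norm s * (c * norm t)" by (intro mult_left_mono c) auto
      also have "\<dots> \<le> nb s * (c * nb t)"
        using nb c(1) by (intro mult_mono mult_left_mono) (auto simp: nb_def inner_form_nonneg[OF b])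
      finally show ?case by (simp add: mult_ac)
    next
      case (Suc k)
      have "\<bar>s \<bullet> (V *v t)\<bar> \<le> \<bar>M s \<bullet> (V *v M t)\<bar> + h\<^sup>2 * \<bar>(B *v s) \<bullet> (V *v (B *v t))\<bar>"
        unfolding rec[of s t] using abs_triangle_ineq4[of "M s \<bullet> (V *v M t)" "h\<^sup>2 * ((B *v s) \<bullet> (V *v (B *v t)))"]
        by (simp add: abs_mult)
      also have "\<dots> \<le> c * \<rho> ^ k * (nb (M s) * nb (M t)) + h\<^sup>2 * (c * \<rho> ^ k * (nb (B *v s) * nb (B *v t)))"
        by (intro add_mono mult_left_mono Suc.IH) auto
      also have "\<dots> \<le> c * \<rho> ^ k * (\<rho>1 * nb s * nb t) + h\<^sup>2 * (c * \<rho> ^ k * (C * nb s * nb t))"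
        using c(1) \<open>\<rho> \<ge> 0\<close> by (intro add_mono mult_left_mono nbM nbB) auto
      also have "\<dots> = c * \<rho> ^ Suc k * (nb s * nb t)" by (simp add: \<rho>_def algebra_simps)
      finally show ?case .
    qed
    have "s \<bullet> (V *v t) = 0" for s t
    proof -
      have "(\<lambda>k. c * \<rho> ^ k * (nb s * nb t)) \<longlonglongrightarrow> c * 0 * (nb s * nb t)"
        using \<open>\<rho> < 1\<close> \<open>\<rho> \<ge> 0\<close> by (intro tendsto_intros LIMSEQ_power_zero) auto
      then have "\<bar>s \<bullet> (V *v t)\<bar> \<le> c * 0 * (nb s * nb t)"
        by (rule LIMSEQ_le_const) (use bound in auto)
      then show ?thesis by simp
    qed
    then have "V *v t = 0" for t by (metis inner_eq_zero_iff)
    then show "V = 0" by (simp add: matrix_eq)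
  qed
  then have "inj L" using linear_injective_0[OF linL] by blast
  then have "surj L" by (intro linear_injective_imp_surjective[OF linL]) auto
  then obtain V0 where V0: "L V0 = - \<Gamma>" by (metis surjD)
  \<comment> \<open>Only the quadratic form of \<open>\<Gamma>\<close> has to be matched, so a
    solution may be replaced by its symmetric part.\<close>
  define V where "V = (1/2) *\<^sub>R (V0 + transpose V0)"
  have "transpose V = V"
    by (simp add: V_def transpose_def vec_eq_iff)
  moreover have "2 * ((B *v t) \<bullet> (V *v t)) = - (t \<bullet> (\<Gamma> *v t))" for t
  proof -
    have "(B *v t) \<bullet> (transpose V0 *v t) = t \<bullet> (V0 *v (B *v t))"
      by (metis dot_lmul_matrix inner_commute transpose_matrix_vector)
    moreover have "(B *v t) \<bullet> (V0 *v t) = t \<bullet> (transpose B *v (V0 *v t))"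
      by (metis dot_lmul_matrix inner_commute transpose_matrix_vector)
    ultimately have "2 * ((B *v t) \<bullet> (V *v t)) = t \<bullet> (L V0 *v t)"
      unfolding V_def L_def scaleR_matrix_vector_assoc[symmetric]
        matrix_vector_mult_add_rdistrib inner_scaleR_right inner_add_right matrix_vector_mul_assoc[symmetric]
      by (simp del: transpose_matrix_vector)
    also have "\<dots> = - (t \<bullet> (\<Gamma> *v t))"
      unfolding V0 using matrix_vector_mult_diff_rdistrib[of 0 \<Gamma> t] by simp
    finally show ?thesis .
  qed
  ultimately show ?thesis by (rule that)
qed

text \<open>Completing the square with a nonzero diagonal entry as pivot: the Schur complement
  \<open>W\<close> is again positive semidefinite, and its diagonal has fewer nonzero entries. A
  vanishing diagonal forces the matrix to vanish. The list of vectors is what the construction of a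
  Gaussian law consumes.\<close>

lemma psd_sum_of_squares:
  fixes V :: "real^'n^'n"
  assumes "transpose V = V" "\<And>t. 0 \<le> t \<bullet> (V *v t)"
  shows "\<exists>as. \<forall>t. t \<bullet> (V *v t) = (\<Sum>a\<leftarrow>as. (a \<bullet> t)\<^sup>2)"
  using assms
proof (induction "card {i. V $ i $ i \<noteq> 0}" arbitrary: V rule: less_induct)
  case less
  have sym: "s \<bullet> (V *v t) = t \<bullet> (V *v s)" for s t
    by (metis dot_lmul_matrix inner_commute transpose_matrix_vector less.prems(1))
  have ent: "axis i 1 \<bullet> (V *v t) = (V *v t) $ i" for i t
    by (simp add: cart_eq_inner_axis inner_commute)
  have ent2: "axis i 1 \<bullet> (V *v axis j 1) = V $ i $ j" for i j
    using ent[of i "axis j 1"] by (simp add: matrix_vector_mult_basis column_def)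
  show ?case
  proof (cases "\<exists>i. V $ i $ i \<noteq> 0")
    case False
    have "V $ i $ j = 0" for i j
    proof (rule ccontr)
      assume n: "V $ i $ j \<noteq> 0"
      \<comment> \<open>With this factor the quadratic form at the test vector is
        \<open>-2 (V $ i $ j)^2\<close>.\<close>
      let ?s = "- V $ i $ j"
      have "0 \<le> (axis i 1 + ?s *\<^sub>R axis j 1) \<bullet> (V *v (axis i 1 + ?s *\<^sub>R axis j 1))" by (rule less.prems)
      also have "\<dots> = 2 * ?s * V $ i $ j"
        using False ent2[of i j] ent2[of j i] sym[of "axis i 1" "axis j 1"] ent2[of i i] ent2[of j j]
        by (simp add: matrix_vector_right_distrib matrix_vector_mult_scaleR inner_add_left inner_add_right
            matrix_vector_mult_diff_distrib inner_diff_left inner_diff_right)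
      also have "\<dots> < 0" using n by (simp add: mult_neg_pos power2_eq_square[symmetric])
      finally show False by simp
    qed
    then have "V = 0" by (simp add: vec_eq_iff)
    then show ?thesis by (intro exI[of _ "[]"]) simp
  next
    case True
    then obtain i where i: "V $ i $ i \<noteq> 0" by blast
    define d where "d = V $ i $ i"
    have "0 \<le> d" using less.prems(2)[of "axis i 1"] ent2[of i i] by (simp add: d_def)
    with i have d: "d > 0" by (simp add: d_def)
    define v where "v = V *v axis i 1"
    have vt: "v \<bullet> t = axis i 1 \<bullet> (V *v t)" for t using sym[of t "axis i 1"] by (simp add: v_def inner_commute)
    have vi: "v $ i = d" using ent[of i "axis i 1"] ent2[of i i] by (simp add: v_def d_def)
    define W where "W = V - (\<chi> j k. v $ j * v $ k / d)"
    have Wt: "W *v t = V *v t - ((v \<bullet> t) / d) *\<^sub>R v" for t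
      unfolding W_def matrix_vector_mult_diff_rdistrib
      by (simp add: vec_eq_iff matrix_vector_mult_def inner_vec_def sum_distrib_left sum_distrib_right sum_divide_distrib mult_ac)
    have qW: "t \<bullet> (W *v t) = t \<bullet> (V *v t) - (v \<bullet> t)\<^sup>2 / d" for t
      by (simp add: Wt inner_diff_right power2_eq_square inner_commute)
    have W0: "0 \<le> t \<bullet> (W *v t)" for t
    proof -
      \<comment> \<open>Minimises the form of \<open>V\<close> along the pivot direction; the
        minimum is the form of \<open>W\<close> at \<open>t\<close>.\<close>
      let ?c = "(v \<bullet> t) / d"
      have "0 \<le> (t - ?c *\<^sub>R axis i 1) \<bullet> (V *v (t - ?c *\<^sub>R axis i 1))" by (rule less.prems)
      also have "\<dots> = t \<bullet> (V *v t) - 2 * ?c * (v \<bullet> t) + ?c\<^sup>2 * d"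
        using sym[of t "axis i 1"] vt[of t] ent2[of i i]
        by (simp add: matrix_vector_mult_scaleR matrix_vector_mult_diff_distrib inner_diff_left inner_diff_right
            d_def power2_eq_square algebra_simps)
      also have "\<dots> = t \<bullet> (W *v t)" using d by (simp add: qW power2_eq_square field_simps)
      finally show ?thesis .
    qed
    have Wsym: "transpose W = W"
    proof -
      have "V $ j $ k = V $ k $ j" for j k
      proof -
        have "V $ j $ k = transpose V $ k $ j" by (simp add: transpose_def)
        then show ?thesis by (simp only: less.prems(1))
      qed
      then show ?thesis by (simp add: W_def transpose_def vec_eq_iff mult.commute)
    qed
    have Wd: "W $ j $ j = V $ j $ j - (v $ j)\<^sup>2 / d" for j by (simp add: W_def power2_eq_square)
    have Wd0: "0 \<le> W $ j $ j" for j
      using W0[of "axis j 1"] by (simp add: inner_axis' matrix_vector_mult_basis column_def)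
    have "{j. W $ j $ j \<noteq> 0} \<subset> {j. V $ j $ j \<noteq> 0}"
    proof
      show "{j. W $ j $ j \<noteq> 0} \<subseteq> {j. V $ j $ j \<noteq> 0}"
      proof (rule subsetI, rule ccontr)
        fix j assume "j \<in> {j. W $ j $ j \<noteq> 0}" "j \<notin> {j. V $ j $ j \<noteq> 0}"
        then have "W $ j $ j \<noteq> 0" "V $ j $ j = 0" by auto
        then have "W $ j $ j \<le> 0" using d by (simp add: Wd)
        with Wd0[of j] \<open>W $ j $ j \<noteq> 0\<close> show False by simp
      qed
      have "W $ i $ i = 0" using d by (simp add: Wd vi power2_eq_square) (simp add: d_def)
      then show "{j. W $ j $ j \<noteq> 0} \<noteq> {j. V $ j $ j \<noteq> 0}" using i by auto
    qed
    then have "card {j. W $ j $ j \<noteq> 0} < card {j. V $ j $ j \<noteq> 0}" by (intro psubset_card_mono) auto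
    from less.hyps[OF this Wsym W0] obtain as where as: "\<And>t. t \<bullet> (W *v t) = (\<Sum>a\<leftarrow>as. (a \<bullet> t)\<^sup>2)" by blast
    have "t \<bullet> (V *v t) = (\<Sum>a\<leftarrow>((1 / sqrt d) *\<^sub>R v) # as. (a \<bullet> t)\<^sup>2)" for t
      using d qW[of t] by (simp add: as power_divide)
    then show ?thesis by blast
  qed
qed

section \<open>The Green matrix and the linear drift\<close>

lemma matrix_power_commute: "matrix_power A k ** A = A ** matrix_power A k"
  by (induction k) (simp_all add: matrix_mul_assoc[symmetric])

lemma matrix_power_Suc_right: "matrix_power A (Suc k) = matrix_power A k ** A"
  by (simp add: matrix_power_commute)

lemma complex_triangle_mult:
  fixes Q :: "real^'n^'n"
  assumes "\<And>x y. 0 \<le> Q $ x $ y" "map_matrix complex_of_real Q *v v = z *s v"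
  shows "cmod z * cmod (v $ x) \<le> (\<Sum>y\<in>UNIV. Q $ x $ y * cmod (v $ y))"
proof -
  have "z * v $ x = (\<Sum>y\<in>UNIV. complex_of_real (Q $ x $ y) * v $ y)"
    using arg_cong[OF assms(2), of "\<lambda>w. w $ x"] by (simp add: matrix_vector_mult_def map_matrix_def)
  then have "cmod (z * v $ x) \<le> (\<Sum>y\<in>UNIV. cmod (complex_of_real (Q $ x $ y) * v $ y))"
    by (simp add: norm_sum)
  then show ?thesis using assms(1) by (simp add: norm_mult)
qed

context killed_chain
begin

text \<open>The mean absorption time under the quasi-stationary distribution, and the Perron
  eigenvalue of the Green matrix.\<close>

definition \<gamma> :: real where "\<gamma> = 1 / (1 - lam)"

lemma gamma_ge_1: "1 \<le> \<gamma>"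
  using lam_nonneg lam_less_1 by (simp add: \<gamma>_def)

text \<open>Moduli of the entries of an eigenvector satisfy
  \<open>cmod z * cmod (v $ x) \<le> (Q |v|) $ x\<close>; pairing with the positive left vector
  \<open>\<mu>\<close> replaces \<open>Q\<close> by \<open>lam\<close>.\<close>

lemma eigenvalue_bound:
  assumes "complex_eigenvalue Q z"
  shows "cmod z \<le> lam"
proof -
  obtain v where v: "v \<noteq> 0" "map_matrix complex_of_real Q *v v = z *s v"
    using assms by (auto simp: complex_eigenvalue_def)
  let ?w = "\<Sum>x\<in>UNIV. \<mu> $ x * cmod (v $ x)"
  obtain x where "v $ x \<noteq> 0" using v(1) by (auto simp: vec_eq_iff)
  then have "0 < \<mu> $ x * cmod (v $ x)" using mu_pos[of x] by simp
  also have "\<dots> \<le> ?w"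
    using mu_pos by (intro member_le_sum[where f="\<lambda>x. \<mu> $ x * cmod (v $ x)"]) (auto intro!: mult_nonneg_nonneg intro: less_imp_le)
  finally have w: "?w > 0" .
  have "cmod z * ?w = (\<Sum>x\<in>UNIV. \<mu> $ x * (cmod z * cmod (v $ x)))"
    by (simp add: sum_distrib_left mult_ac)
  also have "\<dots> \<le> (\<Sum>x\<in>UNIV. \<mu> $ x * (\<Sum>y\<in>UNIV. Q $ x $ y * cmod (v $ y)))"
    using mu_pos complex_triangle_mult[OF Q_nonneg v(2)] by (intro sum_mono mult_left_mono) (auto intro: less_imp_le)
  also have "\<dots> = (\<Sum>y\<in>UNIV. (\<mu> v* Q) $ y * cmod (v $ y))"
    unfolding vector_matrix_mult_def sum_distrib_left vec_lambda_beta sum_distrib_right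
    by (subst sum.swap) (simp add: mult_ac)
  also have "\<dots> = lam * ?w" unfolding mu_Q by (simp add: sum_distrib_left mult_ac)
  finally show ?thesis using w by (simp only: mult_le_cancel_right_pos)
qed

lemma complex_eigenvalue_lam: "complex_eigenvalue Q (complex_of_real lam)"
proof -
  let ?v = "(\<chi> x. complex_of_real (u $ x)) :: complex^'t"
  have "?v $ x \<noteq> 0" for x using u_pos[of x] by simp
  then have "?v \<noteq> 0" by (metis zero_index)
  moreover have "map_matrix complex_of_real Q *v ?v = complex_of_real lam *s ?v"
  proof (simp add: vec_eq_iff, intro allI)
    fix x
    have "(\<Sum>y\<in>UNIV. Q $ x $ y * u $ y) = lam * u $ x"
      using arg_cong[OF Q_u, of "\<lambda>w. w $ x"] by (simp add: matrix_vector_mult_def)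
    then show "(map_matrix complex_of_real Q *v ?v) $ x = complex_of_real lam * complex_of_real (u $ x)"
      by (simp add: matrix_vector_mult_def map_matrix_def flip: of_real_mult of_real_sum)
  qed
  ultimately show ?thesis by (auto simp: complex_eigenvalue_def)
qed

lemma principal_eigenvalue_eq: "principal_eigenvalue Q = lam"
  unfolding principal_eigenvalue_def
proof (rule Max_eqI)
  show "finite (cmod ` {z. complex_eigenvalue Q z})" using finite_complex_eigenvalues by auto
  show "lam \<in> cmod ` {z. complex_eigenvalue Q z}"
    using complex_eigenvalue_lam lam_nonneg by (intro image_eqI[of _ _ "complex_of_real lam"]) auto
qed (use eigenvalue_bound in auto)

text \<open>Simplicity of the principal eigenvalue over the complex numbers, in the form needed for
  \<open>K\<close>: real and imaginary parts are multiples of \<open>u\<close>, and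
  \<open>\<mu> \<bullet> u > 0\<close> leaves only zero.\<close>

lemma lam_eigenvector_orthogonal_zero:
  fixes v :: "complex^'t"
  assumes "map_matrix complex_of_real Q *v v = complex_of_real lam *s v"
    and "(\<Sum>x\<in>UNIV. complex_of_real (\<mu> $ x) * v $ x) = 0"
  shows "v = 0"
proof -
  have mu_u: "\<mu> \<bullet> u > 0" unfolding inner_vec_def using mu_pos u_pos by (intro sum_pos) auto
  have e: "(\<Sum>y\<in>UNIV. complex_of_real (Q $ x $ y) * v $ y) = complex_of_real lam * v $ x" for x
    using arg_cong[OF assms(1), of "\<lambda>w. w $ x"] by (simp add: matrix_vector_mult_def map_matrix_def)
  have "w = 0" if w: "Q *v w = lam *\<^sub>R w" "\<mu> \<bullet> w = 0" for w
  proof -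
    obtain c where c: "w = c *\<^sub>R u" using right_eigenvector_multiple[OF w(1)] by blast
    then have "c = 0" using w(2) mu_u by simp
    with c show "w = 0" by simp
  qed note z = this
  have "(\<chi> x. Re (v $ x)) = (0 :: real^'t)"
  proof (rule z)
    show "Q *v (\<chi> x. Re (v $ x)) = lam *\<^sub>R (\<chi> x. Re (v $ x))"
      using arg_cong[OF e, of Re] by (simp add: vec_eq_iff matrix_vector_mult_def)
    show "\<mu> \<bullet> (\<chi> x. Re (v $ x)) = 0"
      using arg_cong[OF assms(2), of Re] by (simp add: inner_vec_def)
  qed
  moreover have "(\<chi> x. Im (v $ x)) = (0 :: real^'t)"
  proof (rule z)
    show "Q *v (\<chi> x. Im (v $ x)) = lam *\<^sub>R (\<chi> x. Im (v $ x))"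
      using arg_cong[OF e, of Im] by (simp add: vec_eq_iff matrix_vector_mult_def)
    show "\<mu> \<bullet> (\<chi> x. Im (v $ x)) = 0"
      using arg_cong[OF assms(2), of Im] by (simp add: inner_vec_def)
  qed
  ultimately show ?thesis by (simp add: vec_eq_iff complex_eq_iff)
qed

section \<open>Geometric decay of the powers of \<open>Q\<close> and the Green matrix\<close>

definition power_const :: real where
  "power_const = (\<Sum>x\<in>UNIV. \<Sum>y\<in>UNIV. u $ x / u $ y)"

lemma power_const_nonneg: "0 \<le> power_const"
  unfolding power_const_def using u_pos by (intro sum_nonneg divide_nonneg_nonneg) (auto intro: less_imp_le)

lemma matrix_power_nonneg: "0 \<le> matrix_power Q k $ x $ y"
proof (induction k arbitrary: x y)
  case 0
  then show ?case by (simp add: mat_def)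
next
  case (Suc k)
  then show ?case using Q_nonneg by (auto simp: matrix_matrix_mult_def intro!: sum_nonneg)
qed

lemma matrix_power_u: "matrix_power Q k *v u = lam ^ k *\<^sub>R u"
proof (induction k)
  case (Suc k)
  have "matrix_power Q (Suc k) *v u = Q *v (matrix_power Q k *v u)"
    by (simp add: matrix_vector_mul_assoc)
  then show ?case by (simp add: Suc Q_u matrix_vector_mult_scaleR mult.commute)
qed simp

text \<open>Comparison with the eigenvector: each nonnegative summand of an entry of
  \<open>Q^k u\<close> is at most that entry of \<open>lam^k u\<close>. The rate \<open>lam\<close>
  obtained in this way is exact, for periodic \<open>Q\<close> as well.\<close>

lemma matrix_power_le: "matrix_power Q k $ x $ y \<le> power_const * lam ^ k"
proof -
  have "matrix_power Q k $ x $ y * u $ y \<le> (\<Sum>y\<in>UNIV. matrix_power Q k $ x $ y * u $ y)"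
    using matrix_power_nonneg u_pos
    by (intro member_le_sum[where f="\<lambda>y. matrix_power Q k $ x $ y * u $ y"])
       (auto intro!: mult_nonneg_nonneg less_imp_le[OF u_pos])
  also have "\<dots> = lam ^ k * u $ x"
    using arg_cong[OF matrix_power_u, of "\<lambda>w. w $ x"] by (simp add: matrix_vector_mult_def)
  finally have "matrix_power Q k $ x $ y \<le> lam ^ k * (u $ x / u $ y)"
    using u_pos[of y] by (simp add: field_simps)
  moreover have "u $ x / u $ y \<le> (\<Sum>y\<in>UNIV. u $ x / u $ y)"
    using u_pos by (intro member_le_sum[where f="\<lambda>y. u $ x / u $ y"]) (auto intro!: divide_nonneg_nonneg less_imp_le)
  moreover have "(\<Sum>y\<in>UNIV. u $ x / u $ y) \<le> power_const"
    unfolding power_const_def using u_pos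
    by (intro member_le_sum[where f="\<lambda>x. \<Sum>y\<in>UNIV. u $ x / u $ y"])
       (auto intro!: sum_nonneg divide_nonneg_nonneg intro: less_imp_le)
  ultimately show ?thesis
    using lam_nonneg by (smt (verit) mult.commute mult_right_mono zero_le_power)
qed

text \<open>Kept as an entrywise series, since moments of the counts arise as sums over time;
  \<open>G_left\<close> and \<open>G_right\<close> recover the inverse of
  \<open>I - Q\<close>.\<close>

definition G :: "real^'t^'t" where
  "G = (\<chi> x y. \<Sum>k. matrix_power Q k $ x $ y)"

lemma summable_matrix_power: "summable (\<lambda>k. matrix_power Q k $ x $ y)"
proof (rule summable_comparison_test')
  show "summable (\<lambda>k. power_const * lam ^ k)"
    using lam_nonneg lam_less_1 by (intro summable_mult summable_geometric) auto
qed (use matrix_power_nonneg matrix_power_le in auto)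

lemma G_sums: "(\<lambda>k. matrix_power Q k $ x $ y) sums (G $ x $ y)"
  using summable_matrix_power by (simp add: G_def summable_sums)

lemma G_nonneg: "0 \<le> G $ x $ y"
  using matrix_power_nonneg by (simp add: G_def suminf_nonneg summable_matrix_power)

lemma G_left: "G = mat 1 + Q ** G" and G_right: "G = mat 1 + G ** Q"
proof -
  have "(Q ** G) $ x $ y = G $ x $ y - mat 1 $ x $ y" for x y
  proof -
    have "(\<lambda>k. \<Sum>z\<in>UNIV. Q $ x $ z * matrix_power Q k $ z $ y) sums (\<Sum>z\<in>UNIV. Q $ x $ z * G $ z $ y)"
      by (intro sums_sum sums_mult G_sums)
    then have "(\<lambda>k. matrix_power Q (Suc k) $ x $ y) sums ((Q ** G) $ x $ y)"
      by (simp add: matrix_matrix_mult_def)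
    moreover have "(\<lambda>k. matrix_power Q (Suc k) $ x $ y) sums (G $ x $ y - matrix_power Q 0 $ x $ y)"
      using G_sums by (subst sums_Suc_iff) simp
    ultimately show ?thesis using sums_unique2 by fastforce
  qed
  then show "G = mat 1 + Q ** G" by (simp add: vec_eq_iff)
  have "(G ** Q) $ x $ y = G $ x $ y - mat 1 $ x $ y" for x y
  proof -
    have "(\<lambda>k. \<Sum>z\<in>UNIV. matrix_power Q k $ x $ z * Q $ z $ y) sums (\<Sum>z\<in>UNIV. G $ x $ z * Q $ z $ y)"
      by (intro sums_sum sums_mult2 G_sums)
    then have "(\<lambda>k. matrix_power Q (Suc k) $ x $ y) sums ((G ** Q) $ x $ y)"
      unfolding matrix_power_Suc_right by (simp add: matrix_matrix_mult_def)
    moreover have "(\<lambda>k. matrix_power Q (Suc k) $ x $ y) sums (G $ x $ y - matrix_power Q 0 $ x $ y)"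
      using G_sums by (subst sums_Suc_iff) simp
    ultimately show ?thesis using sums_unique2 by fastforce
  qed
  then show "G = mat 1 + G ** Q" by (simp add: vec_eq_iff)
qed

lemma mu_G: "\<mu> v* G = \<gamma> *\<^sub>R \<mu>"
proof -
  have "\<mu> v* G = \<mu> v* mat 1 + (\<mu> v* Q) v* G"
    by (subst G_left) (simp only: vector_matrix_mult_add_rdistrib vector_matrix_mul_assoc)
  then have "\<mu> v* G = \<mu> + lam *\<^sub>R (\<mu> v* G)"
    by (simp add: mu_Q scaleR_vector_matrix_assoc)
  then have "(1 - lam) *\<^sub>R (\<mu> v* G) = \<mu>" by (simp add: algebra_simps)
  then have "\<gamma> *\<^sub>R ((1 - lam) *\<^sub>R (\<mu> v* G)) = \<gamma> *\<^sub>R \<mu>" by simp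
  then show ?thesis using lam_less_1 by (simp add: \<gamma>_def)
qed

lemma G_u: "G *v u = \<gamma> *\<^sub>R u"
proof -
  have "G *v u = mat 1 *v u + G *v (Q *v u)"
    by (subst G_right) (simp only: matrix_vector_mult_add_rdistrib matrix_vector_mul_assoc)
  then have "G *v u = u + lam *\<^sub>R (G *v u)"
    by (simp add: Q_u matrix_vector_mult_scaleR)
  then have "(1 - lam) *\<^sub>R (G *v u) = u" by (simp add: algebra_simps)
  then have "\<gamma> *\<^sub>R ((1 - lam) *\<^sub>R (G *v u)) = \<gamma> *\<^sub>R u" by simp
  then show ?thesis using lam_less_1 by (simp add: \<gamma>_def)
qed

text \<open>The derivative of the drift \<open>x \<mapsto> xG - (xG1)\<mu>\<close> of the deviation \<open>S\<^sub>n(\<mu>\<^sub>n - \<mu>)\<close>, acting on row vectors.\<close>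

definition K :: "real^'t^'t" where
  "K = (\<chi> x y. G $ x $ y - (\<Sum>z\<in>UNIV. G $ x $ z) * \<mu> $ y)"

section \<open>Spectrum of the drift matrix \<open>K\<close>\<close>

lemma vector_K: "w v* K = w v* G - (\<Sum>z\<in>UNIV. (w v* G) $ z) *\<^sub>R \<mu>"
proof -
  have "(w v* K) $ y = (w v* G) $ y - (\<Sum>z\<in>UNIV. (w v* G) $ z) * \<mu> $ y" for y
  proof -
    have "(w v* K) $ y = (\<Sum>x\<in>UNIV. w $ x * G $ x $ y) - (\<Sum>x\<in>UNIV. \<Sum>z\<in>UNIV. w $ x * G $ x $ z) * \<mu> $ y"
      unfolding vector_matrix_mult_def K_def vec_lambda_beta
      by (simp add: right_diff_distrib left_diff_distrib sum_subtractf sum_distrib_left sum_distrib_right mult_ac)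
    also have "(\<Sum>x\<in>UNIV. \<Sum>z\<in>UNIV. w $ x * G $ x $ z) = (\<Sum>z\<in>UNIV. \<Sum>x\<in>UNIV. w $ x * G $ x $ z)"
      by (rule sum.swap)
    finally show ?thesis by (simp add: vector_matrix_mult_def mult.commute)
  qed
  then show ?thesis by (simp add: vec_eq_iff)
qed

lemma mu_K: "\<mu> v* K = 0"
  by (simp add: vector_K mu_G mu_sum flip: sum_distrib_left)

text \<open>Since \<open>\<mu>K = 0\<close>, an eigenvector for \<open>z \<noteq> 0\<close> is
  orthogonal to \<open>\<mu>\<close>. The rank one correction in \<open>K\<close> vanishes on it, so
  it is an eigenvector of \<open>G\<close>, hence of \<open>Q\<close> for \<open>1 - 1 / z\<close>.
  Orthogonality also excludes the principal eigenvalue.\<close>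

lemma K_eigenvalue:
  assumes "complex_eigenvalue K z" "z \<noteq> 0"
  obtains l where "complex_eigenvalue Q l" "l \<noteq> complex_of_real lam" "z = 1 / (1 - l)"
proof -
  let ?c = complex_of_real
  obtain v where v: "v \<noteq> 0" "map_matrix ?c K *v v = z *s v"
    using assms by (auto simp: complex_eigenvalue_def)
  define m where "m = (\<Sum>x\<in>UNIV. ?c (\<mu> $ x) * v $ x)"
  have Kv: "z * v $ x = (\<Sum>y\<in>UNIV. ?c (K $ x $ y) * v $ y)" for x
    using arg_cong[OF v(2), of "\<lambda>w. w $ x"] by (simp add: matrix_vector_mult_def map_matrix_def)
  have "z * m = (\<Sum>x\<in>UNIV. ?c (\<mu> $ x) * (z * v $ x))" by (simp add: m_def sum_distrib_left mult_ac)
  also have "\<dots> = (\<Sum>y\<in>UNIV. ?c ((\<mu> v* K) $ y) * v $ y)"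
    unfolding Kv vector_matrix_mult_def vec_lambda_beta of_real_sum sum_distrib_left sum_distrib_right
    by (subst sum.swap) (simp add: mult_ac)
  also have "\<dots> = 0" by (simp add: mu_K)
  finally have m: "m = 0" using assms(2) by simp
  have Gv: "(\<Sum>y\<in>UNIV. ?c (G $ x $ y) * v $ y) = z * v $ x" for x
  proof -
    have "z * v $ x = (\<Sum>y\<in>UNIV. ?c (G $ x $ y) * v $ y) - ?c (\<Sum>z\<in>UNIV. G $ x $ z) * m"
      unfolding Kv K_def m_def by (simp add: sum_subtractf algebra_simps sum_distrib_left)
    then show ?thesis by (simp add: m)
  qed
  have Qv: "z * (\<Sum>y\<in>UNIV. ?c (Q $ x $ y) * v $ y) = (z - 1) * v $ x" for x
  proof -
    have "(\<Sum>y\<in>UNIV. ?c (G $ x $ y) * v $ y) = (\<Sum>y\<in>UNIV. ?c ((mat 1 + Q ** G) $ x $ y) * v $ y)"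
      using G_left by simp
    also have "\<dots> = (\<Sum>y\<in>UNIV. ?c (mat 1 $ x $ y) * v $ y) + (\<Sum>y\<in>UNIV. ?c ((Q ** G) $ x $ y) * v $ y)"
      by (simp add: algebra_simps sum.distrib)
    also have "(\<Sum>y\<in>UNIV. ?c (mat 1 $ x $ y) * v $ y) = v $ x"
      by (simp add: mat_def if_distrib[where f="\<lambda>a. ?c a * _"] cong: if_cong)
    also have "(\<Sum>y\<in>UNIV. ?c ((Q ** G) $ x $ y) * v $ y) = (\<Sum>y\<in>UNIV. ?c (Q $ x $ y) * (\<Sum>w\<in>UNIV. ?c (G $ y $ w) * v $ w))"
      by (simp add: matrix_matrix_mult_def sum_distrib_left sum_distrib_right mult_ac) (rule sum.swap)
    finally have "z * v $ x = v $ x + (\<Sum>y\<in>UNIV. ?c (Q $ x $ y) * (z * v $ y))" unfolding Gv .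
    also have "(\<Sum>y\<in>UNIV. ?c (Q $ x $ y) * (z * v $ y)) = z * (\<Sum>y\<in>UNIV. ?c (Q $ x $ y) * v $ y)"
      by (simp add: sum_distrib_left mult_ac)
    finally show ?thesis by (simp add: algebra_simps)
  qed
  let ?l = "1 - 1 / z"
  have eig: "map_matrix ?c Q *v v = ?l *s v"
  proof -
    have "(\<Sum>y\<in>UNIV. ?c (Q $ x $ y) * v $ y) = ?l * v $ x" for x
      using Qv[of x] assms(2) by (simp add: field_simps)
    then show ?thesis unfolding vec_eq_iff matrix_vector_mult_def map_matrix_def vector_smult_component by simp
  qed
  show ?thesis
  proof
    show "complex_eigenvalue Q ?l" using eig v(1) by (auto simp: complex_eigenvalue_def)
    show "?l \<noteq> ?c lam"
    proof
      assume "?l = ?c lam"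
      then have "v = 0" using lam_eigenvector_orthogonal_zero[of v] eig m by (simp only: m_def)
      with v(1) show False by simp
    qed
    show "z = 1 / (1 - ?l)" using assms(2) by simp
  qed
qed

text \<open>A periodic \<open>Q\<close> has further eigenvalues of modulus \<open>lam\<close>, but
  none of real part \<open>lam\<close>. That is enough, because
  \<open>cmod (1 - l) \<ge> Re (1 - l) > 1 - lam\<close>.\<close>

lemma K_eigenvalue_Re_less:
  assumes "complex_eigenvalue K z"
  shows "Re z < \<gamma>"
proof (cases "z = 0")
  case False
  then obtain l where l: "complex_eigenvalue Q l" "l \<noteq> complex_of_real lam" "z = 1 / (1 - l)"
    using K_eigenvalue assms by blast
  have n: "cmod l \<le> lam" by (rule eigenvalue_bound[OF l(1)])
  have "Re l \<noteq> lam"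
  proof
    assume "Re l = lam"
    then have "(cmod l)\<^sup>2 = lam\<^sup>2 + (Im l)\<^sup>2" by (simp add: cmod_power2)
    moreover have "(cmod l)\<^sup>2 \<le> lam\<^sup>2" using n by (intro power_mono) auto
    ultimately have "Im l = 0" by simp
    with \<open>Re l = lam\<close> l(2) show False by (simp add: complex_eq_iff)
  qed
  moreover have "Re l \<le> lam" using n complex_Re_le_cmod[of l] by linarith
  ultimately have r: "1 - lam < Re (1 - l)" by simp
  also have "Re (1 - l) \<le> cmod (1 - l)" by (rule complex_Re_le_cmod)
  finally have c: "1 - lam < cmod (1 - l)" .
  have "Re z \<le> cmod z" by (rule complex_Re_le_cmod)
  also have "cmod z = 1 / cmod (1 - l)" using l(3) by (simp add: norm_divide)
  also have "\<dots> < \<gamma>" unfolding \<gamma>_def using c lam_less_1 by (intro divide_strict_left_mono mult_pos_pos) auto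
  finally show ?thesis .
qed (use gamma_ge_1 in simp)

lemma K_form:
  obtains b \<kappa> where "inner_form b" "\<kappa> < \<gamma>" "0 \<le> \<kappa>" "\<And>x. b (x v* K) x \<le> \<kappa> * b x x"
proof -
  let ?E = "insert 0 {z. complex_eigenvalue K z}"
  have fin: "finite (Re ` ?E)" using finite_complex_eigenvalues by auto
  have "Max (Re ` ?E) < \<gamma>" using fin K_eigenvalue_Re_less gamma_ge_1 by (subst Max_less_iff) auto
  then obtain \<kappa> where k: "Max (Re ` ?E) < \<kappa>" "\<kappa> < \<gamma>" using dense by blast
  have r: "Re z < \<kappa>" if "z \<in> ?E" for z
    using k(1) fin that by (meson Max_ge imageI le_less_trans)
  obtain b where "inner_form b" "\<And>x. b (transpose K *v x) x \<le> \<kappa> * b x x"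
    using stable_form[of "transpose K" \<kappa>] r by (auto simp: complex_eigenvalue_transpose)
  moreover have "0 \<le> \<kappa>" using r[of 0] by simp
  ultimately show ?thesis using k(2) by (intro that[of b]) simp_all
qed

text \<open>Two forms with a common constant: \<open>b\<close> controls the deviation, which
  \<open>K\<close> moves as a row vector, and \<open>b'\<close> the arguments of the characteristic
  functions, which it moves as column vectors.\<close>

lemma K_forms_half:
  assumes gap: "\<And>z. complex_eigenvalue Q z \<Longrightarrow> z \<noteq> complex_of_real lam \<Longrightarrow> Re (1 / (1 - z)) < \<gamma> / 2"
  obtains b b' \<kappa> where "inner_form b" "inner_form b'" "\<kappa> < \<gamma> / 2" "0 \<le> \<kappa>"
    "\<And>x. b (x v* K) x \<le> \<kappa> * b x x" "\<And>x. b' (K *v x) x \<le> \<kappa> * b' x x"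
proof -
  \<comment> \<open>Inserting 0 keeps the set nonempty and makes \<open>\<kappa>\<close>
    nonnegative, as the norm version of the Euler estimate requires.\<close>
  let ?E = "insert 0 {z. complex_eigenvalue K z}"
  have fin: "finite (Re ` ?E)" using finite_complex_eigenvalues by auto
  have "Re z < \<gamma> / 2" if "complex_eigenvalue K z" for z
  proof (cases "z = 0")
    case False
    then show ?thesis using K_eigenvalue[OF that] gap by metis
  qed (use gamma_ge_1 in simp)
  then have "Max (Re ` ?E) < \<gamma> / 2" using fin gamma_ge_1 by (subst Max_less_iff) auto
  then obtain \<kappa> where k: "Max (Re ` ?E) < \<kappa>" "\<kappa> < \<gamma> / 2" using dense by blast
  have r: "Re z < \<kappa>" if "z \<in> ?E" for z
    using k(1) fin that by (meson Max_ge imageI le_less_trans)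
  obtain b where "inner_form b" "\<And>x. b (transpose K *v x) x \<le> \<kappa> * b x x"
    using stable_form[of "transpose K" \<kappa>] r by (auto simp: complex_eigenvalue_transpose)
  moreover obtain b' where "inner_form b'" "\<And>x. b' (K *v x) x \<le> \<kappa> * b' x x"
    using stable_form[of K \<kappa>] r by auto
  moreover have "0 \<le> \<kappa>" using r[of 0] by simp
  ultimately show ?thesis using k(2) by (intro that[of b b']) simp_all
qed

end

section \<open>Normal laws and the continuity theorem\<close>

text \<open>An independent standard normal multiple of \<open>a\<close> is added for each list
  entry, which multiplies the characteristic function by
  \<open>exp (- (a \<bullet> t)^2 / 2)\<close>. The vectors need not span, so singular covariances
  are included.\<close>

lemma gaussian_measure_exists:
  fixes as :: "('v::euclidean_space) list"
  shows "\<exists>N::'v measure. prob_space N \<and> sets N = sets borel \<and>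
    (\<forall>t. (CLINT x|N. iexp (t \<bullet> x)) = complex_of_real (exp (- (\<Sum>a\<leftarrow>as. (a \<bullet> t)\<^sup>2) / 2)))"
proof (induction as)
  case Nil
  show ?case
    by (intro exI[of _ "return borel 0"]) (auto simp: prob_space_return integral_return)
next
  case (Cons a as)
  then obtain N :: "'v measure" where N: "prob_space N" "sets N = sets borel"
    "\<And>t. (CLINT x|N. iexp (t \<bullet> x)) = complex_of_real (exp (- (\<Sum>a\<leftarrow>as. (a \<bullet> t)\<^sup>2) / 2))" by blast
  note [measurable_cong] = N(2)
  interpret N: prob_space N by fact
  let ?Z = "density lborel (\<lambda>x. ennreal (std_normal_density x))"
  interpret Z: prob_space ?Z by (rule prob_space_normal_density) simp
  interpret P: pair_prob_space N ?Z ..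
  let ?f = "\<lambda>(x, g). x + g *\<^sub>R a"
  have [measurable]: "?f \<in> borel_measurable (N \<Otimes>\<^sub>M ?Z)" by measurable
  let ?N' = "distr (N \<Otimes>\<^sub>M ?Z) borel ?f"
  have "(CLINT x|?N'. iexp (t \<bullet> x)) = complex_of_real (exp (- (\<Sum>b\<leftarrow>a # as. (b \<bullet> t)\<^sup>2) / 2))" for t
  proof -
    have "(CLINT x|?N'. iexp (t \<bullet> x)) = (CLINT y|N \<Otimes>\<^sub>M ?Z. iexp (t \<bullet> ?f y))"
      by (subst integral_distr) (auto simp: split_beta')
    also have "\<dots> = (CLINT x|N. CLINT g|?Z. iexp (t \<bullet> ?f (x, g)))"
      by (rule P.integral_fst'[symmetric], rule P.integrable_const_bound[where B=1])
         (auto simp: split_beta')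
    also have "\<dots> = (CLINT x|N. iexp (t \<bullet> x) * (CLINT g|?Z. iexp ((a \<bullet> t) * g)))"
      by (simp add: inner_add_right ring_distribs exp_add inner_commute mult_ac)
    also have "\<dots> = (CLINT x|N. iexp (t \<bullet> x)) * char ?Z (a \<bullet> t)"
      by (simp add: char_def)
    also have "\<dots> = complex_of_real (exp (- (\<Sum>b\<leftarrow>a # as. (b \<bullet> t)\<^sup>2) / 2))"
      unfolding N(3) char_std_normal_distribution
      by (simp add: exp_add[symmetric] add_divide_distrib diff_divide_distrib flip: of_real_mult)
    finally show ?thesis .
  qed
  then show ?case
    by (intro exI[of _ ?N']) (auto intro: P.prob_space_distr)
qed

lemma normal_law_char:
  assumes "0 \<le> v"
  shows "real_distribution (normal_law 0 v)" "char (normal_law 0 v) s = complex_of_real (exp (- (s\<^sup>2 * v) / 2))"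
proof -
  let ?Z = "density lborel (\<lambda>x. ennreal (std_normal_density x))"
  interpret Z: prob_space ?Z by (rule prob_space_normal_density) simp
  have "real_distribution (normal_law 0 v) \<and> char (normal_law 0 v) s = complex_of_real (exp (- (s\<^sup>2 * v) / 2))"
  proof (cases "v = 0")
    case True
    then show ?thesis
      by (auto simp: normal_law_def char_def integral_return real_distribution_def real_distribution_axioms_def
          prob_space_return)
  next
    case False
    with assms have v: "sqrt v > 0" by simp
    have "distributed ?Z lborel (\<lambda>x. x) (normal_density 0 1)"
      unfolding distributed_def by (auto simp: distr_id2)
    then have "distributed ?Z lborel (\<lambda>x. 0 + sqrt v * x) (normal_density (0 + sqrt v * 0) (\<bar>sqrt v\<bar> * 1))"
      by (rule Z.normal_density_affine) (use v in auto)
    then have "distr ?Z lborel (\<lambda>x. sqrt v * x) = density lborel (normal_density 0 (sqrt v))"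
      using v by (simp add: distributed_def)
    then have eq: "normal_law 0 v = distr ?Z lborel (\<lambda>x. sqrt v * x)"
      using False by (simp add: normal_law_def)
    have "char (normal_law 0 v) s = char ?Z (s * sqrt v)"
      unfolding eq char_def by (subst integral_distr) (auto simp: mult_ac)
    also have "\<dots> = complex_of_real (exp (- (s\<^sup>2 * v) / 2))"
      using assms by (simp add: char_std_normal_distribution power_mult_distrib)
    finally have 1: "char (normal_law 0 v) s = complex_of_real (exp (- (s\<^sup>2 * v) / 2))" .
    have "real_distribution (normal_law 0 v)"
      unfolding eq real_distribution_def real_distribution_axioms_def
      by (auto intro: Z.prob_space_distr)
    with 1 show ?thesis by simp
  qed
  then show "real_distribution (normal_law 0 v)" "char (normal_law 0 v) s = complex_of_real (exp (- (s\<^sup>2 * v) / 2))"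
    by auto
qed

text \<open>The characteristic function of a projection is that of the vector along a line, so
  uniqueness on the real line identifies all projections.\<close>

lemma multivariate_normal_exists:
  fixes V :: "real^'n^'n"
  assumes V: "transpose V = V" "\<And>t. 0 \<le> t \<bullet> (V *v t)"
  obtains N where "multivariate_normal 0 V N"
    "\<And>t. (CLINT x|N. iexp (t \<bullet> x)) = complex_of_real (exp (- (t \<bullet> (V *v t)) / 2))"
proof -
  obtain as where as: "\<And>t. t \<bullet> (V *v t) = (\<Sum>a\<leftarrow>as. (a \<bullet> t)\<^sup>2)" using psd_sum_of_squares[OF V] by blast
  obtain N :: "(real^'n) measure" where N: "prob_space N" "sets N = sets borel"
    "\<And>t. (CLINT x|N. iexp (t \<bullet> x)) = complex_of_real (exp (- (t \<bullet> (V *v t)) / 2))"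
    using gaussian_measure_exists[of as] unfolding as[symmetric] by blast
  note [measurable_cong] = N(2)
  interpret N: prob_space N by fact
  have "distr N borel (\<lambda>x. t \<bullet> x) = normal_law (t \<bullet> 0) (t \<bullet> (V *v t))" for t
    unfolding inner_zero_right
  proof (rule Levy_uniqueness)
    show "real_distribution (distr N borel (\<lambda>x. t \<bullet> x))"
      by (auto simp: real_distribution_def real_distribution_axioms_def intro!: N.prob_space_distr)
    show "real_distribution (normal_law 0 (t \<bullet> (V *v t)))" by (rule normal_law_char[OF V(2)])
    show "char (distr N borel (\<lambda>x. t \<bullet> x)) = char (normal_law 0 (t \<bullet> (V *v t)))"
    proof
      fix s
      have "char (distr N borel (\<lambda>x. t \<bullet> x)) s = (CLINT x|N. iexp ((s *\<^sub>R t) \<bullet> x))"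
        unfolding char_def by (subst integral_distr) auto
      also have "\<dots> = complex_of_real (exp (- (s\<^sup>2 * (t \<bullet> (V *v t))) / 2))"
        unfolding N(3) by (simp add: matrix_vector_mult_scaleR power2_eq_square mult.assoc)
      finally show "char (distr N borel (\<lambda>x. t \<bullet> x)) s = char (normal_law 0 (t \<bullet> (V *v t))) s"
        by (simp add: normal_law_char[OF V(2)])
    qed
  qed
  with N have "multivariate_normal 0 V N" by (simp add: multivariate_normal_def)
  with N(3) show ?thesis by (intro that)
qed

section \<open>Trigonometric polynomials and the continuity theorem\<close>

inductive trig_poly :: "('v::euclidean_space \<Rightarrow> real) \<Rightarrow> bool" where
  const: "trig_poly (\<lambda>x. c)"
| add: "trig_poly f \<Longrightarrow> trig_poly g \<Longrightarrow> trig_poly (\<lambda>x. f x + g x)"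
| cos: "trig_poly f \<Longrightarrow> trig_poly (\<lambda>x. f x * cos (t \<bullet> x))"
| sin: "trig_poly f \<Longrightarrow> trig_poly (\<lambda>x. f x * sin (t \<bullet> x))"

text \<open>The introduction rules multiply by a single cosine or sine, which suits inductions on
  integrals; Stone-Weierstrass asks for closure under all products.\<close>

lemma trig_poly_mult:
  assumes "trig_poly f" "trig_poly g"
  shows "trig_poly (\<lambda>x. f x * g x)"
  using assms
proof (induction f arbitrary: g rule: trig_poly.induct)
  case (const c)
  from const show ?case
  proof (induction g rule: trig_poly.induct)
    case (add f g)
    then show ?case using trig_poly.add[OF add.IH] by (simp add: algebra_simps)
  next
    case (cos f t)
    then show ?case using trig_poly.cos[OF cos.IH, of t] by (simp add: algebra_simps)
  next
    case (sin f t)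
    then show ?case using trig_poly.sin[OF sin.IH, of t] by (simp add: algebra_simps)
  qed (rule trig_poly.const)
next
  case (add f h)
  show ?case
    using trig_poly.add[OF add.IH(1)[OF add.prems] add.IH(2)[OF add.prems]] by (simp add: distrib_right)
next
  case (cos f t)
  then show ?case using trig_poly.cos[OF cos.IH, of g t] by (simp add: algebra_simps)
next
  case (sin f t)
  then show ?case using trig_poly.sin[OF sin.IH, of g t] by (simp add: algebra_simps)
qed

text \<open>Composition with polynomials allows a trigonometric polynomial to be clipped, up to a
  small error, without leaving the class.\<close>

lemma trig_poly_real_polynomial:
  assumes "real_polynomial_function p" "trig_poly f"
  shows "trig_poly (\<lambda>x. p (f x))"
  using assms(1)
proof (induction rule: real_polynomial_function.induct)
  case (linear p)
  then have "p y = y * p 1" for y using linear_scale[of p y 1] by (simp add: bounded_linear.linear)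
  then have "(\<lambda>x. p (f x)) = (\<lambda>x. f x * p 1)" by (rule ext)
  then show ?case
    using trig_poly_mult[OF assms(2) trig_poly.const[of "p 1"]] by (simp only:)
qed (auto intro: trig_poly.intros trig_poly_mult)

lemma trig_poly_continuous: "trig_poly f \<Longrightarrow> continuous_on UNIV f"
  by (induction rule: trig_poly.induct) (auto intro!: continuous_intros)

lemma trig_poly_bounded: "trig_poly f \<Longrightarrow> \<exists>B. \<forall>x. \<bar>f x\<bar> \<le> B"
proof (induction rule: trig_poly.induct)
  case (add f g)
  then obtain B C where "\<And>x. \<bar>f x\<bar> \<le> B" "\<And>x. \<bar>g x\<bar> \<le> C" by blast
  then have "\<bar>f x + g x\<bar> \<le> B + C" for x using abs_triangle_ineq[of "f x" "g x"] by (meson add_mono order_trans)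
  then show ?case by blast
next
  case (cos f t)
  then obtain B where B: "\<And>x. \<bar>f x\<bar> \<le> B" by blast
  have "\<bar>f x * cos (t \<bullet> x)\<bar> \<le> B * 1" for x
    unfolding abs_mult using B by (intro mult_mono) (auto intro: order_trans[OF abs_ge_zero])
  then show ?case by blast
next
  case (sin f t)
  then obtain B where B: "\<And>x. \<bar>f x\<bar> \<le> B" by blast
  have "\<bar>f x * sin (t \<bullet> x)\<bar> \<le> B * 1" for x
    unfolding abs_mult using B by (intro mult_mono) (auto intro: order_trans[OF abs_ge_zero])
  then show ?case by blast
qed blast

lemma trig_poly_approx:
  fixes f :: "'v::euclidean_space \<Rightarrow> real"
  assumes "compact S" "continuous_on S f" "0 < e"
  obtains g where "trig_poly g" "\<And>x. x \<in> S \<Longrightarrow> \<bar>f x - g x\<bar> < e"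
proof -
  have "\<exists>g. trig_poly g \<and> (\<forall>x\<in>S. \<bar>f x - g x\<bar> < e)"
  proof (rule Stone_Weierstrass_HOL)
    fix x y :: 'v assume xy: "x \<in> S \<and> y \<in> S \<and> x \<noteq> y"
    \<comment> \<open>The phases at \<open>x\<close> and \<open>y\<close> differ by
      \<open>pi\<close>, so cosine and sine both change sign between the two points, and they do not
      vanish together.\<close>
    let ?t = "(pi / (norm (x - y))\<^sup>2) *\<^sub>R (x - y)"
    have "?t \<bullet> x - ?t \<bullet> y = pi"
    proof -
      have "?t \<bullet> x - ?t \<bullet> y = ?t \<bullet> (x - y)" by (rule inner_diff_right[symmetric])
      also have "\<dots> = pi" using xy by (simp add: power2_norm_eq_inner)
      finally show ?thesis .
    qed
    then have "?t \<bullet> x = ?t \<bullet> y + pi" by linarith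
    then have c: "cos (?t \<bullet> x) = - cos (?t \<bullet> y)" "sin (?t \<bullet> x) = - sin (?t \<bullet> y)"
      by (simp_all only: cos_periodic_pi sin_periodic_pi)
    show "\<exists>g. trig_poly g \<and> g x \<noteq> g y"
    proof (cases "cos (?t \<bullet> y) = 0")
      case True
      then have "sin (?t \<bullet> y) \<noteq> 0" using sin_cos_squared_add[of "?t \<bullet> y"] by auto
      then show ?thesis using trig_poly.sin[OF trig_poly.const[of 1], of ?t] c by (intro exI conjI) auto
    next
      case False
      then show ?thesis using trig_poly.cos[OF trig_poly.const[of 1], of ?t] c by (intro exI conjI) auto
    qed
  qed (use assms in \<open>auto intro: trig_poly.intros trig_poly_mult continuous_on_subset[OF trig_poly_continuous]\<close>)
  then show ?thesis using that by blast
qed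

text \<open>On a large ball \<open>f\<close> is close to a trigonometric polynomial
  \<open>g\<close>, but the bound of \<open>g\<close> off the ball may grow with the accuracy, so
  tightness alone does not control the tails. Hence \<open>g\<close> is clipped to the range of
  \<open>f\<close> by a polynomial \<open>p\<close>; the composition is a trigonometric polynomial
  bounded everywhere by the bound of \<open>f\<close> plus 1.\<close>

lemma levy_continuity_euclidean:
  fixes D :: "nat \<Rightarrow> 'v::euclidean_space measure"
  assumes D: "\<And>n. prob_space (D n)" "\<And>n. sets (D n) = sets borel"
    and N: "prob_space N" "sets N = sets borel"
    and lim: "\<And>t. (\<lambda>n. CLINT x|D n. iexp (t \<bullet> x)) \<longlonglongrightarrow> (CLINT x|N. iexp (t \<bullet> x))"
    and tight: "\<And>e. e > 0 \<Longrightarrow> \<exists>R. \<forall>\<^sub>F n in sequentially. measure (D n) {x. R < norm x} \<le> e"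
    and f: "continuous_on UNIV f" "bounded (range f)"
  shows "(\<lambda>n. \<integral>x. f x \<partial>D n) \<longlonglongrightarrow> (\<integral>x. f x \<partial>N :: real)"
proof -
  note [measurable_cong] = N(2) D(2)
  interpret N: prob_space N by fact
  interpret D: prob_space "D n" for n by fact
  have int: "integrable (D n) (\<lambda>x. complex_of_real (g x) * iexp (t \<bullet> x))"
    "integrable N (\<lambda>x. complex_of_real (g x) * iexp (t \<bullet> x))" if g: "trig_poly g" for g t n
  proof -
    obtain B where B: "\<And>x. \<bar>g x\<bar> \<le> B" using trig_poly_bounded[OF g] by blast
    have [measurable]: "g \<in> borel_measurable borel"
      by (rule borel_measurable_continuous_onI[OF trig_poly_continuous[OF g]])
    show "integrable (D n) (\<lambda>x. complex_of_real (g x) * iexp (t \<bullet> x))"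
      by (rule D.integrable_const_bound[where B=B]) (auto simp: norm_mult B)
    show "integrable N (\<lambda>x. complex_of_real (g x) * iexp (t \<bullet> x))"
      by (rule N.integrable_const_bound[where B=B]) (auto simp: norm_mult B)
  qed
  \<comment> \<open>The statement carries a free frequency \<open>t\<close>, because a factor
    \<open>cos (s \<bullet> x)\<close> splits into the frequencies \<open>t + s\<close> and
    \<open>t - s\<close>.\<close>
  have trig: "(\<lambda>n. CLINT x|D n. complex_of_real (g x) * iexp (t \<bullet> x)) \<longlonglongrightarrow> (CLINT x|N. complex_of_real (g x) * iexp (t \<bullet> x))"
    if "trig_poly g" for g t
    using that
  proof (induction arbitrary: t rule: trig_poly.induct)
    case (const c)
    show ?case by (simp add: tendsto_mult_left lim)
  next
    case (add f g)
    then show ?case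
      by (simp add: ring_distribs int tendsto_add)
  next
    case (cos f s)
    have eq: "complex_of_real (f x * cos (s \<bullet> x)) * iexp (t \<bullet> x) =
       (1/2) * (complex_of_real (f x) * iexp ((t + s) \<bullet> x) + complex_of_real (f x) * iexp ((t - s) \<bullet> x))" for x
      by (simp add: inner_add_left inner_diff_left ring_distribs exp_add exp_diff cos_exp_eq exp_minus
          field_simps flip: cos_of_real)
    show ?case
      unfolding eq integral_mult_right_zero Bochner_Integration.integral_add[OF int(1)[OF cos.hyps] int(1)[OF cos.hyps]]
        Bochner_Integration.integral_add[OF int(2)[OF cos.hyps] int(2)[OF cos.hyps]]
      by (intro tendsto_intros cos.IH)
  next
    case (sin f s)
    have eq: "complex_of_real (f x * sin (s \<bullet> x)) * iexp (t \<bullet> x) =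
       (1/(2*\<i>)) * (complex_of_real (f x) * iexp ((t + s) \<bullet> x) - complex_of_real (f x) * iexp ((t - s) \<bullet> x))" for x
      by (simp add: inner_add_left inner_diff_left ring_distribs exp_add exp_diff sin_exp_eq exp_minus
          field_simps flip: sin_of_real)
    show ?case
      unfolding eq integral_mult_right_zero Bochner_Integration.integral_diff[OF int(1)[OF sin.hyps] int(1)[OF sin.hyps]]
        Bochner_Integration.integral_diff[OF int(2)[OF sin.hyps] int(2)[OF sin.hyps]]
      by (intro tendsto_intros sin.IH)
  qed
  have trig_real: "(\<lambda>n. \<integral>x. g x \<partial>D n) \<longlonglongrightarrow> (\<integral>x. g x \<partial>N)" if "trig_poly g" for g
  proof -
    have "(\<lambda>n. complex_of_real (\<integral>x. g x \<partial>D n)) \<longlonglongrightarrow> complex_of_real (\<integral>x. g x \<partial>N)"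
      using trig[OF that, of 0] by simp
    then show ?thesis by (simp only: tendsto_of_real_iff)
  qed
  obtain F where F: "\<And>x. \<bar>f x\<bar> \<le> F" using f(2) by (auto simp: bounded_iff)
  then have F0: "0 \<le> F" using abs_ge_zero order_trans by blast
  have [measurable]: "f \<in> borel_measurable borel" by (rule borel_measurable_continuous_onI[OF f(1)])
  show ?thesis
  proof (rule LIMSEQ_I)
    fix r :: real assume r: "0 < r"
    \<comment> \<open>Replacing \<open>f\<close> by \<open>q\<close> will cost at most
      \<open>2 e\<close> on the ball and \<open>(2 F + 1) e\<close> off it; the sum
      \<open>(3 + 2 F) e\<close> stays within \<open>r / 6\<close>.\<close>
    define e where "e = min 1 (r / (6 * (3 + 2 * F)))"
    have e: "0 < e" "e \<le> 1" using r F0 by (auto simp: e_def)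
    have "e * (3 + 2 * F) \<le> r / (6 * (3 + 2 * F)) * (3 + 2 * F)"
      using F0 by (intro mult_right_mono) (auto simp: e_def)
    also have "\<dots> = r / 6"
    proof -
      have "r / (6 * w) * w = r / 6" if "w > 0" for w :: real using that by simp
      then show ?thesis by this (use F0 in simp)
    qed
    finally have e3: "e * (3 + 2 * F) \<le> r / 6" .
    obtain R1 where R1: "\<forall>\<^sub>F n in sequentially. measure (D n) {x. R1 < norm x} \<le> e" using tight[OF e(1)] by blast
    have "(\<lambda>k. measure N {x. real k < norm x}) \<longlonglongrightarrow> measure N (\<Inter>k. {x. real k < norm x})"
      by (rule N.finite_Lim_measure_decseq) (auto simp: decseq_def)
    moreover have "(\<Inter>k. {x::'v. real k < norm x}) = {}"
    proof (rule equals0I)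
      fix x :: 'v assume x: "x \<in> (\<Inter>k. {x. real k < norm x})"
      obtain k where "norm x < real k" using reals_Archimedean2 by blast
      with x show False by (auto dest: spec[of _ k])
    qed
    ultimately have "(\<lambda>k. measure N {x. real k < norm x}) \<longlonglongrightarrow> 0" by simp
    then obtain k where k: "measure N {x. real k < norm x} < e"
      using e(1) by (metis (no_types, lifting) eventually_sequentially order_refl order_tendstoD(2))
    define R where "R = max R1 (real k)"
    have RN: "measure N {x. R < norm x} \<le> e"
    proof -
      have "measure N {x. R < norm x} \<le> measure N {x. real k < norm x}"
        by (intro N.finite_measure_mono) (auto simp: R_def)
      with k show ?thesis by simp
    qed
    have RD: "\<forall>\<^sub>F n in sequentially. measure (D n) {x. R < norm x} \<le> e"
      using R1
    proof eventually_elim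
      case (elim n)
      have "measure (D n) {x. R < norm x} \<le> measure (D n) {x. R1 < norm x}"
        by (intro D.finite_measure_mono) (auto simp: R_def)
      with elim show ?case by simp
    qed
    obtain g where g: "trig_poly g" "\<And>x. x \<in> cball 0 R \<Longrightarrow> \<bar>f x - g x\<bar> < e"
      using trig_poly_approx[OF compact_cball continuous_on_subset[OF f(1)] e(1)] by (metis subset_UNIV)
    obtain B where B: "\<And>x. \<bar>g x\<bar> \<le> B" using trig_poly_bounded[OF g(1)] by blast
    \<comment> \<open>Since the values of \<open>f\<close> lie in \<open>[-F, F]\<close>, clipping
      never moves \<open>g x\<close> away from \<open>f x\<close>.\<close>
    let ?clip = "\<lambda>y::real. max (- F) (min F y)"
    obtain p where p: "real_polynomial_function p" "\<And>y. y \<in> {-B..B} \<Longrightarrow> \<bar>?clip y - p y\<bar> < e"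
      by (rule Stone_Weierstrass_real_polynomial_function[OF compact_Icc _ e(1), of "-B" B ?clip])
         (auto intro!: continuous_intros)
    define q where "q x = p (g x)" for x
    have q: "trig_poly q" unfolding q_def[abs_def] by (rule trig_poly_real_polynomial[OF p(1) g(1)])
    have qc: "\<bar>?clip (g x) - q x\<bar> < e" for x
      unfolding q_def using B[of x] by (intro p(2)) (auto simp: abs_le_iff)
    have near: "\<bar>f x - q x\<bar> \<le> 2 * e" if "norm x \<le> R" for x
    proof -
      have "\<bar>f x - ?clip (g x)\<bar> \<le> \<bar>f x - g x\<bar>" using F[of x] F0 by (auto simp: abs_if min_def max_def split: if_splits)
      with g(2)[of x] qc[of x] that show ?thesis by (auto simp: abs_if split: if_splits)
    qed
    have far: "\<bar>f x - q x\<bar> \<le> 2 * F + 1" for x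
    proof -
      have "\<bar>?clip (g x)\<bar> \<le> F" using F0 by auto
      with F[of x] qc[of x] e(2) show ?thesis by linarith
    qed
    have [measurable]: "q \<in> borel_measurable borel" by (rule borel_measurable_continuous_onI[OF trig_poly_continuous[OF q]])
    have diff: "\<bar>(\<integral>x. f x \<partial>L) - (\<integral>x. q x \<partial>L)\<bar> \<le> r / 6"
      if L: "prob_space L" "sets L = sets borel" "measure L {x. R < norm x} \<le> e" for L
    proof -
      note [measurable_cong] = L(2)
      interpret L: prob_space L by fact
      obtain Bq where Bq: "\<And>x. \<bar>q x\<bar> \<le> Bq" using trig_poly_bounded[OF q] by blast
      have i1: "integrable L f" by (rule L.integrable_const_bound[where B=F]) (auto simp: F)
      have i2: "integrable L q" by (rule L.integrable_const_bound[where B=Bq]) (auto simp: Bq)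
      have "\<bar>(\<integral>x. f x \<partial>L) - (\<integral>x. q x \<partial>L)\<bar> = \<bar>\<integral>x. f x - q x \<partial>L\<bar>" using i1 i2 by simp
      also have "\<dots> \<le> (\<integral>x. \<bar>f x - q x\<bar> \<partial>L)" by (rule integral_abs_bound)
      also have "\<dots> \<le> (\<integral>x. 2 * e + (2 * F + 1) * indicator {x. R < norm x} x \<partial>L)"
      proof (rule integral_mono)
        show "integrable L (\<lambda>x. 2 * e + (2 * F + 1) * indicator {x. R < norm x} x)"
          by (rule L.integrable_const_bound[where B="2 * e + (2 * F + 1)"])
             (use e F0 in \<open>auto simp: indicator_def\<close>)
        show "\<bar>f x - q x\<bar> \<le> 2 * e + (2 * F + 1) * indicator {x. R < norm x} x" for x
          using near[of x] far[of x] e(1) by (auto simp: indicator_def not_less)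
      qed (use i1 i2 in auto)
      also have "\<dots> = 2 * e + (2 * F + 1) * measure L {x. R < norm x}"
        using L.prob_space by (subst Bochner_Integration.integral_add) (auto simp: L(2) sets_eq_imp_space_eq[OF L(2)] L.emeasure_eq_measure)
      also have "\<dots> \<le> 2 * e + (2 * F + 1) * e" using L(3) F0 by (intro add_left_mono mult_left_mono) auto
      also have "\<dots> \<le> r / 6" using e3 by (simp add: algebra_simps)
      finally show ?thesis .
    qed
    have "\<forall>\<^sub>F n in sequentially. \<bar>(\<integral>x. q x \<partial>D n) - (\<integral>x. q x \<partial>N)\<bar> < r / 6"
      using tendstoD[OF trig_real[OF q], of "r / 6"] r by (simp add: dist_real_def)
    then have "\<forall>\<^sub>F n in sequentially. norm ((\<integral>x. f x \<partial>D n) - (\<integral>x. f x \<partial>N)) < r"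
      using RD
    proof eventually_elim
      case (elim n)
      from diff[OF D(1,2) elim(2)] diff[OF N RN] elim(1) r show ?case unfolding real_norm_def by linarith
    qed
    then show "\<exists>no. \<forall>n\<ge>no. norm ((\<integral>x. f x \<partial>D n) - (\<integral>x. f x \<partial>N)) < r"
      by (simp add: eventually_sequentially)
  qed
qed

section \<open>The Markov property of the runs\<close>

lemma borel_measurable_vec_nth [measurable]: "(\<lambda>v::real^'n. v $ i) \<in> borel_measurable borel"
  by (intro borel_measurable_continuous_onI continuous_intros)

lemma borel_measurable_vecI:
  fixes f :: "'w \<Rightarrow> real^'n"
  assumes "\<And>i. (\<lambda>w. f w $ i) \<in> borel_measurable M"
  shows "f \<in> borel_measurable M"
proof (rule iffD2[OF borel_measurable_euclidean_space], rule ballI)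
  fix b :: "real^'n" assume "b \<in> Basis"
  then obtain i where "b = axis i 1" by (auto simp: Basis_vec_def)
  then have "(\<lambda>w. f w \<bullet> b) = (\<lambda>w. f w $ i)" by (auto simp: inner_axis)
  then show "(\<lambda>w. f w \<bullet> b) \<in> borel_measurable M" using assms by simp
qed

lemma summable_cube_power:
  fixes r :: real
  assumes "0 \<le> r" "r < 1"
  shows "summable (\<lambda>l. (real l + 1) ^ 3 * r ^ l)"
proof (cases "r = 0")
  case True
  then show ?thesis by (intro summable_finite[of "{0}"]) auto
next
  case False
  with assms have r: "0 < r" by simp
  define c where "c = (1 + r) / 2"
  have c: "r < c" "c < 1" using assms by (auto simp: c_def)
  have "(\<lambda>l. ((real l + 2) / (real l + 1)) ^ 3 * r) \<longlonglongrightarrow> r" by real_asymp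
  then have "\<forall>\<^sub>F l in sequentially. ((real l + 2) / (real l + 1)) ^ 3 * r < c" using c(1) by (rule order_tendstoD)
  then obtain N where N: "\<And>l. l \<ge> N \<Longrightarrow> ((real l + 2) / (real l + 1)) ^ 3 * r < c"
    by (auto simp: eventually_sequentially)
  show ?thesis
  proof (rule summable_ratio_test[OF c(2)])
    fix l assume "N \<le> l"
    then have "((real l + 2) / (real l + 1)) ^ 3 * r \<le> c" using N by (simp add: less_imp_le)
    then have "((real l + 2) / (real l + 1)) ^ 3 * r * ((real l + 1) ^ 3 * r ^ l) \<le> c * ((real l + 1) ^ 3 * r ^ l)"
      using r by (intro mult_right_mono) auto
    also have "((real l + 2) / (real l + 1)) ^ 3 * r * ((real l + 1) ^ 3 * r ^ l) = (real (Suc l) + 1) ^ 3 * r ^ Suc l"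
      by (simp add: power_divide add.commute)
    finally show "norm ((real (Suc l) + 1) ^ 3 * r ^ Suc l) \<le> c * norm ((real l + 1) ^ 3 * r ^ l)"
      using r by simp
  qed
qed

section \<open>The runs and their accumulated counts\<close>

locale algorithm = killed_chain Q \<mu> u lam + prob_space M
  for Q :: "real^'t::finite^'t" and \<mu> u lam and M :: "'w measure" +
  fixes P :: "real^('t + 'a::finite)^('t + 'a)" and \<mu>0 :: "real^'t" and T0 :: real
    and X :: "nat \<Rightarrow> nat \<Rightarrow> 'w \<Rightarrow> 't + 'a"
  assumes Q_def: "Q = transient_block P"
    and chain: "irreducible_absorbing_chain P"
    and mu0: "prob_vector \<mu>0" and T0: "T0 \<ge> 1"
    and run: "algorithm_run P \<mu>0 T0 M X"
begin

definition F :: "nat \<Rightarrow> 'w measure" where "F = past M X"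

definition muN :: "nat \<Rightarrow> 'w \<Rightarrow> real^'t" where
  "muN n \<omega> = fst (iterate (\<lambda>j l. X j l \<omega>) \<mu>0 T0 n)"

definition TN :: "nat \<Rightarrow> 'w \<Rightarrow> real" where
  "TN n \<omega> = snd (iterate (\<lambda>j l. X j l \<omega>) \<mu>0 T0 n)"

text \<open>Index shift: \<open>tau n\<close> and \<open>visits n\<close> belong to the run numbered
  \<open>n + 1\<close>, which turns iterate \<open>n\<close> into iterate \<open>n + 1\<close>. They
  are measurable for \<open>F (n + 1)\<close> and still random given \<open>F n\<close>.\<close>

definition tau :: "nat \<Rightarrow> 'w \<Rightarrow> nat" where
  "tau n \<omega> = absorption_time (\<lambda>l. X (Suc n) l \<omega>)"

definition visits :: "nat \<Rightarrow> 'w \<Rightarrow> real^'t" where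
  "visits n \<omega> = (\<chi> x. \<Sum>l<tau n \<omega>. indicator {Inl x} (X (Suc n) l \<omega>))"

text \<open>The initial pair enters like a run of length \<open>T0\<close> with occupation profile
  \<open>\<mu>0\<close>.\<close>

definition SN :: "nat \<Rightarrow> 'w \<Rightarrow> real" where
  "SN n \<omega> = T0 + (\<Sum>j<n. real (tau j \<omega>))"

definition WN :: "nat \<Rightarrow> 'w \<Rightarrow> real^'t" where
  "WN n \<omega> = T0 *\<^sub>R \<mu>0 + (\<Sum>j<n. visits j \<omega>)"

lemma SN_ge: "1 \<le> SN n \<omega>"
  unfolding SN_def using T0 by (simp add: add_increasing2 sum_nonneg)

text \<open>Valid on every path, absorbed or not: below a \<open>LEAST\<close> the defining
  predicate always fails, so all states counted are transient.\<close>

lemma visits_sum: "(\<Sum>x\<in>UNIV. visits n \<omega> $ x) = real (tau n \<omega>)"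
proof -
  have "(\<Sum>x\<in>UNIV. indicator {Inl x} (X (Suc n) l \<omega>)) = (1::real)" if l: "l < tau n \<omega>" for l
  proof -
    have "X (Suc n) l \<omega> \<in> range Inl"
      using not_less_Least[of l "\<lambda>k. X (Suc n) k \<omega> \<notin> range Inl"] l by (auto simp: tau_def absorption_time_def)
    then obtain y where y: "X (Suc n) l \<omega> = Inl y" by auto
    have "(\<Sum>x\<in>UNIV. indicator {Inl x} (X (Suc n) l \<omega>)) = (\<Sum>x\<in>UNIV. if x = y then 1 else (0::real))"
      unfolding y by (intro sum.cong) (auto simp: indicator_def)
    then show ?thesis by simp
  qed
  moreover have "(\<Sum>x\<in>UNIV. visits n \<omega> $ x) = (\<Sum>l<tau n \<omega>. \<Sum>x\<in>UNIV. indicator {Inl x} (X (Suc n) l \<omega>))"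
    unfolding visits_def vec_lambda_beta by (rule sum.swap)
  ultimately show ?thesis by simp
qed

lemma visits_nonneg: "0 \<le> visits n \<omega> $ x"
  by (simp add: visits_def sum_nonneg)

text \<open>The factor \<open>1 / (n + 1)\<close> and the denominator
  \<open>T + tau / (n + 1)\<close> combine to \<open>1 / (S + tau)\<close>, so the update is a
  renormalisation of cumulated counts.\<close>

lemma iterate_eq: "muN n \<omega> = (1 / SN n \<omega>) *\<^sub>R WN n \<omega>" "TN n \<omega> = SN n \<omega> / (real n + 1)"
proof -
  have "muN n \<omega> = (1 / SN n \<omega>) *\<^sub>R WN n \<omega> \<and> TN n \<omega> = SN n \<omega> / (real n + 1)"
  proof (induction n)
    case 0
    show ?case using T0 by (simp add: muN_def TN_def SN_def WN_def)
  next
    case (Suc n)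
    let ?S = "SN n \<omega>" and ?t = "real (tau n \<omega>)"
    have S: "?S \<ge> 1" by (rule SN_ge)
    have St: "?S + ?t > 0" using S by simp
    have S': "SN (Suc n) \<omega> = ?S + ?t" by (simp add: SN_def)
    have W': "WN (Suc n) \<omega> = WN n \<omega> + visits n \<omega>" by (simp add: WN_def algebra_simps)
    have step: "muN (Suc n) \<omega> $ x = muN n \<omega> $ x + 1 / real (n + 1) *
        ((\<Sum>l<tau n \<omega>. (indicator {Inl x} (X (Suc n) l \<omega>) - muN n \<omega> $ x)) / (TN n \<omega> + ?t / real (n + 1)))"
      "TN (Suc n) \<omega> = TN n \<omega> + 1 / real (n + 2) * (?t - TN n \<omega>)" for x
      by (simp_all add: muN_def TN_def tau_def Let_def split_beta)
    have sum: "(\<Sum>l<tau n \<omega>. (indicator {Inl x} (X (Suc n) l \<omega>) - muN n \<omega> $ x)) = visits n \<omega> $ x - ?t * muN n \<omega> $ x" for x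
      by (simp add: sum_subtractf visits_def)
    have den: "real (n + 1) * (TN n \<omega> + ?t / real (n + 1)) = ?S + ?t"
      using Suc by (simp add: field_simps)
    have "muN (Suc n) \<omega> $ x = muN n \<omega> $ x + (visits n \<omega> $ x - ?t * muN n \<omega> $ x) / (?S + ?t)" for x
      unfolding step sum den[symmetric] by simp
    also have "\<dots> x = (?S * muN n \<omega> $ x + visits n \<omega> $ x) / (?S + ?t)" for x
      using St by (simp add: field_simps)
    finally have m: "muN (Suc n) \<omega> $ x = (?S * muN n \<omega> $ x + visits n \<omega> $ x) / (?S + ?t)" for x .
    have "muN (Suc n) \<omega> = (1 / SN (Suc n) \<omega>) *\<^sub>R WN (Suc n) \<omega>"
      unfolding vec_eq_iff m S' W' using S by (simp add: Suc)
    moreover have "TN (Suc n) \<omega> = SN (Suc n) \<omega> / (real (Suc n) + 1)"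
      unfolding step S' using Suc by (simp add: field_simps)
    ultimately show ?case by simp
  qed
  then show "muN n \<omega> = (1 / SN n \<omega>) *\<^sub>R WN n \<omega>" "TN n \<omega> = SN n \<omega> / (real n + 1)" by auto
qed

lemma X_measurable [measurable]: "X (Suc n) k \<in> measurable M (count_space UNIV)"
  using run by (auto simp: algorithm_run_def)

lemma space_F: "space (F n) = space M"
  by (simp add: F_def past_def space_measure_of_conv)

lemma F_generators: "{X j k -` A \<inter> space M | j k A. 1 \<le> j \<and> j \<le> n} \<subseteq> sets M"
proof (clarify)
  fix j k :: nat and A assume "1 \<le> j"
  then have "X j k \<in> measurable M (count_space UNIV)" using run unfolding algorithm_run_def by blast
  then show "X j k -` A \<inter> space M \<in> sets M" by (rule measurable_sets) simp
qed

lemma F_sets: "sets (F n) = sigma_sets (space M) {X j k -` A \<inter> space M | j k A. 1 \<le> j \<and> j \<le> n}"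
  unfolding F_def past_def by (rule sets_measure_of) auto

lemma F_subalgebra: "subalgebra M (F n)"
  unfolding subalgebra_def space_F F_sets using sets.sigma_sets_subset[OF F_generators] by simp

lemma F_mono: "sets (F n) \<subseteq> sets (F (Suc n))"
  unfolding F_sets by (rule sigma_sets_mono') fastforce

lemma X_measurable_F: "j < n \<Longrightarrow> X (Suc j) k \<in> measurable (F n) (count_space UNIV)"
proof (rule measurableI)
  fix A assume "j < n"
  then show "X (Suc j) k -` A \<inter> space (F n) \<in> sets (F n)"
    unfolding space_F F_sets
    by (intro sigma_sets.Basic CollectI exI[of _ "Suc j"] exI[of _ k] exI[of _ A]) auto
qed simp

lemma tau_measurable_F: "j < n \<Longrightarrow> tau j \<in> measurable (F n) (count_space UNIV)"
proof -
  assume "j < n"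
  note X_measurable_F[OF this, measurable]
  show ?thesis unfolding tau_def[abs_def] absorption_time_def by measurable
qed

lemma visits_measurable_F: "j < n \<Longrightarrow> visits j \<in> borel_measurable (F n)"
proof (rule borel_measurable_vecI)
  fix x assume "j < n"
  note X_measurable_F[OF this, measurable] tau_measurable_F[OF this, measurable]
  have [measurable]: "(\<lambda>\<omega>. if l < tau j \<omega> then indicator {Inl x} (X (Suc j) l \<omega>) else 0 :: real) \<in> borel_measurable (F n)" for l
    by measurable
  \<comment> \<open>The number of summands is random; truncated sums over fixed ranges are
    measurable and eventually constant.\<close>
  have "(\<lambda>k. \<Sum>l<k. if l < tau j \<omega> then indicator {Inl x} (X (Suc j) l \<omega>) else 0) \<longlonglongrightarrow> visits j \<omega> $ x" for \<omega>
  proof (rule tendsto_eventually, rule eventually_sequentiallyI)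
    fix k assume k: "tau j \<omega> \<le> k"
    show "(\<Sum>l<k. if l < tau j \<omega> then indicator {Inl x} (X (Suc j) l \<omega>) else 0) = visits j \<omega> $ x"
      unfolding visits_def vec_lambda_beta using k by (intro sum.mono_neutral_cong_right) auto
  qed
  then show "(\<lambda>\<omega>. visits j \<omega> $ x) \<in> borel_measurable (F n)"
    by (rule borel_measurable_LIMSEQ_real) measurable
qed

lemma visits_measurable [measurable]: "visits j \<in> borel_measurable M"
  using measurable_from_subalg[OF F_subalgebra visits_measurable_F[of j "Suc j"]] by simp

lemma tau_measurable [measurable]: "tau j \<in> measurable M (count_space UNIV)"
  using measurable_from_subalg[OF F_subalgebra tau_measurable_F[of j "Suc j"]] by simp

lemma SN_measurable_F: "SN n \<in> borel_measurable (F n)"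
  unfolding SN_def[abs_def]
  by (intro borel_measurable_add borel_measurable_const borel_measurable_sum
      measurable_compose[OF tau_measurable_F, of _ _ real]) auto

lemma WN_measurable_F: "WN n \<in> borel_measurable (F n)"
  unfolding WN_def[abs_def]
  by (intro borel_measurable_add borel_measurable_const borel_measurable_sum visits_measurable_F) auto

lemma muN_measurable_F: "muN n \<in> borel_measurable (F n)"
proof -
  note SN_measurable_F[measurable] WN_measurable_F[measurable]
  have "muN n = (\<lambda>\<omega>. (1 / SN n \<omega>) *\<^sub>R WN n \<omega>)" using iterate_eq by auto
  then show ?thesis by simp
qed

lemma muN_prob: "prob_vector (muN n \<omega>)"
proof -
  have "0 \<le> WN n \<omega> $ x" for x
    using mu0 T0 visits_nonneg by (auto simp: WN_def prob_vector_def intro!: add_nonneg_nonneg sum_nonneg)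
  moreover have "(\<Sum>x\<in>UNIV. WN n \<omega> $ x) = SN n \<omega>"
  proof -
    have "(\<Sum>x\<in>UNIV. WN n \<omega> $ x) = T0 * (\<Sum>x\<in>UNIV. \<mu>0 $ x) + (\<Sum>j<n. \<Sum>x\<in>UNIV. visits j \<omega> $ x)"
      by (simp add: WN_def sum.distrib sum_distrib_left) (rule sum.swap)
    then show ?thesis using mu0 by (simp add: SN_def visits_sum prob_vector_def)
  qed
  ultimately show ?thesis
    using SN_ge[of n \<omega>] by (auto simp: prob_vector_def iterate_eq sum_divide_distrib[symmetric])
qed

lemma muN_bounds: "0 \<le> muN n \<omega> $ x" "muN n \<omega> $ x \<le> 1"
proof -
  show "0 \<le> muN n \<omega> $ x" using muN_prob by (auto simp: prob_vector_def)
  have "muN n \<omega> $ x \<le> (\<Sum>x\<in>UNIV. muN n \<omega> $ x)"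
    using muN_prob[of n \<omega>] by (intro member_le_sum) (auto simp: prob_vector_def)
  then show "muN n \<omega> $ x \<le> 1" using muN_prob[of n \<omega>] by (simp add: prob_vector_def)
qed

section \<open>Conditioning on the past runs\<close>

sublocale cond: finite_measure_subalgebra M "F n" for n
  by unfold_locales (rule F_subalgebra)

text \<open>The test functions through which conditional statements are expressed: expectation
  identities with an arbitrary bounded factor from the past take the place of conditional
  expectations. The bound holds at every point, which makes integrability immediate.\<close>

definition bounded_past :: "nat \<Rightarrow> ('w \<Rightarrow> real) \<Rightarrow> bool" where
  "bounded_past n g \<longleftrightarrow> g \<in> borel_measurable (F n) \<and> (\<exists>B. \<forall>\<omega>. \<bar>g \<omega>\<bar> \<le> B)"

lemma bounded_past_measurable: "bounded_past n g \<Longrightarrow> g \<in> borel_measurable M"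
  using measurable_from_subalg[OF F_subalgebra] by (auto simp: bounded_past_def)

lemma integrable_bounded_past:
  assumes "bounded_past n g" and [measurable]: "h \<in> borel_measurable M" and "\<And>\<omega>. \<bar>h \<omega>\<bar> \<le> C"
  shows "integrable M (\<lambda>\<omega>. g \<omega> * h \<omega>)"
proof -
  have [measurable]: "g \<in> borel_measurable M" using assms by (auto intro: bounded_past_measurable)
  obtain B where "\<And>\<omega>. \<bar>g \<omega>\<bar> \<le> B" using assms by (auto simp: bounded_past_def)
  then have "\<bar>g \<omega> * h \<omega>\<bar> \<le> B * C" for \<omega>
    unfolding abs_mult using assms(3) by (intro mult_mono) (auto intro: order_trans[OF abs_ge_zero])
  then show ?thesis by (intro integrable_const_bound[where B="B * C"]) auto
qed

definition cyl :: "nat \<Rightarrow> nat \<Rightarrow> (nat \<Rightarrow> 't + 'a) \<Rightarrow> 'w \<Rightarrow> real" where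
  "cyl n k s \<omega> = (if \<forall>i\<le>k. X (Suc n) i \<omega> = s i then 1 else 0)"

lemma cyl_measurable [measurable]: "cyl n k s \<in> borel_measurable M"
  unfolding cyl_def[abs_def] by measurable

text \<open>The conditional law demanded by \<open>algorithm_run\<close> enters here, as an
  expectation identity for single finite paths.\<close>

lemma cyl_expectation:
  assumes "bounded_past n g"
  shows "(\<integral>\<omega>. g \<omega> * cyl n k s \<omega> \<partial>M) = (\<integral>\<omega>. g \<omega> * initial_prob (muN n \<omega>) (s 0) \<partial>M) * (\<Prod>i<k. P $ s i $ s (Suc i))"
proof -
  let ?I = "indicator {\<omega> \<in> space M. \<forall>i\<le>k. X (Suc n) i \<omega> = s i} :: 'w \<Rightarrow> real"
  have [measurable]: "?I \<in> borel_measurable M" by measurable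
  have "(\<integral>\<omega>. g \<omega> * cyl n k s \<omega> \<partial>M) = (\<integral>\<omega>. g \<omega> * ?I \<omega> \<partial>M)"
    by (intro Bochner_Integration.integral_cong) (auto simp: cyl_def indicator_def)
  also have "\<dots> = (\<integral>\<omega>. g \<omega> * real_cond_exp M (F n) ?I \<omega> \<partial>M)"
  proof (rule cond.real_cond_exp_intg(2)[symmetric])
    show "integrable M (\<lambda>\<omega>. g \<omega> * ?I \<omega>)"
      by (rule integrable_bounded_past[OF assms, where C=1]) (auto simp: indicator_def)
  qed (use assms in \<open>auto simp: bounded_past_def\<close>)
  also have "\<dots> = (\<integral>\<omega>. g \<omega> * (initial_prob (muN n \<omega>) (s 0) * (\<Prod>i<k. P $ s i $ s (Suc i))) \<partial>M)"
  proof (rule integral_cong_AE)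
    have m: "g \<in> borel_measurable M" using assms by (rule bounded_past_measurable)
    then show "(\<lambda>\<omega>. g \<omega> * real_cond_exp M (F n) ?I \<omega>) \<in> borel_measurable M" by measurable
    have [measurable]: "muN n \<in> borel_measurable M" by (rule measurable_from_subalg[OF F_subalgebra muN_measurable_F])
    have "(\<lambda>\<omega>. initial_prob (muN n \<omega>) (s 0)) \<in> borel_measurable M"
      by (cases "s 0") (simp_all add: initial_prob_def)
    with m show "(\<lambda>\<omega>. g \<omega> * (initial_prob (muN n \<omega>) (s 0) * (\<Prod>i<k. P $ s i $ s (Suc i)))) \<in> borel_measurable M"
      by measurable
    show "AE \<omega> in M. g \<omega> * real_cond_exp M (F n) ?I \<omega> = g \<omega> * (initial_prob (muN n \<omega>) (s 0) * (\<Prod>i<k. P $ s i $ s (Suc i)))"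
    proof -
      have "AE \<omega> in M. real_cond_exp M (F n) ?I \<omega> = initial_prob (muN n \<omega>) (s 0) * (\<Prod>i<k. P $ s i $ s (Suc i))"
        using run unfolding algorithm_run_def F_def muN_def by blast
      then show ?thesis by eventually_elim simp
    qed
  qed
  also have "\<dots> = (\<integral>\<omega>. g \<omega> * initial_prob (muN n \<omega>) (s 0) \<partial>M) * (\<Prod>i<k. P $ s i $ s (Suc i))"
    by (simp add: mult.assoc[symmetric])
  finally show ?thesis .
qed

definition occ :: "nat \<Rightarrow> nat \<Rightarrow> 't + 'a \<Rightarrow> 'w \<Rightarrow> real" where
  "occ n k i \<omega> = (if X (Suc n) k \<omega> = i then 1 else 0)"

lemma occ_measurable [measurable]: "occ n k i \<in> borel_measurable M"
  unfolding occ_def[abs_def] by measurable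

lemma occ_bounds: "0 \<le> occ n k i \<omega>" "occ n k i \<omega> \<le> 1" "\<bar>occ n k i \<omega>\<bar> \<le> 1"
  by (auto simp: occ_def)

text \<open>The hypothesis on \<open>h\<close> says that it depends on the states up to time
  \<open>k\<close> only. As the state space is finite, \<open>h\<close> is a finite combination of
  path cylinders, and for one cylinder the claim is one more factor in the product of transition
  probabilities.\<close>

lemma markov_step:
  assumes g: "bounded_past n g" and h: "\<And>s s'. (\<forall>i\<le>k. s i = s' i) \<Longrightarrow> h s = (h s' :: real)"
  shows "(\<integral>\<omega>. g \<omega> * (h (\<lambda>l. X (Suc n) l \<omega>) * occ n (Suc k) j \<omega>) \<partial>M) =
    (\<Sum>i\<in>UNIV. P $ i $ j * (\<integral>\<omega>. g \<omega> * (h (\<lambda>l. X (Suc n) l \<omega>) * occ n k i \<omega>) \<partial>M))"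
proof -
  let ?E = "PiE {..k} (\<lambda>_. UNIV :: ('t + 'a) set)"
  have fin: "finite ?E" by (intro finite_PiE) auto
  \<comment> \<open>Histories are extensional functions on \<open>{..k}\<close>, so exactly one of
    them agrees with the path and a single term of the sum survives.\<close>
  have dec: "h (\<lambda>l. X (Suc n) l \<omega>) * b = (\<Sum>s\<in>?E. h s * (cyl n k s \<omega> * b))" for \<omega> b
  proof -
    let ?s = "restrict (\<lambda>l. X (Suc n) l \<omega>) {..k}"
    have "h s * (cyl n k s \<omega> * b) = (if s = ?s then h (\<lambda>l. X (Suc n) l \<omega>) * b else 0)" if "s \<in> ?E" for s
    proof (cases "s = ?s")
      case True
      then have "cyl n k s \<omega> = 1" by (simp add: cyl_def)
      moreover have "h s = h (\<lambda>l. X (Suc n) l \<omega>)" by (rule h) (simp add: True)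
      ultimately show ?thesis using True by simp
    next
      case False
      have "\<not> (\<forall>i\<le>k. X (Suc n) i \<omega> = s i)"
      proof
        assume "\<forall>i\<le>k. X (Suc n) i \<omega> = s i"
        then have "s = ?s" using that by (intro ext) (auto simp: PiE_def extensional_def restrict_def)
        with False show False by simp
      qed
      then have "cyl n k s \<omega> = 0" unfolding cyl_def by (rule if_not_P)
      then show ?thesis using False by simp
    qed
    then have "(\<Sum>s\<in>?E. h s * (cyl n k s \<omega> * b)) = (\<Sum>s\<in>?E. if s = ?s then h (\<lambda>l. X (Suc n) l \<omega>) * b else 0)"
      by (intro sum.cong) auto
    also have "\<dots> = h (\<lambda>l. X (Suc n) l \<omega>) * b" using fin by (subst sum.delta) auto
    finally show ?thesis by simp
  qed
  have b: "\<bar>cyl n k s \<omega> * occ n k' i \<omega>\<bar> \<le> 1" for s k' i \<omega> by (auto simp: cyl_def occ_def)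
  have exp: "(\<integral>\<omega>. g \<omega> * (h (\<lambda>l. X (Suc n) l \<omega>) * occ n k' i \<omega>) \<partial>M) =
      (\<Sum>s\<in>?E. h s * (\<integral>\<omega>. g \<omega> * (cyl n k s \<omega> * occ n k' i \<omega>) \<partial>M))" for k' i
  proof -
    have "(\<integral>\<omega>. g \<omega> * (h (\<lambda>l. X (Suc n) l \<omega>) * occ n k' i \<omega>) \<partial>M) =
        (\<integral>\<omega>. (\<Sum>s\<in>?E. h s * (g \<omega> * (cyl n k s \<omega> * occ n k' i \<omega>))) \<partial>M)"
      unfolding dec by (simp add: sum_distrib_left mult_ac)
    also have "\<dots> = (\<Sum>s\<in>?E. (\<integral>\<omega>. h s * (g \<omega> * (cyl n k s \<omega> * occ n k' i \<omega>)) \<partial>M))"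
      by (intro Bochner_Integration.integral_sum integrable_mult_right integrable_bounded_past[OF g _ b]) measurable
    finally show ?thesis by simp
  qed
  have "(\<integral>\<omega>. g \<omega> * (cyl n k s \<omega> * occ n (Suc k) j \<omega>) \<partial>M) = P $ s k $ j * (\<integral>\<omega>. g \<omega> * cyl n k s \<omega> \<partial>M)" for s
  proof -
    let ?s = "s(Suc k := j)"
    have "cyl n k s \<omega> * occ n (Suc k) j \<omega> = cyl n (Suc k) ?s \<omega>" for \<omega>
      by (auto simp: cyl_def occ_def le_Suc_eq)
    then show ?thesis
      using cyl_expectation[OF g, of "Suc k" ?s] cyl_expectation[OF g, of k s] by simp
  qed
  moreover have "(\<Sum>i\<in>UNIV. P $ i $ j * (\<integral>\<omega>. g \<omega> * (cyl n k s \<omega> * occ n k i \<omega>) \<partial>M)) = P $ s k $ j * (\<integral>\<omega>. g \<omega> * cyl n k s \<omega> \<partial>M)" for s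
  proof -
    have "cyl n k s \<omega> * occ n k i \<omega> = (if i = s k then cyl n k s \<omega> else 0)" for i \<omega>
      by (auto simp: cyl_def occ_def)
    then have "(\<Sum>i\<in>UNIV. P $ i $ j * (\<integral>\<omega>. g \<omega> * (cyl n k s \<omega> * occ n k i \<omega>) \<partial>M)) =
      (\<Sum>i\<in>UNIV. if i = s k then P $ s k $ j * (\<integral>\<omega>. g \<omega> * cyl n k s \<omega> \<partial>M) else 0)"
      by (intro sum.cong) auto
    then show ?thesis by simp
  qed
  ultimately have "(\<integral>\<omega>. g \<omega> * (h (\<lambda>l. X (Suc n) l \<omega>) * occ n (Suc k) j \<omega>) \<partial>M) =
      (\<Sum>s\<in>?E. h s * (\<Sum>i\<in>UNIV. P $ i $ j * (\<integral>\<omega>. g \<omega> * (cyl n k s \<omega> * occ n k i \<omega>) \<partial>M)))"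
    unfolding exp by simp
  also have "\<dots> = (\<Sum>i\<in>UNIV. P $ i $ j * (\<integral>\<omega>. g \<omega> * (h (\<lambda>l. X (Suc n) l \<omega>) * occ n k i \<omega>) \<partial>M))"
    unfolding exp sum_distrib_left by (subst sum.swap) (simp add: mult_ac)
  finally show ?thesis .
qed

lemma P_absorbing: "P $ Inr a $ Inl y = 0"
proof -
  have P: "\<And>i j. 0 \<le> P $ i $ j" "\<And>i. (\<Sum>j\<in>UNIV. P $ i $ j) = 1" "P $ Inr a $ Inr a = 1"
    using chain by (auto simp: irreducible_absorbing_chain_def stochastic_matrix_def)
  have "(\<Sum>j\<in>UNIV - {Inr a}. P $ Inr a $ j) = 0"
    using P(2)[of "Inr a"] P(3) sum.remove[of UNIV "Inr a" "\<lambda>j. P $ Inr a $ j"] by simp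
  then show ?thesis using P(1) by (subst (asm) sum_nonneg_eq_0_iff) auto
qed

lemma sum_UNIV_sum: "(\<Sum>i\<in>(UNIV::('t + 'a) set). f i) = (\<Sum>x\<in>UNIV. f (Inl x)) + (\<Sum>a\<in>UNIV. f (Inr a) :: real)"
  unfolding UNIV_Plus_UNIV[symmetric] by (subst sum.Plus) (auto simp: comp_def)

text \<open>A transient state has only transient predecessors, so the sum over all states in
  \<open>markov_step\<close> becomes one over entries of \<open>Q\<close>. The factor
  \<open>h\<close> is frozen at time \<open>k\<close> while the chain moves on for \<open>m\<close>
  steps; this yields joint laws at two times.\<close>

lemma transient_step:
  assumes g: "bounded_past n g" and h: "\<And>s s'. (\<forall>i\<le>k. s i = s' i) \<Longrightarrow> h s = (h s' :: real)"
  shows "(\<integral>\<omega>. g \<omega> * (h (\<lambda>l. X (Suc n) l \<omega>) * occ n (k + m) (Inl y) \<omega>) \<partial>M) =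
    (\<Sum>x\<in>UNIV. (\<integral>\<omega>. g \<omega> * (h (\<lambda>l. X (Suc n) l \<omega>) * occ n k (Inl x) \<omega>) \<partial>M) * matrix_power Q m $ x $ y)"
proof (induction m arbitrary: y)
  case 0
  show ?case by (simp add: mat_def if_distrib cong: if_cong)
next
  case (Suc m)
  have "(\<integral>\<omega>. g \<omega> * (h (\<lambda>l. X (Suc n) l \<omega>) * occ n (k + Suc m) (Inl y) \<omega>) \<partial>M) =
    (\<Sum>i\<in>UNIV. P $ i $ Inl y * (\<integral>\<omega>. g \<omega> * (h (\<lambda>l. X (Suc n) l \<omega>) * occ n (k + m) i \<omega>) \<partial>M))"
    using markov_step[OF g, of "k + m" h "Inl y"] h by simp
  also have "\<dots> = (\<Sum>z\<in>UNIV. Q $ z $ y * (\<integral>\<omega>. g \<omega> * (h (\<lambda>l. X (Suc n) l \<omega>) * occ n (k + m) (Inl z) \<omega>) \<partial>M))"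
    by (simp add: sum_UNIV_sum P_absorbing Q_def transient_block_def)
  also have "\<dots> = (\<Sum>x\<in>UNIV. (\<integral>\<omega>. g \<omega> * (h (\<lambda>l. X (Suc n) l \<omega>) * occ n k (Inl x) \<omega>) \<partial>M) * (\<Sum>z\<in>UNIV. matrix_power Q m $ x $ z * Q $ z $ y))"
    unfolding Suc sum_distrib_left by (subst sum.swap) (simp add: mult_ac)
  finally show ?case by (simp only: matrix_power_Suc_right) (simp add: matrix_matrix_mult_def)
qed

lemma expectation_occ:
  assumes g: "bounded_past n g"
  shows "(\<integral>\<omega>. g \<omega> * occ n l (Inl y) \<omega> \<partial>M) = (\<Sum>x\<in>UNIV. (\<integral>\<omega>. g \<omega> * muN n \<omega> $ x \<partial>M) * matrix_power Q l $ x $ y)"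
proof -
  have "(\<integral>\<omega>. g \<omega> * occ n 0 (Inl x) \<omega> \<partial>M) = (\<integral>\<omega>. g \<omega> * muN n \<omega> $ x \<partial>M)" for x
  proof -
    have "occ n 0 (Inl x) = cyl n 0 (\<lambda>_. Inl x)" by (auto simp: occ_def cyl_def)
    then show ?thesis using cyl_expectation[OF g, of 0 "\<lambda>_. Inl x"] by (simp add: initial_prob_def)
  qed
  then show ?thesis using transient_step[OF g, of 0 "\<lambda>_. 1" l y] by simp
qed

lemma expectation_occ_occ:
  assumes g: "bounded_past n g"
  shows "(\<integral>\<omega>. g \<omega> * (occ n l (Inl x) \<omega> * occ n (l + m) (Inl y) \<omega>) \<partial>M) =
    (\<Sum>z\<in>UNIV. (\<integral>\<omega>. g \<omega> * muN n \<omega> $ z \<partial>M) * (matrix_power Q l $ z $ x * matrix_power Q m $ x $ y))"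
proof -
  have "(\<integral>\<omega>. g \<omega> * (occ n l (Inl x) \<omega> * occ n (l + m) (Inl y) \<omega>) \<partial>M) =
    (\<Sum>z\<in>UNIV. (\<integral>\<omega>. g \<omega> * (occ n l (Inl x) \<omega> * occ n l (Inl z) \<omega>) \<partial>M) * matrix_power Q m $ z $ y)"
    using transient_step[OF g, of l "\<lambda>s. if s l = Inl x then 1 else 0" m y] by (simp add: occ_def)
  also have "\<dots> = (\<Sum>z\<in>UNIV. if z = x then (\<integral>\<omega>. g \<omega> * occ n l (Inl x) \<omega> \<partial>M) * matrix_power Q m $ x $ y else 0)"
  proof (intro sum.cong refl)
    fix z
    have "occ n l (Inl x) \<omega> * occ n l (Inl z) \<omega> = (if z = x then occ n l (Inl x) \<omega> else 0)" for \<omega>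
      by (auto simp: occ_def)
    then show "(\<integral>\<omega>. g \<omega> * (occ n l (Inl x) \<omega> * occ n l (Inl z) \<omega>) \<partial>M) * matrix_power Q m $ z $ y =
      (if z = x then (\<integral>\<omega>. g \<omega> * occ n l (Inl x) \<omega> \<partial>M) * matrix_power Q m $ x $ y else 0)" by simp
  qed
  also have "\<dots> = (\<integral>\<omega>. g \<omega> * occ n l (Inl x) \<omega> \<partial>M) * matrix_power Q m $ x $ y" by simp
  finally show ?thesis by (simp add: expectation_occ[OF g] sum_distrib_right mult.assoc)
qed

end

section \<open>Moments of the occupation counts\<close>

context algorithm
begin

lemma bounded_past_const: "bounded_past n (\<lambda>_. c)"
  by (auto simp: bounded_past_def)

section \<open>Almost sure absorption\<close>

definition occ_const :: real where
  "occ_const = real CARD('t) * power_const"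

lemma occ_integrable: "integrable M (occ n l i)"
  by (rule integrable_const_bound[where B=1]) (auto simp: occ_def)

lemma expectation_occ_le: "(\<integral>\<omega>. occ n l (Inl y) \<omega> \<partial>M) \<le> occ_const * lam ^ l"
proof -
  have [measurable]: "muN n \<in> borel_measurable M" by (rule measurable_from_subalg[OF F_subalgebra muN_measurable_F])
  have mu: "0 \<le> (\<integral>\<omega>. muN n \<omega> $ x \<partial>M)" "(\<integral>\<omega>. muN n \<omega> $ x \<partial>M) \<le> 1" for x
  proof -
    show "0 \<le> (\<integral>\<omega>. muN n \<omega> $ x \<partial>M)" by (intro integral_nonneg_AE) (simp add: muN_bounds)
    have "(\<integral>\<omega>. muN n \<omega> $ x \<partial>M) \<le> (\<integral>\<omega>. 1 \<partial>M)"
      by (intro integral_mono integrable_const_bound[where B=1]) (auto simp: muN_bounds)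
    then show "(\<integral>\<omega>. muN n \<omega> $ x \<partial>M) \<le> 1" by (simp add: prob_space)
  qed
  have "(\<integral>\<omega>. occ n l (Inl y) \<omega> \<partial>M) = (\<Sum>x\<in>UNIV. (\<integral>\<omega>. muN n \<omega> $ x \<partial>M) * matrix_power Q l $ x $ y)"
    using expectation_occ[OF bounded_past_const[of n 1], of l y] by simp
  also have "\<dots> \<le> (\<Sum>x\<in>(UNIV::'t set). 1 * (power_const * lam ^ l))"
    using mu matrix_power_le matrix_power_nonneg by (intro sum_mono mult_mono) auto
  finally show ?thesis by (simp add: occ_const_def)
qed

text \<open>Absorbing rows carry no mass towards transient states, so the expected product of the
  two indicators vanishes for each time and each pair of states; countably many null sets are then
  collected.\<close>

lemma AE_absorbed_stays:
  "AE \<omega> in M. \<forall>l. X (Suc n) l \<omega> \<notin> range Inl \<longrightarrow> X (Suc n) (Suc l) \<omega> \<notin> range Inl"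
proof -
  have "AE \<omega> in M. \<not> (X (Suc n) l \<omega> = Inr a \<and> X (Suc n) (Suc l) \<omega> = Inl y)" for l a y
  proof -
    let ?h = "\<lambda>s. if s l = Inr a then 1 else (0::real)"
    have z: "?h (\<lambda>l. X (Suc n) l \<omega>) * occ n l (Inl x) \<omega> = 0" for x \<omega> by (simp add: occ_def)
    have "(\<integral>\<omega>. 1 * (?h (\<lambda>l. X (Suc n) l \<omega>) * occ n (Suc l) (Inl y) \<omega>) \<partial>M) = 0"
      by (subst markov_step[OF bounded_past_const, of l ?h]) (auto simp: sum_UNIV_sum P_absorbing z)
    then have *: "(\<integral>\<omega>. occ n l (Inr a) \<omega> * occ n (Suc l) (Inl y) \<omega> \<partial>M) = 0" by (simp add: occ_def)
    have "AE \<omega> in M. occ n l (Inr a) \<omega> * occ n (Suc l) (Inl y) \<omega> = 0"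
      using * by (subst (asm) integral_nonneg_eq_0_iff_AE)
        (auto simp: occ_def intro!: integrable_const_bound[where B=1])
    then show ?thesis by eventually_elim (auto simp: occ_def)
  qed
  then have "AE \<omega> in M. \<forall>l. \<forall>a\<in>UNIV. \<forall>y\<in>UNIV. \<not> (X (Suc n) l \<omega> = Inr a \<and> X (Suc n) (Suc l) \<omega> = Inl y)"
    unfolding AE_all_countable by (intro allI AE_finite_allI) auto
  then show ?thesis
    by eventually_elim (metis UNIV_I old.sum.exhaust rangeE rangeI)
qed

lemma AE_start_transient: "AE \<omega> in M. X (Suc n) 0 \<omega> \<in> range Inl"
proof -
  have "AE \<omega> in M. X (Suc n) 0 \<omega> \<noteq> Inr a" for a
  proof -
    have "occ n 0 (Inr a) = cyl n 0 (\<lambda>_. Inr a)" by (auto simp: occ_def cyl_def)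
    then have "(\<integral>\<omega>. occ n 0 (Inr a) \<omega> \<partial>M) = 0"
      using cyl_expectation[OF bounded_past_const[of n 1], of 0 "\<lambda>_. Inr a"] by (simp add: initial_prob_def)
    then have "AE \<omega> in M. occ n 0 (Inr a) \<omega> = 0"
      by (subst (asm) integral_nonneg_eq_0_iff_AE) (auto simp: occ_integrable occ_bounds)
    then show ?thesis by eventually_elim (auto simp: occ_def split: if_splits)
  qed
  then have "AE \<omega> in M. \<forall>a\<in>UNIV. X (Suc n) 0 \<omega> \<noteq> Inr a" by (intro AE_finite_allI) auto
  then show ?thesis by eventually_elim (metis UNIV_I old.sum.exhaust rangeI)
qed

text \<open>A path that is never absorbed survives to every time \<open>l\<close>, and the
  probability of this is at most a multiple of \<open>lam^l\<close>.\<close>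

lemma AE_absorbed: "AE \<omega> in M. \<exists>l. X (Suc n) l \<omega> \<notin> range Inl"
proof -
  let ?A = "{\<omega> \<in> space M. \<forall>l. X (Suc n) l \<omega> \<in> range Inl}"
  have [measurable]: "?A \<in> events" by measurable
  have "prob ?A \<le> real CARD('t) * occ_const * lam ^ l" for l
  proof -
    have "prob ?A = (\<integral>\<omega>. indicator ?A \<omega> \<partial>M)" by simp
    also have "\<dots> \<le> (\<integral>\<omega>. (\<Sum>y\<in>UNIV. occ n l (Inl y) \<omega>) \<partial>M)"
    proof (rule integral_mono)
      fix \<omega>
      show "indicator ?A \<omega> \<le> (\<Sum>y\<in>UNIV. occ n l (Inl y) \<omega>)"
      proof (cases "\<omega> \<in> ?A")
        case True
        then obtain y where "X (Suc n) l \<omega> = Inl y" by auto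
        then have "1 = occ n l (Inl y) \<omega>" by (simp add: occ_def)
        also have "\<dots> \<le> (\<Sum>y\<in>UNIV. occ n l (Inl y) \<omega>)"
          by (rule member_le_sum) (auto simp: occ_bounds)
        finally show ?thesis using True by simp
      qed (simp add: sum_nonneg occ_bounds)
    next
      show "integrable M (indicat_real ?A)" by (rule integrable_const_bound[where B=1]) (auto simp: indicator_def)
    qed (auto intro!: occ_integrable)
    also have "\<dots> = (\<Sum>y\<in>UNIV. (\<integral>\<omega>. occ n l (Inl y) \<omega> \<partial>M))"
      by (intro Bochner_Integration.integral_sum occ_integrable)
    also have "\<dots> \<le> (\<Sum>y\<in>(UNIV::'t set). occ_const * lam ^ l)" by (intro sum_mono expectation_occ_le)
    finally show ?thesis by simp
  qed
  moreover have "(\<lambda>l. real CARD('t) * occ_const * lam ^ l) \<longlonglongrightarrow> real CARD('t) * occ_const * 0"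
    using lam_nonneg lam_less_1 by (intro tendsto_intros LIMSEQ_power_zero) auto
  ultimately have "prob ?A \<le> real CARD('t) * occ_const * 0"
    by (intro LIMSEQ_le_const) auto
  then have "prob ?A = 0" using measure_nonneg[of M ?A] by linarith
  then have "AE \<omega> in M. \<omega> \<notin> ?A" by (subst (asm) prob_eq_0) auto
  then show ?thesis using AE_space by eventually_elim auto
qed

text \<open>Off a null set, \<open>l < tau n \<omega>\<close> is an event of the state at time
  \<open>l\<close> alone. This makes the counts, defined through a \<open>LEAST\<close>, accessible
  to computations at fixed times.\<close>

lemma AE_tau: "AE \<omega> in M. 1 \<le> tau n \<omega> \<and> (\<forall>l. l < tau n \<omega> \<longleftrightarrow> X (Suc n) l \<omega> \<in> range Inl)"
  using AE_absorbed_stays[of n] AE_start_transient[of n] AE_absorbed[of n]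
proof eventually_elim
  case (elim \<omega>)
  have t: "tau n \<omega> = (LEAST l. X (Suc n) l \<omega> \<notin> range Inl)" by (simp add: tau_def absorption_time_def)
  have abs: "X (Suc n) (tau n \<omega>) \<omega> \<notin> range Inl" unfolding t using elim(3) by (rule LeastI_ex)
  have "X (Suc n) l \<omega> \<notin> range Inl" if "tau n \<omega> \<le> l" for l
    using that by (induction rule: dec_induct) (use abs elim(1) in auto)
  moreover have "X (Suc n) l \<omega> \<in> range Inl" if "l < tau n \<omega>" for l
    using not_less_Least[of l "\<lambda>k. X (Suc n) k \<omega> \<notin> range Inl"] that unfolding t by blast
  ultimately have *: "l < tau n \<omega> \<longleftrightarrow> X (Suc n) l \<omega> \<in> range Inl" for l by (meson not_less)
  have "0 < tau n \<omega>" unfolding * by (rule elim(2))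
  then have "1 \<le> tau n \<omega>" by linarith
  with * show ?case by blast
qed

section \<open>Counts up to a fixed time and their moments\<close>

definition pvisits :: "nat \<Rightarrow> nat \<Rightarrow> 't \<Rightarrow> 'w \<Rightarrow> real" where
  "pvisits n k x \<omega> = (\<Sum>l<k. occ n l (Inl x) \<omega>)"

lemma pvisits_measurable [measurable]: "pvisits n k x \<in> borel_measurable M"
  unfolding pvisits_def[abs_def] by measurable

lemma pvisits_bounds: "0 \<le> pvisits n k x \<omega>" "pvisits n k x \<omega> \<le> real k"
proof -
  show "0 \<le> pvisits n k x \<omega>" by (simp add: pvisits_def sum_nonneg occ_bounds)
  have "pvisits n k x \<omega> \<le> (\<Sum>l<k. 1)" unfolding pvisits_def by (intro sum_mono occ_bounds)
  then show "pvisits n k x \<omega> \<le> real k" by simp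
qed

lemma pvisits_Suc: "pvisits n (Suc k) x \<omega> = pvisits n k x \<omega> + occ n k (Inl x) \<omega>"
  by (simp add: pvisits_def)

lemma AE_pvisits: "AE \<omega> in M. \<forall>x. \<forall>k\<ge>tau n \<omega>. pvisits n k x \<omega> = visits n \<omega> $ x"
  using AE_tau[of n]
proof eventually_elim
  case (elim \<omega>)
  show ?case
  proof (intro allI impI)
    fix x k assume k: "tau n \<omega> \<le> k"
    have "visits n \<omega> $ x = (\<Sum>l<tau n \<omega>. occ n l (Inl x) \<omega>)"
      unfolding visits_def vec_lambda_beta by (intro sum.cong) (auto simp: occ_def)
    also have "\<dots> = pvisits n k x \<omega>"
      unfolding pvisits_def
    proof (rule sum.mono_neutral_left)
      show "\<forall>l\<in>{..<k} - {..<tau n \<omega>}. occ n l (Inl x) \<omega> = 0"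
      proof
        fix l assume "l \<in> {..<k} - {..<tau n \<omega>}"
        then have "\<not> l < tau n \<omega>" by simp
        then have "X (Suc n) l \<omega> \<notin> range Inl" using elim by blast
        then show "occ n l (Inl x) \<omega> = 0" by (auto simp: occ_def)
      qed
    qed (use k in auto)
    finally show "pvisits n k x \<omega> = visits n \<omega> $ x" by simp
  qed
qed

definition alive :: "nat \<Rightarrow> nat \<Rightarrow> 'w \<Rightarrow> real" where
  "alive n k \<omega> = (\<Sum>y\<in>UNIV. occ n k (Inl y) \<omega>)"

lemma alive_measurable [measurable]: "alive n k \<in> borel_measurable M"
  unfolding alive_def[abs_def] by measurable

lemma alive_eq: "alive n k \<omega> = (if X (Suc n) k \<omega> \<in> range Inl then 1 else 0)"
proof (cases "X (Suc n) k \<omega> \<in> range Inl")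
  case True
  then obtain z where "X (Suc n) k \<omega> = Inl z" by auto
  then show ?thesis by (simp add: alive_def occ_def cong: if_cong)
qed (auto simp: alive_def occ_def intro!: sum.neutral)

lemma occ_le_alive: "occ n k (Inl x) \<omega> \<le> alive n k \<omega>"
  by (auto simp: occ_def alive_eq)

lemma expectation_alive_le: "(\<integral>\<omega>. alive n k \<omega> \<partial>M) \<le> real CARD('t) * occ_const * lam ^ k"
proof -
  have "(\<integral>\<omega>. alive n k \<omega> \<partial>M) = (\<Sum>y\<in>UNIV. (\<integral>\<omega>. occ n k (Inl y) \<omega> \<partial>M))"
    unfolding alive_def by (intro Bochner_Integration.integral_sum occ_integrable)
  also have "\<dots> \<le> (\<Sum>y\<in>(UNIV::'t set). occ_const * lam ^ k)" by (intro sum_mono expectation_occ_le)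
  finally show ?thesis by simp
qed

lemma alive_integrable: "integrable M (alive n k)"
  by (rule integrable_const_bound[where B=1]) (auto simp: alive_eq)

text \<open>
  Functionals of the whole run are computed by telescoping along the approximations that see the
  first \<open>k\<close> states only; the increments live on the survival event, whose probability is geometric.
\<close>

lemma telescoped_expectation:
  fixes \<phi> :: "nat \<Rightarrow> 'w \<Rightarrow> real"
  assumes [measurable]: "\<And>k. \<phi> k \<in> borel_measurable M" and \<phi>0: "\<And>\<omega>. \<phi> 0 \<omega> = 0"
    and lim: "AE \<omega> in M. \<forall>k\<ge>tau n \<omega>. \<phi> k \<omega> = \<Phi> \<omega>" and [measurable]: "\<Phi> \<in> borel_measurable M"
    and inc: "\<And>k \<omega>. \<bar>\<phi> (Suc k) \<omega> - \<phi> k \<omega>\<bar> \<le> a k * alive n k \<omega>"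
    and a: "\<And>k. 0 \<le> a k" "summable (\<lambda>k. a k * lam ^ k)"
    and g: "bounded_past n g"
  shows "integrable M (\<lambda>\<omega>. g \<omega> * \<Phi> \<omega>)"
    and "(\<lambda>k. \<integral>\<omega>. g \<omega> * (\<phi> (Suc k) \<omega> - \<phi> k \<omega>) \<partial>M) sums (\<integral>\<omega>. g \<omega> * \<Phi> \<omega> \<partial>M)"
proof -
  have [measurable]: "g \<in> borel_measurable M" using g by (rule bounded_past_measurable)
  obtain B where B: "\<And>\<omega>. \<bar>g \<omega>\<bar> \<le> B" using g by (auto simp: bounded_past_def)
  have B0: "0 \<le> B" using B order_trans[OF abs_ge_zero] by blast
  let ?f = "\<lambda>k \<omega>. g \<omega> * (\<phi> (Suc k) \<omega> - \<phi> k \<omega>)"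
  have alive01: "0 \<le> alive n k \<omega>" "alive n k \<omega> \<le> 1" for k \<omega> by (auto simp: alive_eq)
  have fb: "\<bar>?f k \<omega>\<bar> \<le> B * a k * alive n k \<omega>" for k :: nat and \<omega>
  proof -
    have "\<bar>g \<omega>\<bar> * \<bar>\<phi> (Suc k) \<omega> - \<phi> k \<omega>\<bar> \<le> B * (a k * alive n k \<omega>)"
      using B inc B0 by (intro mult_mono) auto
    then show ?thesis by (simp add: abs_mult mult.assoc)
  qed
  have int: "integrable M (?f k)" for k
    by (rule Bochner_Integration.integrable_bound[OF integrable_mult_right[OF alive_integrable[of n k], of "B * a k"]])
       (use fb B0 a(1) alive01 in \<open>auto simp: abs_mult\<close>)
  have nb: "(\<integral>\<omega>. norm (?f k \<omega>) \<partial>M) \<le> (B * real CARD('t) * occ_const) * (a k * lam ^ k)" for k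
  proof -
    have "(\<integral>\<omega>. norm (?f k \<omega>) \<partial>M) \<le> (\<integral>\<omega>. B * a k * alive n k \<omega> \<partial>M)"
      using fb by (intro integral_mono integrable_norm int integrable_mult_right alive_integrable) auto
    also have "\<dots> \<le> B * a k * (real CARD('t) * occ_const * lam ^ k)"
      using B0 a(1) expectation_alive_le by (simp add: mult_left_mono)
    finally show ?thesis by (simp add: mult_ac)
  qed
  \<comment> \<open>On almost every path the series is a finite sum, since the approximations are
    constant from \<open>tau\<close> on; the geometric bound is what licenses exchanging it with the
    expectation.\<close>
  have s1: "AE \<omega> in M. summable (\<lambda>k. norm (?f k \<omega>))" and eq: "AE \<omega> in M. (\<Sum>k. ?f k \<omega>) = g \<omega> * \<Phi> \<omega>"
  proof -
    have *: "AE \<omega> in M. summable (\<lambda>k. norm (?f k \<omega>)) \<and> (\<Sum>k. ?f k \<omega>) = g \<omega> * \<Phi> \<omega>"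
      using lim
    proof eventually_elim
      case (elim \<omega>)
      have "summable (\<lambda>k. norm (?f k \<omega>))"
        by (rule summable_finite[of "{..<tau n \<omega>}"]) (use elim in auto)
      moreover have "(\<lambda>k. \<phi> k \<omega>) \<longlonglongrightarrow> \<Phi> \<omega>"
        by (rule tendsto_eventually, rule eventually_sequentiallyI[of "tau n \<omega>"]) (use elim in auto)
      then have "(\<lambda>k. g \<omega> * (\<phi> (Suc k) \<omega> - \<phi> k \<omega>)) sums (g \<omega> * (\<Phi> \<omega> - \<phi> 0 \<omega>))"
        by (intro sums_mult telescope_sums)
      ultimately show ?case by (simp add: \<phi>0 sums_iff)
    qed
    then show "AE \<omega> in M. summable (\<lambda>k. norm (?f k \<omega>))" "AE \<omega> in M. (\<Sum>k. ?f k \<omega>) = g \<omega> * \<Phi> \<omega>"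
      by (auto elim: eventually_mono)
  qed
  have s2: "summable (\<lambda>k. \<integral>\<omega>. norm (?f k \<omega>) \<partial>M)"
  proof (rule summable_comparison_test'[where N=0])
    show "summable (\<lambda>k. (B * real CARD('t) * occ_const) * (a k * lam ^ k))" by (intro summable_mult a)
  qed (use nb in auto)
  have int': "integrable M (\<lambda>\<omega>. \<Sum>k. ?f k \<omega>)" by (rule integrable_suminf[OF int s1 s2])
  show "integrable M (\<lambda>\<omega>. g \<omega> * \<Phi> \<omega>)"
    using integrable_cong_AE[THEN iffD1, OF _ _ eq int'] by simp
  have "(\<lambda>k. \<integral>\<omega>. ?f k \<omega> \<partial>M) sums (\<integral>\<omega>. (\<Sum>k. ?f k \<omega>) \<partial>M)" by (rule sums_integral[OF int s1 s2])
  also have "(\<integral>\<omega>. (\<Sum>k. ?f k \<omega>) \<partial>M) = (\<integral>\<omega>. g \<omega> * \<Phi> \<omega> \<partial>M)"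
    by (rule integral_cong_AE) (use eq in auto)
  finally show "(\<lambda>k. \<integral>\<omega>. ?f k \<omega> \<partial>M) sums (\<integral>\<omega>. g \<omega> * \<Phi> \<omega> \<partial>M)" .
qed

lemma summable_lam:
  assumes "\<And>k. 0 \<le> a k" "\<And>k. a k \<le> C * (real k + 1) ^ 3"
  shows "summable (\<lambda>k. a k * lam ^ k)"
proof (rule summable_comparison_test'[where N=0])
  show "summable (\<lambda>k. C * ((real k + 1) ^ 3 * lam ^ k))"
    by (intro summable_mult summable_cube_power lam_nonneg lam_less_1)
  fix k
  have "a k * lam ^ k \<le> C * (real k + 1) ^ 3 * lam ^ k" using assms lam_nonneg by (intro mult_right_mono) auto
  then show "norm (a k * lam ^ k) \<le> C * ((real k + 1) ^ 3 * lam ^ k)" using assms(1) lam_nonneg by (simp add: mult.assoc)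
qed

lemma one_le_cube: "1 \<le> (real k + 1) ^ 3" "real k + 1 \<le> (real k + 1) ^ 3"
  using one_le_power[of "real k + 1" 3] self_le_power[of "real k + 1" 3] by simp_all

text \<open>Third moments suffice for the Taylor remainder of the characteristic functions. The
  bound is uniform in \<open>n\<close>, since the survival estimate holds for every initial
  distribution.\<close>

lemma tau_cube:
  "integrable M (\<lambda>\<omega>. real (tau n \<omega>) ^ 3)"
  "(\<integral>\<omega>. real (tau n \<omega>) ^ 3 \<partial>M) \<le> (\<Sum>k. (real k + 1) ^ 3 * (real CARD('t) * occ_const * lam ^ k))"
proof -
  let ?p = "\<lambda>k \<omega>. \<Sum>x\<in>UNIV. pvisits n k x \<omega>"
  have pS: "?p (Suc k) \<omega> = ?p k \<omega> + alive n k \<omega>" for k \<omega>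
    by (simp add: pvisits_Suc sum.distrib alive_def)
  have p0: "0 \<le> ?p k \<omega>" for k \<omega> by (intro sum_nonneg pvisits_bounds)
  have pk: "?p k \<omega> \<le> real k" for k \<omega>
  proof (induction k)
    case (Suc k)
    moreover have "alive n k \<omega> \<le> 1" by (auto simp: alive_eq)
    ultimately show ?case unfolding pS by simp
  qed (simp add: pvisits_def)
  have inc: "\<bar>?p (Suc k) \<omega> ^ 3 - ?p k \<omega> ^ 3\<bar> \<le> (real k + 1) ^ 3 * alive n k \<omega>" for k \<omega>
  proof (cases "alive n k \<omega> = 0")
    case False
    then have 1: "alive n k \<omega> = 1" by (auto simp: alive_eq split: if_splits)
    have "(?p k \<omega> + 1) ^ 3 \<le> (real k + 1) ^ 3" using p0[of k \<omega>] pk[of k \<omega>] by (intro power_mono) auto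
    moreover have "?p k \<omega> ^ 3 \<le> (?p k \<omega> + 1) ^ 3" using p0[of k \<omega>] by (intro power_mono) auto
    moreover have "0 \<le> ?p k \<omega> ^ 3" using p0 by simp
    ultimately show ?thesis unfolding pS 1 by linarith
  qed (simp add: pS)
  have lim: "AE \<omega> in M. \<forall>k\<ge>tau n \<omega>. ?p k \<omega> ^ 3 = real (tau n \<omega>) ^ 3"
    using AE_pvisits[of n] by eventually_elim (simp add: visits_sum)
  have sm: "summable (\<lambda>k. (real k + 1) ^ 3 * lam ^ k)" by (rule summable_cube_power[OF lam_nonneg lam_less_1])
  have *: "(\<lambda>\<omega>. ?p k \<omega> ^ 3) \<in> borel_measurable M" for k by measurable
  note t = telescoped_expectation[where \<phi>="\<lambda>k \<omega>. ?p k \<omega> ^ 3" and \<Phi>="\<lambda>\<omega>. real (tau n \<omega>) ^ 3" and n=n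
      and a="\<lambda>k. (real k + 1) ^ 3" and g="\<lambda>_. 1", OF * _ lim _ inc _ sm bounded_past_const]
  show int: "integrable M (\<lambda>\<omega>. real (tau n \<omega>) ^ 3)" using t(1) by (simp add: pvisits_def)
  have s: "(\<lambda>k. \<integral>\<omega>. ?p (Suc k) \<omega> ^ 3 - ?p k \<omega> ^ 3 \<partial>M) sums (\<integral>\<omega>. real (tau n \<omega>) ^ 3 \<partial>M)"
    using t(2) by (simp add: pvisits_def)
  have "(\<integral>\<omega>. ?p (Suc k) \<omega> ^ 3 - ?p k \<omega> ^ 3 \<partial>M) \<le> (real k + 1) ^ 3 * (real CARD('t) * occ_const * lam ^ k)" for k
  proof -
    have "(\<integral>\<omega>. ?p (Suc k) \<omega> ^ 3 - ?p k \<omega> ^ 3 \<partial>M) \<le> (\<integral>\<omega>. (real k + 1) ^ 3 * alive n k \<omega> \<partial>M)"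
    proof (rule integral_mono)
      have ub: "\<bar>?p (Suc k) \<omega> ^ 3 - ?p k \<omega> ^ 3\<bar> \<le> (real k + 1) ^ 3" for \<omega>
        using inc[of k \<omega>] by (rule order_trans) (auto simp: alive_eq)
      show "integrable M (\<lambda>\<omega>. ?p (Suc k) \<omega> ^ 3 - ?p k \<omega> ^ 3)"
        by (rule integrable_const_bound[where B="(real k + 1) ^ 3"]) (use ub in auto)
      show "?p (Suc k) \<omega> ^ 3 - ?p k \<omega> ^ 3 \<le> (real k + 1) ^ 3 * alive n k \<omega>" for \<omega>
        using inc[of k \<omega>] by linarith
    qed (intro integrable_mult_right alive_integrable)
    also have "\<dots> \<le> (real k + 1) ^ 3 * (real CARD('t) * occ_const * lam ^ k)"
      using expectation_alive_le by (simp add: mult_left_mono)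
    finally show ?thesis .
  qed
  moreover have "summable (\<lambda>k. (real k + 1) ^ 3 * (real CARD('t) * occ_const * lam ^ k))"
    using summable_mult[OF sm, of "real CARD('t) * occ_const"] by (simp add: mult_ac)
  ultimately show "(\<integral>\<omega>. real (tau n \<omega>) ^ 3 \<partial>M) \<le> (\<Sum>k. (real k + 1) ^ 3 * (real CARD('t) * occ_const * lam ^ k))"
    using s by (subst sums_unique[OF s]) (intro suminf_le, auto simp: sums_iff)
qed

lemma muN_integrable: "bounded_past n g \<Longrightarrow> integrable M (\<lambda>\<omega>. g \<omega> * muN n \<omega> $ x)"
  by (rule integrable_bounded_past[where C=1])
     (use measurable_from_subalg[OF F_subalgebra muN_measurable_F] in \<open>auto simp: muN_bounds\<close>)

text \<open>Summing the occupation laws \<open>\<mu>\<^sub>n Q^k\<close> over all times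
  \<open>k\<close> gives \<open>\<mu>\<^sub>n G\<close>.\<close>

lemma expectation_visits_bounded:
  assumes g: "bounded_past n g"
  shows "integrable M (\<lambda>\<omega>. g \<omega> * visits n \<omega> $ x)"
    "(\<integral>\<omega>. g \<omega> * visits n \<omega> $ x \<partial>M) = (\<integral>\<omega>. g \<omega> * (muN n \<omega> v* G) $ x \<partial>M)"
proof -
  have sm: "summable (\<lambda>k. 1 * lam ^ k)" by (rule summable_lam[of _ 1]) (use one_le_cube in auto)
  have lim: "AE \<omega> in M. \<forall>k\<ge>tau n \<omega>. pvisits n k x \<omega> = visits n \<omega> $ x"
    using AE_pvisits[of n] by eventually_elim simp
  have inc: "\<bar>pvisits n (Suc k) x \<omega> - pvisits n k x \<omega>\<bar> \<le> 1 * alive n k \<omega>" for k \<omega>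
    using occ_le_alive occ_bounds by (simp add: pvisits_Suc)
  note t = telescoped_expectation[where \<phi>="\<lambda>k. pvisits n k x" and a="\<lambda>_. 1", OF _ _ lim _ inc _ sm g]
  show "integrable M (\<lambda>\<omega>. g \<omega> * visits n \<omega> $ x)" using t(1) by (simp add: pvisits_def)
  have "(\<lambda>k. \<Sum>z\<in>UNIV. (\<integral>\<omega>. g \<omega> * muN n \<omega> $ z \<partial>M) * matrix_power Q k $ z $ x) sums (\<integral>\<omega>. g \<omega> * visits n \<omega> $ x \<partial>M)"
    using t(2) by (simp add: pvisits_Suc expectation_occ[OF g]) (simp add: pvisits_def)
  moreover have "(\<lambda>k. \<Sum>z\<in>UNIV. (\<integral>\<omega>. g \<omega> * muN n \<omega> $ z \<partial>M) * matrix_power Q k $ z $ x) sums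
      (\<Sum>z\<in>UNIV. (\<integral>\<omega>. g \<omega> * muN n \<omega> $ z \<partial>M) * G $ z $ x)"
    by (intro sums_sum sums_mult G_sums)
  ultimately have "(\<integral>\<omega>. g \<omega> * visits n \<omega> $ x \<partial>M) = (\<Sum>z\<in>UNIV. (\<integral>\<omega>. g \<omega> * muN n \<omega> $ z \<partial>M) * G $ z $ x)"
    by (rule sums_unique2)
  also have "\<dots> = (\<integral>\<omega>. (\<Sum>z\<in>UNIV. (g \<omega> * muN n \<omega> $ z) * G $ z $ x) \<partial>M)"
    by (subst Bochner_Integration.integral_sum) (auto intro!: muN_integrable[OF g])
  also have "\<dots> = (\<integral>\<omega>. g \<omega> * (muN n \<omega> v* G) $ x \<partial>M)"
    by (simp add: vector_matrix_mult_def sum_distrib_left mult_ac)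
  finally show "(\<integral>\<omega>. g \<omega> * visits n \<omega> $ x \<partial>M) = (\<integral>\<omega>. g \<omega> * (muN n \<omega> v* G) $ x \<partial>M)" .
qed

text \<open>Extends the identity from bounded factors to past factors with integrable product, by
  identifying the conditional expectation of the counts. Unbounded factors such as
  \<open>mart\<close> occur later.\<close>

lemma expectation_visits:
  assumes [measurable]: "g \<in> borel_measurable (F n)" and int: "integrable M (\<lambda>\<omega>. g \<omega> * visits n \<omega> $ x)"
  shows "integrable M (\<lambda>\<omega>. g \<omega> * (muN n \<omega> v* G) $ x)"
    "(\<integral>\<omega>. g \<omega> * visits n \<omega> $ x \<partial>M) = (\<integral>\<omega>. g \<omega> * (muN n \<omega> v* G) $ x \<partial>M)"
proof -
  have muG[measurable]: "(\<lambda>\<omega>. (muN n \<omega> v* G) $ x) \<in> borel_measurable (F n)"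
    unfolding vector_matrix_mult_def vec_lambda_beta
    by (intro borel_measurable_sum borel_measurable_times borel_measurable_const
        measurable_compose[OF muN_measurable_F borel_measurable_vec_nth])
  have [measurable]: "g \<in> borel_measurable M" "(\<lambda>\<omega>. (muN n \<omega> v* G) $ x) \<in> borel_measurable M"
    using measurable_from_subalg[OF F_subalgebra assms(1)] measurable_from_subalg[OF F_subalgebra muG] .
  have bp: "bounded_past n (indicator A)" if "A \<in> sets (F n)" for A
    using that by (auto simp: bounded_past_def indicator_def intro!: exI[of _ 1])
  have i1: "integrable M (\<lambda>\<omega>. visits n \<omega> $ x)" using expectation_visits_bounded(1)[OF bounded_past_const[of n 1]] by simp
  have i2: "integrable M (\<lambda>\<omega>. (muN n \<omega> v* G) $ x)"
  proof -
    have "integrable M (\<lambda>\<omega>. \<Sum>z\<in>UNIV. (1 * muN n \<omega> $ z) * G $ z $ x)"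
      by (intro Bochner_Integration.integrable_sum integrable_mult_left muN_integrable bounded_past_const)
    then show ?thesis by (simp add: vector_matrix_mult_def mult.commute)
  qed
  have ce: "AE \<omega> in M. real_cond_exp M (F n) (\<lambda>\<omega>. visits n \<omega> $ x) \<omega> = (muN n \<omega> v* G) $ x"
  proof (rule cond.real_cond_exp_charact[OF _ i1 i2 muG])
    fix A assume "A \<in> sets (F n)"
    then show "(LINT \<omega>:A|M. visits n \<omega> $ x) = (LINT \<omega>:A|M. (muN n \<omega> v* G) $ x)"
      using expectation_visits_bounded(2)[OF bp] by (simp add: set_lebesgue_integral_def)
  qed
  note r = cond.real_cond_exp_intg[OF int assms(1) borel_measurable_integrable[OF i1]]
  have ce': "AE \<omega> in M. g \<omega> * real_cond_exp M (F n) (\<lambda>\<omega>. visits n \<omega> $ x) \<omega> = g \<omega> * (muN n \<omega> v* G) $ x"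
    using ce by eventually_elim simp
  show "integrable M (\<lambda>\<omega>. g \<omega> * (muN n \<omega> v* G) $ x)"
    using integrable_cong_AE[THEN iffD1, OF _ _ ce' r(1)] by simp
  show "(\<integral>\<omega>. g \<omega> * visits n \<omega> $ x \<partial>M) = (\<integral>\<omega>. g \<omega> * (muN n \<omega> v* G) $ x \<partial>M)"
    unfolding r(2)[symmetric] by (rule integral_cong_AE) (use ce' in auto)
qed

text \<open>Expected increment at time \<open>k\<close> of the product of the counts of
  \<open>x\<close> and \<open>y\<close>, starting from \<open>z\<close>: a visit to one of them at
  time \<open>k\<close> is paired with all earlier visits to the other, and the last summand pairs
  the visit with itself.\<close>

definition second_term :: "nat \<Rightarrow> 't \<Rightarrow> 't \<Rightarrow> 't \<Rightarrow> real" where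
  "second_term k z x y = (\<Sum>j<k. matrix_power Q j $ z $ y * matrix_power Q (k - j) $ y $ x
       + matrix_power Q j $ z $ x * matrix_power Q (k - j) $ x $ y)
     + (if x = y then matrix_power Q k $ z $ x else 0)"

definition second_moment :: "'t \<Rightarrow> 't \<Rightarrow> 't \<Rightarrow> real" where
  "second_moment z x y = (\<Sum>k. second_term k z x y)"

lemma second_term_sums: "(\<lambda>k. second_term k z x y) sums second_moment z x y"
proof -
  have pp: "0 \<le> matrix_power Q j $ a $ b * matrix_power Q (k - j) $ c $ d"
    "matrix_power Q j $ a $ b * matrix_power Q (k - j) $ c $ d \<le> power_const\<^sup>2 * lam ^ k" if "j < k" for j k a b c d
  proof -
    show "0 \<le> matrix_power Q j $ a $ b * matrix_power Q (k - j) $ c $ d" by (simp add: matrix_power_nonneg)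
    have "matrix_power Q j $ a $ b * matrix_power Q (k - j) $ c $ d \<le> (power_const * lam ^ j) * (power_const * lam ^ (k - j))"
      by (intro mult_mono matrix_power_le matrix_power_nonneg) (simp add: power_const_nonneg lam_nonneg)
    also have "\<dots> = power_const\<^sup>2 * (lam ^ j * lam ^ (k - j))" by (simp add: power2_eq_square)
    finally show "matrix_power Q j $ a $ b * matrix_power Q (k - j) $ c $ d \<le> power_const\<^sup>2 * lam ^ k"
      using that by (simp flip: power_add)
  qed
  have "0 \<le> second_term k z x y" for k
    unfolding second_term_def using pp(1) matrix_power_nonneg by (intro add_nonneg_nonneg sum_nonneg) auto
  moreover have "second_term k z x y \<le> (2 * power_const\<^sup>2 + power_const) * (real k + 1) ^ 3 * lam ^ k" for k
  proof -
    have "second_term k z x y \<le> (\<Sum>j<k. power_const\<^sup>2 * lam ^ k + power_const\<^sup>2 * lam ^ k) + power_const * lam ^ k"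
      unfolding second_term_def using matrix_power_le[of k z x] power_const_nonneg lam_nonneg
      by (intro add_mono sum_mono pp(2)) auto
    also have "\<dots> = (2 * power_const\<^sup>2 * real k + power_const * 1) * lam ^ k" by (simp add: algebra_simps)
    also have "\<dots> \<le> (2 * power_const\<^sup>2 * (real k + 1) ^ 3 + power_const * (real k + 1) ^ 3) * lam ^ k"
      using power_const_nonneg lam_nonneg one_le_cube[of k]
      by (intro mult_right_mono add_mono mult_left_mono) auto
    finally show ?thesis by (simp add: algebra_simps)
  qed
  moreover have "summable (\<lambda>k. (2 * power_const\<^sup>2 + power_const) * (real k + 1) ^ 3 * lam ^ k)"
    using summable_mult[OF summable_cube_power[OF lam_nonneg lam_less_1]] by (simp add: mult.assoc)
  ultimately have "summable (\<lambda>k. second_term k z x y)"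
    by (intro summable_comparison_test'[where N=0 and f="\<lambda>k. second_term k z x y"]) auto
  then show ?thesis unfolding second_moment_def by (rule summable_sums)
qed

text \<open>Conditional second moments are linear in the current iterate, so they will converge
  along with it.\<close>

lemma expectation_visits_visits:
  assumes g: "bounded_past n g"
  shows "(\<integral>\<omega>. g \<omega> * (visits n \<omega> $ x * visits n \<omega> $ y) \<partial>M) =
    (\<integral>\<omega>. g \<omega> * (\<Sum>z\<in>UNIV. muN n \<omega> $ z * second_moment z x y) \<partial>M)"
proof -
  let ?p = "pvisits n"
  have eq: "?p (Suc k) x \<omega> * ?p (Suc k) y \<omega> - ?p k x \<omega> * ?p k y \<omega> =
     (\<Sum>j<k. occ n j (Inl y) \<omega> * occ n k (Inl x) \<omega> + occ n j (Inl x) \<omega> * occ n k (Inl y) \<omega>)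
     + (if x = y then occ n k (Inl x) \<omega> else 0)" for k \<omega>
  proof -
    have "occ n k (Inl x) \<omega> * occ n k (Inl y) \<omega> = (if x = y then occ n k (Inl x) \<omega> else 0)"
      by (auto simp: occ_def)
    moreover have "?p (Suc k) x \<omega> * ?p (Suc k) y \<omega> - ?p k x \<omega> * ?p k y \<omega> =
       ?p k y \<omega> * occ n k (Inl x) \<omega> + ?p k x \<omega> * occ n k (Inl y) \<omega> + occ n k (Inl x) \<omega> * occ n k (Inl y) \<omega>"
      by (simp add: pvisits_Suc algebra_simps)
    ultimately show ?thesis
      by (simp add: pvisits_def sum_distrib_right sum.distrib)
  qed
  have inc: "\<bar>?p (Suc k) x \<omega> * ?p (Suc k) y \<omega> - ?p k x \<omega> * ?p k y \<omega>\<bar> \<le> (2 * real k + 1) * alive n k \<omega>" for k \<omega>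
  proof -
    have "?p (Suc k) x \<omega> * ?p (Suc k) y \<omega> - ?p k x \<omega> * ?p k y \<omega> =
       ?p k y \<omega> * occ n k (Inl x) \<omega> + ?p k x \<omega> * occ n k (Inl y) \<omega> + occ n k (Inl x) \<omega> * occ n k (Inl y) \<omega>"
      by (simp add: pvisits_Suc algebra_simps)
    moreover have "?p k y \<omega> * occ n k (Inl x) \<omega> \<le> real k * alive n k \<omega>" "?p k x \<omega> * occ n k (Inl y) \<omega> \<le> real k * alive n k \<omega>"
      "occ n k (Inl x) \<omega> * occ n k (Inl y) \<omega> \<le> 1 * alive n k \<omega>"
      by (intro mult_mono pvisits_bounds occ_le_alive occ_bounds; simp)+
    moreover have "0 \<le> ?p k y \<omega> * occ n k (Inl x) \<omega>" "0 \<le> ?p k x \<omega> * occ n k (Inl y) \<omega>" "0 \<le> occ n k (Inl x) \<omega> * occ n k (Inl y) \<omega>"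
      by (simp_all add: pvisits_bounds occ_bounds)
    ultimately show ?thesis by (simp add: algebra_simps)
  qed
  have sm: "summable (\<lambda>k. (2 * real k + 1) * lam ^ k)"
  proof (rule summable_lam[of _ 2])
    show "2 * real k + 1 \<le> 2 * (real k + 1) ^ 3" for k using one_le_cube[of k] by linarith
  qed auto
  have lim: "AE \<omega> in M. \<forall>k\<ge>tau n \<omega>. ?p k x \<omega> * ?p k y \<omega> = visits n \<omega> $ x * visits n \<omega> $ y"
    using AE_pvisits[of n] by eventually_elim simp
  have mm: "(\<lambda>\<omega>. ?p k x \<omega> * ?p k y \<omega>) \<in> borel_measurable M" for k by measurable
  note t = telescoped_expectation[where \<phi>="\<lambda>k \<omega>. ?p k x \<omega> * ?p k y \<omega>" and a="\<lambda>k. 2 * real k + 1", OF mm _ lim _ inc _ sm g]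
  have oi: "integrable M (\<lambda>\<omega>. g \<omega> * (occ n i a \<omega> * occ n j b \<omega>))" for i j a b
    by (rule integrable_bounded_past[OF g, where C=1]) (auto simp: occ_def)
  have oi1: "integrable M (\<lambda>\<omega>. g \<omega> * occ n i a \<omega>)" for i a
    by (rule integrable_bounded_past[OF g, where C=1]) (auto simp: occ_def)
  have incr: "(\<integral>\<omega>. g \<omega> * (?p (Suc k) x \<omega> * ?p (Suc k) y \<omega> - ?p k x \<omega> * ?p k y \<omega>) \<partial>M) =
      (\<Sum>z\<in>UNIV. (\<integral>\<omega>. g \<omega> * muN n \<omega> $ z \<partial>M) * second_term k z x y)" for k
  proof -
    have o2: "(\<integral>\<omega>. g \<omega> * (occ n j (Inl a) \<omega> * occ n k (Inl b) \<omega>) \<partial>M) =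
      (\<Sum>z\<in>UNIV. (\<integral>\<omega>. g \<omega> * muN n \<omega> $ z \<partial>M) * (matrix_power Q j $ z $ a * matrix_power Q (k - j) $ a $ b))"
      if "j < k" for j a b using expectation_occ_occ[OF g, of j a "k - j" b] that by simp
    have i4: "(\<integral>\<omega>. g \<omega> * (if x = y then occ n k (Inl x) \<omega> else 0) \<partial>M) =
        (\<Sum>z\<in>UNIV. (\<integral>\<omega>. g \<omega> * muN n \<omega> $ z \<partial>M) * (if x = y then matrix_power Q k $ z $ x else 0))"
      by (cases "x = y") (simp_all add: expectation_occ[OF g])
    have i3: "integrable M (\<lambda>\<omega>. g \<omega> * (if x = y then occ n k (Inl x) \<omega> else 0))" using oi1 by (cases "x = y") auto
    have "(\<integral>\<omega>. g \<omega> * (?p (Suc k) x \<omega> * ?p (Suc k) y \<omega> - ?p k x \<omega> * ?p k y \<omega>) \<partial>M) =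
      (\<integral>\<omega>. (\<Sum>j<k. g \<omega> * (occ n j (Inl y) \<omega> * occ n k (Inl x) \<omega>) + g \<omega> * (occ n j (Inl x) \<omega> * occ n k (Inl y) \<omega>))
         + g \<omega> * (if x = y then occ n k (Inl x) \<omega> else 0) \<partial>M)"
      unfolding eq by (simp only: distrib_left sum_distrib_left)
    also have "\<dots> = (\<Sum>j<k. (\<integral>\<omega>. g \<omega> * (occ n j (Inl y) \<omega> * occ n k (Inl x) \<omega>) \<partial>M) + (\<integral>\<omega>. g \<omega> * (occ n j (Inl x) \<omega> * occ n k (Inl y) \<omega>) \<partial>M))
         + (\<integral>\<omega>. g \<omega> * (if x = y then occ n k (Inl x) \<omega> else 0) \<partial>M)"
      by (subst Bochner_Integration.integral_add, intro Bochner_Integration.integrable_sum Bochner_Integration.integrable_add oi, rule i3,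
          subst Bochner_Integration.integral_sum, intro Bochner_Integration.integrable_add oi,
          subst Bochner_Integration.integral_add, rule oi, rule oi, rule refl)
    also have "\<dots> = (\<Sum>j<k. \<Sum>z\<in>UNIV. (\<integral>\<omega>. g \<omega> * muN n \<omega> $ z \<partial>M) * (matrix_power Q j $ z $ y * matrix_power Q (k - j) $ y $ x
       + matrix_power Q j $ z $ x * matrix_power Q (k - j) $ x $ y))
      + (\<Sum>z\<in>UNIV. (\<integral>\<omega>. g \<omega> * muN n \<omega> $ z \<partial>M) * (if x = y then matrix_power Q k $ z $ x else 0))"
      by (intro arg_cong2[where f="(+)"] sum.cong refl)
         (auto simp: o2 i4 distrib_left sum.distrib)
    also have "\<dots> = (\<Sum>z\<in>UNIV. (\<integral>\<omega>. g \<omega> * muN n \<omega> $ z \<partial>M) * second_term k z x y)"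
      unfolding second_term_def distrib_left[of _ "sum _ _"] sum.distrib[of _ _ UNIV] sum_distrib_left
      by (subst sum.swap) (rule refl)
    finally show ?thesis .
  qed
  have "(\<lambda>k. \<Sum>z\<in>UNIV. (\<integral>\<omega>. g \<omega> * muN n \<omega> $ z \<partial>M) * second_term k z x y) sums
      (\<integral>\<omega>. g \<omega> * (visits n \<omega> $ x * visits n \<omega> $ y) \<partial>M)"
    using t(2) unfolding incr by (simp add: pvisits_def)
  moreover have "(\<lambda>k. \<Sum>z\<in>UNIV. (\<integral>\<omega>. g \<omega> * muN n \<omega> $ z \<partial>M) * second_term k z x y) sums
      (\<Sum>z\<in>UNIV. (\<integral>\<omega>. g \<omega> * muN n \<omega> $ z \<partial>M) * second_moment z x y)"
    by (intro sums_sum sums_mult second_term_sums)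
  ultimately have "(\<integral>\<omega>. g \<omega> * (visits n \<omega> $ x * visits n \<omega> $ y) \<partial>M) =
      (\<Sum>z\<in>UNIV. (\<integral>\<omega>. g \<omega> * muN n \<omega> $ z \<partial>M) * second_moment z x y)" by (rule sums_unique2)
  also have "\<dots> = (\<integral>\<omega>. (\<Sum>z\<in>UNIV. (g \<omega> * muN n \<omega> $ z) * second_moment z x y) \<partial>M)"
    by (subst Bochner_Integration.integral_sum) (auto intro!: muN_integrable[OF g])
  also have "\<dots> = (\<integral>\<omega>. g \<omega> * (\<Sum>z\<in>UNIV. muN n \<omega> $ z * second_moment z x y) \<partial>M)"
    by (simp add: sum_distrib_left mult_ac)
  finally show ?thesis .
qed

end

section \<open>Almost sure convergence\<close>

lemma AE_summable_of_expectation: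
  fixes f :: "nat \<Rightarrow> 'w \<Rightarrow> real"
  assumes int: "\<And>k. integrable M (f k)" and nonneg: "\<And>k \<omega>. 0 \<le> f k \<omega>"
    and s: "summable (\<lambda>k. \<integral>\<omega>. f k \<omega> \<partial>M)"
  shows "AE \<omega> in M. summable (\<lambda>k. f k \<omega>)"
proof -
  have [measurable]: "f k \<in> borel_measurable M" for k using int by auto
  have "(\<integral>\<^sup>+\<omega>. (\<Sum>k. ennreal (f k \<omega>)) \<partial>M) = (\<Sum>k. \<integral>\<^sup>+\<omega>. ennreal (f k \<omega>) \<partial>M)"
    by (rule nn_integral_suminf) measurable
  also have "\<dots> = (\<Sum>k. ennreal (\<integral>\<omega>. f k \<omega> \<partial>M))"
    by (simp add: nn_integral_eq_integral[OF int] nonneg)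
  also have "\<dots> \<noteq> \<infinity>"
    using s by (subst suminf_ennreal_eq[OF _ summable_sums[OF s]]) (auto intro!: integral_nonneg_AE simp: nonneg)
  finally have "AE \<omega> in M. (\<Sum>k. ennreal (f k \<omega>)) \<noteq> \<infinity>" by (intro nn_integral_PInf_AE) auto
  then show ?thesis
    by eventually_elim (auto intro!: summable_suminf_not_top nonneg)
qed

lemma integrable_mult_L2:
  fixes f g :: "'w \<Rightarrow> real"
  assumes [measurable]: "f \<in> borel_measurable M" "g \<in> borel_measurable M"
    and "integrable M (\<lambda>\<omega>. (f \<omega>)\<^sup>2)" "integrable M (\<lambda>\<omega>. (g \<omega>)\<^sup>2)"
  shows "integrable M (\<lambda>\<omega>. f \<omega> * g \<omega>)"
proof (rule Bochner_Integration.integrable_bound[OF Bochner_Integration.integrable_add[OF assms(3,4)]])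
  show "AE \<omega> in M. norm (f \<omega> * g \<omega>) \<le> norm ((f \<omega>)\<^sup>2 + (g \<omega>)\<^sup>2)"
  proof (rule AE_I2)
    fix \<omega>
    have "2 * (\<bar>f \<omega>\<bar> * \<bar>g \<omega>\<bar>) \<le> \<bar>f \<omega>\<bar>\<^sup>2 + \<bar>g \<omega>\<bar>\<^sup>2" using sum_squares_bound[of "\<bar>f \<omega>\<bar>" "\<bar>g \<omega>\<bar>"] by simp
    moreover have "0 \<le> \<bar>f \<omega>\<bar> * \<bar>g \<omega>\<bar>" by simp
    ultimately have "\<bar>f \<omega>\<bar> * \<bar>g \<omega>\<bar> \<le> \<bar>f \<omega>\<bar>\<^sup>2 + \<bar>g \<omega>\<bar>\<^sup>2" by linarith
    then show "norm (f \<omega> * g \<omega>) \<le> norm ((f \<omega>)\<^sup>2 + (g \<omega>)\<^sup>2)" by (simp add: abs_mult)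
  qed
qed simp

lemma square_interval: "\<exists>k::nat. k\<^sup>2 \<le> n \<and> n < (k + 1)\<^sup>2"
proof (induction n)
  case (Suc n)
  then obtain k where k: "k\<^sup>2 \<le> n" "n < (k + 1)\<^sup>2" by blast
  show ?case
  proof (cases "Suc n < (k + 1)\<^sup>2")
    case False
    then have "Suc n = (k + 1)\<^sup>2" using k by simp
    then show ?thesis by (intro exI[of _ "k + 1"]) (simp add: power2_eq_square)
  qed (use k in \<open>auto intro: exI[of _ k]\<close>)
qed (auto intro: exI[of _ 0])

text \<open>The subsequence method for strong laws. Consecutive squares are \<open>2 k + 1\<close>
  apart, which is negligible against \<open>k^2\<close>. If decrements are at most \<open>c\<close>,
  a high value persists until the next square and a low value is reached only slowly from the
  previous one, so one-sided control suffices.\<close>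

lemma tendsto_along_squares:
  fixes D :: "nat \<Rightarrow> real"
  assumes sq: "(\<lambda>k. D (k\<^sup>2) / real (k\<^sup>2)) \<longlonglongrightarrow> 0" and inc: "\<And>n. D n - c \<le> D (Suc n)" and c: "0 \<le> c"
  shows "(\<lambda>n. D n / real n) \<longlonglongrightarrow> 0"
proof -
  define e where "e k = \<bar>D (k\<^sup>2) / real (k\<^sup>2)\<bar> + \<bar>D ((k+1)\<^sup>2) / real ((k+1)\<^sup>2)\<bar> * (real ((k+1)\<^sup>2) / real (k\<^sup>2)) + c * (2 * real k + 1) / real (k\<^sup>2)" for k
  have "(\<lambda>k. D ((k+1)\<^sup>2) / real ((k+1)\<^sup>2)) \<longlonglongrightarrow> 0"
    using LIMSEQ_ignore_initial_segment[OF sq, of 1] by simp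
  moreover have "(\<lambda>k. real ((k+1)\<^sup>2) / real (k\<^sup>2)) \<longlonglongrightarrow> 1" unfolding of_nat_power of_nat_add by real_asymp
  moreover have "(\<lambda>k. c * (2 * real k + 1) / real (k\<^sup>2)) \<longlonglongrightarrow> 0"
  proof -
    have "(\<lambda>k. (2 * real k + 1) / real (k\<^sup>2)) \<longlonglongrightarrow> 0" unfolding of_nat_power by real_asymp
    then show ?thesis using tendsto_mult_left[of _ 0 _ c] by fastforce
  qed
  ultimately have "e \<longlonglongrightarrow> \<bar>0\<bar> + \<bar>0\<bar> * 1 + 0"
    unfolding e_def[abs_def] using sq by (intro tendsto_intros) auto
  then have e0: "e \<longlonglongrightarrow> 0" by simp
  have lower: "D n - c * real (m - n) \<le> D m" if "n \<le> m" for n m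
    using that
  proof (induction rule: dec_induct)
    case (step m)
    then show ?case using inc[of m] by (simp add: Suc_diff_le algebra_simps)
  qed simp
  show ?thesis
  proof (rule LIMSEQ_I)
    fix r :: real assume "0 < r"
    then have "\<forall>\<^sub>F k in sequentially. e k < r" using order_tendstoD(2)[OF e0] by blast
    then obtain K where K: "\<And>k. k \<ge> K \<Longrightarrow> e k < r" by (auto simp: eventually_sequentially)
    show "\<exists>no. \<forall>n\<ge>no. norm (D n / real n - 0) < r"
    proof (intro exI[of _ "(K + 1)\<^sup>2"] allI impI)
      fix n assume n: "(K + 1)\<^sup>2 \<le> n"
      obtain k where k: "k\<^sup>2 \<le> n" "n < (k + 1)\<^sup>2" using square_interval by blast
      have "(K + 1)\<^sup>2 < (k + 1)\<^sup>2" using n k by simp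
      then have Kk: "K < k" using power_less_imp_less_base[of "K+1" 2 "k+1"] by simp
      have k2: "real (k\<^sup>2) > 0" using Kk by simp
      have d1: "real (n - k\<^sup>2) \<le> 2 * real k + 1" "real ((k+1)\<^sup>2 - n) \<le> 2 * real k + 1"
      proof -
        have "n - k\<^sup>2 \<le> 2 * k + 1" "(k+1)\<^sup>2 - n \<le> 2 * k + 1" using k by (simp_all add: power2_eq_square)
        then have "real (n - k\<^sup>2) \<le> real (2 * k + 1)" "real ((k+1)\<^sup>2 - n) \<le> real (2 * k + 1)"
          by (simp_all only: of_nat_le_iff)
        then show "real (n - k\<^sup>2) \<le> 2 * real k + 1" "real ((k+1)\<^sup>2 - n) \<le> 2 * real k + 1"
          by simp_all
      qed
      have "D (k\<^sup>2) - c * (2 * real k + 1) \<le> D n"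
        using lower[OF k(1)] mult_left_mono[OF d1(1) c] by linarith
      moreover have "D n \<le> D ((k+1)\<^sup>2) + c * (2 * real k + 1)"
        using lower[of n "(k+1)\<^sup>2"] k(2) mult_left_mono[OF d1(2) c] by linarith
      ultimately have "\<bar>D n\<bar> \<le> \<bar>D (k\<^sup>2)\<bar> + \<bar>D ((k+1)\<^sup>2)\<bar> + c * (2 * real k + 1)" by linarith
      then have "\<bar>D n\<bar> / real (k\<^sup>2) \<le> (\<bar>D (k\<^sup>2)\<bar> + \<bar>D ((k+1)\<^sup>2)\<bar> + c * (2 * real k + 1)) / real (k\<^sup>2)"
        using k2 by (intro divide_right_mono) auto
      also have "\<dots> = e k" using k2 by (simp add: e_def add_divide_distrib abs_divide)
      also have "\<dots> < r" using K Kk by simp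
      finally have "\<bar>D n\<bar> / real (k\<^sup>2) < r" .
      moreover have "\<bar>D n\<bar> / real n \<le> \<bar>D n\<bar> / real (k\<^sup>2)"
      proof (rule divide_left_mono)
        show kn: "real (k\<^sup>2) \<le> real n" using k(1) by (simp only: of_nat_le_iff)
        show "0 < real n * real (k\<^sup>2)" using kn k2 by (intro mult_pos_pos) linarith+
      qed simp
      ultimately show "norm (D n / real n - 0) < r" by simp
    qed
  qed
qed

lemma cesaro_mean:
  fixes d :: "nat \<Rightarrow> real"
  assumes "d \<longlonglongrightarrow> l"
  shows "(\<lambda>n. (\<Sum>j<n. d j) / real n) \<longlonglongrightarrow> l"
proof (rule LIMSEQ_I)
  fix r :: real assume r: "0 < r"
  then obtain N where N: "\<And>n. n \<ge> N \<Longrightarrow> \<bar>d n - l\<bar> < r / 2"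
    using LIMSEQ_D[OF assms, of "r / 2"] by auto
  define A where "A = (\<Sum>j<N. \<bar>d j - l\<bar>)"
  have "(\<lambda>n. A / real n) \<longlonglongrightarrow> 0" by (rule lim_const_over_n)
  then obtain N' where N': "\<And>n. n \<ge> N' \<Longrightarrow> \<bar>A / real n\<bar> < r / 2" using r LIMSEQ_D[of _ 0 "r/2"] by fastforce
  show "\<exists>no. \<forall>n\<ge>no. norm ((\<Sum>j<n. d j) / real n - l) < r"
  proof (intro exI[of _ "max (N' + 1) N"] allI impI)
    fix n assume n: "max (N' + 1) N \<le> n"
    have "(\<Sum>j<n. d j) / real n - l = (\<Sum>j<n. d j - l) / real n" using n by (simp add: sum_subtractf field_simps)
    also have "\<bar>\<dots>\<bar> \<le> (\<Sum>j<n. \<bar>d j - l\<bar>) / real n" by (simp add: divide_right_mono)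
    also have "(\<Sum>j<n. \<bar>d j - l\<bar>) = A + (\<Sum>j\<in>{N..<n}. \<bar>d j - l\<bar>)"
      unfolding A_def using n by (simp add: sum.union_disjoint[symmetric] ivl_disj_un ivl_disj_int flip: atLeast0LessThan)
    also have "(\<Sum>j\<in>{N..<n}. \<bar>d j - l\<bar>) \<le> (\<Sum>j\<in>{N..<n}. r / 2)" using N by (intro sum_mono) (auto intro: less_imp_le)
    also have "\<dots> \<le> real n * (r / 2)" using r by simp
    finally have "\<bar>(\<Sum>j<n. d j) / real n - l\<bar> \<le> (A + real n * (r / 2)) / real n" by (simp add: divide_right_mono)
    also have "\<dots> = A / real n + r / 2" using n by (simp add: add_divide_distrib)
    also have "\<dots> < r" using N'[of n] n by linarith
    finally show "norm ((\<Sum>j<n. d j) / real n - l) < r" by simp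
  qed
qed

text \<open>
  If \<open>v n \<ge> \<delta>\<close>, slow variation keeps \<open>v\<close> above \<open>\<delta>/2\<close> on a whole block \<open>{n..n+\<theta>n}\<close>, which
  contributes a fixed amount to the series.
\<close>

lemma slowly_varying_tendsto_0:
  fixes v S D :: "nat \<Rightarrow> real"
  assumes v: "\<And>n. 0 \<le> v n" and sum: "summable (\<lambda>n. v n / S n)"
    and S: "\<And>n. real n \<le> S n" "\<And>n. 0 < S n"
    and inc: "\<And>m n. n \<le> m \<Longrightarrow> S m - S n \<le> c * real (m - n) + (D m - D n)" and c: "0 \<le> c"
    and mono: "\<And>m n. n \<le> m \<Longrightarrow> S n \<le> S m"
    and D: "(\<lambda>n. D n / real n) \<longlonglongrightarrow> 0"
    and slow: "\<And>\<delta>. 0 < \<delta> \<Longrightarrow> \<exists>\<eta>>0. \<forall>n m. n \<le> m \<longrightarrow> S m - S n \<le> \<eta> * S n \<longrightarrow> v n - \<delta> \<le> v m"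
  shows "v \<longlonglongrightarrow> 0"
proof (rule LIMSEQ_I)
  fix \<delta> :: real assume d: "0 < \<delta>"
  obtain \<eta> where eta: "\<eta> > 0" "\<And>n m. n \<le> m \<Longrightarrow> S m - S n \<le> \<eta> * S n \<Longrightarrow> v n - \<delta> / 2 \<le> v m"
    using slow[of "\<delta> / 2"] d by auto
  \<comment> \<open>On the block \<open>S\<close> grows by at most
    \<open>c \<theta> n \<le> \<eta> n / 4\<close> plus the fluctuations of \<open>D\<close>, in
    total at most \<open>\<eta> n\<close>. The minimum with 1 keeps the block below
    \<open>2 n\<close>.\<close>
  define \<theta> where "\<theta> = min 1 (\<eta> / (4 * (c + 1)))"
  have th: "0 < \<theta>" "\<theta> \<le> 1" "c * \<theta> \<le> \<eta> / 4"
  proof -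
    show "0 < \<theta>" "\<theta> \<le> 1" using eta(1) c by (auto simp: \<theta>_def)
    have "c * \<theta> \<le> c * (\<eta> / (4 * (c + 1)))" using c by (intro mult_left_mono) (auto simp: \<theta>_def)
    also have "\<dots> \<le> (c + 1) * (\<eta> / (4 * (c + 1)))" using c eta(1) by (intro mult_right_mono) auto
    also have "\<dots> = \<eta> / 4" using c by (simp add: field_simps)
    finally show "c * \<theta> \<le> \<eta> / 4" .
  qed
  have "\<forall>\<^sub>F n in sequentially. \<bar>D n / real n\<bar> < min 1 (\<eta> / 8)"
    using tendstoD[OF D, of "min 1 (\<eta> / 8)"] eta(1) by (simp add: dist_real_def)
  then obtain N1 where N1: "\<And>n. n \<ge> N1 \<Longrightarrow> \<bar>D n / real n\<bar> < min 1 (\<eta> / 8)" by (auto simp: eventually_sequentially)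
  have DN: "\<bar>D n\<bar> \<le> (\<eta> / 8) * real n" "\<bar>D n\<bar> \<le> real n" if "n \<ge> N1 + 1" for n
    using N1[of n] that by (auto simp: abs_divide field_simps)
  define K where "K = \<bar>S 0\<bar> + c + 1 + \<bar>D 0\<bar>"
  have SK: "S n \<le> K * real n" if "n \<ge> N1 + 1" for n
  proof -
    have "S n \<le> S 0 + c * real n + (D n - D 0)" using inc[of 0 n] by simp
    also have "\<dots> \<le> \<bar>S 0\<bar> * 1 + c * real n + real n + \<bar>D 0\<bar> * 1" using DN(2)[OF that] by simp
    also have "\<dots> \<le> \<bar>S 0\<bar> * real n + c * real n + real n + \<bar>D 0\<bar> * real n"
      using that c by (intro add_mono mult_left_mono) auto
    finally show ?thesis by (simp add: K_def algebra_simps)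
  qed
  have K: "K \<ge> 1" using c by (simp add: K_def)
  \<comment> \<open>A block has at least \<open>\<theta> n\<close> terms, each at least
    \<open>(\<delta> / 2) / ((1 + \<eta>) K n)\<close>; their product \<open>q\<close> does not
    depend on \<open>n\<close>.\<close>
  define q where "q = \<theta> * (\<delta> / 2) / ((1 + \<eta>) * K)"
  have q: "q > 0" using th d eta K by (simp add: q_def)
  obtain N2 where N2: "\<And>m n. m \<ge> N2 \<Longrightarrow> norm (\<Sum>k\<in>{m..<n}. v k / S k) < q"
    using sum q unfolding summable_Cauchy by blast
  show "\<exists>no. \<forall>n\<ge>no. norm (v n - 0) < \<delta>"
  proof (intro exI[of _ "max (N1 + 1) N2"] allI impI)
    fix n assume n: "max (N1 + 1) N2 \<le> n"
    show "norm (v n - 0) < \<delta>"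
    proof (rule ccontr)
      assume "\<not> norm (v n - 0) < \<delta>"
      then have vn: "\<delta> \<le> v n" using v[of n] by simp
      define m' where "m' = n + nat \<lfloor>\<theta> * real n\<rfloor>"
      have blk: "q \<le> (\<Sum>k\<in>{n..<Suc m'}. v k / S k)"
      proof -
        have each: "(\<delta> / 2) / ((1 + \<eta>) * K * real n) \<le> v k / S k" if k: "k \<in> {n..<Suc m'}" for k
        proof -
          have kn: "n \<le> k" "real (k - n) \<le> \<theta> * real n"
          proof -
            show "n \<le> k" using k by simp
            have "k - n \<le> nat \<lfloor>\<theta> * real n\<rfloor>" using k unfolding m'_def atLeastLessThan_iff by linarith
            moreover have "0 \<le> \<theta> * real n" using th by simp
            ultimately show "real (k - n) \<le> \<theta> * real n" by linarith
          qed
          have "real k = real n + real (k - n)" using kn(1) by simp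
          also have "\<dots> \<le> real n + 1 * real n" using kn(2) th(2) mult_right_mono[OF th(2), of "real n"] by linarith
          finally have k2: "real k \<le> 2 * real n" by simp
          have "S k - S n \<le> c * real (k - n) + (D k - D n)" by (rule inc[OF kn(1)])
          also have "\<dots> \<le> c * (\<theta> * real n) + ((\<eta> / 8) * (2 * real n) + (\<eta> / 8) * real n)"
          proof -
            have "c * real (k - n) \<le> c * (\<theta> * real n)" using kn(2) c by (rule mult_left_mono)
            moreover have "D k \<le> (\<eta> / 8) * (2 * real n)"
            proof -
              have "D k \<le> (\<eta> / 8) * real k" using DN(1)[of k] n kn(1) by auto
              also have "\<dots> \<le> (\<eta> / 8) * (2 * real n)" using k2 eta(1) by (intro mult_left_mono) auto
              finally show ?thesis .
            qed
            moreover have "- D n \<le> (\<eta> / 8) * real n" using DN(1)[of n] n by auto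
            ultimately show ?thesis by linarith
          qed
          also have "\<dots> \<le> (\<eta> / 4) * real n + (3 * \<eta> / 8) * real n"
            using mult_right_mono[OF th(3), of "real n"] by (simp add: algebra_simps)
          also have "\<dots> \<le> \<eta> * real n" using eta(1) by (simp add: algebra_simps)
          also have "\<dots> \<le> \<eta> * S n" using S eta(1) by (intro mult_left_mono) auto
          finally have close: "S k - S n \<le> \<eta> * S n" .
          then have vk: "\<delta> / 2 \<le> v k" using eta(2)[OF kn(1)] vn by fastforce
          have "S k \<le> (1 + \<eta>) * S n" using close by (simp add: algebra_simps)
          also have "\<dots> \<le> (1 + \<eta>) * (K * real n)" using SK[of n] n eta(1) by (intro mult_left_mono) auto
          finally have Sk: "S k \<le> (1 + \<eta>) * K * real n" by (simp add: mult.assoc)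
          show ?thesis using vk Sk S(2)[of k] d by (intro frac_le) auto
        qed
        have "\<theta> * real n \<le> real (card {n..<Suc m'})" unfolding m'_def by simp linarith
        then have "q \<le> real (card {n..<Suc m'}) * ((\<delta> / 2) / ((1 + \<eta>) * K * real n))"
        proof -
          have n0: "real n > 0" using n by simp
          have "q = (\<theta> * real n) * ((\<delta> / 2) / ((1 + \<eta>) * K * real n))"
            using n0 by (simp add: q_def)
          also have "\<dots> \<le> real (card {n..<Suc m'}) * ((\<delta> / 2) / ((1 + \<eta>) * K * real n))"
            using \<open>\<theta> * real n \<le> real (card {n..<Suc m'})\<close> d eta K n0 by (intro mult_right_mono) auto
          finally show ?thesis .
        qed
        also have "\<dots> \<le> (\<Sum>k\<in>{n..<Suc m'}. v k / S k)" using each by (intro sum_bounded_below)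
        finally show ?thesis .
      qed
      moreover have "(\<Sum>k\<in>{n..<Suc m'}. v k / S k) < q" using N2[of n "Suc m'"] n by auto
      ultimately show False by simp
    qed
  qed
qed

context algorithm
begin

section \<open>Uniform moments and the growth of \<open>S\<close>\<close>

definition moment :: real where
  "moment = (\<Sum>k. (real k + 1) ^ 3 * (real CARD('t) * occ_const * lam ^ k))"

lemma tau_moments:
  shows "integrable M (\<lambda>\<omega>. real (tau n \<omega>))" "integrable M (\<lambda>\<omega>. (real (tau n \<omega>))\<^sup>2)"
    "(\<integral>\<omega>. (real (tau n \<omega>))\<^sup>2 \<partial>M) \<le> moment" "(\<integral>\<omega>. real (tau n \<omega>) ^ 3 \<partial>M) \<le> moment" "0 \<le> moment"
proof -
  have le: "t \<le> t ^ 3" "t\<^sup>2 \<le> t ^ 3" for t :: nat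
    by (cases "t = 0"; simp add: power_increasing self_le_power)+
  have le': "real t \<le> real t ^ 3" "(real t)\<^sup>2 \<le> real t ^ 3" for t :: nat
    using le[of t] by (simp_all only: of_nat_le_iff flip: of_nat_power)
  show "integrable M (\<lambda>\<omega>. real (tau n \<omega>))"
    by (rule Bochner_Integration.integrable_bound[OF tau_cube(1)[of n]]) (use le' in \<open>auto simp del: of_nat_power\<close>)
  show i2: "integrable M (\<lambda>\<omega>. (real (tau n \<omega>))\<^sup>2)"
    by (rule Bochner_Integration.integrable_bound[OF tau_cube(1)[of n]]) (auto simp: le')
  show m3: "(\<integral>\<omega>. real (tau n \<omega>) ^ 3 \<partial>M) \<le> moment" using tau_cube(2) by (simp add: moment_def)
  have "(\<integral>\<omega>. (real (tau n \<omega>))\<^sup>2 \<partial>M) \<le> (\<integral>\<omega>. real (tau n \<omega>) ^ 3 \<partial>M)"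
    by (intro integral_mono i2 tau_cube le')
  with m3 show "(\<integral>\<omega>. (real (tau n \<omega>))\<^sup>2 \<partial>M) \<le> moment" by simp
  have "0 \<le> (\<integral>\<omega>. real (tau n \<omega>) ^ 3 \<partial>M)" by (intro integral_nonneg_AE) auto
  with m3 show "0 \<le> moment" by linarith
qed

lemma visits_le_tau: "visits n \<omega> $ x \<le> real (tau n \<omega>)"
  using member_le_sum[of x UNIV "\<lambda>x. visits n \<omega> $ x"] visits_nonneg visits_sum[of n \<omega>] by auto

lemma visits_square_integrable: "integrable M (\<lambda>\<omega>. (visits n \<omega> $ x)\<^sup>2)"
  by (rule Bochner_Integration.integrable_bound[OF tau_moments(2)[of n]])
     (auto simp: visits_nonneg visits_le_tau intro!: power_mono)

lemma SN_measurable [measurable]: "SN n \<in> borel_measurable M"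
  by (rule measurable_from_subalg[OF F_subalgebra SN_measurable_F])

lemma WN_measurable [measurable]: "WN n \<in> borel_measurable M"
  by (rule measurable_from_subalg[OF F_subalgebra WN_measurable_F])

lemma muN_measurable [measurable]: "muN n \<in> borel_measurable M"
  by (rule measurable_from_subalg[OF F_subalgebra muN_measurable_F])

definition G_total :: real where
  "G_total = (\<Sum>x\<in>UNIV. \<Sum>y\<in>UNIV. G $ x $ y)"

text \<open>The conditional mean of \<open>tau n\<close> given \<open>F n\<close>.\<close>

definition mean_tau :: "nat \<Rightarrow> 'w \<Rightarrow> real" where
  "mean_tau n \<omega> = (\<Sum>y\<in>UNIV. (muN n \<omega> v* G) $ y)"

lemma muN_G_nonneg: "0 \<le> (muN n \<omega> v* G) $ y"
  unfolding vector_matrix_mult_def using muN_bounds G_nonneg by (auto intro!: sum_nonneg)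

lemma mean_tau_bounds: "0 \<le> mean_tau n \<omega>" "mean_tau n \<omega> \<le> G_total"
proof -
  show "0 \<le> mean_tau n \<omega>" unfolding mean_tau_def by (intro sum_nonneg muN_G_nonneg)
  have "mean_tau n \<omega> = (\<Sum>x\<in>UNIV. \<Sum>y\<in>UNIV. G $ x $ y * muN n \<omega> $ x)"
    unfolding mean_tau_def vector_matrix_mult_def vec_lambda_beta
    by (subst sum.swap) (simp add: mult.commute)
  also have "\<dots> \<le> G_total"
    unfolding G_total_def using muN_bounds G_nonneg by (intro sum_mono) (simp add: mult_left_le)
  finally show "mean_tau n \<omega> \<le> G_total" .
qed

lemma muN_G_measurable_F: "(\<lambda>\<omega>. (muN n \<omega> v* G) $ x) \<in> borel_measurable (F n)"
  unfolding vector_matrix_mult_def vec_lambda_beta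
  by (intro borel_measurable_sum borel_measurable_times borel_measurable_const
      measurable_compose[OF muN_measurable_F borel_measurable_vec_nth])

lemma muN_G_measurable [measurable]: "(\<lambda>\<omega>. (muN n \<omega> v* G) $ x) \<in> borel_measurable M"
  by (rule measurable_from_subalg[OF F_subalgebra muN_G_measurable_F])

lemma muN_G_le: "(muN n \<omega> v* G) $ x \<le> G_total"
  using member_le_sum[of x UNIV "\<lambda>y. (muN n \<omega> v* G) $ y"] muN_G_nonneg mean_tau_bounds(2)[of n \<omega>]
  by (auto simp: mean_tau_def)

lemma mean_tau_measurable_F: "mean_tau n \<in> borel_measurable (F n)"
  unfolding mean_tau_def[abs_def] by (intro borel_measurable_sum muN_G_measurable_F)

lemma mean_tau_measurable [measurable]: "mean_tau n \<in> borel_measurable M"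
  by (rule measurable_from_subalg[OF F_subalgebra mean_tau_measurable_F])

definition mart :: "nat \<Rightarrow> 'w \<Rightarrow> real" where
  "mart n \<omega> = (\<Sum>j<n. real (tau j \<omega>) - mean_tau j \<omega>)"

lemma F_mono': "m \<le> n \<Longrightarrow> f \<in> borel_measurable (F m) \<Longrightarrow> f \<in> borel_measurable (F n)"
proof (induction rule: dec_induct)
  case (step n)
  have "subalgebra (F (Suc n)) (F n)" using F_mono by (simp add: subalgebra_def space_F)
  then show ?case using step measurable_from_subalg by blast
qed

lemma tau_real_measurable_F: "j < n \<Longrightarrow> (\<lambda>\<omega>. real (tau j \<omega>)) \<in> borel_measurable (F n)"
  by (rule measurable_compose[OF tau_measurable_F]) auto

lemma mart_measurable_F: "mart n \<in> borel_measurable (F n)"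
  unfolding mart_def[abs_def]
  by (intro borel_measurable_sum borel_measurable_diff tau_real_measurable_F F_mono'[OF _ mean_tau_measurable_F]) auto

text \<open>The form in which conditioning enters all martingale arguments: the coefficients may be
  unbounded, and square integrability is enough because the counts have second moments.\<close>

lemma expectation_linear_visits:
  assumes "\<And>x. c x \<in> borel_measurable (F n)" and "\<And>x. integrable M (\<lambda>\<omega>. (c x \<omega>)\<^sup>2)"
  shows "integrable M (\<lambda>\<omega>. \<Sum>x\<in>UNIV. c x \<omega> * visits n \<omega> $ x)"
    "integrable M (\<lambda>\<omega>. \<Sum>x\<in>UNIV. c x \<omega> * (muN n \<omega> v* G) $ x)"
    "(\<integral>\<omega>. (\<Sum>x\<in>UNIV. c x \<omega> * visits n \<omega> $ x) \<partial>M) = (\<integral>\<omega>. (\<Sum>x\<in>UNIV. c x \<omega> * (muN n \<omega> v* G) $ x) \<partial>M)"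
proof -
  have m: "c x \<in> borel_measurable M" for x by (rule measurable_from_subalg[OF F_subalgebra assms(1)])
  have i: "integrable M (\<lambda>\<omega>. c x \<omega> * visits n \<omega> $ x)" for x
    by (rule integrable_mult_L2[OF m _ assms(2) visits_square_integrable]) measurable
  note e = expectation_visits[OF assms(1) i]
  show "integrable M (\<lambda>\<omega>. \<Sum>x\<in>UNIV. c x \<omega> * visits n \<omega> $ x)"
    "integrable M (\<lambda>\<omega>. \<Sum>x\<in>UNIV. c x \<omega> * (muN n \<omega> v* G) $ x)"
    by (intro Bochner_Integration.integrable_sum i e(1))+
  show "(\<integral>\<omega>. (\<Sum>x\<in>UNIV. c x \<omega> * visits n \<omega> $ x) \<partial>M) = (\<integral>\<omega>. (\<Sum>x\<in>UNIV. c x \<omega> * (muN n \<omega> v* G) $ x) \<partial>M)"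
    by (simp add: Bochner_Integration.integral_sum i e)
qed

text \<open>The cross term with the past vanishes by \<open>expectation_linear_visits\<close>, so
  variances of the increments add up.\<close>

lemma mart_L2:
  "integrable M (\<lambda>\<omega>. (mart n \<omega>)\<^sup>2) \<and> (\<integral>\<omega>. (mart n \<omega>)\<^sup>2 \<partial>M) \<le> real n * (2 * moment + 2 * G_total\<^sup>2)"
proof (induction n)
  case 0
  show ?case by (simp add: mart_def)
next
  case (Suc n)
  let ?z = "\<lambda>\<omega>. real (tau n \<omega>) - mean_tau n \<omega>"
  have zb: "(?z \<omega>)\<^sup>2 \<le> 2 * (real (tau n \<omega>))\<^sup>2 + 2 * G_total\<^sup>2" for \<omega>
  proof -
    have "0 \<le> (real (tau n \<omega>) + mean_tau n \<omega>)\<^sup>2" by simp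
    then have "(?z \<omega>)\<^sup>2 \<le> 2 * (real (tau n \<omega>))\<^sup>2 + 2 * (mean_tau n \<omega>)\<^sup>2"
      by (simp add: power2_eq_square algebra_simps)
    moreover have "(mean_tau n \<omega>)\<^sup>2 \<le> G_total\<^sup>2" using mean_tau_bounds by (intro power_mono) auto
    ultimately show ?thesis by linarith
  qed
  have ib: "integrable M (\<lambda>\<omega>. 2 * (real (tau n \<omega>))\<^sup>2 + 2 * G_total\<^sup>2)"
    using tau_moments(2) by simp
  have zi: "integrable M (\<lambda>\<omega>. (?z \<omega>)\<^sup>2)"
    by (rule Bochner_Integration.integrable_bound[OF ib]) (use zb in \<open>auto intro: order_trans[OF _ abs_ge_self]\<close>)
  have "(\<integral>\<omega>. (?z \<omega>)\<^sup>2 \<partial>M) \<le> (\<integral>\<omega>. 2 * (real (tau n \<omega>))\<^sup>2 + 2 * G_total\<^sup>2 \<partial>M)"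
    by (intro integral_mono zi ib zb)
  also have "\<dots> \<le> 2 * moment + 2 * G_total\<^sup>2"
    using tau_moments(2,3)[of n] by (simp add: prob_space)
  finally have ez: "(\<integral>\<omega>. (?z \<omega>)\<^sup>2 \<partial>M) \<le> 2 * moment + 2 * G_total\<^sup>2" .
  note lin = expectation_linear_visits[OF mart_measurable_F, of n, OF conjunct1[OF Suc]]
  have cr: "mart n \<omega> * ?z \<omega> = (\<Sum>x\<in>UNIV. mart n \<omega> * visits n \<omega> $ x) - (\<Sum>x\<in>UNIV. mart n \<omega> * (muN n \<omega> v* G) $ x)" for \<omega>
    unfolding visits_sum[symmetric] mean_tau_def by (simp add: right_diff_distrib sum_distrib_left)
  have cross: "integrable M (\<lambda>\<omega>. mart n \<omega> * ?z \<omega>)" "(\<integral>\<omega>. mart n \<omega> * ?z \<omega> \<partial>M) = 0"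
    unfolding cr using lin by auto
  have eq: "(mart (Suc n) \<omega>)\<^sup>2 = (mart n \<omega>)\<^sup>2 + 2 * (mart n \<omega> * ?z \<omega>) + (?z \<omega>)\<^sup>2" for \<omega>
    by (simp add: mart_def power2_eq_square algebra_simps)
  have "integrable M (\<lambda>\<omega>. (mart (Suc n) \<omega>)\<^sup>2)"
    unfolding eq using Suc cross(1) zi by (intro Bochner_Integration.integrable_add integrable_mult_right) auto
  moreover have "(\<integral>\<omega>. (mart (Suc n) \<omega>)\<^sup>2 \<partial>M) = (\<integral>\<omega>. (mart n \<omega>)\<^sup>2 \<partial>M) + (\<integral>\<omega>. (?z \<omega>)\<^sup>2 \<partial>M)"
    unfolding eq using Suc cross zi by simp
  ultimately show ?case using Suc ez by (simp add: algebra_simps)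
qed

text \<open>Along squares the second moments of \<open>mart n / n\<close> are of order
  \<open>1 / k^2\<close>, hence summable. The increments are bounded below by
  \<open>- G_total\<close> since \<open>tau\<close> is nonnegative, which is just the one-sided
  control that \<open>tendsto_along_squares\<close> accepts.\<close>

lemma AE_mart: "AE \<omega> in M. (\<lambda>n. mart n \<omega> / real n) \<longlonglongrightarrow> 0"
proof -
  let ?C = "2 * moment + 2 * G_total\<^sup>2"
  have C: "0 \<le> ?C" using tau_moments(5) by simp
  let ?f = "\<lambda>k \<omega>. (mart (k\<^sup>2) \<omega> / real (k\<^sup>2))\<^sup>2"
  have int: "integrable M (?f k)" for k using mart_L2[of "k\<^sup>2"] by (simp add: power_divide)
  have "(\<integral>\<omega>. ?f k \<omega> \<partial>M) \<le> ?C * (1 / (real k)\<^sup>2)" for k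
  proof (cases "k = 0")
    case False
    have "(\<integral>\<omega>. ?f k \<omega> \<partial>M) = (\<integral>\<omega>. (mart (k\<^sup>2) \<omega>)\<^sup>2 \<partial>M) / (real (k\<^sup>2))\<^sup>2" by (simp add: power_divide)
    also have "\<dots> \<le> (real (k\<^sup>2) * ?C) / (real (k\<^sup>2))\<^sup>2" using mart_L2[of "k\<^sup>2"] by (intro divide_right_mono) auto
    also have "\<dots> = ?C * (1 / (real k)\<^sup>2)" using False by (simp add: power2_eq_square)
    finally show ?thesis .
  qed simp
  moreover have "summable (\<lambda>k. ?C * (1 / (real k)\<^sup>2))"
    using inverse_power_summable[of 2, where 'a=real] by (intro summable_mult) (simp add: inverse_eq_divide)
  ultimately have "summable (\<lambda>k. \<integral>\<omega>. ?f k \<omega> \<partial>M)"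
    by (intro summable_comparison_test'[where N=0 and f="\<lambda>k. \<integral>\<omega>. ?f k \<omega> \<partial>M"]) auto
  then have "AE \<omega> in M. summable (\<lambda>k. ?f k \<omega>)"
    by (intro AE_summable_of_expectation int) auto
  then show ?thesis
  proof eventually_elim
    case (elim \<omega>)
    then have "(\<lambda>k. ?f k \<omega>) \<longlonglongrightarrow> 0" by (rule summable_LIMSEQ_zero)
    then have "(\<lambda>k. mart (k\<^sup>2) \<omega> / real (k\<^sup>2)) \<longlonglongrightarrow> 0"
      using tendsto_real_sqrt[of "\<lambda>k. ?f k \<omega>" 0] by (simp add: tendsto_rabs_zero_iff del: of_nat_power)
    then show ?case
    proof (rule tendsto_along_squares)
      show "mart n \<omega> - G_total \<le> mart (Suc n) \<omega>" for n
        using mean_tau_bounds(2)[of n \<omega>] by (simp add: mart_def)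
      show "0 \<le> G_total" using mean_tau_bounds[of 0 \<omega>] by linarith
    qed
  qed
qed

lemma SN_eq: "SN n \<omega> = T0 + (\<Sum>j<n. mean_tau j \<omega>) + mart n \<omega>"
  by (simp add: SN_def mart_def sum_subtractf)

lemma SN_Suc: "SN (Suc n) \<omega> = SN n \<omega> + real (tau n \<omega>)"
  by (simp add: SN_def)

lemma WN_Suc: "WN (Suc n) \<omega> = WN n \<omega> + visits n \<omega>"
  by (simp add: WN_def)

lemma WN_eq: "WN n \<omega> = SN n \<omega> *\<^sub>R muN n \<omega>"
  using SN_ge[of n \<omega>] by (simp add: iterate_eq)

lemma AE_tau_ge_1: "AE \<omega> in M. \<forall>n. 1 \<le> tau n \<omega>"
  unfolding AE_all_countable using AE_tau by (auto elim: eventually_mono)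

text \<open>Runs start in a transient state only almost surely, so the linear lower bound is stated
  for paths on which every run has positive length.\<close>

lemma SN_ge_Suc:
  assumes "\<forall>n. 1 \<le> tau n \<omega>"
  shows "real n + 1 \<le> SN n \<omega>"
proof -
  have "(\<Sum>j<n. 1) \<le> (\<Sum>j<n. real (tau j \<omega>))" using assms by (intro sum_mono) (metis One_nat_def of_nat_1 of_nat_le_iff)
  then show ?thesis using T0 by (simp add: SN_def)
qed

text \<open>Apart from the martingale, \<open>S\<close> sums the conditional means of the run
  lengths, and these converge to the total mass \<open>\<gamma>\<close> of
  \<open>\<mu>G\<close>.\<close>

lemma AE_T_limit:
  assumes "AE \<omega> in M. (\<lambda>n. muN n \<omega>) \<longlonglongrightarrow> \<mu>"
  shows "AE \<omega> in M. (\<lambda>n. TN n \<omega>) \<longlonglongrightarrow> \<gamma>"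
  using assms AE_mart
proof eventually_elim
  case (elim \<omega>)
  have "(\<lambda>n. \<Sum>y\<in>UNIV. \<Sum>x\<in>UNIV. G $ x $ y * muN n \<omega> $ x) \<longlonglongrightarrow> (\<Sum>y\<in>UNIV. \<Sum>x\<in>UNIV. G $ x $ y * \<mu> $ x)"
    by (intro tendsto_intros elim(1))
  then have "(\<lambda>n. mean_tau n \<omega>) \<longlonglongrightarrow> (\<Sum>y\<in>UNIV. (\<mu> v* G) $ y)"
    by (simp add: mean_tau_def vector_matrix_mult_def mult.commute)
  also have "(\<Sum>y\<in>UNIV. (\<mu> v* G) $ y) = \<gamma>" by (simp add: mu_G mu_sum flip: sum_distrib_left)
  finally have c: "(\<lambda>n. (\<Sum>j<n. mean_tau j \<omega>) / real n) \<longlonglongrightarrow> \<gamma>" by (rule cesaro_mean)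
  have "(\<lambda>n. T0 / real n) \<longlonglongrightarrow> 0" by (rule lim_const_over_n)
  then have conv: "(\<lambda>n. (T0 / real n + (\<Sum>j<n. mean_tau j \<omega>) / real n + mart n \<omega> / real n) * (real n / (real n + 1))) \<longlonglongrightarrow> (0 + \<gamma> + 0) * 1"
    by (intro tendsto_mult tendsto_add c elim(2)) real_asymp+
  have "\<forall>\<^sub>F n in sequentially. (T0 / real n + (\<Sum>j<n. mean_tau j \<omega>) / real n + mart n \<omega> / real n) * (real n / (real n + 1)) = TN n \<omega>"
    by (rule eventually_sequentiallyI[of 1]) (simp add: iterate_eq(2) SN_eq add_divide_distrib[symmetric])
  from Lim_transform_eventually[OF conv this] show ?case by simp
qed

section \<open>The deviation process and its Lyapunov function\<close>

definition dev :: "nat \<Rightarrow> 'w \<Rightarrow> real^'t" where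
  "dev n \<omega> = WN n \<omega> - SN n \<omega> *\<^sub>R \<mu>"

lemma dev_eq: "dev n \<omega> = SN n \<omega> *\<^sub>R (muN n \<omega> - \<mu>)"
  by (simp add: dev_def WN_eq scaleR_diff_right)

lemma dev_Suc: "dev (Suc n) \<omega> = dev n \<omega> + (visits n \<omega> - real (tau n \<omega>) *\<^sub>R \<mu>)"
  by (simp add: dev_def WN_Suc SN_Suc scaleR_add_left)

lemma dev_measurable_F: "dev n \<in> borel_measurable (F n)"
  unfolding dev_def[abs_def]
  using SN_measurable_F[measurable] WN_measurable_F[measurable] by measurable

lemma dev_measurable [measurable]: "dev n \<in> borel_measurable M"
  by (rule measurable_from_subalg[OF F_subalgebra dev_measurable_F])

text \<open>Because \<open>\<mu>K = 0\<close>, the conditional drift of \<open>dev\<close> is exactly linear.\<close>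

lemma dev_drift: "(muN n \<omega> v* G) - mean_tau n \<omega> *\<^sub>R \<mu> = (1 / SN n \<omega>) *\<^sub>R (dev n \<omega> v* K)"
proof -
  have "(muN n \<omega> v* G) - mean_tau n \<omega> *\<^sub>R \<mu> = muN n \<omega> v* K" by (simp add: vector_K mean_tau_def)
  also have "\<dots> = (muN n \<omega> - \<mu>) v* K" by (simp add: vector_matrix_mult_diff_distrib mu_K)
  also have "\<dots> = (1 / SN n \<omega>) *\<^sub>R (dev n \<omega> v* K)"
    using SN_ge[of n \<omega>] by (simp add: dev_eq scaleR_vector_matrix_assoc)
  finally show ?thesis .
qed

end

lemma inner_form_measurable:
  fixes b :: "'v::euclidean_space \<Rightarrow> 'v \<Rightarrow> real"
  assumes "inner_form b" "f \<in> borel_measurable N" "g \<in> borel_measurable N"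
  shows "(\<lambda>\<omega>. b (f \<omega>) (g \<omega>)) \<in> borel_measurable N"
proof -
  have bb: "bounded_bilinear b" using assms(1) by (simp add: inner_form_def bilinear_conv_bounded_bilinear)
  show ?thesis
    by (rule borel_measurable_continuous_Pair[OF assms(2,3)])
       (intro bounded_bilinear.continuous_on[OF bb] continuous_intros)
qed

text \<open>Separates from one step of the quotient the part linear in the counts of the run, whose
  conditional mean is computable, from a second order remainder. With \<open>r = a / Z\<close> the
  factor \<open>1 / (1 + r)^2\<close> lies between \<open>1 - 2 r\<close> and
  \<open>1 - 2 r + 3 r^2\<close>; estimates from both sides are used because the sign of
  \<open>\<beta>\<close> is free.\<close>

lemma quotient_step_bound:
  fixes B D Z a \<beta> :: real
  assumes "0 \<le> B" "0 \<le> D" "0 < Z" "0 \<le> a"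
  shows "(B + 2 * \<beta> + D) / (Z + a)\<^sup>2 \<le> B / Z\<^sup>2 - 2 * a * B / Z ^ 3 + 2 * \<beta> / Z\<^sup>2
     + (3 * a\<^sup>2 * B / Z ^ 4 + D / Z\<^sup>2 + 4 * \<bar>\<beta>\<bar> * a / Z ^ 3)"
proof -
  define r where "r = a / Z"
  have r: "0 \<le> r" and a: "a = r * Z" using assms by (auto simp: r_def)
  define w where "w = 1 / (1 + r)\<^sup>2"
  have r1: "(1 + r)\<^sup>2 > 0" using r by simp
  have w: "0 \<le> w" "w \<le> 1" "w \<le> 1 - 2 * r + 3 * r\<^sup>2" "1 - 2 * r \<le> w"
  proof -
    show "0 \<le> w" by (simp add: w_def)
    have "1 \<le> (1 + r)\<^sup>2" using r by (intro one_le_power) auto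
    then show "w \<le> 1" using r1 by (simp add: w_def divide_le_eq_1)
    have "(1 - 2 * r + 3 * r\<^sup>2) * (1 + r)\<^sup>2 = 1 + 4 * r ^ 3 + 3 * r ^ 4"
      by (simp add: power2_eq_square power3_eq_cube power4_eq_xxxx algebra_simps)
    moreover have "1 + 4 * r ^ 3 + 3 * r ^ 4 \<ge> 1" using r by simp
    ultimately have "1 \<le> (1 - 2 * r + 3 * r\<^sup>2) * (1 + r)\<^sup>2" by simp
    then show "w \<le> 1 - 2 * r + 3 * r\<^sup>2" using r1 by (simp add: w_def pos_divide_le_eq)
    have "(1 - 2 * r) * (1 + r)\<^sup>2 = 1 - 3 * r\<^sup>2 - 2 * r ^ 3"
      by (simp add: power2_eq_square power3_eq_cube algebra_simps)
    moreover have "0 \<le> r\<^sup>2" "0 \<le> r ^ 3" using r by auto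
    ultimately have "(1 - 2 * r) * (1 + r)\<^sup>2 \<le> 1" by linarith
    then show "1 - 2 * r \<le> w" using r1 by (simp add: w_def pos_le_divide_eq)
  qed
  have "(Z + a)\<^sup>2 = Z\<^sup>2 * (1 + r)\<^sup>2" unfolding a by (simp add: power2_eq_square algebra_simps)
  then have "(B + 2 * \<beta> + D) / (Z + a)\<^sup>2 = (B * w + 2 * (\<beta> * w) + D * w) / Z\<^sup>2"
    by (simp add: w_def add_divide_distrib field_simps)
  also have "\<dots> \<le> (B * (1 - 2 * r + 3 * r\<^sup>2) + 2 * (\<beta> + 2 * \<bar>\<beta>\<bar> * r) + D * 1) / Z\<^sup>2"
  proof (intro divide_right_mono add_mono mult_left_mono)
    show "\<beta> * w \<le> \<beta> + 2 * \<bar>\<beta>\<bar> * r"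
    proof (cases "0 \<le> \<beta>")
      case True
      then have "\<beta> * w \<le> \<beta> * 1" using w by (intro mult_left_mono) auto
      moreover have "0 \<le> 2 * \<bar>\<beta>\<bar> * r" using r by simp
      ultimately show ?thesis by linarith
    next
      case False
      then have "\<beta> * w \<le> \<beta> * (1 - 2 * r)" using w by (intro mult_left_mono_neg) auto
      then show ?thesis using False by (simp add: algebra_simps)
    qed
  qed (use assms w in auto)
  also have "\<dots> = B / Z\<^sup>2 - 2 * a * B / Z ^ 3 + 2 * \<beta> / Z\<^sup>2
     + (3 * a\<^sup>2 * B / Z ^ 4 + D / Z\<^sup>2 + 4 * \<bar>\<beta>\<bar> * a / Z ^ 3)"
    using assms(3) unfolding a by (simp add: power2_eq_square power3_eq_cube power4_eq_xxxx field_simps)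
  finally show ?thesis .
qed

context algorithm
begin

lemma norm_visits_le: "norm (visits n \<omega>) \<le> real (tau n \<omega>)"
  using norm_le_l1_cart[of "visits n \<omega>"] visits_sum[of n \<omega>] by (simp add: visits_nonneg)

lemma norm_prob_vector_le: "prob_vector (m::real^'n) \<Longrightarrow> norm m \<le> 1"
  using norm_le_l1_cart[of m] by (simp add: prob_vector_def)

lemma norm_increment_le: "norm (visits n \<omega> - real (tau n \<omega>) *\<^sub>R \<mu>) \<le> 2 * real (tau n \<omega>)"
proof -
  have "norm (visits n \<omega> - real (tau n \<omega>) *\<^sub>R \<mu>) \<le> norm (visits n \<omega>) + norm (real (tau n \<omega>) *\<^sub>R \<mu>)"
    by (rule norm_triangle_ineq4)
  also have "\<dots> \<le> real (tau n \<omega>) + real (tau n \<omega>) * 1"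
    using norm_prob_vector_le[OF mu_prob] by (intro add_mono norm_visits_le) (simp add: mult_left_le)
  finally show ?thesis by simp
qed

lemma norm_dev_le: "norm (dev n \<omega>) \<le> 2 * SN n \<omega>"
proof -
  have "norm (muN n \<omega> - \<mu>) \<le> norm (muN n \<omega>) + norm \<mu>" by (rule norm_triangle_ineq4)
  also have "\<dots> \<le> 2" using norm_prob_vector_le[OF mu_prob] norm_prob_vector_le[OF muN_prob[of n \<omega>]] by linarith
  finally have "norm (muN n \<omega> - \<mu>) \<le> 2" .
  then show ?thesis using SN_ge[of n \<omega>] by (simp add: dev_eq)
qed

lemma SN_mono: "n \<le> m \<Longrightarrow> SN n \<omega> \<le> SN m \<omega>"
  by (induction rule: dec_induct) (auto simp: SN_Suc)

lemma norm_WN_diff: "n \<le> m \<Longrightarrow> norm (WN m \<omega> - WN n \<omega>) \<le> SN m \<omega> - SN n \<omega>"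
proof (induction rule: dec_induct)
  case (step m)
  have "norm (WN (Suc m) \<omega> - WN n \<omega>) \<le> norm (WN m \<omega> - WN n \<omega>) + norm (visits m \<omega>)"
    unfolding WN_Suc using norm_triangle_ineq[of "WN m \<omega> - WN n \<omega>" "visits m \<omega>"] by (simp add: algebra_simps)
  then show ?case using step norm_visits_le[of m \<omega>] by (simp add: SN_Suc)
qed simp

text \<open>However long the stretch from \<open>n\<close> to \<open>m\<close>, the iterate moves by
  at most twice the relative growth of \<open>S\<close>. This supplies the slow variation for
  \<open>slowly_varying_tendsto_0\<close>.\<close>

lemma norm_muN_diff:
  assumes "n \<le> m"
  shows "norm (muN m \<omega> - muN n \<omega>) \<le> 2 * (SN m \<omega> - SN n \<omega>) / SN n \<omega>"
proof -
  have S: "0 < SN n \<omega>" "SN n \<omega> \<le> SN m \<omega>" using SN_ge[of n \<omega>] SN_mono[OF assms] by auto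
  have "SN m \<omega> *\<^sub>R (muN m \<omega> - muN n \<omega>) = (WN m \<omega> - WN n \<omega>) - (SN m \<omega> - SN n \<omega>) *\<^sub>R muN n \<omega>"
    by (simp add: WN_eq algebra_simps)
  then have "SN m \<omega> * norm (muN m \<omega> - muN n \<omega>) = norm ((WN m \<omega> - WN n \<omega>) - (SN m \<omega> - SN n \<omega>) *\<^sub>R muN n \<omega>)"
    using S by (metis abs_of_pos less_le_trans norm_scaleR)
  also have "\<dots> \<le> norm (WN m \<omega> - WN n \<omega>) + norm ((SN m \<omega> - SN n \<omega>) *\<^sub>R muN n \<omega>)" by (rule norm_triangle_ineq4)
  also have "\<dots> \<le> (SN m \<omega> - SN n \<omega>) + (SN m \<omega> - SN n \<omega>) * 1"
    using S norm_prob_vector_le[OF muN_prob[of n \<omega>]] by (intro add_mono norm_WN_diff assms) (simp add: mult_left_le)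
  finally have "SN m \<omega> * norm (muN m \<omega> - muN n \<omega>) \<le> 2 * (SN m \<omega> - SN n \<omega>)" by simp
  moreover have "SN n \<omega> * norm (muN m \<omega> - muN n \<omega>) \<le> SN m \<omega> * norm (muN m \<omega> - muN n \<omega>)"
    using S by (intro mult_right_mono) auto
  ultimately show ?thesis using S by (simp add: pos_le_divide_eq mult.commute)
qed

lemma expectation_recursion_summable:
  fixes v w :: "nat \<Rightarrow> real"
  assumes v: "\<And>n. 0 \<le> v n" and w: "\<And>n. 0 \<le> w n"
    and step: "\<And>n. v (Suc n) \<le> v n - w n + e n" and e: "\<And>n. 0 \<le> e n" "summable e"
  shows "summable w"
proof (rule summableI_nonneg_bounded[OF w])
  fix n
  have "v n + (\<Sum>k<n. w k) \<le> v 0 + (\<Sum>k<n. e k)"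
  proof (induction n)
    case (Suc n)
    then show ?case using step[of n] by simp
  qed simp
  also have "(\<Sum>k<n. e k) \<le> suminf e" using e by (intro sum_le_suminf) auto
  finally show "(\<Sum>k<n. w k) \<le> v 0 + suminf e" using v[of n] by linarith
qed

text \<open>With \<open>Z = W \<bullet> u\<close> as denominator the drift of \<open>V\<close> is at
  most \<open>-2 (\<gamma> - \<kappa>) V / S\<close> plus a summable error, with no information on
  the growth of \<open>S\<close> beyond \<open>S \<ge> n + 1\<close>. Expectations give summability
  of \<open>V / S\<close> only; as \<open>V\<close> is a continuous function of the iterate, slow
  variation improves this to convergence.\<close>

lemma AE_muN_limit: "AE \<omega> in M. (\<lambda>n. muN n \<omega>) \<longlonglongrightarrow> \<mu>"
proof -
  obtain b \<kappa> where b: "inner_form b" and kap: "\<kappa> < \<gamma>" "0 \<le> \<kappa>" and bK: "\<And>x. b (x v* K) x \<le> \<kappa> * b x x"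
    using K_form by blast
  obtain C1 where C1: "C1 > 0" "\<And>x y. \<bar>b x y\<bar> \<le> C1 * norm x * norm y" using inner_form_bounds[OF b] by blast
  define c1 where "c1 = Min (range (($) u))"
  define c2 where "c2 = Max (range (($) u))"
  have u12: "c1 \<le> u $ x" "u $ x \<le> c2" for x by (auto simp: c1_def c2_def)
  have c1: "c1 > 0" using u_pos by (simp add: c1_def)
  have c12: "c1 \<le> c2" using u12 order_trans by blast
  have c2: "c2 > 0" using c1 c12 by simp
  have inner_u: "c1 * (\<Sum>x\<in>UNIV. w $ x) \<le> w \<bullet> u" "w \<bullet> u \<le> c2 * (\<Sum>x\<in>UNIV. w $ x)"
    if w: "\<And>x. 0 \<le> w $ x" for w :: "real^'t"
    unfolding inner_vec_def sum_distrib_left using w u12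
    by (auto intro!: sum_mono simp: mult.commute[of _ "w $ _"] mult_left_mono)
  define Z where "Z n \<omega> = WN n \<omega> \<bullet> u" for n \<omega>
  have Wnn: "0 \<le> WN n \<omega> $ x" for n \<omega> x using muN_bounds SN_ge[of n \<omega>] by (simp add: WN_eq)
  have Wsum: "(\<Sum>x\<in>UNIV. WN n \<omega> $ x) = SN n \<omega>" for n \<omega>
    using muN_prob[of n \<omega>] by (simp add: WN_eq prob_vector_def flip: sum_distrib_left)
  have Z: "c1 * SN n \<omega> \<le> Z n \<omega>" "Z n \<omega> \<le> c2 * SN n \<omega>" for n \<omega>
    using inner_u[of "WN n \<omega>"] Wnn Wsum by (auto simp: Z_def)
  have Z0: "0 < Z n \<omega>" "c1 \<le> Z n \<omega>" for n \<omega>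
  proof -
    have "c1 * 1 \<le> c1 * SN n \<omega>" using c1 SN_ge[of n \<omega>] by (intro mult_left_mono) auto
    then show "c1 \<le> Z n \<omega>" using Z(1)[of n \<omega>] by simp
    then show "0 < Z n \<omega>" using c1 by simp
  qed
  define a where "a n \<omega> = visits n \<omega> \<bullet> u" for n \<omega>
  have a: "0 \<le> a n \<omega>" "a n \<omega> \<le> c2 * real (tau n \<omega>)" for n \<omega>
  proof -
    show "a n \<omega> \<le> c2 * real (tau n \<omega>)" using inner_u(2)[of "visits n \<omega>"] visits_nonneg visits_sum by (simp add: a_def)
    have "0 \<le> c1 * real (tau n \<omega>)" using c1 by simp
    also have "\<dots> \<le> a n \<omega>" using inner_u(1)[of "visits n \<omega>"] visits_nonneg visits_sum by (simp add: a_def)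
    finally show "0 \<le> a n \<omega>" .
  qed
  define V where "V n \<omega> = b (dev n \<omega>) (dev n \<omega>) / (Z n \<omega>)\<^sup>2" for n \<omega>
  have V0: "0 \<le> V n \<omega>" for n \<omega> using inner_form_nonneg[OF b] by (simp add: V_def)
  have bdev: "b (dev n \<omega>) (dev n \<omega>) \<le> (4 * C1 / c1\<^sup>2) * (Z n \<omega>)\<^sup>2" for n \<omega>
  proof -
    have "b (dev n \<omega>) (dev n \<omega>) \<le> C1 * norm (dev n \<omega>) * norm (dev n \<omega>)" using C1(2) abs_le_D1 by blast
    also have "\<dots> \<le> C1 * (2 * SN n \<omega>) * (2 * SN n \<omega>)"
      using C1(1) norm_dev_le SN_ge[of n \<omega>] by (intro mult_mono) auto
    also have "\<dots> = (4 * C1 / c1\<^sup>2) * (c1 * SN n \<omega>)\<^sup>2" using c1 by (simp add: power2_eq_square)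
    also have "\<dots> \<le> (4 * C1 / c1\<^sup>2) * (Z n \<omega>)\<^sup>2"
      using C1(1) c1 Z(1) SN_ge[of n \<omega>] by (intro mult_left_mono power_mono) auto
    finally show ?thesis .
  qed
  define CV where "CV = 4 * C1 / c1\<^sup>2"
  have CV: "0 \<le> CV" using C1 by (simp add: CV_def)
  have VC: "V n \<omega> \<le> CV" for n \<omega>
    using bdev[of n \<omega>] Z0(1)[of n \<omega>] by (simp add: V_def CV_def pos_divide_le_eq)
  define \<Delta> where "\<Delta> n \<omega> = visits n \<omega> - real (tau n \<omega>) *\<^sub>R \<mu>" for n \<omega>
  \<comment> \<open>First order effect on \<open>V\<close> of one visit to \<open>x\<close>: growth
    of the denominator, and displacement of the deviation by \<open>axis x 1 - \<mu>\<close>.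
    Linearity in the counts brings \<open>expectation_linear_visits\<close> into play.\<close>
  define c where "c n x \<omega> = - 2 * u $ x * V n \<omega> / Z n \<omega> + 2 * b (dev n \<omega>) (axis x 1 - \<mu>) / (Z n \<omega>)\<^sup>2" for n x \<omega>
  have csum: "(\<Sum>x\<in>UNIV. c n x \<omega> * w $ x) = - 2 * (w \<bullet> u) * V n \<omega> / Z n \<omega>
      + 2 * b (dev n \<omega>) (w - (\<Sum>x\<in>UNIV. w $ x) *\<^sub>R \<mu>) / (Z n \<omega>)\<^sup>2" for n \<omega> w
  proof -
    have lin: "linear (b (dev n \<omega>))" using b by (simp add: inner_form_def bilinear_def)
    have "w - (\<Sum>x\<in>UNIV. w $ x) *\<^sub>R \<mu> = (\<Sum>x\<in>UNIV. w $ x *\<^sub>R (axis x 1 - \<mu>))"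
      using basis_expansion[of w] by (simp add: scaleR_diff_right sum_subtractf scaleR_sum_left scalar_mult_eq_scaleR)
    then have "b (dev n \<omega>) (w - (\<Sum>x\<in>UNIV. w $ x) *\<^sub>R \<mu>) = (\<Sum>x\<in>UNIV. w $ x * b (dev n \<omega>) (axis x 1 - \<mu>))"
      by (simp add: linear_sum[OF lin] linear_scale[OF lin])
    moreover have "c n x \<omega> * w $ x = (- 2 * V n \<omega> / Z n \<omega>) * (w $ x * u $ x)
        + (2 / (Z n \<omega>)\<^sup>2) * (w $ x * b (dev n \<omega>) (axis x 1 - \<mu>))" for x
      by (simp add: c_def algebra_simps)
    then have "(\<Sum>x\<in>UNIV. c n x \<omega> * w $ x) = (- 2 * V n \<omega> / Z n \<omega>) * (\<Sum>x\<in>UNIV. w $ x * u $ x)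
        + (2 / (Z n \<omega>)\<^sup>2) * (\<Sum>x\<in>UNIV. w $ x * b (dev n \<omega>) (axis x 1 - \<mu>))"
      by (simp only: sum.distrib sum_distrib_left)
    ultimately show ?thesis by (simp add: inner_vec_def mult_ac)
  qed
  have cm: "c n x \<in> borel_measurable (F n)" for n x
  proof -
    note [measurable] = dev_measurable_F[of n] WN_measurable_F[of n]
    have [measurable]: "Z n \<in> borel_measurable (F n)" unfolding Z_def[abs_def] by measurable
    have [measurable]: "(\<lambda>\<omega>. b (dev n \<omega>) (dev n \<omega>)) \<in> borel_measurable (F n)"
      "(\<lambda>\<omega>. b (dev n \<omega>) (axis x 1 - \<mu>)) \<in> borel_measurable (F n)"
      by (intro inner_form_measurable[OF b] borel_measurable_const; measurable)+
    show ?thesis unfolding c_def[abs_def] V_def by measurable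
  qed
  define Cc where "Cc = 2 * c2 * CV / c1 + 8 * C1 / c1\<^sup>2"
  have cb: "\<bar>c n x \<omega>\<bar> \<le> Cc" for n x \<omega>
  proof -
    have "\<bar>- 2 * u $ x * V n \<omega> / Z n \<omega>\<bar> \<le> 2 * c2 * CV / c1"
      using u12(2)[of x] less_imp_le[OF u_pos[of x]] V0 VC Z0[of n \<omega>] c1 c2 CV
      by (simp add: abs_mult abs_divide) (intro frac_le mult_mono; simp)
    moreover have "\<bar>2 * b (dev n \<omega>) (axis x 1 - \<mu>) / (Z n \<omega>)\<^sup>2\<bar> \<le> 8 * C1 / c1\<^sup>2"
    proof -
      have "norm (axis x 1 - \<mu>) \<le> 2"
        using norm_triangle_ineq4[of "axis x 1" \<mu>] norm_prob_vector_le[OF mu_prob] by (simp add: norm_axis_1)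
      then have "\<bar>b (dev n \<omega>) (axis x 1 - \<mu>)\<bar> \<le> C1 * (2 * SN n \<omega>) * 2"
        using C1 norm_dev_le[of n \<omega>] SN_ge[of n \<omega>]
        by (intro order_trans[OF C1(2)] mult_mono) auto
      then have "2 * \<bar>b (dev n \<omega>) (axis x 1 - \<mu>)\<bar> / (Z n \<omega>)\<^sup>2 \<le> (8 * C1 * SN n \<omega>) / (c1 * SN n \<omega>)\<^sup>2"
        using Z(1)[of n \<omega>] c1 SN_ge[of n \<omega>] C1 by (intro frac_le power_mono) auto
      also have "\<dots> = 8 * C1 / c1\<^sup>2 / SN n \<omega>" using SN_ge[of n \<omega>] by (simp add: power2_eq_square)
      also have "\<dots> \<le> 8 * C1 / c1\<^sup>2 / 1" using SN_ge[of n \<omega>] C1 by (intro divide_left_mono) auto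
      finally show ?thesis by (simp add: abs_mult abs_divide)
    qed
    ultimately show ?thesis unfolding c_def Cc_def by linarith
  qed
  have ci: "integrable M (\<lambda>\<omega>. (c n x \<omega>)\<^sup>2)" for n x
  proof (rule integrable_const_bound[where B="Cc\<^sup>2"])
    have "(c n x \<omega>)\<^sup>2 \<le> Cc\<^sup>2" for \<omega> using cb[of n x \<omega>] by (rule abs_le_square_iff[THEN iffD1, OF order_trans[OF _ abs_ge_self]])
    then show "AE \<omega> in M. norm ((c n x \<omega>)\<^sup>2) \<le> Cc\<^sup>2" by simp
    show "(\<lambda>\<omega>. (c n x \<omega>)\<^sup>2) \<in> borel_measurable M"
      using measurable_from_subalg[OF F_subalgebra cm] by measurable
  qed
  note lin = expectation_linear_visits[of "c _", OF cm ci]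
  \<comment> \<open>Collects the three remainder terms of \<open>quotient_step_bound\<close>, each
    at most a multiple of \<open>tau^2 / Z^2\<close>, with \<open>Z \<ge> c1 * S\<close>.\<close>
  define CR where "CR = (3 * c2\<^sup>2 * CV + 4 * C1 + 16 * C1 / c1 * c2) / c1\<^sup>2"
  have step: "V (Suc n) \<omega> \<le> V n \<omega> + (\<Sum>x\<in>UNIV. c n x \<omega> * visits n \<omega> $ x) + CR * (real (tau n \<omega>))\<^sup>2 / (SN n \<omega>)\<^sup>2" for n \<omega>
  proof -
    let ?B = "b (dev n \<omega>) (dev n \<omega>)" and ?D = "b (\<Delta> n \<omega>) (\<Delta> n \<omega>)" and ?\<beta> = "b (dev n \<omega>) (\<Delta> n \<omega>)" and ?Z = "Z n \<omega>" and ?a = "a n \<omega>"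
      and ?t = "real (tau n \<omega>)"
    have ZS: "Z (Suc n) \<omega> = ?Z + ?a" by (simp add: Z_def a_def WN_Suc inner_add_left)
    have "b (dev (Suc n) \<omega>) (dev (Suc n) \<omega>) = ?B + 2 * ?\<beta> + ?D"
      unfolding dev_Suc \<Delta>_def[symmetric] using inner_form_commute[OF b, of "\<Delta> n \<omega>" "dev n \<omega>"]
      by (simp add: inner_form_simps[OF b])
    then have "V (Suc n) \<omega> = (?B + 2 * ?\<beta> + ?D) / (?Z + ?a)\<^sup>2" by (simp add: V_def ZS)
    also have "\<dots> \<le> ?B / ?Z\<^sup>2 - 2 * ?a * ?B / ?Z ^ 3 + 2 * ?\<beta> / ?Z\<^sup>2
       + (3 * ?a\<^sup>2 * ?B / ?Z ^ 4 + ?D / ?Z\<^sup>2 + 4 * \<bar>?\<beta>\<bar> * ?a / ?Z ^ 3)"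
      using Z0[of n \<omega>] a(1) inner_form_nonneg[OF b] by (intro quotient_step_bound) auto
    also have "?B / ?Z\<^sup>2 - 2 * ?a * ?B / ?Z ^ 3 + 2 * ?\<beta> / ?Z\<^sup>2 = V n \<omega> + (\<Sum>x\<in>UNIV. c n x \<omega> * visits n \<omega> $ x)"
      unfolding csum V_def a_def \<Delta>_def visits_sum by (simp add: power2_eq_square power3_eq_cube)
    also have "3 * ?a\<^sup>2 * ?B / ?Z ^ 4 + ?D / ?Z\<^sup>2 + 4 * \<bar>?\<beta>\<bar> * ?a / ?Z ^ 3 \<le> CR * ?t\<^sup>2 / (SN n \<omega>)\<^sup>2"
    proof -
      have nD: "norm (\<Delta> n \<omega>) \<le> 2 * ?t" unfolding \<Delta>_def by (rule norm_increment_le)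
      have "3 * ?a\<^sup>2 * ?B / ?Z ^ 4 = 3 * ?a\<^sup>2 * V n \<omega> / ?Z\<^sup>2"
        by (simp add: V_def power2_eq_square power4_eq_xxxx)
      also have "\<dots> \<le> 3 * (c2 * ?t)\<^sup>2 * CV / ?Z\<^sup>2"
        using a VC V0 CV by (intro divide_right_mono mult_mono power_mono) auto
      finally have 1: "3 * ?a\<^sup>2 * ?B / ?Z ^ 4 \<le> (3 * c2\<^sup>2 * CV) * ?t\<^sup>2 / ?Z\<^sup>2" by (simp add: power_mult_distrib mult_ac)
      have "?D \<le> C1 * norm (\<Delta> n \<omega>) * norm (\<Delta> n \<omega>)" using C1(2) abs_le_D1 by blast
      also have "\<dots> \<le> C1 * (2 * ?t) * (2 * ?t)" using C1(1) nD by (intro mult_mono) auto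
      finally have "?D \<le> (4 * C1) * ?t\<^sup>2" by (simp add: power2_eq_square mult_ac)
      then have 2: "?D / ?Z\<^sup>2 \<le> (4 * C1) * ?t\<^sup>2 / ?Z\<^sup>2" by (intro divide_right_mono) auto
      have "\<bar>?\<beta>\<bar> \<le> C1 * (2 * SN n \<omega>) * (2 * ?t)"
        using C1 norm_dev_le[of n \<omega>] nD SN_ge[of n \<omega>] by (intro order_trans[OF C1(2)] mult_mono) auto
      also have "\<dots> = 4 * C1 / c1 * (c1 * SN n \<omega>) * ?t" using c1 by simp
      also have "\<dots> \<le> 4 * C1 / c1 * ?Z * ?t" using Z(1) C1 c1 by (intro mult_right_mono mult_left_mono) auto
      finally have be: "\<bar>?\<beta>\<bar> \<le> 4 * C1 / c1 * ?Z * ?t" .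
      have "4 * \<bar>?\<beta>\<bar> * ?a / ?Z ^ 3 \<le> 4 * (4 * C1 / c1 * ?Z * ?t) * (c2 * ?t) / ?Z ^ 3"
        using be a Z0[of n \<omega>] C1 c1 by (intro divide_right_mono mult_mono) auto
      also have "\<dots> = (16 * C1 / c1 * c2) * ?t\<^sup>2 / ?Z\<^sup>2"
        using Z0[of n \<omega>] by (simp add: power2_eq_square power3_eq_cube)
      finally have 3: "4 * \<bar>?\<beta>\<bar> * ?a / ?Z ^ 3 \<le> (16 * C1 / c1 * c2) * ?t\<^sup>2 / ?Z\<^sup>2" .
      have "3 * ?a\<^sup>2 * ?B / ?Z ^ 4 + ?D / ?Z\<^sup>2 + 4 * \<bar>?\<beta>\<bar> * ?a / ?Z ^ 3 \<le> (3 * c2\<^sup>2 * CV + 4 * C1 + 16 * C1 / c1 * c2) * ?t\<^sup>2 / ?Z\<^sup>2"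
        using add_mono[OF add_mono[OF 1 2] 3] by (simp add: add_divide_distrib distrib_right)
      also have "\<dots> \<le> (3 * c2\<^sup>2 * CV + 4 * C1 + 16 * C1 / c1 * c2) * ?t\<^sup>2 / (c1 * SN n \<omega>)\<^sup>2"
      proof (rule divide_left_mono)
        have cS: "0 < c1 * SN n \<omega>" using c1 SN_ge[of n \<omega>] by (intro mult_pos_pos) auto
        then show "(c1 * SN n \<omega>)\<^sup>2 \<le> ?Z\<^sup>2" using Z(1)[of n \<omega>] by (intro power_mono) auto
        show "0 \<le> (3 * c2\<^sup>2 * CV + 4 * C1 + 16 * C1 / c1 * c2) * ?t\<^sup>2" using c1 c2 C1 CV by simp
        show "0 < ?Z\<^sup>2 * (c1 * SN n \<omega>)\<^sup>2" by (rule mult_pos_pos[OF zero_less_power[OF Z0(1)] zero_less_power[OF cS]])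
      qed
      also have "\<dots> = CR * ?t\<^sup>2 / (SN n \<omega>)\<^sup>2" by (simp add: CR_def power_mult_distrib)
      finally show ?thesis .
    qed
    finally show ?thesis by simp
  qed
  have CR: "0 \<le> CR" using c1 c2 C1 CV by (simp add: CR_def)
  \<comment> \<open>The first term of \<open>csum\<close> contributes
    \<open>-2 \<gamma> V / S\<close> by \<open>G u = \<gamma> u\<close>, the second at most
    \<open>2 \<kappa> V / S\<close> by the choice of \<open>b\<close>.\<close>
  have drift: "(\<Sum>x\<in>UNIV. c n x \<omega> * (muN n \<omega> v* G) $ x) \<le> - (2 * (\<gamma> - \<kappa>)) * (V n \<omega> / SN n \<omega>)" for n \<omega>
  proof -
    have S: "SN n \<omega> > 0" using SN_ge[of n \<omega>] by simp
    have "(muN n \<omega> v* G) \<bullet> u = \<gamma> * (muN n \<omega> \<bullet> u)" by (simp add: dot_lmul_matrix G_u)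
    also have "muN n \<omega> \<bullet> u = Z n \<omega> / SN n \<omega>" using S by (simp add: Z_def WN_eq)
    finally have 1: "(muN n \<omega> v* G) \<bullet> u = \<gamma> * (Z n \<omega> / SN n \<omega>)" .
    have "b (dev n \<omega>) ((muN n \<omega> v* G) - (\<Sum>x\<in>UNIV. (muN n \<omega> v* G) $ x) *\<^sub>R \<mu>) = b (dev n \<omega> v* K) (dev n \<omega>) / SN n \<omega>"
      using dev_drift[of n \<omega>] inner_form_commute[OF b] by (simp add: mean_tau_def inner_form_simps[OF b])
    also have "\<dots> \<le> \<kappa> * b (dev n \<omega>) (dev n \<omega>) / SN n \<omega>" using bK S by (intro divide_right_mono) auto
    finally have 2: "b (dev n \<omega>) ((muN n \<omega> v* G) - (\<Sum>x\<in>UNIV. (muN n \<omega> v* G) $ x) *\<^sub>R \<mu>) / (Z n \<omega>)\<^sup>2 \<le> \<kappa> * V n \<omega> / SN n \<omega>"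
      using Z0(1)[of n \<omega>] unfolding V_def by (simp add: divide_right_mono field_simps)
    have "(\<Sum>x\<in>UNIV. c n x \<omega> * (muN n \<omega> v* G) $ x) \<le> - 2 * (\<gamma> * (Z n \<omega> / SN n \<omega>)) * V n \<omega> / Z n \<omega> + 2 * (\<kappa> * V n \<omega> / SN n \<omega>)"
      unfolding csum 1 using 2 by simp
    also have "\<dots> = - (2 * (\<gamma> - \<kappa>)) * (V n \<omega> / SN n \<omega>)"
      using Z0(1)[of n \<omega>] S by (simp add: field_simps)
    finally show ?thesis .
  qed
  have Zm[measurable]: "Z n \<in> borel_measurable M" for n unfolding Z_def[abs_def] by measurable
  have Vm[measurable]: "V n \<in> borel_measurable M" for n
  proof -
    have [measurable]: "(\<lambda>\<omega>. b (dev n \<omega>) (dev n \<omega>)) \<in> borel_measurable M"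
      by (intro inner_form_measurable[OF b]; measurable)
    show ?thesis unfolding V_def[abs_def] by measurable
  qed
  have Vi: "integrable M (V n)" for n
    by (rule integrable_const_bound[where B=CV]) (auto simp: V0 VC)
  have VS: "V n \<omega> / SN n \<omega> \<le> CV" for n \<omega>
  proof -
    have "V n \<omega> / SN n \<omega> \<le> V n \<omega> / 1" using V0 SN_ge[of n \<omega>] by (intro divide_left_mono) auto
    then show ?thesis using VC[of n \<omega>] by simp
  qed
  have VSi: "integrable M (\<lambda>\<omega>. V n \<omega> / SN n \<omega>)" for n
    by (rule integrable_const_bound[where B=CV]) (use V0 VS SN_ge[THEN order_trans[OF zero_le_one]] in auto)
  have sumVS: "summable (\<lambda>n. (2 * (\<gamma> - \<kappa>)) * (\<integral>\<omega>. V n \<omega> / SN n \<omega> \<partial>M))"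
  proof (rule expectation_recursion_summable)
    show "0 \<le> (\<integral>\<omega>. V n \<omega> \<partial>M)" for n using V0 by (intro integral_nonneg_AE) auto
    have "0 \<le> (\<integral>\<omega>. V n \<omega> / SN n \<omega> \<partial>M)" for n
      using V0 SN_ge[THEN order_trans[OF zero_le_one]] by (intro integral_nonneg_AE) auto
    then show "0 \<le> (2 * (\<gamma> - \<kappa>)) * (\<integral>\<omega>. V n \<omega> / SN n \<omega> \<partial>M)" for n using kap by simp
    show "0 \<le> CR * moment / (real n + 1)\<^sup>2" for n using CR tau_moments(5) by simp
    have "summable (\<lambda>n. CR * moment * (1 / (real (Suc n))\<^sup>2))"
      by (rule summable_mult) (use inverse_power_summable[of 2, where 'a=real] in \<open>subst summable_Suc_iff, simp add: inverse_eq_divide\<close>)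
    then show "summable (\<lambda>n. CR * moment / (real n + 1)\<^sup>2)" by (simp add: add.commute)
    fix n
    \<comment> \<open>Almost surely \<open>S \<ge> n + 1\<close>, so with uniformly bounded second
      moments of \<open>tau\<close> the remainder is of order \<open>1 / (n + 1)^2\<close>.\<close>
    have AE: "AE \<omega> in M. V (Suc n) \<omega> \<le> V n \<omega> + (\<Sum>x\<in>UNIV. c n x \<omega> * visits n \<omega> $ x) + CR / (real n + 1)\<^sup>2 * (real (tau n \<omega>))\<^sup>2"
      using AE_tau_ge_1
    proof eventually_elim
      case (elim \<omega>)
      have "CR * (real (tau n \<omega>))\<^sup>2 / (SN n \<omega>)\<^sup>2 \<le> CR * (real (tau n \<omega>))\<^sup>2 / (real n + 1)\<^sup>2"
        using SN_ge_Suc[OF elim, of n] CR by (intro divide_left_mono power_mono) auto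
      then show ?case using step[of n \<omega>] by simp
    qed
    have "(\<integral>\<omega>. V (Suc n) \<omega> \<partial>M) \<le> (\<integral>\<omega>. V n \<omega> + (\<Sum>x\<in>UNIV. c n x \<omega> * visits n \<omega> $ x) + CR / (real n + 1)\<^sup>2 * (real (tau n \<omega>))\<^sup>2 \<partial>M)"
      by (rule integral_mono_AE[OF Vi _ AE])
         (intro Bochner_Integration.integrable_add Vi lin(1) integrable_mult_right tau_moments(2))
    also have "\<dots> = (\<integral>\<omega>. V n \<omega> \<partial>M) + (\<integral>\<omega>. (\<Sum>x\<in>UNIV. c n x \<omega> * (muN n \<omega> v* G) $ x) \<partial>M) + CR / (real n + 1)\<^sup>2 * (\<integral>\<omega>. (real (tau n \<omega>))\<^sup>2 \<partial>M)"
      using Vi lin tau_moments(2) by simp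
    also have "(\<integral>\<omega>. (\<Sum>x\<in>UNIV. c n x \<omega> * (muN n \<omega> v* G) $ x) \<partial>M) \<le> (\<integral>\<omega>. - (2 * (\<gamma> - \<kappa>)) * (V n \<omega> / SN n \<omega>) \<partial>M)"
      by (intro integral_mono lin(2) integrable_mult_right VSi drift)
    also have "\<dots> = - ((2 * (\<gamma> - \<kappa>)) * (\<integral>\<omega>. V n \<omega> / SN n \<omega> \<partial>M))"
      by (subst integral_mult_right_zero) (simp add: algebra_simps)
    also have "CR / (real n + 1)\<^sup>2 * (\<integral>\<omega>. (real (tau n \<omega>))\<^sup>2 \<partial>M) \<le> CR / (real n + 1)\<^sup>2 * moment"
      using tau_moments(3) CR by (intro mult_left_mono) auto
    finally show "(\<integral>\<omega>. V (Suc n) \<omega> \<partial>M) \<le> (\<integral>\<omega>. V n \<omega> \<partial>M) - (2 * (\<gamma> - \<kappa>)) * (\<integral>\<omega>. V n \<omega> / SN n \<omega> \<partial>M) + CR * moment / (real n + 1)\<^sup>2"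
      by simp
  qed
  have "AE \<omega> in M. summable (\<lambda>n. V n \<omega> / SN n \<omega>)"
  proof (rule AE_summable_of_expectation[OF VSi])
    show "0 \<le> V n \<omega> / SN n \<omega>" for n \<omega> using V0 SN_ge[of n \<omega>] by simp
    show "summable (\<lambda>n. \<integral>\<omega>. V n \<omega> / SN n \<omega> \<partial>M)"
      using sumVS kap by (subst (asm) summable_cmult_iff) simp
  qed
  then show ?thesis
    using AE_mart AE_tau_ge_1
  proof eventually_elim
    case (elim \<omega>)
    let ?f = "\<lambda>m. b (m - \<mu>) (m - \<mu>) / (m \<bullet> u)\<^sup>2"
    have S0: "0 < SN n \<omega>" for n using SN_ge[of n \<omega>] by simp
    \<comment> \<open>The factor \<open>S^2\<close> cancels, so \<open>V\<close> is a fixed function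
      of the iterate, continuous on the compact simplex because
      \<open>m \<bullet> u \<ge> c1\<close> there.\<close>
    have Vf: "V n \<omega> = ?f (muN n \<omega>)" for n
      unfolding V_def Z_def dev_eq WN_eq inner_scaleR_left inner_form_simps(3,4)[OF b] power2_eq_square
      using S0[of n] by simp
    have mu: "muN n \<omega> \<in> {m. prob_vector m}" for n using muN_prob by simp
    have pu: "c1 \<le> m \<bullet> u" "m \<bullet> u \<le> c2" if "prob_vector m" for m
      using inner_u[of m] that by (auto simp: prob_vector_def)
    have bb: "bounded_bilinear b" using b by (simp add: inner_form_def bilinear_conv_bounded_bilinear)
    have "continuous_on {m. prob_vector m} ?f"
      using pu(1) c1 by (intro continuous_intros bounded_bilinear.continuous_on[OF bb]) fastforce
    then have uc: "uniformly_continuous_on {m. prob_vector m} ?f"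
      by (rule compact_uniformly_continuous[OF _ compact_convex_prob_vectors(1)])
    have "(\<lambda>n. V n \<omega>) \<longlonglongrightarrow> 0"
    proof (rule slowly_varying_tendsto_0[where S="\<lambda>n. SN n \<omega>" and D="\<lambda>n. mart n \<omega>" and c=G_total])
      show "0 \<le> V n \<omega>" for n by (rule V0)
      show "summable (\<lambda>n. V n \<omega> / SN n \<omega>)" by (rule elim(1))
      show "real n \<le> SN n \<omega>" for n using SN_ge_Suc[OF elim(3), of n] by simp
      show "0 < SN n \<omega>" for n by (rule S0)
      show "0 \<le> G_total" using mean_tau_bounds[of 0 \<omega>] by linarith
      show "SN m \<omega> - SN n \<omega> \<le> G_total * real (m - n) + (mart m \<omega> - mart n \<omega>)" if "n \<le> m" for m n
        using that
      proof (induction rule: dec_induct)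
        case (step m)
        then show ?case using mean_tau_bounds(2)[of m \<omega>]
          by (simp add: SN_Suc mart_def Suc_diff_le algebra_simps)
      qed simp
      show "SN n \<omega> \<le> SN m \<omega>" if "n \<le> m" for m n using that by (rule SN_mono)
      show "(\<lambda>n. mart n \<omega> / real n) \<longlonglongrightarrow> 0" by (rule elim(2))
      fix d :: real assume "0 < d"
      then obtain r where r: "r > 0" "\<And>m m'. prob_vector m \<Longrightarrow> prob_vector m' \<Longrightarrow> dist m' m < r \<Longrightarrow> dist (?f m') (?f m) < d"
        using uc unfolding uniformly_continuous_on_def by (metis mem_Collect_eq)
      show "\<exists>\<eta>>0. \<forall>n m. n \<le> m \<longrightarrow> SN m \<omega> - SN n \<omega> \<le> \<eta> * SN n \<omega> \<longrightarrow> V n \<omega> - d \<le> V m \<omega>"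
      proof (intro exI[of _ "r / 3"] conjI allI impI)
        show "0 < r / 3" using r by simp
        fix n m :: nat assume nm: "n \<le> m" "SN m \<omega> - SN n \<omega> \<le> r / 3 * SN n \<omega>"
        have "norm (muN m \<omega> - muN n \<omega>) \<le> 2 * (SN m \<omega> - SN n \<omega>) / SN n \<omega>" by (rule norm_muN_diff[OF nm(1)])
        also have "\<dots> \<le> 2 * (r / 3 * SN n \<omega>) / SN n \<omega>" using nm(2) S0[of n] by (intro divide_right_mono) auto
        also have "\<dots> < r" using S0[of n] r by simp
        finally have "dist (muN m \<omega>) (muN n \<omega>) < r" by (simp add: dist_norm)
        then have "dist (V m \<omega>) (V n \<omega>) < d" unfolding Vf using r(2) mu by blast
        then show "V n \<omega> - d \<le> V m \<omega>" by (simp add: dist_real_def)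
      qed
    qed
    then have "(\<lambda>n. V n \<omega> * c2\<^sup>2) \<longlonglongrightarrow> 0" using tendsto_mult_left_zero by blast
    have "(\<lambda>n. (norm (muN n \<omega> - \<mu>))\<^sup>2) \<longlonglongrightarrow> 0"
    proof (rule tendsto_sandwich[OF _ _ tendsto_const \<open>(\<lambda>n. V n \<omega> * c2\<^sup>2) \<longlonglongrightarrow> 0\<close>])
      show "\<forall>\<^sub>F n in sequentially. (norm (muN n \<omega> - \<mu>))\<^sup>2 \<le> V n \<omega> * c2\<^sup>2"
      proof (rule always_eventually, rule allI)
        fix n
        have p: "c1 \<le> muN n \<omega> \<bullet> u" "muN n \<omega> \<bullet> u \<le> c2" using pu[OF muN_prob] by auto
        have "(norm (muN n \<omega> - \<mu>))\<^sup>2 \<le> b (muN n \<omega> - \<mu>) (muN n \<omega> - \<mu>)" by (rule inner_form_ge[OF b])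
        also have "\<dots> = V n \<omega> * (muN n \<omega> \<bullet> u)\<^sup>2" unfolding Vf using p c1 by simp
        also have "\<dots> \<le> V n \<omega> * c2\<^sup>2" using p c1 V0 by (intro mult_left_mono power_mono) auto
        finally show "(norm (muN n \<omega> - \<mu>))\<^sup>2 \<le> V n \<omega> * c2\<^sup>2" .
      qed
    qed auto
    then have "(\<lambda>n. norm (muN n \<omega> - \<mu>)) \<longlonglongrightarrow> 0"
      using tendsto_real_sqrt[of "\<lambda>n. (norm (muN n \<omega> - \<mu>))\<^sup>2" 0] by simp
    then show ?case using LIM_zero_cancel tendsto_norm_zero_iff by blast
  qed
qed

end

section \<open>Perturbed contractions\<close>

text \<open>Comparison with \<open>(n + 1) powr - c\<close>, the solution of the homogeneous recursion.\<close>

lemma contraction_tendsto_0: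
  fixes y e :: "nat \<Rightarrow> real"
  assumes c: "0 < c" and y: "\<And>n. 0 \<le> y n" and e: "e \<longlonglongrightarrow> 0"
    and step: "\<And>n. n \<ge> start \<Longrightarrow> y (Suc n) \<le> (1 - c / (real n + 1)) * y n + e n / (real n + 1)"
  shows "y \<longlonglongrightarrow> 0"
proof (rule LIMSEQ_I)
  fix r :: real assume r: "0 < r"
  define d where "d = r / 2"
  have d: "d > 0" using r by (simp add: d_def)
  have "\<forall>\<^sub>F n in sequentially. e n < c * d" using order_tendstoD(2)[OF e, of "c * d"] c d by simp
  then obtain N1 where N1: "\<And>n. n \<ge> N1 \<Longrightarrow> e n < c * d" by (auto simp: eventually_sequentially)
  \<comment> \<open>From \<open>N\<close> on the forcing is below \<open>c d\<close>, whose
    equilibrium is \<open>d\<close>, and the factor \<open>1 - c / (n + 1)\<close> is nonnegative,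
    so inequalities may be multiplied by it.\<close>
  define N where "N = max (max N1 start) (nat \<lceil>c\<rceil>)"
  define W where "W = \<bar>y N - d\<bar> / (real N + 1) powr (- c)"
  have W: "0 \<le> W" by (simp add: W_def)
  have main: "y n - d \<le> W * (real n + 1) powr (- c)" if "N \<le> n" for n
    using that
  proof (induction rule: dec_induct)
    case base
    have "(real N + 1) powr (- c) > 0" by simp
    then show ?case by (simp add: W_def)
  next
    case (step n)
    have n: "n \<ge> N1" "n \<ge> start" "c \<le> real n + 1" using step(1) by (auto simp: N_def)
    have k: "0 \<le> 1 - c / (real n + 1)" using n(3) by simp
    have "e n / (real n + 1) \<le> c * d / (real n + 1)" using N1[OF n(1)] by (intro divide_right_mono) auto
    then have "y (Suc n) - d \<le> (1 - c / (real n + 1)) * y n + c * d / (real n + 1) - d"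
      using assms(4)[OF n(2)] by linarith
    also have "\<dots> = (1 - c / (real n + 1)) * (y n - d)"
      by (simp add: left_diff_distrib right_diff_distrib diff_divide_distrib)
    also have "\<dots> \<le> (1 - c / (real n + 1)) * (W * (real n + 1) powr (- c))" using step.IH k by (rule mult_left_mono)
    also have "\<dots> \<le> W * (real (Suc n) + 1) powr (- c)"
    proof -
      have "(1 - c / (real n + 1)) * (real n + 1) powr (- c) \<le> exp (- (c / (real n + 1))) * (real n + 1) powr (- c)"
        using exp_ge_add_one_self[of "- (c / (real n + 1))"] by (intro mult_right_mono) auto
      also have "\<dots> = exp (- c * (1 / (real n + 1) + ln (real n + 1)))"
        by (simp add: powr_def exp_add[symmetric] algebra_simps)
      also have "\<dots> \<le> exp (- c * ln (real n + 2))"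
      proof -
        have "ln ((real n + 2) / (real n + 1)) \<le> (real n + 2) / (real n + 1) - 1" by (rule ln_le_minus_one) simp
        also have "\<dots> = 1 / (real n + 1)" by (simp add: field_simps)
        finally have "ln (real n + 2) \<le> 1 / (real n + 1) + ln (real n + 1)" by (simp add: ln_div)
        then show ?thesis using c by simp
      qed
      also have "\<dots> = (real (Suc n) + 1) powr (- c)" by (simp add: powr_def add.commute)
      finally show ?thesis using mult_left_mono[OF _ W] by (simp add: mult.left_commute)
    qed
    finally show ?case .
  qed
  have "(\<lambda>n. W * (real n + 1) powr (- c)) \<longlonglongrightarrow> W * 0"
  proof (intro tendsto_mult tendsto_const)
    have "filterlim (\<lambda>n. real n + 1) at_top sequentially" by real_asymp
    then show "(\<lambda>n. (real n + 1) powr (- c)) \<longlonglongrightarrow> 0" using c by (intro tendsto_neg_powr) auto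
  qed
  then have "\<forall>\<^sub>F n in sequentially. W * (real n + 1) powr (- c) < d" using order_tendstoD(2)[of _ "W * 0"] d by auto
  then obtain N2 where N2: "\<And>n. n \<ge> N2 \<Longrightarrow> W * (real n + 1) powr (- c) < d" by (auto simp: eventually_sequentially)
  show "\<exists>no. \<forall>n\<ge>no. norm (y n - 0) < r"
  proof (intro exI[of _ "max N N2"] allI impI)
    fix n assume "max N N2 \<le> n"
    then have "y n - d \<le> W * (real n + 1) powr (- c)" "W * (real n + 1) powr (- c) < d" using main N2 by auto
    then show "norm (y n - 0) < r" using y[of n] by (simp add: d_def)
  qed
qed

text \<open>\<open>D (n + 1)\<close> is a supersolution once \<open>\<rho> D + C \<le> D\<close>,
  which \<open>\<rho> < 1\<close> makes possible; the sum in \<open>D\<close> covers the indices up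
  to \<open>start\<close>.\<close>

lemma linear_growth_bound:
  fixes v :: "nat \<Rightarrow> real"
  assumes rho: "\<rho> < 1" "0 \<le> \<rho>" and C: "0 \<le> C"
    and step: "\<And>n. n \<ge> start \<Longrightarrow> v (Suc n) \<le> (1 + \<rho> / (real n + 1)) * v n + C"
  obtains D where "0 \<le> D" "\<And>n. v n \<le> D * (real n + 1)"
proof -
  define D where "D = (\<Sum>k\<le>start. \<bar>v k\<bar>) + C / (1 - \<rho>)"
  have D0: "0 \<le> D" using rho C by (auto simp: D_def intro!: add_nonneg_nonneg sum_nonneg)
  have DC: "\<rho> * D + C \<le> D"
  proof -
    have "C / (1 - \<rho>) \<le> D" by (simp add: D_def sum_nonneg)
    then have "C \<le> D * (1 - \<rho>)" using rho by (simp add: pos_divide_le_eq)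
    then show ?thesis by (simp add: algebra_simps)
  qed
  have small: "v n \<le> D * (real n + 1)" if "n \<le> start" for n
  proof -
    have "v n \<le> \<bar>v n\<bar>" by simp
    also have "\<dots> \<le> (\<Sum>k\<le>start. \<bar>v k\<bar>)" using that by (intro member_le_sum) auto
    also have "\<dots> \<le> D" using C rho by (simp add: D_def)
    also have "D * 1 \<le> D * (real n + 1)" using D0 by (intro mult_left_mono) auto
    finally show ?thesis by simp
  qed
  have "v n \<le> D * (real n + 1)" if "start \<le> n" for n
    using that
  proof (induction rule: dec_induct)
    case base
    then show ?case using small by simp
  next
    case (step n)
    have "v (Suc n) \<le> (1 + \<rho> / (real n + 1)) * v n + C" using assms(4) step by simp
    also have "\<dots> \<le> (1 + \<rho> / (real n + 1)) * (D * (real n + 1)) + C"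
      using step.IH rho by (intro add_right_mono mult_left_mono) auto
    also have "\<dots> = D * (real n + 1) + (\<rho> * D + C)" by (simp add: field_simps)
    also have "\<dots> \<le> D * (real n + 1) + D" using DC by simp
    finally show ?case by (simp add: algebra_simps)
  qed
  with small have "v n \<le> D * (real n + 1)" for n using linear[of n start] by blast
  with D0 show ?thesis by (rule that)
qed

text \<open>The origin of the threshold one half: passing from \<open>sqrt (n + 1)\<close> to
  \<open>sqrt (n + 2)\<close> gains a factor about \<open>1 - (1 / 2) / (n + 1)\<close>, which beats
  a growth \<open>1 + \<rho> / (n + 1)\<close> when \<open>\<rho> < 1 / 2\<close>. Half of the
  surplus is given up to absorb higher order terms.\<close>

lemma sqrt_ratio_contracts:
  assumes "\<rho> < 1 / 2"
  shows "\<forall>\<^sub>F n in sequentially. sqrt ((real n + 1) / (real n + 2)) * (1 + \<rho> / (real n + 1)) \<le> 1 - ((1/2 - \<rho>) / 2) / (real n + 1)"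
proof -
  have "((\<lambda>n. (1 - sqrt ((real n + 1) / (real n + 2)) * (1 + \<rho> / (real n + 1))) * (real n + 1)) \<longlongrightarrow> 1/2 - \<rho>) sequentially"
    by real_asymp
  then have "\<forall>\<^sub>F n in sequentially. (1/2 - \<rho>) / 2 < (1 - sqrt ((real n + 1) / (real n + 2)) * (1 + \<rho> / (real n + 1))) * (real n + 1)"
    using assms by (intro order_tendstoD(1)) auto
  then show ?thesis
  proof eventually_elim
    case (elim n)
    then have "((1/2 - \<rho>) / 2) / (real n + 1) < 1 - sqrt ((real n + 1) / (real n + 2)) * (1 + \<rho> / (real n + 1))"
      by (subst pos_divide_less_eq) auto
    then show ?case by linarith
  qed
qed

lemma sqrt_growth_tendsto_0:
  fixes a e :: "nat \<Rightarrow> real"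
  assumes rho: "\<rho> < 1 / 2" and a: "\<And>n. 0 \<le> a n" and e: "e \<longlonglongrightarrow> 0" "\<And>n. 0 \<le> e n"
    and step: "\<And>n. n \<ge> start \<Longrightarrow> a (Suc n) \<le> (1 + \<rho> / (real n + 1)) * a n + e n * sqrt (real n + 1) / (real n + 1)"
  shows "(\<lambda>n. a n / sqrt (real n + 1)) \<longlonglongrightarrow> 0"
proof -
  obtain N where N: "\<And>n. n \<ge> N \<Longrightarrow> sqrt ((real n + 1) / (real n + 2)) * (1 + \<rho> / (real n + 1)) \<le> 1 - ((1/2 - \<rho>) / 2) / (real n + 1)"
    using sqrt_ratio_contracts[OF rho] by (auto simp: eventually_sequentially)
  show ?thesis
  proof (rule contraction_tendsto_0[where c="(1/2 - \<rho>) / 2" and start="max N start", OF _ _ e(1)])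
    show "0 < (1/2 - \<rho>) / 2" using rho by simp
    show "0 \<le> a n / sqrt (real n + 1)" for n using a by simp
    fix n assume n: "max N start \<le> n"
    have sp: "sqrt (real n + 1) > 0" "sqrt (real n + 2) > 0" by simp_all
    have "a (Suc n) / sqrt (real (Suc n) + 1) \<le> ((1 + \<rho> / (real n + 1)) * a n + e n * sqrt (real n + 1) / (real n + 1)) / sqrt (real n + 2)"
      using step[of n] n by (simp add: add.commute divide_right_mono)
    also have "\<dots> = (sqrt ((real n + 1) / (real n + 2)) * (1 + \<rho> / (real n + 1))) * (a n / sqrt (real n + 1))
       + (e n / (real n + 1)) * sqrt ((real n + 1) / (real n + 2))"
    proof -
      have "(p * q + e n * s / k) / s' = (s / s' * p) * (q / s) + (e n / k) * (s / s')" if "s \<noteq> 0" for p q s s' k :: real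
        using that by (simp add: add_divide_distrib)
      then show ?thesis unfolding real_sqrt_divide using sp by simp
    qed
    also have "\<dots> \<le> (1 - ((1/2 - \<rho>) / 2) / (real n + 1)) * (a n / sqrt (real n + 1)) + (e n / (real n + 1)) * 1"
      using n N[of n] a e(2) by (intro add_mono mult_right_mono mult_left_mono) auto
    finally show "a (Suc n) / sqrt (real (Suc n) + 1) \<le> (1 - ((1/2 - \<rho>) / 2) / (real n + 1)) * (a n / sqrt (real n + 1)) + e n / (real n + 1)"
      by simp
  qed
qed

section \<open>Norms of inner forms and Euler steps\<close>

lemma inner_form_Cauchy_Schwarz:
  assumes "inner_form b"
  shows "\<bar>b x y\<bar> \<le> sqrt (b x x) * sqrt (b y y)"
proof (cases "b y y = 0")
  case True
  then have "y = 0" using inner_form_ge[OF assms, of y] by simp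
  then show ?thesis by (simp add: inner_form_simps[OF assms])
next
  case False
  then have y: "b y y > 0" using inner_form_nonneg[OF assms, of y] by simp
  define s where "s = b x y / b y y"
  have "0 \<le> b (x - s *\<^sub>R y) (x - s *\<^sub>R y)" by (rule inner_form_nonneg[OF assms])
  also have "\<dots> = b x x - 2 * s * b x y + s * s * b y y"
    using inner_form_commute[OF assms, of y x] by (simp add: inner_form_simps[OF assms] algebra_simps)
  also have "\<dots> = b x x - (b x y)\<^sup>2 / b y y" using y by (simp add: s_def power2_eq_square field_simps)
  finally have "(b x y)\<^sup>2 \<le> b x x * b y y" using y by (simp add: field_simps)
  then have "sqrt ((b x y)\<^sup>2) \<le> sqrt (b x x * b y y)" by (rule real_sqrt_le_mono)
  then show ?thesis by (simp add: real_sqrt_mult)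
qed

definition form_norm :: "('v::euclidean_space \<Rightarrow> 'v \<Rightarrow> real) \<Rightarrow> 'v \<Rightarrow> real" where
  "form_norm b x = sqrt (b x x)"

lemma form_norm_nonneg: "inner_form b \<Longrightarrow> 0 \<le> form_norm b x"
  using inner_form_nonneg[of b x] by (simp add: form_norm_def)

lemma form_norm_square: "inner_form b \<Longrightarrow> (form_norm b x)\<^sup>2 = b x x"
  using inner_form_nonneg[of b x] by (simp add: form_norm_def)

lemma norm_le_form_norm: "inner_form b \<Longrightarrow> norm x \<le> form_norm b x"
  unfolding form_norm_def using inner_form_ge[of b x] by (simp add: real_le_rsqrt)

lemma form_norm_scaleR: "inner_form b \<Longrightarrow> form_norm b (c *\<^sub>R x) = \<bar>c\<bar> * form_norm b x"
  by (simp add: form_norm_def inner_form_simps real_sqrt_mult flip: mult.assoc)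

lemma form_norm_triangle:
  assumes "inner_form b"
  shows "form_norm b (x + y) \<le> form_norm b x + form_norm b y"
proof (rule power2_le_imp_le)
  have "b (x + y) (x + y) = b x x + 2 * b x y + b y y"
    using inner_form_commute[OF assms, of y x] by (simp add: inner_form_simps[OF assms])
  also have "\<dots> \<le> (form_norm b x)\<^sup>2 + 2 * (form_norm b x * form_norm b y) + (form_norm b y)\<^sup>2"
    using inner_form_Cauchy_Schwarz[OF assms, of x y]
    unfolding form_norm_square[OF assms] by (simp add: form_norm_def)
  finally show "(form_norm b (x + y))\<^sup>2 \<le> (form_norm b x + form_norm b y)\<^sup>2"
    by (simp add: power2_sum form_norm_square[OF assms] mult.assoc)
qed (simp add: assms form_norm_nonneg)

lemma form_norm_le:
  assumes "inner_form b"
  obtains C where "C > 0" "\<And>x. form_norm b x \<le> C * norm x"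
proof -
  obtain C where C: "C > 0" "\<And>x y. \<bar>b x y\<bar> \<le> C * norm x * norm y" using inner_form_bounds[OF assms] by blast
  have "form_norm b x \<le> sqrt C * norm x" for x
  proof -
    have "b x x \<le> C * (norm x)\<^sup>2" using C(2)[of x x] by (simp add: power2_eq_square)
    then show ?thesis unfolding form_norm_def by (metis norm_ge_zero real_sqrt_le_mono real_sqrt_mult real_sqrt_unique)
  qed
  with C(1) show ?thesis by (intro that[of "sqrt C"]) auto
qed

text \<open>The norm estimate follows from the squared one without expanding a square root:
  \<open>(1 + h \<kappa> + C h^2)^2\<close> dominates
  \<open>1 + 2 h \<kappa> + C h^2\<close>.\<close>

lemma form_norm_Euler_step:
  assumes b: "inner_form b" and lin: "linear L" and stable: "\<And>x. b (L x) x \<le> \<kappa> * b x x"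
  obtains C where "0 \<le> C" "\<And>h x. 0 \<le> h \<Longrightarrow> b (x + h *\<^sub>R L x) (x + h *\<^sub>R L x) \<le> (1 + 2 * h * \<kappa> + C * h\<^sup>2) * b x x"
    "\<And>h x. 0 \<le> h \<Longrightarrow> 0 \<le> \<kappa> \<Longrightarrow> form_norm b (x + h *\<^sub>R L x) \<le> (1 + h * \<kappa> + C * h\<^sup>2) * form_norm b x"
    "\<And>x. form_norm b (L x) \<le> C * form_norm b x"
proof -
  obtain C1 where C1: "C1 > 0" "\<And>x. form_norm b x \<le> C1 * norm x" using form_norm_le[OF b] by blast
  obtain C2 where C2: "C2 > 0" "\<And>x. norm (L x) \<le> C2 * norm x" using linear_bounded_pos[OF lin] by blast
  define C3 where "C3 = C1 * C2"
  have L: "form_norm b (L x) \<le> C3 * form_norm b x" for x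
  proof -
    have "form_norm b (L x) \<le> C1 * (C2 * norm x)" using C1 C2(2)[of x] by (meson mult_left_mono less_imp_le order_trans)
    also have "\<dots> \<le> C1 * (C2 * form_norm b x)" using norm_le_form_norm[OF b] C1 C2 by (intro mult_left_mono) auto
    finally show ?thesis by (simp add: C3_def)
  qed
  \<comment> \<open>One constant for all claims: the squared estimate uses \<open>C3^2\<close>, the
    bound on \<open>L\<close> itself uses \<open>C3\<close>.\<close>
  define C where "C = C3 + C3\<^sup>2"
  have C3: "0 < C3" using C1 C2 by (simp add: C3_def)
  have LL: "b (L x) (L x) \<le> C * b x x" for x
  proof -
    have "(form_norm b (L x))\<^sup>2 \<le> (C3 * form_norm b x)\<^sup>2" using L form_norm_nonneg[OF b] by (intro power_mono) auto
    then have "b (L x) (L x) \<le> C3\<^sup>2 * b x x" unfolding power_mult_distrib form_norm_square[OF b] .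
    also have "\<dots> \<le> C * b x x" using C3 inner_form_nonneg[OF b] by (intro mult_right_mono) (auto simp: C_def)
    finally show ?thesis .
  qed
  have sq: "b (x + h *\<^sub>R L x) (x + h *\<^sub>R L x) \<le> (1 + 2 * h * \<kappa> + C * h\<^sup>2) * b x x" if h: "0 \<le> h" for h x
  proof -
    have "b (x + h *\<^sub>R L x) (x + h *\<^sub>R L x) = b x x + 2 * h * b (L x) x + h\<^sup>2 * b (L x) (L x)"
      using inner_form_commute[OF b, of x "L x"] by (simp add: inner_form_simps[OF b] power2_eq_square algebra_simps)
    also have "\<dots> \<le> b x x + 2 * h * (\<kappa> * b x x) + h\<^sup>2 * (C * b x x)"
      using h by (intro add_mono mult_left_mono stable LL) auto
    finally show ?thesis by (simp add: algebra_simps)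
  qed
  show ?thesis
  proof (rule that[of C])
    show "0 \<le> C" using C3 by (simp add: C_def)
    show "b (x + h *\<^sub>R L x) (x + h *\<^sub>R L x) \<le> (1 + 2 * h * \<kappa> + C * h\<^sup>2) * b x x" if "0 \<le> h" for h x
      using that by (rule sq)
    show "form_norm b (x + h *\<^sub>R L x) \<le> (1 + h * \<kappa> + C * h\<^sup>2) * form_norm b x" if h: "0 \<le> h" "0 \<le> \<kappa>" for h x
    proof (rule power2_le_imp_le)
      have "1 + 2 * h * \<kappa> + C * h\<^sup>2 \<le> (1 + h * \<kappa> + C * h\<^sup>2)\<^sup>2"
      proof -
        have "0 \<le> C" using C3 by (simp add: C_def)
        then have "0 \<le> C * h\<^sup>2" "0 \<le> (h * \<kappa> + C * h\<^sup>2)\<^sup>2" by simp_all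
        moreover have "(1 + h * \<kappa> + C * h\<^sup>2)\<^sup>2 = 1 + 2 * h * \<kappa> + 2 * (C * h\<^sup>2) + (h * \<kappa> + C * h\<^sup>2)\<^sup>2"
          by (simp add: power2_eq_square algebra_simps)
        ultimately show ?thesis by linarith
      qed
      then have "(1 + 2 * h * \<kappa> + C * h\<^sup>2) * b x x \<le> (1 + h * \<kappa> + C * h\<^sup>2)\<^sup>2 * b x x"
        using inner_form_nonneg[OF b] by (rule mult_right_mono)
      then show "(form_norm b (x + h *\<^sub>R L x))\<^sup>2 \<le> ((1 + h * \<kappa> + C * h\<^sup>2) * form_norm b x)\<^sup>2"
        unfolding power_mult_distrib form_norm_square[OF b] using sq[OF h(1), of x] by linarith
      show "0 \<le> (1 + h * \<kappa> + C * h\<^sup>2) * form_norm b x"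
        using h C3 form_norm_nonneg[OF b] by (auto simp: C_def intro!: mult_nonneg_nonneg add_nonneg_nonneg)
    qed
    show "form_norm b (L x) \<le> C * form_norm b x" for x
      using L[of x] mult_right_mono[of C3 C "form_norm b x"] form_norm_nonneg[OF b, of x] by (simp add: C_def)
  qed
qed

section \<open>The linearised recursion\<close>

lemma expectation_mult_le_sqrt:
  fixes f g :: "'w \<Rightarrow> real"
  assumes [measurable]: "f \<in> borel_measurable M" "g \<in> borel_measurable M"
    and f: "integrable M (\<lambda>\<omega>. (f \<omega>)\<^sup>2)" and g: "integrable M (\<lambda>\<omega>. (g \<omega>)\<^sup>2)"
  shows "(\<integral>\<omega>. f \<omega> * g \<omega> \<partial>M) \<le> sqrt (\<integral>\<omega>. (f \<omega>)\<^sup>2 \<partial>M) * sqrt (\<integral>\<omega>. (g \<omega>)\<^sup>2 \<partial>M)"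
proof -
  let ?A = "\<integral>\<omega>. (f \<omega>)\<^sup>2 \<partial>M" and ?B = "\<integral>\<omega>. (g \<omega>)\<^sup>2 \<partial>M" and ?C = "\<integral>\<omega>. f \<omega> * g \<omega> \<partial>M"
  have fg: "integrable M (\<lambda>\<omega>. f \<omega> * g \<omega>)" by (rule integrable_mult_L2[OF assms])
  have quad: "0 \<le> ?A - 2 * s * ?C + s\<^sup>2 * ?B" for s
  proof -
    have "0 \<le> (\<integral>\<omega>. (f \<omega> - s * g \<omega>)\<^sup>2 \<partial>M)" by (intro integral_nonneg_AE) auto
    also have "\<dots> = (\<integral>\<omega>. (f \<omega>)\<^sup>2 - 2 * s * (f \<omega> * g \<omega>) + s\<^sup>2 * (g \<omega>)\<^sup>2 \<partial>M)"
      by (intro Bochner_Integration.integral_cong) (auto simp: power2_eq_square algebra_simps)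
    also have "\<dots> = ?A - 2 * s * ?C + s\<^sup>2 * ?B" using f g fg by simp
    finally show ?thesis .
  qed
  have A: "0 \<le> ?A" and B: "0 \<le> ?B" by (intro integral_nonneg_AE; simp)+
  have "?C\<^sup>2 \<le> ?A * ?B"
  proof (cases "?B = 0")
    case True
    have "?C = 0"
    proof (rule ccontr)
      assume C: "?C \<noteq> 0"
      have "2 * ((?A + 1) / (2 * ?C)) * ?C = ?A + 1" using C by simp
      then show False using quad[of "(?A + 1) / (2 * ?C)"] True by simp
    qed
    then show ?thesis using A B by simp
  next
    case False
    then have "?B > 0" using B by (metis order_le_less)
    then show ?thesis using quad[of "?C / ?B"] by (simp add: power2_eq_square field_simps)
  qed
  then have "sqrt (?C\<^sup>2) \<le> sqrt (?A * ?B)" by (rule real_sqrt_le_mono)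
  then show ?thesis by (simp add: real_sqrt_mult)
qed

lemma linear_vK: "linear (\<lambda>x. x v* (K :: real^'n^'n))"
  using matrix_vector_mul_linear[of "transpose K"] by simp

lemma vK_measurable:
  fixes K :: "real^'n^'n"
  assumes "f \<in> borel_measurable M"
  shows "(\<lambda>\<omega>. f \<omega> v* K) \<in> borel_measurable M"
  by (rule measurable_compose[OF assms])
     (intro borel_measurable_continuous_onI linear_continuous_on linear_conv_bounded_linear[THEN iffD1] linear_vK)

context algorithm
begin

section \<open>The martingale differences of the deviation\<close>

definition noise :: "nat \<Rightarrow> 'w \<Rightarrow> real^'t" where
  "noise n \<omega> = (visits n \<omega> - muN n \<omega> v* G) - (real (tau n \<omega>) - mean_tau n \<omega>) *\<^sub>R \<mu>"

lemma dev_Suc_noise: "dev (Suc n) \<omega> = dev n \<omega> + (1 / SN n \<omega>) *\<^sub>R (dev n \<omega> v* K) + noise n \<omega>"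
  unfolding dev_Suc dev_drift[symmetric] noise_def by (simp add: algebra_simps)

lemma norm_muN_G_le: "norm (muN n \<omega> v* G) \<le> mean_tau n \<omega>"
  using norm_le_l1_cart[of "muN n \<omega> v* G"] by (simp add: mean_tau_def muN_G_nonneg)

lemma norm_noise_le: "norm (noise n \<omega>) \<le> 2 * real (tau n \<omega>) + 2 * G_total"
proof -
  have mu1: "norm \<mu> \<le> 1" by (rule norm_prob_vector_le[OF mu_prob])
  have "noise n \<omega> = (visits n \<omega> - real (tau n \<omega>) *\<^sub>R \<mu>) - (muN n \<omega> v* G - mean_tau n \<omega> *\<^sub>R \<mu>)"
    by (simp add: noise_def algebra_simps)
  then have "norm (noise n \<omega>) \<le> norm (visits n \<omega> - real (tau n \<omega>) *\<^sub>R \<mu>) + norm (muN n \<omega> v* G - mean_tau n \<omega> *\<^sub>R \<mu>)"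
    by (simp only: norm_triangle_ineq4)
  also have "norm (muN n \<omega> v* G - mean_tau n \<omega> *\<^sub>R \<mu>) \<le> norm (muN n \<omega> v* G) + norm (mean_tau n \<omega> *\<^sub>R \<mu>)"
    by (rule norm_triangle_ineq4)
  also have "norm (mean_tau n \<omega> *\<^sub>R \<mu>) \<le> mean_tau n \<omega>" using mean_tau_bounds[of n \<omega>] mu1 by (simp add: mult_left_le)
  finally show ?thesis using norm_increment_le[of n \<omega>] norm_muN_G_le[of n \<omega>] mean_tau_bounds[of n \<omega>] by linarith
qed

lemma visits_measurable_Suc: "visits n \<in> borel_measurable (F (Suc n))"
  by (rule visits_measurable_F) simp

lemma muN_vG_measurable_F: "(\<lambda>\<omega>. muN n \<omega> v* G) \<in> borel_measurable (F n)"
  by (rule vK_measurable[OF muN_measurable_F])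

lemma noise_measurable_F: "noise n \<in> borel_measurable (F (Suc n))"
proof -
  note [measurable] = visits_measurable_Suc[of n] F_mono'[OF le_SucI[OF order_refl] muN_vG_measurable_F[of n]]
    F_mono'[OF le_SucI[OF order_refl] mean_tau_measurable_F[of n]] tau_real_measurable_F[OF lessI, of n]
  show ?thesis unfolding noise_def[abs_def] by measurable
qed

lemma noise_measurable [measurable]: "noise n \<in> borel_measurable M"
  by (rule measurable_from_subalg[OF F_subalgebra noise_measurable_F])

lemma noise_square_integrable: "integrable M (\<lambda>\<omega>. (norm (noise n \<omega>))\<^sup>2)"
  and noise_square_expectation: "(\<integral>\<omega>. (norm (noise n \<omega>))\<^sup>2 \<partial>M) \<le> 8 * moment + 8 * G_total\<^sup>2"
proof -
  have le: "(norm (noise n \<omega>))\<^sup>2 \<le> 8 * (real (tau n \<omega>))\<^sup>2 + 8 * G_total\<^sup>2" for \<omega>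
  proof -
    have "(norm (noise n \<omega>))\<^sup>2 \<le> (2 * real (tau n \<omega>) + 2 * G_total)\<^sup>2" by (intro power_mono norm_noise_le) simp
    moreover have "0 \<le> (2 * real (tau n \<omega>) - 2 * G_total)\<^sup>2" by simp
    ultimately show ?thesis by (simp add: power2_eq_square algebra_simps)
  qed
  have i: "integrable M (\<lambda>\<omega>. 8 * (real (tau n \<omega>))\<^sup>2 + 8 * G_total\<^sup>2)" using tau_moments(2) by simp
  show int: "integrable M (\<lambda>\<omega>. (norm (noise n \<omega>))\<^sup>2)"
    by (rule Bochner_Integration.integrable_bound[OF i]) (use le in \<open>auto intro: order_trans[OF _ abs_ge_self]\<close>)
  have "(\<integral>\<omega>. (norm (noise n \<omega>))\<^sup>2 \<partial>M) \<le> (\<integral>\<omega>. 8 * (real (tau n \<omega>))\<^sup>2 + 8 * G_total\<^sup>2 \<partial>M)"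
    by (intro integral_mono int i le)
  also have "\<dots> \<le> 8 * moment + 8 * G_total\<^sup>2" using tau_moments(2,3)[of n] by (simp add: prob_space)
  finally show "(\<integral>\<omega>. (norm (noise n \<omega>))\<^sup>2 \<partial>M) \<le> 8 * moment + 8 * G_total\<^sup>2" .
qed

text \<open>Since \<open>tau\<close> is the total of the counts, the recentring by
  \<open>\<mu>\<close> can be moved to the coefficients; what remains is a linear combination of
  counts minus their conditional means.\<close>

lemma inner_noise:
  "(\<Sum>x\<in>UNIV. c x * noise n \<omega> $ x) = (\<Sum>x\<in>UNIV. (c x - (\<Sum>y\<in>UNIV. c y * \<mu> $ y)) * visits n \<omega> $ x)
     - (\<Sum>x\<in>UNIV. (c x - (\<Sum>y\<in>UNIV. c y * \<mu> $ y)) * (muN n \<omega> v* G) $ x)"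
proof -
  let ?m = "\<Sum>y\<in>UNIV. c y * \<mu> $ y"
  have *: "(\<Sum>x\<in>UNIV. c x * noise n \<omega> $ x) = (\<Sum>x\<in>UNIV. c x * visits n \<omega> $ x) - (\<Sum>x\<in>UNIV. c x * (muN n \<omega> v* G) $ x)
      - (real (tau n \<omega>) - mean_tau n \<omega>) * ?m"
    by (simp add: noise_def right_diff_distrib sum_subtractf sum_distrib_left mult_ac)
  have **: "(\<Sum>x\<in>UNIV. (c x - m) * w $ x) = (\<Sum>x\<in>UNIV. c x * w $ x) - m * (\<Sum>x\<in>UNIV. w $ x)" for w :: "real^'t" and m
    by (simp add: left_diff_distrib sum_subtractf sum_distrib_left)
  show ?thesis unfolding * ** visits_sum mean_tau_def by (simp add: algebra_simps)
qed

lemma integrable_square_sum: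
  fixes f g :: "'w \<Rightarrow> real"
  assumes [measurable]: "f \<in> borel_measurable M" "g \<in> borel_measurable M"
    and f: "integrable M (\<lambda>\<omega>. (f \<omega>)\<^sup>2)" and g: "integrable M (\<lambda>\<omega>. (g \<omega>)\<^sup>2)"
  shows "integrable M (\<lambda>\<omega>. (f \<omega> + g \<omega>)\<^sup>2)"
proof -
  have "integrable M (\<lambda>\<omega>. (f \<omega>)\<^sup>2 + 2 * (f \<omega> * g \<omega>) + (g \<omega>)\<^sup>2)"
    using f g integrable_mult_L2[OF assms] by simp
  then show ?thesis by (simp add: power2_eq_square algebra_simps)
qed

lemma noise_orthogonal:
  assumes m: "\<And>x. c x \<in> borel_measurable (F n)" and i: "\<And>x. integrable M (\<lambda>\<omega>. (c x \<omega>)\<^sup>2)"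
  shows "integrable M (\<lambda>\<omega>. \<Sum>x\<in>UNIV. c x \<omega> * noise n \<omega> $ x)" "(\<integral>\<omega>. (\<Sum>x\<in>UNIV. c x \<omega> * noise n \<omega> $ x) \<partial>M) = 0"
proof -
  have mM[measurable]: "c x \<in> borel_measurable M" for x by (rule measurable_from_subalg[OF F_subalgebra m])
  let ?c = "\<lambda>x \<omega>. c x \<omega> - (\<Sum>y\<in>UNIV. c y \<omega> * \<mu> $ y)"
  have m': "?c x \<in> borel_measurable (F n)" for x
    by (intro borel_measurable_diff borel_measurable_sum borel_measurable_times borel_measurable_const m)
  have sumi: "integrable M (\<lambda>\<omega>. (\<Sum>y\<in>I. c y \<omega> * - \<mu> $ y)\<^sup>2)" for I
  proof (induction I rule: infinite_finite_induct)
    case (insert y I)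
    have "integrable M (\<lambda>\<omega>. (c y \<omega> * - \<mu> $ y + (\<Sum>y\<in>I. c y \<omega> * - \<mu> $ y))\<^sup>2)"
      by (rule integrable_square_sum) (use i insert.IH in \<open>auto simp: power_mult_distrib\<close>)
    then show ?case using insert by simp
  qed auto
  have i': "integrable M (\<lambda>\<omega>. (?c x \<omega>)\<^sup>2)" for x
    using integrable_square_sum[OF _ _ i sumi, of x UNIV] by (simp add: sum_negf)
  note l = expectation_linear_visits[of ?c, OF m' i']
  show "integrable M (\<lambda>\<omega>. \<Sum>x\<in>UNIV. c x \<omega> * noise n \<omega> $ x)" "(\<integral>\<omega>. (\<Sum>x\<in>UNIV. c x \<omega> * noise n \<omega> $ x) \<partial>M) = 0"
    unfolding inner_noise using l by simp_all
qed

text \<open>The linearisation of \<open>dev\<close>: the random rate \<open>1 / S\<^sub>n\<close> is replaced by its limit \<open>1 / (\<gamma>(n + 1))\<close>.\<close>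

primrec xt :: "nat \<Rightarrow> 'w \<Rightarrow> real^'t" where
  "xt 0 \<omega> = 0"
| "xt (Suc n) \<omega> = xt n \<omega> + (1 / (\<gamma> * (real n + 1))) *\<^sub>R (xt n \<omega> v* K) + noise n \<omega>"

lemma xt_measurable_F: "xt n \<in> borel_measurable (F n)"
proof (induction n)
  case 0
  have "xt 0 = (\<lambda>_. 0)" by auto
  then show ?case by simp
next
  case (Suc n)
  note [measurable] = F_mono'[OF le_SucI[OF order_refl] Suc] vK_measurable[OF F_mono'[OF le_SucI[OF order_refl] Suc], of K]
    noise_measurable_F[of n]
  have "xt (Suc n) = (\<lambda>\<omega>. xt n \<omega> + (1 / (\<gamma> * (real n + 1))) *\<^sub>R (xt n \<omega> v* K) + noise n \<omega>)" by auto
  then show ?case by simp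
qed

lemma xt_measurable [measurable]: "xt n \<in> borel_measurable M"
  by (rule measurable_from_subalg[OF F_subalgebra xt_measurable_F])

lemma inverse_T_limit: "AE \<omega> in M. (\<lambda>n. 1 / TN n \<omega>) \<longlonglongrightarrow> 1 / \<gamma>"
  using AE_T_limit[OF AE_muN_limit] gamma_ge_1 by (auto elim!: eventually_mono intro!: tendsto_divide)

lemma TN_measurable [measurable]: "TN n \<in> borel_measurable M"
proof -
  have "TN n = (\<lambda>\<omega>. SN n \<omega> / (real n + 1))" using iterate_eq(2) by auto
  then show ?thesis by simp
qed

text \<open>The minimum is inactive almost surely, where \<open>T \<ge> 1\<close> and
  \<open>\<gamma> \<ge> 1\<close>. It bounds the error at every point, which gives square
  integrability and dominated convergence at once.\<close>

definition rate_err :: "nat \<Rightarrow> 'w \<Rightarrow> real" where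
  "rate_err n \<omega> = min 1 \<bar>1 / TN n \<omega> - 1 / \<gamma>\<bar>"

lemma rate_err_bounds: "0 \<le> rate_err n \<omega>" "rate_err n \<omega> \<le> 1"
  by (auto simp: rate_err_def)

lemma rate_err_measurable [measurable]: "rate_err n \<in> borel_measurable M"
  unfolding rate_err_def[abs_def] by measurable

lemma rate_err_eq:
  assumes "\<forall>n. 1 \<le> tau n \<omega>"
  shows "rate_err n \<omega> = \<bar>1 / TN n \<omega> - 1 / \<gamma>\<bar>"
proof -
  have "1 \<le> TN n \<omega>" using SN_ge_Suc[OF assms, of n] by (simp add: iterate_eq(2))
  then have "0 \<le> 1 / TN n \<omega>" "1 / TN n \<omega> \<le> 1" by simp_all
  moreover have "0 \<le> 1 / \<gamma>" "1 / \<gamma> \<le> 1" using gamma_ge_1 by simp_all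
  ultimately have "\<bar>1 / TN n \<omega> - 1 / \<gamma>\<bar> \<le> 1" by linarith
  then show ?thesis by (simp add: rate_err_def)
qed

lemma rate_err_square_tendsto_0: "(\<lambda>n. \<integral>\<omega>. (rate_err n \<omega>)\<^sup>2 \<partial>M) \<longlonglongrightarrow> 0"
proof -
  have "(\<lambda>n. \<integral>\<omega>. (rate_err n \<omega>)\<^sup>2 \<partial>M) \<longlonglongrightarrow> (\<integral>\<omega>. 0 \<partial>M)"
  proof (rule integral_dominated_convergence[where w="\<lambda>_. 1"])
    show "AE \<omega> in M. (\<lambda>n. (rate_err n \<omega>)\<^sup>2) \<longlonglongrightarrow> 0"
      using inverse_T_limit
    proof eventually_elim
      case (elim \<omega>)
      have "(\<lambda>n. \<bar>1 / TN n \<omega> - 1 / \<gamma>\<bar>) \<longlonglongrightarrow> 0" using elim LIM_zero tendsto_rabs_zero by blast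
      then have "(\<lambda>n. (min 1 \<bar>1 / TN n \<omega> - 1 / \<gamma>\<bar>)\<^sup>2) \<longlonglongrightarrow> (min 1 0)\<^sup>2" by (intro tendsto_intros)
      then show ?case by (simp add: rate_err_def)
    qed
    show "AE \<omega> in M. norm ((rate_err n \<omega>)\<^sup>2) \<le> 1" for n
      using rate_err_bounds by (simp add: power_le_one)
  qed auto
  then show ?thesis by simp
qed

end

section \<open>Consequences of the spectral gap condition\<close>

locale algorithm_gap = algorithm Q \<mu> u lam M P \<mu>0 T0 X
  for Q :: "real^'t::finite^'t" and \<mu> u lam and M :: "'w measure"
    and P :: "real^('t + 'a::finite)^('t + 'a)" and \<mu>0 T0 X +
  fixes b b' :: "real^'t \<Rightarrow> real^'t \<Rightarrow> real" and \<kappa> :: real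
  assumes b: "inner_form b" and b': "inner_form b'" and kap: "\<kappa> < \<gamma> / 2" "0 \<le> \<kappa>"
    and bK: "b (x v* K) x \<le> \<kappa> * b x x" and b'K: "b' (K *v x) x \<le> \<kappa> * b' x x"
begin

lemma kap_gamma: "0 \<le> \<kappa> / \<gamma>" "\<kappa> / \<gamma> < 1 / 2"
  using kap gamma_ge_1 by (auto simp: pos_divide_less_eq)

text \<open>Orthogonality of the noise lets second moments \<open>v\<close> obey
  \<open>v (n + 1) \<le> (1 + 2 h \<kappa> + C h^2) v n + N2\<close> with
  \<open>h = 1 / (\<gamma> (n + 1))\<close>. As \<open>2 \<kappa> / \<gamma> < 1\<close>, the linear
  growth of the accumulated noise dominates.\<close>

lemma xt_second_moment:
  obtains D where "0 \<le> D" "\<And>n. integrable M (\<lambda>\<omega>. b (xt n \<omega>) (xt n \<omega>))"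
    "\<And>n. (\<integral>\<omega>. b (xt n \<omega>) (xt n \<omega>) \<partial>M) \<le> D * (real n + 1)"
proof -
  obtain C where C: "0 \<le> C" and E: "\<And>h x. 0 \<le> h \<Longrightarrow> b (x + h *\<^sub>R (x v* K)) (x + h *\<^sub>R (x v* K)) \<le> (1 + 2 * h * \<kappa> + C * h\<^sup>2) * b x x"
    using form_norm_Euler_step[OF b linear_vK bK] by metis
  obtain C1 where C1: "C1 > 0" "\<And>x y. \<bar>b x y\<bar> \<le> C1 * norm x * norm y" using inner_form_bounds[OF b] by blast
  define N2 where "N2 = C1 * (8 * moment + 8 * G_total\<^sup>2)"
  define h where "h n = 1 / (\<gamma> * (real n + 1))" for n
  have h: "0 \<le> h n" for n using gamma_ge_1 by (simp add: h_def)
  have bm: "(\<lambda>\<omega>. b (f \<omega>) (g \<omega>)) \<in> borel_measurable M" if "f \<in> borel_measurable M" "g \<in> borel_measurable M" for f g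
    using inner_form_measurable[OF b that] .
  have step: "integrable M (\<lambda>\<omega>. b (xt (Suc n) \<omega>) (xt (Suc n) \<omega>)) \<and>
      (\<integral>\<omega>. b (xt (Suc n) \<omega>) (xt (Suc n) \<omega>) \<partial>M) \<le> (1 + 2 * h n * \<kappa> + C * (h n)\<^sup>2) * (\<integral>\<omega>. b (xt n \<omega>) (xt n \<omega>) \<partial>M) + N2"
    if int: "integrable M (\<lambda>\<omega>. b (xt n \<omega>) (xt n \<omega>))" for n
  proof -
    define A where "A \<omega> = xt n \<omega> + h n *\<^sub>R (xt n \<omega> v* K)" for \<omega>
    have Am: "A \<in> borel_measurable (F n)"
    proof -
      note [measurable] = xt_measurable_F[of n] vK_measurable[OF xt_measurable_F[of n], of K]
      show ?thesis unfolding A_def[abs_def] by measurable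
    qed
    have AM[measurable]: "A \<in> borel_measurable M" by (rule measurable_from_subalg[OF F_subalgebra Am])
    have bA: "b (A \<omega>) (A \<omega>) \<le> (1 + 2 * h n * \<kappa> + C * (h n)\<^sup>2) * b (xt n \<omega>) (xt n \<omega>)" for \<omega>
      unfolding A_def by (rule E[OF h])
    have intA: "integrable M (\<lambda>\<omega>. b (A \<omega>) (A \<omega>))"
    proof (rule Bochner_Integration.integrable_bound[OF integrable_mult_right[OF int, of "1 + 2 * h n * \<kappa> + C * (h n)\<^sup>2"]])
      show "AE \<omega> in M. norm (b (A \<omega>) (A \<omega>)) \<le> norm ((1 + 2 * h n * \<kappa> + C * (h n)\<^sup>2) * b (xt n \<omega>) (xt n \<omega>))"
        using bA inner_form_nonneg[OF b] by (auto intro!: AE_I2 order_trans[OF _ abs_ge_self])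
    qed (intro bm AM)
    have intN: "integrable M (\<lambda>\<omega>. b (noise n \<omega>) (noise n \<omega>))"
    proof (rule Bochner_Integration.integrable_bound[OF integrable_mult_right[OF noise_square_integrable, of C1]])
      show "AE \<omega> in M. norm (b (noise n \<omega>) (noise n \<omega>)) \<le> norm (C1 * (norm (noise n \<omega>))\<^sup>2)"
        using C1 by (auto simp: power2_eq_square mult.assoc)
    qed (intro bm noise_measurable)
    have "(\<integral>\<omega>. b (noise n \<omega>) (noise n \<omega>) \<partial>M) \<le> (\<integral>\<omega>. C1 * (norm (noise n \<omega>))\<^sup>2 \<partial>M)"
    proof (intro integral_mono intN integrable_mult_right noise_square_integrable)
      show "b (noise n \<omega>) (noise n \<omega>) \<le> C1 * (norm (noise n \<omega>))\<^sup>2" for \<omega>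
        using C1(2)[of "noise n \<omega>" "noise n \<omega>"] by (simp add: power2_eq_square mult.assoc)
    qed
    also have "\<dots> \<le> N2" using noise_square_expectation[of n] C1(1) by (simp add: N2_def)
    finally have EN: "(\<integral>\<omega>. b (noise n \<omega>) (noise n \<omega>) \<partial>M) \<le> N2" .
    let ?c = "\<lambda>x \<omega>. b (A \<omega>) (axis x 1)"
    have cm: "?c x \<in> borel_measurable (F n)" for x by (intro inner_form_measurable[OF b] Am borel_measurable_const)
    have ci: "integrable M (\<lambda>\<omega>. (?c x \<omega>)\<^sup>2)" for x
    proof (rule Bochner_Integration.integrable_bound[OF integrable_mult_right[OF intA, of "C1\<^sup>2"]])
      have "(?c x \<omega>)\<^sup>2 \<le> C1\<^sup>2 * b (A \<omega>) (A \<omega>)" for \<omega>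
      proof -
        have "\<bar>?c x \<omega>\<bar> \<le> C1 * norm (A \<omega>)" using C1(2)[of "A \<omega>" "axis x 1"] by (simp add: norm_axis_1)
        then have "(?c x \<omega>)\<^sup>2 \<le> (C1 * norm (A \<omega>))\<^sup>2" by (metis abs_ge_zero power2_abs power_mono)
        also have "\<dots> \<le> C1\<^sup>2 * b (A \<omega>) (A \<omega>)" using inner_form_ge[OF b] by (simp add: power_mult_distrib mult_left_mono)
        finally show ?thesis .
      qed
      then show "AE \<omega> in M. norm ((?c x \<omega>)\<^sup>2) \<le> norm (C1\<^sup>2 * b (A \<omega>) (A \<omega>))"
        by (auto intro!: AE_I2 order_trans[OF _ abs_ge_self])
      show "(\<lambda>\<omega>. (?c x \<omega>)\<^sup>2) \<in> borel_measurable M" by (intro borel_measurable_power bm AM borel_measurable_const)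
    qed
    have bsum: "b (A \<omega>) w = (\<Sum>x\<in>UNIV. ?c x \<omega> * w $ x)" for \<omega> w
    proof -
      have lin: "linear (b (A \<omega>))" using b by (simp add: inner_form_def bilinear_def)
      have "b (A \<omega>) w = b (A \<omega>) (\<Sum>x\<in>UNIV. w $ x *\<^sub>R axis x 1)"
        using basis_expansion[of w] by (simp add: scalar_mult_eq_scaleR)
      then show ?thesis by (simp add: linear_sum[OF lin] linear_scale[OF lin] mult.commute)
    qed
    note orth = noise_orthogonal[of ?c, OF cm ci, folded bsum]
    have eq: "b (xt (Suc n) \<omega>) (xt (Suc n) \<omega>) = b (A \<omega>) (A \<omega>) + 2 * b (A \<omega>) (noise n \<omega>) + b (noise n \<omega>) (noise n \<omega>)" for \<omega>
    proof -
      have "xt (Suc n) \<omega> = A \<omega> + noise n \<omega>" by (simp add: A_def h_def)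
      then show ?thesis using inner_form_commute[OF b, of "noise n \<omega>" "A \<omega>"] by (simp only: inner_form_simps[OF b])
    qed
    have "(\<integral>\<omega>. b (xt (Suc n) \<omega>) (xt (Suc n) \<omega>) \<partial>M) = (\<integral>\<omega>. b (A \<omega>) (A \<omega>) \<partial>M) + (\<integral>\<omega>. b (noise n \<omega>) (noise n \<omega>) \<partial>M)"
      unfolding eq using intA intN orth by simp
    also have "(\<integral>\<omega>. b (A \<omega>) (A \<omega>) \<partial>M) \<le> (\<integral>\<omega>. (1 + 2 * h n * \<kappa> + C * (h n)\<^sup>2) * b (xt n \<omega>) (xt n \<omega>) \<partial>M)"
      by (intro integral_mono intA integrable_mult_right int bA)
    finally have "(\<integral>\<omega>. b (xt (Suc n) \<omega>) (xt (Suc n) \<omega>) \<partial>M) \<le> (1 + 2 * h n * \<kappa> + C * (h n)\<^sup>2) * (\<integral>\<omega>. b (xt n \<omega>) (xt n \<omega>) \<partial>M) + N2"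
      using EN by simp
    moreover have "integrable M (\<lambda>\<omega>. b (xt (Suc n) \<omega>) (xt (Suc n) \<omega>))" unfolding eq using intA intN orth by simp
    ultimately show ?thesis by blast
  qed
  have int: "integrable M (\<lambda>\<omega>. b (xt n \<omega>) (xt n \<omega>))" for n
    by (induction n) (use step in \<open>auto simp: inner_form_simps[OF b]\<close>)
  \<comment> \<open>Halfway between \<open>2 \<kappa> / \<gamma>\<close> and 1; the margin absorbs
    the quadratic term of the Euler estimate from some index on.\<close>
  define \<rho> where "\<rho> = (2 * (\<kappa> / \<gamma>) + 1) / 2"
  have "(2 * k + 1) / 2 < 1 \<and> 0 \<le> (2 * k + 1) / 2 \<and> 2 * k < (2 * k + 1) / 2" if "0 \<le> k" "k < 1 / 2" for k :: real
    using that by auto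
  from this[OF kap_gamma] have rho: "\<rho> < 1" "0 \<le> \<rho>" "2 * (\<kappa> / \<gamma>) < \<rho>" by (simp_all only: \<rho>_def)
  have "(\<lambda>n. C / \<gamma>\<^sup>2 / (real n + 1)) \<longlonglongrightarrow> 0" by real_asymp
  then have "\<forall>\<^sub>F n in sequentially. C / \<gamma>\<^sup>2 / (real n + 1) < \<rho> - 2 * (\<kappa> / \<gamma>)" using rho by (intro order_tendstoD(2)) auto
  then obtain n1 where n1: "\<And>n. n \<ge> n1 \<Longrightarrow> C / \<gamma>\<^sup>2 / (real n + 1) < \<rho> - 2 * (\<kappa> / \<gamma>)" by (auto simp: eventually_sequentially)
  have vn: "0 \<le> (\<integral>\<omega>. b (xt n \<omega>) (xt n \<omega>) \<partial>M)" for n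
    by (intro integral_nonneg_AE) (simp add: inner_form_nonneg[OF b])
  have N2: "0 \<le> N2" using C1(1) tau_moments(5) by (simp add: N2_def)
  obtain D where "0 \<le> D" "\<And>n. (\<integral>\<omega>. b (xt n \<omega>) (xt n \<omega>) \<partial>M) \<le> D * (real n + 1)"
  proof (rule linear_growth_bound[OF rho(1,2) N2])
    fix n assume "n1 \<le> n"
    then have "(2 * (\<kappa> / \<gamma>) + C / \<gamma>\<^sup>2 / (real n + 1)) / (real n + 1) \<le> \<rho> / (real n + 1)"
      using n1[of n] by (intro divide_right_mono) auto
    moreover have "2 * h n * \<kappa> + C * (h n)\<^sup>2 = (2 * (\<kappa> / \<gamma>) + C / \<gamma>\<^sup>2 / (real n + 1)) / (real n + 1)"
      by (simp add: h_def power2_eq_square add_divide_distrib mult_ac)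
    ultimately have "1 + 2 * h n * \<kappa> + C * (h n)\<^sup>2 \<le> 1 + \<rho> / (real n + 1)" by simp
    from mult_right_mono[OF this vn[of n]]
    show "(\<integral>\<omega>. b (xt (Suc n) \<omega>) (xt (Suc n) \<omega>) \<partial>M) \<le> (1 + \<rho> / (real n + 1)) * (\<integral>\<omega>. b (xt n \<omega>) (xt n \<omega>) \<partial>M) + N2"
      using conjunct2[OF step[OF int[of n]]] by linarith
  qed blast
  with int show ?thesis by (intro that)
qed

end

context algorithm_gap
begin

text \<open>Up to a homogeneous solution, a majorant of the form norm of
  \<open>dev n - xt n\<close>, driven by the rate error. The true difference obeys such a recursion
  only from a random index on; the majorant obeys it from the start, so its expectation can be
  estimated.\<close>

primrec zeta :: "real \<Rightarrow> real \<Rightarrow> nat \<Rightarrow> 'w \<Rightarrow> real" where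
  "zeta \<rho> C 0 \<omega> = 0"
| "zeta \<rho> C (Suc n) \<omega> = (1 + \<rho> / (real n + 1)) * zeta \<rho> C n \<omega> + C / (real n + 1) * (rate_err n \<omega> * form_norm b (xt n \<omega>))"

lemma form_norm_xt_measurable [measurable]: "(\<lambda>\<omega>. form_norm b (xt n \<omega>)) \<in> borel_measurable M"
proof -
  have [measurable]: "(\<lambda>\<omega>. b (xt n \<omega>) (xt n \<omega>)) \<in> borel_measurable M"
    by (intro inner_form_measurable[OF b] xt_measurable)
  show ?thesis unfolding form_norm_def by measurable
qed

lemma zeta_measurable [measurable]: "zeta \<rho> C n \<in> borel_measurable M"
proof (induction n)
  case 0
  have "zeta \<rho> C 0 = (\<lambda>_. 0)" by auto
  then show ?case by simp
next
  case (Suc n)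
  note [measurable] = Suc
  have "zeta \<rho> C (Suc n) = (\<lambda>\<omega>. (1 + \<rho> / (real n + 1)) * zeta \<rho> C n \<omega> + C / (real n + 1) * (rate_err n \<omega> * form_norm b (xt n \<omega>)))"
    by auto
  then show ?case by simp
qed

lemma zeta_nonneg: "0 \<le> \<rho> \<Longrightarrow> 0 \<le> C \<Longrightarrow> 0 \<le> zeta \<rho> C n \<omega>"
  by (induction n) (auto intro!: add_nonneg_nonneg mult_nonneg_nonneg simp: rate_err_bounds form_norm_nonneg[OF b])

text \<open>The random growth rate \<open>\<kappa> / T\<close> falls below \<open>\<rho>\<close>
  only from an index depending on the path. The difference is therefore bounded by
  \<open>zeta\<close>, whose mean is \<open>o(sqrt n)\<close> by the Cauchy-Schwarz inequality, plus
  a random multiple of the homogeneous solution, which is \<open>o(sqrt n)\<close> on almost every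
  path; truncation by 1 opens the latter to dominated convergence.\<close>

lemma dev_xt_tendsto_0:
  "(\<lambda>n. \<integral>\<omega>. min 1 (norm (dev n \<omega> - xt n \<omega>) / sqrt (real n + 1)) \<partial>M) \<longlonglongrightarrow> 0"
proof -
  obtain C where C: "0 \<le> C"
    and E: "\<And>h x. 0 \<le> h \<Longrightarrow> 0 \<le> \<kappa> \<Longrightarrow> form_norm b (x + h *\<^sub>R (x v* K)) \<le> (1 + h * \<kappa> + C * h\<^sup>2) * form_norm b x"
    and EK: "\<And>x. form_norm b (x v* K) \<le> C * form_norm b x"
    using form_norm_Euler_step[OF b linear_vK bK] by metis
  obtain D where D: "0 \<le> D" "\<And>n. integrable M (\<lambda>\<omega>. b (xt n \<omega>) (xt n \<omega>))"
    "\<And>n. (\<integral>\<omega>. b (xt n \<omega>) (xt n \<omega>) \<partial>M) \<le> D * (real n + 1)" using xt_second_moment by blast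
  \<comment> \<open>Halfway between \<open>\<kappa> / \<gamma>\<close> and the critical value one
    half.\<close>
  define \<rho> where "\<rho> = (\<kappa> / \<gamma> + 1 / 2) / 2"
  have "(k + 1 / 2) / 2 < 1 / 2 \<and> 0 \<le> (k + 1 / 2) / 2 \<and> k < (k + 1 / 2) / 2" if "0 \<le> k" "k < 1 / 2" for k :: real
    using that by auto
  from this[OF kap_gamma] have rho: "\<rho> < 1 / 2" "0 \<le> \<rho>" "\<kappa> / \<gamma> < \<rho>" by (simp_all only: \<rho>_def)
  let ?z = "zeta \<rho> C"
  let ?nb = "form_norm b"
  have int: "integrable M (\<lambda>\<omega>. rate_err n \<omega> * ?nb (xt n \<omega>))"
    and exp: "(\<integral>\<omega>. rate_err n \<omega> * ?nb (xt n \<omega>) \<partial>M) \<le> (sqrt (\<integral>\<omega>. (rate_err n \<omega>)\<^sup>2 \<partial>M) * sqrt D) * sqrt (real n + 1)" for n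
  proof -
    have i1: "integrable M (\<lambda>\<omega>. (rate_err n \<omega>)\<^sup>2)"
      by (rule integrable_const_bound[where B=1]) (auto simp: rate_err_bounds power_le_one)
    have i2: "integrable M (\<lambda>\<omega>. (?nb (xt n \<omega>))\<^sup>2)" unfolding form_norm_square[OF b] by (rule D(2))
    show "integrable M (\<lambda>\<omega>. rate_err n \<omega> * ?nb (xt n \<omega>))" by (rule integrable_mult_L2[OF _ _ i1 i2]) measurable
    have "(\<integral>\<omega>. rate_err n \<omega> * ?nb (xt n \<omega>) \<partial>M) \<le> sqrt (\<integral>\<omega>. (rate_err n \<omega>)\<^sup>2 \<partial>M) * sqrt (\<integral>\<omega>. (?nb (xt n \<omega>))\<^sup>2 \<partial>M)"
      by (rule expectation_mult_le_sqrt[OF _ _ i1 i2]) measurable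
    also have "\<dots> \<le> sqrt (\<integral>\<omega>. (rate_err n \<omega>)\<^sup>2 \<partial>M) * sqrt (D * (real n + 1))"
      unfolding form_norm_square[OF b] by (intro mult_left_mono real_sqrt_le_mono D(3)) (auto intro!: integral_nonneg_AE)
    finally show "(\<integral>\<omega>. rate_err n \<omega> * ?nb (xt n \<omega>) \<partial>M) \<le> (sqrt (\<integral>\<omega>. (rate_err n \<omega>)\<^sup>2 \<partial>M) * sqrt D) * sqrt (real n + 1)"
      by (simp add: real_sqrt_mult mult.assoc)
  qed
  have zi: "integrable M (?z n)" for n
    by (induction n) (auto intro!: Bochner_Integration.integrable_add integrable_mult_right int)
  have Ez: "(\<lambda>n. (\<integral>\<omega>. ?z n \<omega> \<partial>M) / sqrt (real n + 1)) \<longlonglongrightarrow> 0"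
  proof (rule sqrt_growth_tendsto_0[OF rho(1)])
    show "0 \<le> (\<integral>\<omega>. ?z n \<omega> \<partial>M)" for n by (intro integral_nonneg_AE) (simp add: zeta_nonneg rho C)
    have "(\<lambda>n. C * (sqrt (\<integral>\<omega>. (rate_err n \<omega>)\<^sup>2 \<partial>M) * sqrt D)) \<longlonglongrightarrow> C * (sqrt 0 * sqrt D)"
      by (intro tendsto_intros rate_err_square_tendsto_0)
    then show "(\<lambda>n. C * (sqrt (\<integral>\<omega>. (rate_err n \<omega>)\<^sup>2 \<partial>M) * sqrt D)) \<longlonglongrightarrow> 0" by simp
    show "0 \<le> C * (sqrt (\<integral>\<omega>. (rate_err n \<omega>)\<^sup>2 \<partial>M) * sqrt D)" for n
      using C D(1) by (intro mult_nonneg_nonneg) (auto intro!: integral_nonneg_AE)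
    fix n :: nat
    have "(\<integral>\<omega>. ?z (Suc n) \<omega> \<partial>M) = (1 + \<rho> / (real n + 1)) * (\<integral>\<omega>. ?z n \<omega> \<partial>M) + C / (real n + 1) * (\<integral>\<omega>. rate_err n \<omega> * ?nb (xt n \<omega>) \<partial>M)"
      using zi[of n] int[of n] by simp
    also have "C / (real n + 1) * (\<integral>\<omega>. rate_err n \<omega> * ?nb (xt n \<omega>) \<partial>M) \<le> C / (real n + 1) * ((sqrt (\<integral>\<omega>. (rate_err n \<omega>)\<^sup>2 \<partial>M) * sqrt D) * sqrt (real n + 1))"
      using C by (intro mult_left_mono exp) auto
    finally show "(\<integral>\<omega>. ?z (Suc n) \<omega> \<partial>M) \<le> (1 + \<rho> / (real n + 1)) * (\<integral>\<omega>. ?z n \<omega> \<partial>M)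
       + C * (sqrt (\<integral>\<omega>. (rate_err n \<omega>)\<^sup>2 \<partial>M) * sqrt D) * sqrt (real n + 1) / (real n + 1)"
      by simp
  qed
  \<comment> \<open>The homogeneous solution. It propagates the error present at the random index,
    which includes the effect of the different initial values of \<open>dev\<close> and
    \<open>xt\<close>.\<close>
  define H where "H n = (\<Prod>k<n. 1 + \<rho> / (real k + 1))" for n
  have H1: "1 \<le> H n" for n unfolding H_def by (rule prod_ge_1) (use rho in auto)
  have Hlim: "(\<lambda>n. H n / sqrt (real n + 1)) \<longlonglongrightarrow> 0"
  proof (rule sqrt_growth_tendsto_0[OF rho(1), where e="\<lambda>_. 0"])
    show "0 \<le> H n" for n using H1[of n] by simp
    show "H (Suc n) \<le> (1 + \<rho> / (real n + 1)) * H n + 0 * sqrt (real n + 1) / (real n + 1)" for n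
      by (simp add: H_def mult.commute)
  qed auto
  let ?r = "\<lambda>n \<omega>. dev n \<omega> - xt n \<omega>"
  \<comment> \<open>The rescaled excess over \<open>zeta\<close>, cut to \<open>[0, 1]\<close> so
    that almost sure convergence carries over to the mean.\<close>
  define q where "q n \<omega> = min 1 (max 0 ((?nb (?r n \<omega>) - ?z n \<omega>) / sqrt (real n + 1)))" for n \<omega>
  have [measurable]: "(\<lambda>\<omega>. ?nb (?r n \<omega>)) \<in> borel_measurable M" for n
  proof -
    have [measurable]: "(\<lambda>\<omega>. b (?r n \<omega>) (?r n \<omega>)) \<in> borel_measurable M"
      by (intro inner_form_measurable[OF b]; measurable)
    show ?thesis unfolding form_norm_def by measurable
  qed
  have qm[measurable]: "q n \<in> borel_measurable M" for n unfolding q_def[abs_def] by measurable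
  have q0: "(\<lambda>n. \<integral>\<omega>. q n \<omega> \<partial>M) \<longlonglongrightarrow> (\<integral>\<omega>. 0 \<partial>M)"
  proof (rule integral_dominated_convergence[where w="\<lambda>_. 1"])
    show "AE \<omega> in M. (\<lambda>n. q n \<omega>) \<longlonglongrightarrow> 0"
      using inverse_T_limit AE_tau_ge_1
    proof eventually_elim
      case (elim \<omega>)
      have S: "real n + 1 \<le> SN n \<omega>" for n by (rule SN_ge_Suc[OF elim(2)])
      have T: "1 / SN n \<omega> = (1 / TN n \<omega>) / (real n + 1)" for n by (simp add: iterate_eq(2))
      have "(\<lambda>n. \<kappa> * (1 / TN n \<omega>) + C * ((1 / TN n \<omega>)\<^sup>2 * (1 / (real n + 1)))) \<longlonglongrightarrow> \<kappa> * (1 / \<gamma>) + C * ((1 / \<gamma>)\<^sup>2 * 0)"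
        by (intro tendsto_intros elim(1)) real_asymp
      then have "\<forall>\<^sub>F n in sequentially. \<kappa> * (1 / TN n \<omega>) + C * ((1 / TN n \<omega>)\<^sup>2 * (1 / (real n + 1))) < \<rho>"
        using rho(3) by (intro order_tendstoD(2)) auto
      then obtain N where N: "\<And>n. n \<ge> N \<Longrightarrow> \<kappa> * (1 / TN n \<omega>) + C * ((1 / TN n \<omega>)\<^sup>2 * (1 / (real n + 1))) < \<rho>"
        by (auto simp: eventually_sequentially)
      have rstep: "?nb (?r (Suc n) \<omega>) \<le> (1 + \<rho> / (real n + 1)) * ?nb (?r n \<omega>) + C / (real n + 1) * (rate_err n \<omega> * ?nb (xt n \<omega>))"
        if n: "n \<ge> N" for n
      proof -
        let ?s = "1 / SN n \<omega>" and ?h = "1 / (\<gamma> * (real n + 1))"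
        have s0: "0 \<le> ?s" using SN_ge[of n \<omega>] by simp
        have "?r (Suc n) \<omega> = (?r n \<omega> + ?s *\<^sub>R (?r n \<omega> v* K)) + (?s - ?h) *\<^sub>R (xt n \<omega> v* K)"
          by (simp add: dev_Suc_noise vector_matrix_mult_diff_distrib algebra_simps)
        then have "?nb (?r (Suc n) \<omega>) \<le> ?nb (?r n \<omega> + ?s *\<^sub>R (?r n \<omega> v* K)) + ?nb ((?s - ?h) *\<^sub>R (xt n \<omega> v* K))"
          using form_norm_triangle[OF b] by metis
        also have "\<dots> \<le> (1 + ?s * \<kappa> + C * ?s\<^sup>2) * ?nb (?r n \<omega>) + \<bar>?s - ?h\<bar> * (C * ?nb (xt n \<omega>))"
          unfolding form_norm_scaleR[OF b] by (intro add_mono E[OF s0 kap(2)] mult_left_mono EK) auto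
        also have "\<bar>?s - ?h\<bar> = rate_err n \<omega> / (real n + 1)"
        proof -
          have "?s - ?h = (1 / TN n \<omega> - 1 / \<gamma>) / (real n + 1)" unfolding T by (simp add: diff_divide_distrib)
          then show ?thesis unfolding rate_err_eq[OF elim(2)] by (simp add: abs_divide)
        qed
        also have "(1 + ?s * \<kappa> + C * ?s\<^sup>2) * ?nb (?r n \<omega>) \<le> (1 + \<rho> / (real n + 1)) * ?nb (?r n \<omega>)"
        proof (rule mult_right_mono)
          have "?s * \<kappa> + C * ?s\<^sup>2 = (\<kappa> * (1 / TN n \<omega>) + C * ((1 / TN n \<omega>)\<^sup>2 * (1 / (real n + 1)))) / (real n + 1)"
            unfolding T by (simp add: power2_eq_square add_divide_distrib mult_ac)
          also have "\<dots> \<le> \<rho> / (real n + 1)" using N[OF n] by (intro divide_right_mono) auto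
          finally show "1 + ?s * \<kappa> + C * ?s\<^sup>2 \<le> 1 + \<rho> / (real n + 1)" by simp
        qed (rule form_norm_nonneg[OF b])
        finally show ?thesis by (simp add: mult_ac)
      qed
      define R where "R = ?nb (?r N \<omega>)"
      have R: "0 \<le> R" by (simp add: R_def form_norm_nonneg[OF b])
      have bound: "?nb (?r n \<omega>) \<le> ?z n \<omega> + R * H n" if "N \<le> n" for n
        using that
      proof (induction rule: dec_induct)
        case base
        have "R * 1 \<le> R * H N" using R H1 by (rule mult_left_mono[rotated])
        then show ?case using zeta_nonneg[OF rho(2) C, of N \<omega>] by (simp add: R_def)
      next
        case (step n)
        have "(1 + \<rho> / (real n + 1)) * ?nb (?r n \<omega>) \<le> (1 + \<rho> / (real n + 1)) * (?z n \<omega> + R * H n)"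
          using step.IH rho(2) by (intro mult_left_mono) auto
        then have "?nb (?r (Suc n) \<omega>) \<le> (1 + \<rho> / (real n + 1)) * (?z n \<omega> + R * H n) + C / (real n + 1) * (rate_err n \<omega> * ?nb (xt n \<omega>))"
          using rstep[of n] step by linarith
        also have "\<dots> = ?z (Suc n) \<omega> + R * H (Suc n)" by (simp add: H_def algebra_simps)
        finally show ?case .
      qed
      show ?case
      proof (rule tendsto_sandwich[OF _ _ tendsto_const])
        show "\<forall>\<^sub>F n in sequentially. 0 \<le> q n \<omega>" by (simp add: q_def)
        show "\<forall>\<^sub>F n in sequentially. q n \<omega> \<le> R * (H n / sqrt (real n + 1))"
        proof (rule eventually_sequentiallyI[of N])
          fix n assume "N \<le> n"
          then have "(?nb (?r n \<omega>) - ?z n \<omega>) / sqrt (real n + 1) \<le> R * H n / sqrt (real n + 1)"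
            using bound[of n] by (intro divide_right_mono) auto
          moreover have "0 \<le> R * H n / sqrt (real n + 1)" using R H1[of n] by simp
          ultimately show "q n \<omega> \<le> R * (H n / sqrt (real n + 1))" unfolding q_def by simp
        qed
        show "(\<lambda>n. R * (H n / sqrt (real n + 1))) \<longlonglongrightarrow> 0" using tendsto_mult[OF tendsto_const Hlim, of R] by simp
      qed
    qed
    show "AE \<omega> in M. norm (q n \<omega>) \<le> 1" for n by (simp add: q_def)
  qed auto
  have le: "min 1 (norm (?r n \<omega>) / sqrt (real n + 1)) \<le> q n \<omega> + ?z n \<omega> / sqrt (real n + 1)" for n \<omega>
  proof -
    have z0: "0 \<le> ?z n \<omega> / sqrt (real n + 1)" using zeta_nonneg[OF rho(2) C, of n \<omega>] by simp
    have "norm (?r n \<omega>) / sqrt (real n + 1) \<le> ?nb (?r n \<omega>) / sqrt (real n + 1)"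
      by (intro divide_right_mono norm_le_form_norm[OF b]) auto
    also have "\<dots> = (?nb (?r n \<omega>) - ?z n \<omega>) / sqrt (real n + 1) + ?z n \<omega> / sqrt (real n + 1)"
      by (simp add: diff_divide_distrib)
    finally show ?thesis using z0 unfolding q_def by linarith
  qed
  show ?thesis
  proof (rule tendsto_sandwich[OF _ _ tendsto_const])
    show "\<forall>\<^sub>F n in sequentially. 0 \<le> (\<integral>\<omega>. min 1 (norm (?r n \<omega>) / sqrt (real n + 1)) \<partial>M)"
      by (intro always_eventually allI integral_nonneg_AE) auto
    have qi: "integrable M (q n)" for n by (rule integrable_const_bound[where B=1]) (auto simp: q_def)
    show "\<forall>\<^sub>F n in sequentially. (\<integral>\<omega>. min 1 (norm (?r n \<omega>) / sqrt (real n + 1)) \<partial>M) \<le> (\<integral>\<omega>. q n \<omega> \<partial>M) + (\<integral>\<omega>. ?z n \<omega> \<partial>M) / sqrt (real n + 1)"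
    proof (intro always_eventually allI)
      fix n
      have "(\<integral>\<omega>. min 1 (norm (?r n \<omega>) / sqrt (real n + 1)) \<partial>M) \<le> (\<integral>\<omega>. q n \<omega> + ?z n \<omega> / sqrt (real n + 1) \<partial>M)"
        by (rule integral_mono[OF integrable_const_bound[where B=1] _ le])
           (auto intro!: Bochner_Integration.integrable_add qi zi integrable_divide)
      then show "(\<integral>\<omega>. min 1 (norm (?r n \<omega>) / sqrt (real n + 1)) \<partial>M) \<le> (\<integral>\<omega>. q n \<omega> \<partial>M) + (\<integral>\<omega>. ?z n \<omega> \<partial>M) / sqrt (real n + 1)"
        using qi[of n] zi[of n] by simp
    qed
    show "(\<lambda>n. (\<integral>\<omega>. q n \<omega> \<partial>M) + (\<integral>\<omega>. ?z n \<omega> \<partial>M) / sqrt (real n + 1)) \<longlonglongrightarrow> 0"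
      using tendsto_add[OF q0 Ez] by simp
  qed
qed

end

section \<open>Characteristic functions\<close>

text \<open>Matches the second order factor \<open>1 - s\<close> of the noise with the Gaussian
  factor \<open>exp (s - p)\<close> produced by the pull-back: the terms of first order in
  \<open>s\<close> cancel, and \<open>p\<close> will be of order \<open>1 / n^2\<close>.\<close>

lemma exp_times_one_minus:
  fixes s p :: real
  assumes "\<bar>s\<bar> \<le> 1 / 2" "\<bar>p\<bar> \<le> 1 / 2"
  shows "\<bar>exp (s - p) * (1 - s) - 1\<bar> \<le> 6 * (\<bar>p\<bar> + s\<^sup>2)"
proof -
  have y: "\<bar>p - s\<bar> \<le> 1" using assms by linarith
  have "\<bar>exp (p - s) - 1 - (p - s)\<bar> \<le> (p - s)\<^sup>2"
  proof (cases "0 \<le> p - s")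
    case True
    have "p - s \<le> 1" using y by linarith
    from exp_bound[OF True this] exp_ge_add_one_self[of "p - s"] show ?thesis by linarith
  next
    case False
    define v where "v = s - p"
    have v: "0 \<le> v" using False by (simp add: v_def)
    have pos: "0 \<le> 1 - v + v\<^sup>2" using zero_le_power2[of "v - 1/2"] by (simp add: power2_eq_square algebra_simps)
    have "1 \<le> (1 + v) * (1 - v + v\<^sup>2)" using v by (simp add: power2_eq_square algebra_simps)
    also have "\<dots> \<le> exp v * (1 - v + v\<^sup>2)" using pos exp_ge_add_one_self[of v] by (intro mult_right_mono) auto
    finally have "exp (- v) * 1 \<le> exp (- v) * (exp v * (1 - v + v\<^sup>2))" by (intro mult_left_mono) auto
    also have "\<dots> = 1 - v + v\<^sup>2" by (simp add: exp_minus)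
    finally have "exp (- v) \<le> 1 - v + v\<^sup>2" by simp
    moreover have "p - s = - v" by (simp add: v_def)
    ultimately show ?thesis using exp_ge_add_one_self[of "- v"] by (simp add: abs_le_iff)
  qed
  moreover have "(p - s)\<^sup>2 \<le> 2 * p\<^sup>2 + 2 * s\<^sup>2"
    using zero_le_power2[of "p + s"] by (simp add: power2_eq_square algebra_simps)
  moreover have "2 * p\<^sup>2 \<le> \<bar>p\<bar>"
  proof -
    have "2 * \<bar>p\<bar> * \<bar>p\<bar> \<le> 1 * \<bar>p\<bar>" using assms by (intro mult_right_mono) auto
    then show ?thesis by (simp add: power2_eq_square)
  qed
  moreover have "\<bar>(1 - s) - exp (p - s)\<bar> \<le> \<bar>exp (p - s) - 1 - (p - s)\<bar> + \<bar>p\<bar>" by linarith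
  ultimately have "\<bar>(1 - s) - exp (p - s)\<bar> \<le> 2 * (\<bar>p\<bar> + s\<^sup>2)" unfolding distrib_left by linarith
  then have "exp (s - p) * \<bar>(1 - s) - exp (p - s)\<bar> \<le> 3 * (2 * (\<bar>p\<bar> + s\<^sup>2))"
  proof (intro mult_mono)
    have "exp (s - p) \<le> exp 1" using y by simp
    also have "\<dots> \<le> (3::real)" by (rule exp_le)
    finally show "exp (s - p) \<le> 3" .
  qed auto
  moreover have "exp (s - p) * \<bar>(1 - s) - exp (p - s)\<bar> = \<bar>exp (s - p) * (1 - s) - 1\<bar>"
  proof -
    have "exp (s - p) * \<bar>(1 - s) - exp (p - s)\<bar> = \<bar>exp (s - p) * ((1 - s) - exp (p - s))\<bar>" by (simp add: abs_mult)
    also have "exp (s - p) * ((1 - s) - exp (p - s)) = exp (s - p) * (1 - s) - 1"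
      by (simp add: right_diff_distrib exp_add[symmetric])
    finally show ?thesis .
  qed
  ultimately show ?thesis by simp
qed

lemma iexp_second_order: "cmod (iexp x - (1 + \<i> * complex_of_real x - complex_of_real (x\<^sup>2 / 2))) \<le> \<bar>x\<bar> ^ 3 / 6"
proof -
  have "(\<Sum>k\<le>2. (\<i> * complex_of_real x) ^ k / fact k) = 1 + \<i> * complex_of_real x - complex_of_real (x\<^sup>2 / 2)"
  proof -
    have "(\<Sum>k\<le>2. f k) = f 0 + f 1 + f 2" for f :: "nat \<Rightarrow> complex" by (simp add: numeral_2_eq_2)
    then show ?thesis by (simp add: power_mult_distrib)
  qed
  then show ?thesis using iexp_approx1[of x 2] by (simp add: fact_numeral eval_nat_numeral)
qed

lemma integral_cmod_le:
  fixes f :: "'w \<Rightarrow> complex"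
  assumes "integrable M f" "integrable M g" "\<And>\<omega>. cmod (f \<omega>) \<le> g \<omega>"
  shows "cmod (integral\<^sup>L M f) \<le> integral\<^sup>L M g"
  by (rule order_trans[OF integral_norm_bound integral_mono]) (use assms in auto)

context algorithm
begin

section \<open>Conditional covariances of the counts\<close>

definition cov :: "nat \<Rightarrow> 'w \<Rightarrow> 't \<Rightarrow> 't \<Rightarrow> real" where
  "cov n \<omega> x y = (\<Sum>z\<in>UNIV. muN n \<omega> $ z * second_moment z x y) - (muN n \<omega> v* G) $ x * (muN n \<omega> v* G) $ y"

definition cov_lim :: "'t \<Rightarrow> 't \<Rightarrow> real" where
  "cov_lim x y = (\<Sum>z\<in>UNIV. \<mu> $ z * second_moment z x y) - (\<mu> v* G) $ x * (\<mu> v* G) $ y"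

text \<open>The coefficient of the count of \<open>x\<close> in \<open>t \<bullet> noise\<close>:
  subtracting a constant vector gives \<open>t\<close> the \<open>\<mu>\<close>-mean zero.\<close>

definition centred :: "real^'t \<Rightarrow> 't \<Rightarrow> real" where
  "centred t x = t $ x - t \<bullet> \<mu>"

definition noise_var :: "nat \<Rightarrow> 'w \<Rightarrow> real^'t \<Rightarrow> real" where
  "noise_var n \<omega> t = (\<Sum>x\<in>UNIV. \<Sum>y\<in>UNIV. centred t x * centred t y * cov n \<omega> x y)"

definition noise_var_lim :: "real^'t \<Rightarrow> real" where
  "noise_var_lim t = (\<Sum>x\<in>UNIV. \<Sum>y\<in>UNIV. centred t x * centred t y * cov_lim x y)"

text \<open>One scalar that controls the error of the conditional variance for all \<open>t\<close>
  at once, with the factor \<open>(norm t)^2\<close>. The argument \<open>t\<close> moves at every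
  step of the recursion, so the error has to be uniform in it.\<close>

definition cov_err :: "nat \<Rightarrow> 'w \<Rightarrow> real" where
  "cov_err n \<omega> = (\<Sum>x\<in>UNIV. \<Sum>y\<in>UNIV. \<bar>cov n \<omega> x y - cov_lim x y\<bar>)"

lemma inner_noise_centred: "t \<bullet> noise n \<omega> = (\<Sum>x\<in>UNIV. centred t x * (visits n \<omega> $ x - (muN n \<omega> v* G) $ x))"
  using inner_noise[of "($) t" n \<omega>] by (simp add: inner_vec_def centred_def right_diff_distrib sum_subtractf)

lemma cov_measurable [measurable]: "(\<lambda>\<omega>. cov n \<omega> x y) \<in> borel_measurable M"
  unfolding cov_def by measurable

lemma bounded_past_mult:
  assumes "bounded_past n f" "bounded_past n g"
  shows "bounded_past n (\<lambda>\<omega>. f \<omega> * g \<omega>)"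
proof -
  obtain A B where "\<And>\<omega>. \<bar>f \<omega>\<bar> \<le> A" "\<And>\<omega>. \<bar>g \<omega>\<bar> \<le> B" using assms by (auto simp: bounded_past_def)
  then have "\<bar>f \<omega> * g \<omega>\<bar> \<le> A * B" for \<omega>
    unfolding abs_mult by (intro mult_mono) (auto intro: order_trans[OF abs_ge_zero])
  then show ?thesis using assms by (auto simp: bounded_past_def)
qed

lemma bounded_past_integrable:
  assumes "bounded_past n g"
  shows "integrable M g"
  using integrable_bounded_past[OF assms, of "\<lambda>_. 1" 1] by simp

lemma bounded_past_mG: "bounded_past n (\<lambda>\<omega>. (muN n \<omega> v* G) $ x)"
  unfolding bounded_past_def using muN_G_measurable_F muN_G_nonneg muN_G_le
  by (intro conjI exI[of _ G_total]) auto

lemma expectation_noise_square: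
  assumes g: "bounded_past n g"
  shows "integrable M (\<lambda>\<omega>. g \<omega> * (t \<bullet> noise n \<omega>)\<^sup>2)" "integrable M (\<lambda>\<omega>. g \<omega> * noise_var n \<omega> t)"
    "(\<integral>\<omega>. g \<omega> * (t \<bullet> noise n \<omega>)\<^sup>2 \<partial>M) = (\<integral>\<omega>. g \<omega> * noise_var n \<omega> t \<partial>M)"
proof -
  let ?m = "\<lambda>\<omega>. muN n \<omega> v* G"
  let ?N = "visits n"
  have [measurable]: "g \<in> borel_measurable M" using g by (rule bounded_past_measurable)
  obtain B where B: "\<And>\<omega>. \<bar>g \<omega>\<bar> \<le> B" using g by (auto simp: bounded_past_def)
  have gm: "bounded_past n (\<lambda>\<omega>. g \<omega> * ?m \<omega> $ x)" for x by (rule bounded_past_mult[OF g bounded_past_mG])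
  have gmm: "bounded_past n (\<lambda>\<omega>. g \<omega> * ?m \<omega> $ x * ?m \<omega> $ y)" for x y by (rule bounded_past_mult[OF gm bounded_past_mG])
  have iNN: "integrable M (\<lambda>\<omega>. g \<omega> * (?N \<omega> $ x * ?N \<omega> $ y))" for x y
  proof (rule Bochner_Integration.integrable_bound[OF integrable_mult_right[OF tau_moments(2)[of n], of B]])
    have "\<bar>g \<omega> * (?N \<omega> $ x * ?N \<omega> $ y)\<bar> \<le> B * (real (tau n \<omega>) * real (tau n \<omega>))" for \<omega>
      unfolding abs_mult using B[of \<omega>] visits_nonneg visits_le_tau
      by (intro mult_mono) (auto intro: order_trans[OF abs_ge_zero])
    then show "AE \<omega> in M. norm (g \<omega> * (?N \<omega> $ x * ?N \<omega> $ y)) \<le> norm (B * (real (tau n \<omega>))\<^sup>2)"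
      by (auto simp: power2_eq_square intro!: AE_I2 order_trans[OF _ abs_ge_self])
  qed measurable
  have isec: "integrable M (\<lambda>\<omega>. g \<omega> * (\<Sum>z\<in>UNIV. muN n \<omega> $ z * second_moment z x y))" for x y
  proof -
    have "integrable M (\<lambda>\<omega>. \<Sum>z\<in>UNIV. (g \<omega> * muN n \<omega> $ z) * second_moment z x y)"
      by (intro Bochner_Integration.integrable_sum integrable_mult_left muN_integrable g)
    then show ?thesis by (simp add: sum_distrib_left mult.assoc)
  qed
  have prod: "integrable M (\<lambda>\<omega>. g \<omega> * ((?N \<omega> $ x - ?m \<omega> $ x) * (?N \<omega> $ y - ?m \<omega> $ y)))"
      "integrable M (\<lambda>\<omega>. g \<omega> * cov n \<omega> x y)"
      "(\<integral>\<omega>. g \<omega> * ((?N \<omega> $ x - ?m \<omega> $ x) * (?N \<omega> $ y - ?m \<omega> $ y)) \<partial>M) = (\<integral>\<omega>. g \<omega> * cov n \<omega> x y \<partial>M)" for x y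
  proof -
    have eq: "g \<omega> * ((?N \<omega> $ x - ?m \<omega> $ x) * (?N \<omega> $ y - ?m \<omega> $ y)) =
      g \<omega> * (?N \<omega> $ x * ?N \<omega> $ y) - g \<omega> * ?m \<omega> $ y * ?N \<omega> $ x - g \<omega> * ?m \<omega> $ x * ?N \<omega> $ y + g \<omega> * ?m \<omega> $ x * ?m \<omega> $ y" for \<omega>
      by (simp add: algebra_simps)
    have eqc: "g \<omega> * cov n \<omega> x y = g \<omega> * (\<Sum>z\<in>UNIV. muN n \<omega> $ z * second_moment z x y) - g \<omega> * ?m \<omega> $ x * ?m \<omega> $ y" for \<omega>
      by (simp add: cov_def algebra_simps)
    note i = iNN[of x y] expectation_visits_bounded(1)[OF gm[of y], of x] expectation_visits_bounded(1)[OF gm[of x], of y]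
      bounded_past_integrable[OF gmm[of x y]] isec[of x y]
    show "integrable M (\<lambda>\<omega>. g \<omega> * ((?N \<omega> $ x - ?m \<omega> $ x) * (?N \<omega> $ y - ?m \<omega> $ y)))" unfolding eq
      by (intro Bochner_Integration.integrable_add Bochner_Integration.integrable_diff i)
    show "integrable M (\<lambda>\<omega>. g \<omega> * cov n \<omega> x y)" unfolding eqc by (intro Bochner_Integration.integrable_diff i)
    have "(\<integral>\<omega>. g \<omega> * ?m \<omega> $ y * ?N \<omega> $ x \<partial>M) = (\<integral>\<omega>. g \<omega> * ?m \<omega> $ x * ?m \<omega> $ y \<partial>M)"
      using expectation_visits_bounded(2)[OF gm[of y], of x] by (simp add: mult_ac)
    moreover have "(\<integral>\<omega>. g \<omega> * ?m \<omega> $ x * ?N \<omega> $ y \<partial>M) = (\<integral>\<omega>. g \<omega> * ?m \<omega> $ x * ?m \<omega> $ y \<partial>M)"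
      by (rule expectation_visits_bounded(2)[OF gm[of x], of y])
    ultimately show "(\<integral>\<omega>. g \<omega> * ((?N \<omega> $ x - ?m \<omega> $ x) * (?N \<omega> $ y - ?m \<omega> $ y)) \<partial>M) = (\<integral>\<omega>. g \<omega> * cov n \<omega> x y \<partial>M)"
      unfolding eq eqc using i expectation_visits_visits[OF g, of x y] by simp
  qed
  have sq: "g \<omega> * (t \<bullet> noise n \<omega>)\<^sup>2 = (\<Sum>x\<in>UNIV. \<Sum>y\<in>UNIV. (centred t x * centred t y) * (g \<omega> * ((?N \<omega> $ x - ?m \<omega> $ x) * (?N \<omega> $ y - ?m \<omega> $ y))))" for \<omega>
  proof -
    have "(t \<bullet> noise n \<omega>)\<^sup>2 = (\<Sum>x\<in>UNIV. \<Sum>y\<in>UNIV. (centred t x * (?N \<omega> $ x - ?m \<omega> $ x)) * (centred t y * (?N \<omega> $ y - ?m \<omega> $ y)))"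
      by (simp only: inner_noise_centred power2_eq_square sum_product)
    then show ?thesis by (simp add: sum_distrib_left mult_ac)
  qed
  have nv: "g \<omega> * noise_var n \<omega> t = (\<Sum>x\<in>UNIV. \<Sum>y\<in>UNIV. (centred t x * centred t y) * (g \<omega> * cov n \<omega> x y))" for \<omega>
    unfolding noise_var_def sum_distrib_left by (intro sum.cong refl) (simp add: mult_ac)
  show "integrable M (\<lambda>\<omega>. g \<omega> * (t \<bullet> noise n \<omega>)\<^sup>2)" "integrable M (\<lambda>\<omega>. g \<omega> * noise_var n \<omega> t)"
    unfolding sq nv by (intro Bochner_Integration.integrable_sum integrable_mult_right prod)+
  have "(\<integral>\<omega>. g \<omega> * (t \<bullet> noise n \<omega>)\<^sup>2 \<partial>M) = (\<Sum>x\<in>UNIV. \<Sum>y\<in>UNIV. (centred t x * centred t y) * (\<integral>\<omega>. g \<omega> * ((?N \<omega> $ x - ?m \<omega> $ x) * (?N \<omega> $ y - ?m \<omega> $ y)) \<partial>M))"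
    unfolding sq
    by (subst Bochner_Integration.integral_sum, intro Bochner_Integration.integrable_sum integrable_mult_right prod,
        subst Bochner_Integration.integral_sum, intro integrable_mult_right prod, subst integral_mult_right_zero, rule refl)
  also have "\<dots> = (\<integral>\<omega>. g \<omega> * noise_var n \<omega> t \<partial>M)"
    unfolding nv prod(3)
    by (subst Bochner_Integration.integral_sum, intro Bochner_Integration.integrable_sum integrable_mult_right prod,
        subst Bochner_Integration.integral_sum, intro integrable_mult_right prod, subst integral_mult_right_zero, rule refl)
  finally show "(\<integral>\<omega>. g \<omega> * (t \<bullet> noise n \<omega>)\<^sup>2 \<partial>M) = (\<integral>\<omega>. g \<omega> * noise_var n \<omega> t \<partial>M)" .
qed

lemma cov_err_nonneg: "0 \<le> cov_err n \<omega>"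
  by (simp add: cov_err_def sum_nonneg)

lemma cov_err_measurable [measurable]: "cov_err n \<in> borel_measurable M"
  unfolding cov_err_def[abs_def] by measurable

text \<open>Conditional covariances are polynomials in the iterate, so they converge almost surely;
  boundedness of the iterates carries this over to expectations.\<close>

lemma cov_err_integrable: "integrable M (cov_err n)"
  and cov_err_tendsto_0: "(\<lambda>n. \<integral>\<omega>. cov_err n \<omega> \<partial>M) \<longlonglongrightarrow> 0"
proof -
  define B where "B = (\<Sum>x\<in>UNIV. \<Sum>y\<in>UNIV. (\<Sum>z\<in>UNIV. \<bar>second_moment z x y\<bar>) + G_total * G_total + \<bar>cov_lim x y\<bar>)"
  have bound: "cov_err n \<omega> \<le> B" for n \<omega>
    unfolding cov_err_def B_def
  proof (intro sum_mono)
    fix x y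
    have "\<bar>\<Sum>z\<in>UNIV. muN n \<omega> $ z * second_moment z x y\<bar> \<le> (\<Sum>z\<in>UNIV. \<bar>second_moment z x y\<bar>)"
    proof (rule order_trans[OF sum_abs], rule sum_mono)
      fix z
      have "\<bar>muN n \<omega> $ z\<bar> * \<bar>second_moment z x y\<bar> \<le> 1 * \<bar>second_moment z x y\<bar>"
        using muN_bounds[of n \<omega> z] by (intro mult_right_mono) auto
      then show "\<bar>muN n \<omega> $ z * second_moment z x y\<bar> \<le> \<bar>second_moment z x y\<bar>" by (simp add: abs_mult)
    qed
    moreover have "\<bar>(muN n \<omega> v* G) $ x * (muN n \<omega> v* G) $ y\<bar> \<le> G_total * G_total"
      unfolding abs_mult using muN_G_nonneg[of n \<omega>] muN_G_le[of n \<omega>]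
      by (intro mult_mono) (auto intro: order_trans[OF muN_G_nonneg])
    ultimately show "\<bar>cov n \<omega> x y - cov_lim x y\<bar> \<le> (\<Sum>z\<in>UNIV. \<bar>second_moment z x y\<bar>) + G_total * G_total + \<bar>cov_lim x y\<bar>"
      unfolding cov_def by linarith
  qed
  show "integrable M (cov_err n)" for n
    by (rule integrable_const_bound[where B=B]) (use bound cov_err_nonneg in auto)
  have "(\<lambda>n. \<integral>\<omega>. cov_err n \<omega> \<partial>M) \<longlonglongrightarrow> (\<integral>\<omega>. 0 \<partial>M)"
  proof (rule integral_dominated_convergence[where w="\<lambda>_. B"])
    show "AE \<omega> in M. (\<lambda>n. cov_err n \<omega>) \<longlonglongrightarrow> 0"
      using AE_muN_limit
    proof eventually_elim
      case (elim \<omega>)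
      have mG: "(\<lambda>n. (muN n \<omega> v* G) $ x) \<longlonglongrightarrow> (\<mu> v* G) $ x" for x
        unfolding vector_matrix_mult_def vec_lambda_beta by (intro tendsto_intros elim)
      have "(\<lambda>n. cov n \<omega> x y) \<longlonglongrightarrow> cov_lim x y" for x y
        unfolding cov_def cov_lim_def by (intro tendsto_intros mG elim)
      then have "(\<lambda>n. \<bar>cov n \<omega> x y - cov_lim x y\<bar>) \<longlonglongrightarrow> 0" for x y using LIM_zero tendsto_rabs_zero by blast
      then show ?case unfolding cov_err_def by (intro tendsto_null_sum)
    qed
    show "AE \<omega> in M. norm (cov_err n \<omega>) \<le> B" for n using bound cov_err_nonneg by auto
  qed auto
  then show "(\<lambda>n. \<integral>\<omega>. cov_err n \<omega> \<partial>M) \<longlonglongrightarrow> 0" by simp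
qed

lemma centred_le: "\<bar>centred t x\<bar> \<le> 2 * norm t"
proof -
  have "\<bar>t $ x\<bar> \<le> norm t" by (rule component_le_norm_cart)
  moreover have "\<bar>t \<bullet> \<mu>\<bar> \<le> norm t * norm \<mu>" by (rule Cauchy_Schwarz_ineq2)
  moreover have "norm t * norm \<mu> \<le> norm t" using norm_prob_vector_le[OF mu_prob] by (simp add: mult_left_le)
  ultimately show ?thesis unfolding centred_def by linarith
qed

lemma centred_mult_le: "\<bar>centred t x * centred t y\<bar> \<le> 4 * (norm t)\<^sup>2"
proof -
  have "\<bar>centred t x\<bar> * \<bar>centred t y\<bar> \<le> (2 * norm t) * (2 * norm t)" by (intro mult_mono centred_le) auto
  then show ?thesis by (simp add: abs_mult power2_eq_square)
qed

lemma noise_var_diff: "\<bar>noise_var n \<omega> t - noise_var_lim t\<bar> \<le> 4 * (norm t)\<^sup>2 * cov_err n \<omega>"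
proof -
  have "noise_var n \<omega> t - noise_var_lim t = (\<Sum>x\<in>UNIV. \<Sum>y\<in>UNIV. centred t x * centred t y * (cov n \<omega> x y - cov_lim x y))"
    unfolding noise_var_def noise_var_lim_def by (simp add: right_diff_distrib sum_subtractf)
  also have "\<bar>\<dots>\<bar> \<le> (\<Sum>x\<in>UNIV. \<Sum>y\<in>UNIV. \<bar>centred t x * centred t y * (cov n \<omega> x y - cov_lim x y)\<bar>)"
    by (intro order_trans[OF sum_abs] sum_mono sum_abs)
  also have "\<dots> \<le> (\<Sum>x\<in>UNIV. \<Sum>y\<in>UNIV. 4 * (norm t)\<^sup>2 * \<bar>cov n \<omega> x y - cov_lim x y\<bar>)"
    unfolding abs_mult[of "_ * _"] by (intro sum_mono mult_right_mono centred_mult_le) auto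
  also have "\<dots> = 4 * (norm t)\<^sup>2 * cov_err n \<omega>" by (simp add: cov_err_def sum_distrib_left)
  finally show ?thesis .
qed

lemma noise_var_lim_le: obtains c where "0 \<le> c" "\<And>t. \<bar>noise_var_lim t\<bar> \<le> c * (norm t)\<^sup>2"
proof -
  define c where "c = (\<Sum>x\<in>UNIV. \<Sum>y\<in>UNIV. 4 * \<bar>cov_lim x y\<bar>)"
  have "\<bar>noise_var_lim t\<bar> \<le> c * (norm t)\<^sup>2" for t
  proof -
    have "\<bar>noise_var_lim t\<bar> \<le> (\<Sum>x\<in>UNIV. \<Sum>y\<in>UNIV. \<bar>centred t x * centred t y * cov_lim x y\<bar>)"
      unfolding noise_var_lim_def by (intro order_trans[OF sum_abs] sum_mono sum_abs)
    also have "\<dots> \<le> (\<Sum>x\<in>UNIV. \<Sum>y\<in>UNIV. 4 * (norm t)\<^sup>2 * \<bar>cov_lim x y\<bar>)"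
      unfolding abs_mult[of "_ * _"] by (intro sum_mono mult_right_mono centred_mult_le) auto
    also have "\<dots> = c * (norm t)\<^sup>2" by (simp add: c_def sum_distrib_left sum_distrib_right mult_ac)
    finally show ?thesis .
  qed
  moreover have "0 \<le> c" by (simp add: c_def sum_nonneg)
  ultimately show ?thesis by (intro that)
qed

lemma noise_var_integrable: "integrable M (\<lambda>\<omega>. noise_var n \<omega> t)"
  using expectation_noise_square(2)[OF bounded_past_const[of n 1], of t] by simp

text \<open>A limit of variances of \<open>t \<bullet> noise\<close>. Nonnegativity will keep the
  factor \<open>1 - s\<close> of the recursion at most 1.\<close>

lemma noise_var_lim_nonneg: "0 \<le> noise_var_lim t"
proof -
  have lb: "- (4 * (norm t)\<^sup>2 * (\<integral>\<omega>. cov_err n \<omega> \<partial>M)) \<le> noise_var_lim t" for n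
  proof -
    have "0 \<le> (\<integral>\<omega>. (t \<bullet> noise n \<omega>)\<^sup>2 \<partial>M)" by (intro integral_nonneg_AE) auto
    also have "\<dots> = (\<integral>\<omega>. noise_var n \<omega> t \<partial>M)" using expectation_noise_square(3)[OF bounded_past_const[of n 1], of t] by simp
    also have "\<dots> \<le> (\<integral>\<omega>. noise_var_lim t + 4 * (norm t)\<^sup>2 * cov_err n \<omega> \<partial>M)"
    proof (rule integral_mono[OF noise_var_integrable])
      show "integrable M (\<lambda>\<omega>. noise_var_lim t + 4 * (norm t)\<^sup>2 * cov_err n \<omega>)" using cov_err_integrable by simp
      show "noise_var n \<omega> t \<le> noise_var_lim t + 4 * (norm t)\<^sup>2 * cov_err n \<omega>" for \<omega>
        using noise_var_diff[of n \<omega> t] by linarith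
    qed
    also have "\<dots> = noise_var_lim t + 4 * (norm t)\<^sup>2 * (\<integral>\<omega>. cov_err n \<omega> \<partial>M)"
      using cov_err_integrable by (simp add: prob_space)
    finally show ?thesis by linarith
  qed
  have "(\<lambda>n. - (4 * (norm t)\<^sup>2 * (\<integral>\<omega>. cov_err n \<omega> \<partial>M))) \<longlonglongrightarrow> - (4 * (norm t)\<^sup>2 * 0)"
    by (intro tendsto_intros cov_err_tendsto_0)
  then have "- (4 * (norm t)\<^sup>2 * 0) \<le> noise_var_lim t" by (rule LIMSEQ_le_const2) (use lb in auto)
  then show ?thesis by simp
qed

text \<open>The matrix is \<open>transpose R ** C ** R\<close>, where \<open>C\<close> holds the
  limiting covariances and \<open>R\<close> is the centring map.\<close>

lemma noise_var_lim_matrix: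
  obtains \<Gamma> :: "real^'t^'t" where "\<And>t. t \<bullet> (\<Gamma> *v t) = noise_var_lim t"
proof -
  define R :: "real^'t^'t" where "R = (\<chi> x y. (if x = y then 1 else 0) - \<mu> $ y)"
  define C :: "real^'t^'t" where "C = (\<chi> x y. cov_lim x y)"
  have Rt: "R *v t = (\<chi> x. centred t x)" for t
  proof -
    have "(R *v t) $ x = (\<Sum>y\<in>UNIV. (if y = x then t $ y else 0) - t $ y * \<mu> $ y)" for x
      unfolding matrix_vector_mult_def R_def vec_lambda_beta by (intro sum.cong) (auto simp: algebra_simps)
    then show ?thesis by (simp add: vec_eq_iff sum_subtractf centred_def inner_vec_def)
  qed
  have "t \<bullet> ((transpose R ** C ** R) *v t) = noise_var_lim t" for t
  proof -
    have "t \<bullet> ((transpose R ** C ** R) *v t) = t \<bullet> (transpose R *v (C *v (R *v t)))"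
      by (simp only: matrix_vector_mul_assoc[symmetric])
    also have "\<dots> = (R *v t) \<bullet> (C *v (R *v t))"
      by (metis dot_lmul_matrix inner_commute transpose_matrix_vector)
    also have "\<dots> = noise_var_lim t"
      unfolding Rt by (simp add: C_def inner_vec_def matrix_vector_mult_def noise_var_lim_def sum_distrib_left mult_ac)
    finally show ?thesis .
  qed
  then show ?thesis by (rule that)
qed

lemma noise_cube:
  "integrable M (\<lambda>\<omega>. norm (noise n \<omega>) ^ 3)" "(\<integral>\<omega>. norm (noise n \<omega>) ^ 3 \<partial>M) \<le> 32 * moment + 32 * G_total ^ 3"
proof -
  have G0: "0 \<le> G_total" using mean_tau_bounds[of 0 undefined] by linarith
  have cub: "(a + c) ^ 3 \<le> 4 * a ^ 3 + 4 * c ^ 3" if "0 \<le> a" "0 \<le> c" for a c :: real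
  proof -
    have "4 * a ^ 3 + 4 * c ^ 3 - (a + c) ^ 3 = 3 * (a + c) * (a - c)\<^sup>2"
      by (simp add: power3_eq_cube power2_eq_square algebra_simps)
    moreover have "0 \<le> 3 * (a + c) * (a - c)\<^sup>2" using that by simp
    ultimately show ?thesis by linarith
  qed
  have le: "norm (noise n \<omega>) ^ 3 \<le> 32 * real (tau n \<omega>) ^ 3 + 32 * G_total ^ 3" for \<omega>
  proof -
    have "norm (noise n \<omega>) ^ 3 \<le> (2 * real (tau n \<omega>) + 2 * G_total) ^ 3" by (intro power_mono norm_noise_le) simp
    also have "\<dots> \<le> 4 * (2 * real (tau n \<omega>)) ^ 3 + 4 * (2 * G_total) ^ 3" using G0 by (intro cub) auto
    finally show ?thesis by (simp add: power_mult_distrib)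
  qed
  have i: "integrable M (\<lambda>\<omega>. 32 * real (tau n \<omega>) ^ 3 + 32 * G_total ^ 3)" using tau_cube(1) by simp
  show int: "integrable M (\<lambda>\<omega>. norm (noise n \<omega>) ^ 3)"
    by (rule Bochner_Integration.integrable_bound[OF i]) (use le in \<open>auto intro!: order_trans[OF _ abs_ge_self]\<close>)
  have "(\<integral>\<omega>. norm (noise n \<omega>) ^ 3 \<partial>M) \<le> (\<integral>\<omega>. 32 * real (tau n \<omega>) ^ 3 + 32 * G_total ^ 3 \<partial>M)"
    by (intro integral_mono int i le)
  also have "\<dots> \<le> 32 * moment + 32 * G_total ^ 3" using tau_cube(1) tau_moments(4)[of n] by (simp add: prob_space)
  finally show "(\<integral>\<omega>. norm (noise n \<omega>) ^ 3 \<partial>M) \<le> 32 * moment + 32 * G_total ^ 3" .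
qed

section \<open>Characteristic functions of the rescaled linear recursion\<close>

definition scaled :: "nat \<Rightarrow> 'w \<Rightarrow> real^'t" where
  "scaled n \<omega> = (1 / sqrt (real n + 1)) *\<^sub>R xt n \<omega>"

lemma scaled_measurable_F: "scaled n \<in> borel_measurable (F n)"
  using xt_measurable_F[of n] unfolding scaled_def[abs_def] by measurable

lemma scaled_measurable [measurable]: "scaled n \<in> borel_measurable M"
  by (rule measurable_from_subalg[OF F_subalgebra scaled_measurable_F])

definition cf :: "nat \<Rightarrow> real^'t \<Rightarrow> complex" where
  "cf n t = (CLINT \<omega>|M. iexp (t \<bullet> scaled n \<omega>))"

text \<open>Transpose of one linear step together with the change of scale from
  \<open>sqrt (n + 1)\<close> to \<open>sqrt (n + 2)\<close>: through \<open>pull n t\<close> the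
  past contributes to \<open>t \<bullet> scaled (n + 1)\<close>.\<close>

definition pull :: "nat \<Rightarrow> real^'t \<Rightarrow> real^'t" where
  "pull n t = sqrt ((real n + 1) / (real n + 2)) *\<^sub>R (t + (1 / (\<gamma> * (real n + 1))) *\<^sub>R (K *v t))"

lemma scaled_Suc: "t \<bullet> scaled (Suc n) \<omega> = pull n t \<bullet> scaled n \<omega> + (t \<bullet> noise n \<omega>) / sqrt (real n + 2)"
proof -
  have "sqrt ((real n + 1) / (real n + 2)) * (1 / sqrt (real n + 1)) = 1 / sqrt (real n + 2)"
    by (simp add: real_sqrt_divide)
  moreover have "pull n t \<bullet> scaled n \<omega> = (sqrt ((real n + 1) / (real n + 2)) * (1 / sqrt (real n + 1))) * ((t + (1 / (\<gamma> * (real n + 1))) *\<^sub>R (K *v t)) \<bullet> xt n \<omega>)"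
    unfolding pull_def scaled_def inner_scaleR_left inner_scaleR_right by (simp only: mult_ac)
  ultimately have "pull n t \<bullet> scaled n \<omega> = (1 / sqrt (real n + 2)) * ((t + (1 / (\<gamma> * (real n + 1))) *\<^sub>R (K *v t)) \<bullet> xt n \<omega>)"
    by (simp only:)
  moreover have "t \<bullet> xt (Suc n) \<omega> = (t + (1 / (\<gamma> * (real n + 1))) *\<^sub>R (K *v t)) \<bullet> xt n \<omega> + t \<bullet> noise n \<omega>"
    using dot_lmul_matrix[of "xt n \<omega>" K t] by (simp add: inner_add_left inner_add_right inner_commute)
  ultimately show ?thesis
    by (simp add: scaled_def add.commute add_divide_distrib distrib_left)
qed

text \<open>
  Conditioning on the past and expanding the characteristic function of the noise to second order;
  the first order term vanishes by orthogonality.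
\<close>

lemma cf_Suc:
  "cmod (cf (Suc n) t - cf n (pull n t) * complex_of_real (1 - noise_var_lim t / (2 * (real n + 2))))
    \<le> 2 * (norm t)\<^sup>2 * (\<integral>\<omega>. cov_err n \<omega> \<partial>M) / (real n + 2)
      + (32 * moment + 32 * G_total ^ 3) * norm t ^ 3 / ((real n + 2) * sqrt (real n + 2))"
proof -
  let ?s = "sqrt (real n + 2)"
  have s: "?s > 0" "?s\<^sup>2 = real n + 2" by simp_all
  define \<theta> where "\<theta> \<omega> = (t \<bullet> noise n \<omega>) / ?s" for \<omega>
  define a where "a \<omega> = pull n t \<bullet> scaled n \<omega>" for \<omega>
  have [measurable]: "\<theta> \<in> borel_measurable M" "a \<in> borel_measurable M"
    unfolding \<theta>_def[abs_def] a_def[abs_def] by measurable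
  have am: "a \<in> borel_measurable (F n)"
    using scaled_measurable_F[of n] unfolding a_def[abs_def] by measurable
  \<comment> \<open>The expectation identities concern real bounded factors from the past, so
    \<open>iexp (a \<omega>)\<close> is used through its cosine and sine.\<close>
  have bc: "bounded_past n (\<lambda>\<omega>. cos (a \<omega>))" "bounded_past n (\<lambda>\<omega>. sin (a \<omega>))"
    using am by (auto simp: bounded_past_def intro!: exI[of _ 1])
  have iexp_eq: "iexp x = complex_of_real (cos x) + \<i> * complex_of_real (sin x)" for x
    by (simp add: exp_Euler cos_of_real sin_of_real mult.commute)
  have nv_meas[measurable]: "(\<lambda>\<omega>. noise_var n \<omega> t) \<in> borel_measurable M" unfolding noise_var_def by measurable
  have first: "integrable M (\<lambda>\<omega>. g \<omega> * \<theta> \<omega>)" "(\<integral>\<omega>. g \<omega> * \<theta> \<omega> \<partial>M) = 0" if g: "bounded_past n g" for g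
  proof -
    let ?c = "\<lambda>x \<omega>. g \<omega> * (t $ x / ?s)"
    have cb: "bounded_past n (?c x)" for x by (rule bounded_past_mult[OF g bounded_past_const])
    have eq: "g \<omega> * \<theta> \<omega> = (\<Sum>x\<in>UNIV. ?c x \<omega> * noise n \<omega> $ x)" for \<omega>
      by (simp add: \<theta>_def inner_vec_def sum_distrib_left sum_divide_distrib mult_ac)
    have "integrable M (\<lambda>\<omega>. (?c x \<omega>)\<^sup>2)" for x
      unfolding power2_eq_square by (rule bounded_past_integrable[OF bounded_past_mult[OF cb cb]])
    note o = noise_orthogonal[of ?c n, OF _ this]
    show "integrable M (\<lambda>\<omega>. g \<omega> * \<theta> \<omega>)" "(\<integral>\<omega>. g \<omega> * \<theta> \<omega> \<partial>M) = 0"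
      unfolding eq using o cb by (auto simp: bounded_past_def)
  qed
  have second: "integrable M (\<lambda>\<omega>. g \<omega> * (\<theta> \<omega>)\<^sup>2)" "(\<integral>\<omega>. g \<omega> * (\<theta> \<omega>)\<^sup>2 \<partial>M) = (\<integral>\<omega>. g \<omega> * noise_var n \<omega> t \<partial>M) / (real n + 2)"
    if g: "bounded_past n g" for g
  proof -
    have eq: "g \<omega> * (\<theta> \<omega>)\<^sup>2 = (g \<omega> * (t \<bullet> noise n \<omega>)\<^sup>2) / (real n + 2)" for \<omega>
      by (simp add: \<theta>_def power_divide)
    show "integrable M (\<lambda>\<omega>. g \<omega> * (\<theta> \<omega>)\<^sup>2)" "(\<integral>\<omega>. g \<omega> * (\<theta> \<omega>)\<^sup>2 \<partial>M) = (\<integral>\<omega>. g \<omega> * noise_var n \<omega> t \<partial>M) / (real n + 2)"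
      unfolding eq using expectation_noise_square[OF g, of t] by auto
  qed
  have i0: "integrable M (\<lambda>\<omega>. iexp (a \<omega>))" by (rule integrable_const_bound[where B=1]) auto
  have cI: "integrable M (\<lambda>\<omega>. iexp (a \<omega>) * complex_of_real (f \<omega>))"
      "(CLINT \<omega>|M. iexp (a \<omega>) * complex_of_real (f \<omega>)) = complex_of_real (\<integral>\<omega>. cos (a \<omega>) * f \<omega> \<partial>M) + \<i> * complex_of_real (\<integral>\<omega>. sin (a \<omega>) * f \<omega> \<partial>M)"
    if "integrable M (\<lambda>\<omega>. cos (a \<omega>) * f \<omega>)" "integrable M (\<lambda>\<omega>. sin (a \<omega>) * f \<omega>)" for f
  proof -
    have eq: "iexp (a \<omega>) * complex_of_real (f \<omega>) = complex_of_real (cos (a \<omega>) * f \<omega>) + \<i> * complex_of_real (sin (a \<omega>) * f \<omega>)" for \<omega>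
      unfolding iexp_eq by (simp add: algebra_simps)
    have i1: "integrable M (\<lambda>\<omega>. complex_of_real (cos (a \<omega>) * f \<omega>))" "integrable M (\<lambda>\<omega>. complex_of_real (sin (a \<omega>) * f \<omega>))"
      using that by (simp_all only: integrable_of_real)
    show "integrable M (\<lambda>\<omega>. iexp (a \<omega>) * complex_of_real (f \<omega>))"
      unfolding eq by (intro Bochner_Integration.integrable_add integrable_mult_right i1)
    show "(CLINT \<omega>|M. iexp (a \<omega>) * complex_of_real (f \<omega>)) = complex_of_real (\<integral>\<omega>. cos (a \<omega>) * f \<omega> \<partial>M) + \<i> * complex_of_real (\<integral>\<omega>. sin (a \<omega>) * f \<omega> \<partial>M)"
      unfolding eq
      by (subst Bochner_Integration.integral_add[OF i1(1) integrable_mult_right[OF i1(2)]])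
         (simp only: integral_mult_right_zero integral_complex_of_real)
  qed
  note I1 = cI[OF first(1)[OF bc(1)] first(1)[OF bc(2)]]
  note I2 = cI[OF second(1)[OF bc(1)] second(1)[OF bc(2)]]
  note I3 = cI[OF expectation_noise_square(2)[OF bc(1), of t] expectation_noise_square(2)[OF bc(2), of t]]
  have E1: "(CLINT \<omega>|M. iexp (a \<omega>) * complex_of_real (\<theta> \<omega>)) = 0"
    unfolding I1(2) first(2)[OF bc(1)] first(2)[OF bc(2)] by simp
  have E2: "(CLINT \<omega>|M. iexp (a \<omega>) * complex_of_real ((\<theta> \<omega>)\<^sup>2)) = (CLINT \<omega>|M. iexp (a \<omega>) * complex_of_real (noise_var n \<omega> t)) / (real n + 2)"
    unfolding I2(2) I3(2) second(2)[OF bc(1)] second(2)[OF bc(2)] by (simp add: add_divide_distrib)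
  let ?T = "\<lambda>\<omega>. iexp (a \<omega>) * (1 + \<i> * complex_of_real (\<theta> \<omega>) - complex_of_real ((\<theta> \<omega>)\<^sup>2 / 2))"
  have Teq: "?T \<omega> = iexp (a \<omega>) + \<i> * (iexp (a \<omega>) * complex_of_real (\<theta> \<omega>)) - (1/2) * (iexp (a \<omega>) * complex_of_real ((\<theta> \<omega>)\<^sup>2))" for \<omega>
    by (simp add: algebra_simps)
  have Ti: "integrable M ?T" unfolding Teq
    by (intro Bochner_Integration.integrable_add Bochner_Integration.integrable_diff integrable_mult_right i0 I1(1) I2(1))
  have "(CLINT \<omega>|M. ?T \<omega>) = cf n (pull n t) + \<i> * 0 - (1/2) * ((CLINT \<omega>|M. iexp (a \<omega>) * complex_of_real (noise_var n \<omega> t)) / (real n + 2))"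
    unfolding Teq
    by (subst Bochner_Integration.integral_diff,
        intro Bochner_Integration.integrable_add integrable_mult_right i0 I1(1), intro integrable_mult_right I2(1),
        subst Bochner_Integration.integral_add, rule i0, intro integrable_mult_right I1(1))
       (simp only: integral_mult_right_zero E1 E2, simp only: cf_def a_def)
  then have ET: "(CLINT \<omega>|M. ?T \<omega>) = cf n (pull n t) - (CLINT \<omega>|M. iexp (a \<omega>) * complex_of_real (noise_var n \<omega> t)) / (2 * (real n + 2))"
    by simp
  have nvc: "(CLINT \<omega>|M. iexp (a \<omega>) * complex_of_real (noise_var n \<omega> t)) - cf n (pull n t) * complex_of_real (noise_var_lim t)
     = (CLINT \<omega>|M. iexp (a \<omega>) * complex_of_real (noise_var n \<omega> t - noise_var_lim t))"
  proof -
    have "(CLINT \<omega>|M. iexp (a \<omega>) * complex_of_real (noise_var n \<omega> t - noise_var_lim t)) =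
      (CLINT \<omega>|M. iexp (a \<omega>) * complex_of_real (noise_var n \<omega> t) - iexp (a \<omega>) * complex_of_real (noise_var_lim t))"
      by (simp add: right_diff_distrib)
    also have "\<dots> = (CLINT \<omega>|M. iexp (a \<omega>) * complex_of_real (noise_var n \<omega> t)) - (CLINT \<omega>|M. iexp (a \<omega>) * complex_of_real (noise_var_lim t))"
      by (rule Bochner_Integration.integral_diff[OF I3(1) integrable_mult_left[OF i0]])
    finally show ?thesis by (simp add: cf_def a_def)
  qed
  have B1: "cmod (CLINT \<omega>|M. iexp (a \<omega>) * complex_of_real (noise_var n \<omega> t - noise_var_lim t)) \<le> 4 * (norm t)\<^sup>2 * (\<integral>\<omega>. cov_err n \<omega> \<partial>M)"
  proof -
    have "cmod (CLINT \<omega>|M. iexp (a \<omega>) * complex_of_real (noise_var n \<omega> t - noise_var_lim t)) \<le> (\<integral>\<omega>. 4 * (norm t)\<^sup>2 * cov_err n \<omega> \<partial>M)"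
    proof (rule integral_cmod_le)
      have "integrable M (\<lambda>\<omega>. iexp (a \<omega>) * complex_of_real (noise_var n \<omega> t) - iexp (a \<omega>) * complex_of_real (noise_var_lim t))"
        by (rule Bochner_Integration.integrable_diff[OF I3(1) integrable_mult_left[OF i0]])
      then show "integrable M (\<lambda>\<omega>. iexp (a \<omega>) * complex_of_real (noise_var n \<omega> t - noise_var_lim t))"
        by (simp add: right_diff_distrib)
      show "integrable M (\<lambda>\<omega>. 4 * (norm t)\<^sup>2 * cov_err n \<omega>)" by (intro integrable_mult_right cov_err_integrable)
      show "cmod (iexp (a \<omega>) * complex_of_real (noise_var n \<omega> t - noise_var_lim t)) \<le> 4 * (norm t)\<^sup>2 * cov_err n \<omega>" for \<omega>
        using noise_var_diff[of n \<omega> t] by (simp add: norm_mult del: of_real_diff)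
    qed
    then show ?thesis by simp
  qed
  have B2: "cmod (cf (Suc n) t - (CLINT \<omega>|M. ?T \<omega>)) \<le> (32 * moment + 32 * G_total ^ 3) * norm t ^ 3 / ((real n + 2) * ?s)"
  proof -
    have e: "iexp (t \<bullet> scaled (Suc n) \<omega>) = iexp (a \<omega>) * iexp (\<theta> \<omega>)" for \<omega>
      unfolding scaled_Suc a_def \<theta>_def by (simp add: distrib_left exp_add)
    have i2: "integrable M (\<lambda>\<omega>. iexp (a \<omega>) * iexp (\<theta> \<omega>))"
      by (rule integrable_const_bound[where B=1]) (auto simp: norm_mult)
    have "cf (Suc n) t - (CLINT \<omega>|M. ?T \<omega>) = (CLINT \<omega>|M. iexp (a \<omega>) * iexp (\<theta> \<omega>) - ?T \<omega>)"
      unfolding cf_def e by (rule Bochner_Integration.integral_diff[OF i2 Ti, symmetric])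
    also have "cmod \<dots> \<le> (\<integral>\<omega>. norm t ^ 3 / ((real n + 2) * ?s) * norm (noise n \<omega>) ^ 3 \<partial>M)"
    proof (rule integral_cmod_le)
      show "integrable M (\<lambda>\<omega>. iexp (a \<omega>) * iexp (\<theta> \<omega>) - ?T \<omega>)" by (rule Bochner_Integration.integrable_diff[OF i2 Ti])
      show "integrable M (\<lambda>\<omega>. norm t ^ 3 / ((real n + 2) * ?s) * norm (noise n \<omega>) ^ 3)"
        by (intro integrable_mult_right noise_cube)
      fix \<omega>
      have "iexp (a \<omega>) * iexp (\<theta> \<omega>) - ?T \<omega> = iexp (a \<omega>) * (iexp (\<theta> \<omega>) - (1 + \<i> * complex_of_real (\<theta> \<omega>) - complex_of_real ((\<theta> \<omega>)\<^sup>2 / 2)))"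
        by (rule right_diff_distrib[symmetric])
      then have "cmod (iexp (a \<omega>) * iexp (\<theta> \<omega>) - ?T \<omega>) = cmod (iexp (\<theta> \<omega>) - (1 + \<i> * complex_of_real (\<theta> \<omega>) - complex_of_real ((\<theta> \<omega>)\<^sup>2 / 2)))"
        by (simp only: norm_mult norm_exp_i_times mult_1)
      also have "\<dots> \<le> \<bar>\<theta> \<omega>\<bar> ^ 3 / 6" by (rule iexp_second_order)
      also have "\<dots> \<le> \<bar>\<theta> \<omega>\<bar> ^ 3" by simp
      also have "\<dots> \<le> (norm t * norm (noise n \<omega>) / ?s) ^ 3"
        unfolding \<theta>_def abs_divide using s Cauchy_Schwarz_ineq2[of t "noise n \<omega>"]
        by (intro power_mono) (auto intro!: divide_right_mono)
      also have "\<dots> = norm t ^ 3 / ((real n + 2) * ?s) * norm (noise n \<omega>) ^ 3"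
        using s(2) by (simp add: power_divide power_mult_distrib power3_eq_cube power2_eq_square)
      finally show "cmod (iexp (a \<omega>) * iexp (\<theta> \<omega>) - ?T \<omega>) \<le> norm t ^ 3 / ((real n + 2) * ?s) * norm (noise n \<omega>) ^ 3" .
    qed
    also have "\<dots> = norm t ^ 3 / ((real n + 2) * ?s) * (\<integral>\<omega>. norm (noise n \<omega>) ^ 3 \<partial>M)" by simp
    also have "\<dots> \<le> norm t ^ 3 / ((real n + 2) * ?s) * (32 * moment + 32 * G_total ^ 3)"
      by (intro mult_left_mono noise_cube) auto
    finally show ?thesis by (simp add: mult.commute)
  qed
  have "cf (Suc n) t - cf n (pull n t) * complex_of_real (1 - noise_var_lim t / (2 * (real n + 2))) =
     (cf (Suc n) t - (CLINT \<omega>|M. ?T \<omega>)) - ((CLINT \<omega>|M. iexp (a \<omega>) * complex_of_real (noise_var n \<omega> t)) - cf n (pull n t) * complex_of_real (noise_var_lim t)) / (2 * (real n + 2))"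
    unfolding ET by (simp add: right_diff_distrib diff_divide_distrib)
  then have "cmod (cf (Suc n) t - cf n (pull n t) * complex_of_real (1 - noise_var_lim t / (2 * (real n + 2)))) \<le>
     cmod (cf (Suc n) t - (CLINT \<omega>|M. ?T \<omega>)) + cmod ((CLINT \<omega>|M. iexp (a \<omega>) * complex_of_real (noise_var n \<omega> t - noise_var_lim t)) / (2 * (real n + 2)))"
    unfolding nvc by (simp only: norm_triangle_ineq4)
  also have "cmod ((CLINT \<omega>|M. iexp (a \<omega>) * complex_of_real (noise_var n \<omega> t - noise_var_lim t)) / (2 * (real n + 2))) \<le> 2 * (norm t)\<^sup>2 * (\<integral>\<omega>. cov_err n \<omega> \<partial>M) / (real n + 2)"
  proof -
    have c: "cmod (2 * (complex_of_real (real n) + 2)) = 2 * (real n + 2)"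
      by (metis (no_types, opaque_lifting) norm_of_real abs_of_nonneg of_real_add of_real_mult of_real_numeral of_nat_0_le_iff add_nonneg_nonneg mult_nonneg_nonneg zero_le_numeral)
    have "cmod (CLINT \<omega>|M. iexp (a \<omega>) * complex_of_real (noise_var n \<omega> t - noise_var_lim t)) / (2 * (real n + 2)) \<le> 4 * (norm t)\<^sup>2 * (\<integral>\<omega>. cov_err n \<omega> \<partial>M) / (2 * (real n + 2))"
      by (intro divide_right_mono B1) auto
    also have "4 * (norm t)\<^sup>2 * (\<integral>\<omega>. cov_err n \<omega> \<partial>M) / (2 * (real n + 2)) = 2 * (norm t)\<^sup>2 * (\<integral>\<omega>. cov_err n \<omega> \<partial>M) / (real n + 2)"
    proof -
      have "4 * x * y / (2 * w) = 2 * x * y / w" for x y w :: real by simp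
      then show ?thesis by this
    qed
    finally have le: "cmod (CLINT \<omega>|M. iexp (a \<omega>) * complex_of_real (noise_var n \<omega> t - noise_var_lim t)) / (2 * (real n + 2)) \<le> 2 * (norm t)\<^sup>2 * (\<integral>\<omega>. cov_err n \<omega> \<partial>M) / (real n + 2)" .
    have c': "cmod (z / (2 * (complex_of_real (real n) + 2))) = cmod z / (2 * (real n + 2))" for z
      unfolding norm_divide c by (rule refl)
    show ?thesis using le unfolding of_real_add of_real_mult of_real_numeral c' .
  qed
  finally show ?thesis using B2 by simp
qed

end

section \<open>The central limit theorem\<close>

context algorithm_gap
begin

text \<open>One step adds at most \<open>form_norm b' x * e n / (n + 1)\<close> to the error, with
  \<open>e n\<close> tending to 0. The induction carries a bound \<open>d * form_norm b' x\<close>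
  for all \<open>x\<close> in a ball simultaneously: \<open>pull n\<close> maps the ball into itself
  and shrinks the norm by \<open>1 - c / (n + 1)\<close>, so \<open>d\<close> satisfies a perturbed
  contraction. The weight can be afforded at the start because both functions equal 1 at the origin
  and are Lipschitz on the ball.\<close>

lemma cf_limit:
  obtains V where "transpose V = V" "\<And>t. 0 \<le> t \<bullet> (V *v t)"
    "\<And>t. (\<lambda>n. cf n t) \<longlonglongrightarrow> complex_of_real (exp (- (t \<bullet> (V *v t)) / 2))"
proof -
  have g1: "1 \<le> \<gamma>" by (rule gamma_ge_1)
  obtain \<Gamma> where Gam: "\<And>t. t \<bullet> (\<Gamma> *v t) = noise_var_lim t" using noise_var_lim_matrix by blast
  \<comment> \<open>To first order \<open>pull n t = t + B t / (n + 1)\<close>, where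
    \<open>1 / 2\<close> comes from the rescaling. The Lyapunov equation sets the derivative of
    \<open>q\<close> along \<open>B\<close> to \<open>- noise_var_lim t\<close>, which is the loss
    compensated by the noise.\<close>
  define B where "B = (1 / \<gamma>) *\<^sub>R K - (1 / 2) *\<^sub>R mat 1"
  have Bt: "B *v t = (1 / \<gamma>) *\<^sub>R (K *v t) - (1 / 2) *\<^sub>R t" for t
    by (simp add: B_def matrix_vector_mult_diff_rdistrib scaleR_matrix_vector_assoc[symmetric])
  have e: "1 / 2 - \<kappa> / \<gamma> > 0" using kap_gamma by linarith
  have stable: "b' (B *v t) t \<le> - (1 / 2 - \<kappa> / \<gamma>) * b' t t" for t
  proof -
    have "b' (B *v t) t = (1 / \<gamma>) * b' (K *v t) t - (1 / 2) * b' t t"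
      unfolding Bt by (simp only: inner_form_simps[OF b'])
    also have "\<dots> \<le> (1 / \<gamma>) * (\<kappa> * b' t t) - (1 / 2) * b' t t"
      using g1 b'K by (intro diff_right_mono mult_left_mono) auto
    finally show ?thesis by (simp add: algebra_simps)
  qed
  obtain V where V: "transpose V = V" "\<And>t. 2 * ((B *v t) \<bullet> (V *v t)) = - (t \<bullet> (\<Gamma> *v t))"
    using lyapunov_solution[OF b' e stable] by metis
  define q where "q t = t \<bullet> (V *v t)" for t
  define \<psi> where "\<psi> t = exp (- q t / 2)" for t
  let ?Q = noise_var_lim
  have Vsym: "x \<bullet> (V *v y) = y \<bullet> (V *v x)" for x y
    by (metis dot_lmul_matrix inner_commute transpose_matrix_vector V(1))
  \<comment> \<open>The identity is exact; its last term is of second order in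
    \<open>1 / n\<close>.\<close>
  have qpull: "q (pull n t) = q t - ?Q t / (real n + 2) + q (K *v t) / (\<gamma>\<^sup>2 * (real n + 1) * (real n + 2))" for n t
  proof -
    let ?h = "1 / (\<gamma> * (real n + 1))"
    have k: "2 * ((K *v t) \<bullet> (V *v t)) / \<gamma> = q t - ?Q t"
      using V(2)[of t] unfolding Bt Gam by (simp add: inner_diff_left q_def algebra_simps)
    have "q (pull n t) = (real n + 1) / (real n + 2) * q (t + ?h *\<^sub>R (K *v t))"
      by (simp add: q_def pull_def matrix_vector_mult_scaleR flip: mult.assoc)
    also have "q (t + ?h *\<^sub>R (K *v t)) = q t + ?h * (2 * ((K *v t) \<bullet> (V *v t))) + ?h\<^sup>2 * q (K *v t)"
      using Vsym[of t "K *v t"]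
      by (simp add: q_def matrix_vector_right_distrib matrix_vector_mult_scaleR inner_add_left inner_add_right power2_eq_square algebra_simps)
    also have "?h * (2 * ((K *v t) \<bullet> (V *v t))) = (q t - ?Q t) / (real n + 1)" by (simp flip: k)
    finally have 1: "q (pull n t) = (real n + 1) / (real n + 2) * (q t + (q t - ?Q t) / (real n + 1) + ?h\<^sup>2 * q (K *v t))" .
    have gen: "m / w * (a + (a - c) / m + (1 / (\<gamma> * m))\<^sup>2 * d) = (m + 1) / w * a - c / w + d / (\<gamma>\<^sup>2 * m * w)"
      if "m > 0" "w > 0" for m w a c d :: real
      using that g1 by (simp add: field_simps power2_eq_square)
    have "(real n + 1 + 1) / (real n + 2) = 1" by simp
    then show ?thesis unfolding 1 gen[of "real n + 1" "real n + 2" "q t" "?Q t" "q (K *v t)", simplified of_nat_0_le_iff add_nonneg_pos zero_less_one zero_less_numeral True_implies_equals] by (simp only: mult_1)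
  qed
  obtain cV where cV: "0 < cV" "\<And>t. \<bar>q t\<bar> \<le> cV * (norm t)\<^sup>2"
  proof -
    obtain c where c: "c > 0" "\<And>x. norm (V *v x) \<le> c * norm x"
      using linear_bounded_pos[OF matrix_vector_mul_linear[of V]] by blast
    have "\<bar>q t\<bar> \<le> c * (norm t)\<^sup>2" for t
    proof -
      have "\<bar>q t\<bar> \<le> norm t * norm (V *v t)" unfolding q_def by (rule Cauchy_Schwarz_ineq2)
      also have "\<dots> \<le> norm t * (c * norm t)" by (intro mult_left_mono c) auto
      finally show ?thesis by (simp add: power2_eq_square mult_ac)
    qed
    with c(1) show ?thesis by (intro that)
  qed
  obtain cK where cK: "cK > 0" "\<And>x. norm (K *v x) \<le> cK * norm x"
    using linear_bounded_pos[OF matrix_vector_mul_linear[of K]] by blast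
  define cP where "cP = cV * cK\<^sup>2"
  have cP: "0 < cP" "\<bar>q (K *v t)\<bar> \<le> cP * (norm t)\<^sup>2" for t
  proof -
    show "0 < cP" using cV cK by (simp add: cP_def)
    have "\<bar>q (K *v t)\<bar> \<le> cV * (norm (K *v t))\<^sup>2" by (rule cV(2))
    also have "\<dots> \<le> cV * (cK * norm t)\<^sup>2" using cV(1) cK by (intro mult_left_mono power_mono) auto
    finally show "\<bar>q (K *v t)\<bar> \<le> cP * (norm t)\<^sup>2" by (simp add: cP_def power_mult_distrib)
  qed
  obtain cQ where cQ: "0 \<le> cQ" "\<And>t. \<bar>?Q t\<bar> \<le> cQ * (norm t)\<^sup>2" using noise_var_lim_le by blast
  obtain CE where CE: "0 \<le> CE"
    and Euler: "\<And>h x. 0 \<le> h \<Longrightarrow> 0 \<le> \<kappa> \<Longrightarrow> form_norm b' (x + h *\<^sub>R (K *v x)) \<le> (1 + h * \<kappa> + CE * h\<^sup>2) * form_norm b' x"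
    using form_norm_Euler_step[OF b' matrix_vector_mul_linear[of K] b'K] by metis
  define \<rho> where "\<rho> = (\<kappa> / \<gamma> + 1 / 2) / 2"
  have "(k + 1 / 2) / 2 < 1 / 2 \<and> 0 \<le> (k + 1 / 2) / 2 \<and> k < (k + 1 / 2) / 2" if "0 \<le> k" "k < 1 / 2" for k :: real
    using that by auto
  from this[OF kap_gamma] have rho: "\<rho> < 1 / 2" "0 \<le> \<rho>" "\<kappa> / \<gamma> < \<rho>" by (simp_all only: \<rho>_def)
  define c where "c = (1 / 2 - \<rho>) / 2"
  have c: "0 < c" "c \<le> 1 / 2" using rho by (simp_all add: c_def)
  have "\<forall>\<^sub>F n in sequentially. \<forall>t. form_norm b' (pull n t) \<le> (1 - c / (real n + 1)) * form_norm b' t"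
  proof -
    have "(\<lambda>n. CE / \<gamma>\<^sup>2 / (real n + 1)) \<longlonglongrightarrow> 0" by real_asymp
    then have "\<forall>\<^sub>F n in sequentially. CE / \<gamma>\<^sup>2 / (real n + 1) < \<rho> - \<kappa> / \<gamma>" using rho by (intro order_tendstoD(2)) auto
    then show ?thesis using sqrt_ratio_contracts[OF rho(1)]
    proof eventually_elim
      case (elim n)
      show ?case
      proof
        fix t
        let ?h = "1 / (\<gamma> * (real n + 1))"
        have h0: "0 \<le> ?h" using g1 by simp
        have "?h * \<kappa> + CE * ?h\<^sup>2 = (\<kappa> / \<gamma> + CE / \<gamma>\<^sup>2 / (real n + 1)) / (real n + 1)"
          by (simp add: power2_eq_square add_divide_distrib mult_ac)
        also have "\<dots> \<le> \<rho> / (real n + 1)" using elim(1) by (intro divide_right_mono) auto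
        finally have le: "1 + ?h * \<kappa> + CE * ?h\<^sup>2 \<le> 1 + \<rho> / (real n + 1)" by simp
        have "form_norm b' (pull n t) = sqrt ((real n + 1) / (real n + 2)) * form_norm b' (t + ?h *\<^sub>R (K *v t))"
          unfolding pull_def form_norm_scaleR[OF b'] by simp
        also have "\<dots> \<le> sqrt ((real n + 1) / (real n + 2)) * ((1 + \<rho> / (real n + 1)) * form_norm b' t)"
          by (intro mult_left_mono order_trans[OF Euler[OF h0 kap(2)]] mult_right_mono le form_norm_nonneg[OF b']) auto
        also have "\<dots> = (sqrt ((real n + 1) / (real n + 2)) * (1 + \<rho> / (real n + 1))) * form_norm b' t" by simp
        also have "\<dots> \<le> (1 - c / (real n + 1)) * form_norm b' t"
          unfolding c_def by (intro mult_right_mono elim(2) form_norm_nonneg[OF b'])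
        finally show "form_norm b' (pull n t) \<le> (1 - c / (real n + 1)) * form_norm b' t" .
      qed
    qed
  qed
  then obtain n1 where n1: "\<And>n t. n \<ge> n1 \<Longrightarrow> form_norm b' (pull n t) \<le> (1 - c / (real n + 1)) * form_norm b' t"
    by (auto simp: eventually_sequentially)
  have lim: "(\<lambda>n. cf n t) \<longlonglongrightarrow> complex_of_real (\<psi> t)" for t
  proof -
    define R where "R = form_norm b' t + 1"
    have R: "1 \<le> R" using form_norm_nonneg[OF b', of t] by (simp add: R_def)
    define M3 where "M3 = 32 * moment + 32 * G_total ^ 3"
    have M3: "0 \<le> M3" using tau_moments(5) mean_tau_bounds[of 0 undefined] by (simp add: M3_def)
    \<comment> \<open>Semidefiniteness of \<open>V\<close> is still open at this stage, so
      \<open>\<psi>\<close> is bounded on the ball through the estimate for the modulus of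
      \<open>q\<close>.\<close>
    define Mp where "Mp = exp (cV * R\<^sup>2 / 2)"
    have Mp: "0 < Mp" by (simp add: Mp_def)
    define Cp where "Cp = 6 * Mp * (R * (cP / 2 + cQ\<^sup>2 * R\<^sup>2 / 4))"
    have Cp: "0 \<le> Cp" using Mp R cP(1) by (simp add: Cp_def)
    \<comment> \<open>The three parts come from the covariance error, the third moments and the
      second order terms of the Gaussian. A factor \<open>form_norm b' x\<close> has been taken out
      of each, the remaining powers being bounded by powers of \<open>R\<close>.\<close>
    define e where "e n = 2 * R * (\<integral>\<omega>. cov_err n \<omega> \<partial>M) + M3 * R\<^sup>2 / sqrt (real n + 1) + Cp / (real n + 1)" for n
    have Ew: "0 \<le> (\<integral>\<omega>. cov_err n \<omega> \<partial>M)" for n by (intro integral_nonneg_AE) (simp add: cov_err_nonneg)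
    have e0: "0 \<le> e n" for n using R M3 Cp Ew[of n] by (simp add: e_def)
    have elim0: "e \<longlonglongrightarrow> 0"
    proof -
      have 1: "(\<lambda>n. M3 * R\<^sup>2 / sqrt (real n + 1)) \<longlonglongrightarrow> 0" by real_asymp
      have 2: "(\<lambda>n. Cp / (real n + 1)) \<longlonglongrightarrow> 0" by real_asymp
      have "e \<longlonglongrightarrow> 2 * R * 0 + 0 + 0"
        unfolding e_def[abs_def] by (intro tendsto_add 1 2 tendsto_mult_left cov_err_tendsto_0)
      then show ?thesis by simp
    qed
    have "(\<lambda>n. (cQ * R\<^sup>2 + cP * R\<^sup>2) / (real n + 1)) \<longlonglongrightarrow> 0" by real_asymp
    then have "\<forall>\<^sub>F n in sequentially. (cQ * R\<^sup>2 + cP * R\<^sup>2) / (real n + 1) < 1 / 2" by (intro order_tendstoD(2)) auto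
    then obtain n2 where n2: "\<And>n. n \<ge> n2 \<Longrightarrow> (cQ * R\<^sup>2 + cP * R\<^sup>2) / (real n + 1) < 1 / 2" by (auto simp: eventually_sequentially)
    define start where "start = max n1 n2"
    have psi_le: "\<psi> x \<le> Mp" if x: "form_norm b' x \<le> R" for x
    proof -
      have "norm x \<le> R" using norm_le_form_norm[OF b', of x] x by simp
      then have "cV * (norm x)\<^sup>2 \<le> cV * R\<^sup>2" using cV(1) by (intro mult_left_mono power_mono) auto
      then have "- q x / 2 \<le> cV * R\<^sup>2 / 2" using cV(2)[of x] by linarith
      then show ?thesis by (simp add: \<psi>_def Mp_def)
    qed
    have main_step: "cmod (cf (Suc n) x - complex_of_real (\<psi> x)) \<le> cmod (cf n (pull n x) - complex_of_real (\<psi> (pull n x))) + form_norm b' x * (e n / (real n + 1))"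
      if n: "n \<ge> start" and x: "form_norm b' x \<le> R" for n x
    proof -
      let ?N = "form_norm b' x"
      define s where "s = ?Q x / (2 * (real n + 2))"
      define p where "p = q (K *v x) / (2 * (\<gamma>\<^sup>2 * (real n + 1) * (real n + 2)))"
      have N0: "0 \<le> ?N" by (rule form_norm_nonneg[OF b'])
      have xN: "norm x \<le> ?N" by (rule norm_le_form_norm[OF b'])
      have x2: "(norm x)\<^sup>2 \<le> ?N\<^sup>2" "?N\<^sup>2 \<le> R\<^sup>2" using xN x N0 by (auto intro!: power_mono)
      have Q0: "0 \<le> ?Q x" by (rule noise_var_lim_nonneg)
      have Qb: "?Q x \<le> cQ * ?N\<^sup>2" using cQ(2)[of x] mult_left_mono[OF x2(1) cQ(1)] by linarith
      have s0: "0 \<le> s" using Q0 by (simp add: s_def)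
      have sb: "s \<le> cQ * ?N\<^sup>2 / (2 * (real n + 1))"
      proof -
        have "s \<le> cQ * ?N\<^sup>2 / (2 * (real n + 2))" unfolding s_def using Qb by (intro divide_right_mono) auto
        also have "\<dots> \<le> cQ * ?N\<^sup>2 / (2 * (real n + 1))" using cQ by (intro divide_left_mono) auto
        finally show ?thesis .
      qed
      have pb: "\<bar>p\<bar> \<le> cP * ?N\<^sup>2 / (2 * (real n + 1)\<^sup>2)"
      proof -
        have "\<bar>p\<bar> = \<bar>q (K *v x)\<bar> / (2 * (\<gamma>\<^sup>2 * (real n + 1) * (real n + 2)))" by (simp add: p_def abs_divide abs_mult)
        also have "\<dots> \<le> (cP * ?N\<^sup>2) / (2 * (real n + 1)\<^sup>2)"
        proof (rule frac_le)
          show "\<bar>q (K *v x)\<bar> \<le> cP * ?N\<^sup>2" using cP(2)[of x] mult_left_mono[OF x2(1) less_imp_le[OF cP(1)]] by linarith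
          have "1 * (real n + 1) * (real n + 1) \<le> \<gamma>\<^sup>2 * (real n + 1) * (real n + 2)"
            using g1 by (intro mult_mono) auto
          then show "2 * (real n + 1)\<^sup>2 \<le> 2 * (\<gamma>\<^sup>2 * (real n + 1) * (real n + 2))" by (simp add: power2_eq_square)
        qed (use cP in auto)
        finally show ?thesis .
      qed
      have nb: "(cQ * R\<^sup>2 + cP * R\<^sup>2) / (real n + 1) < 1 / 2" using n2[of n] n by (simp add: start_def)
      have s_half: "s \<le> 1 / 2"
      proof -
        have "s \<le> cQ * ?N\<^sup>2 / (2 * (real n + 1))" by (rule sb)
        also have "\<dots> \<le> (cQ * R\<^sup>2 + cP * R\<^sup>2) / (real n + 1)"
          using add_increasing2[OF _ mult_left_mono[OF x2(2) cQ(1)], of "cP * R\<^sup>2"] cQ(1) cP(1) by (intro frac_le) auto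
        finally show ?thesis using nb by linarith
      qed
      have p_half: "\<bar>p\<bar> \<le> 1 / 2"
      proof -
        have "\<bar>p\<bar> \<le> cP * ?N\<^sup>2 / (2 * (real n + 1)\<^sup>2)" by (rule pb)
        also have "\<dots> \<le> (cQ * R\<^sup>2 + cP * R\<^sup>2) / (real n + 1)"
        proof (rule frac_le)
          have "cP * ?N\<^sup>2 \<le> cP * R\<^sup>2" using x2(2) cP(1) by (intro mult_left_mono) auto
          moreover have "0 \<le> cQ * R\<^sup>2" using cQ by simp
          ultimately show "cP * ?N\<^sup>2 \<le> cQ * R\<^sup>2 + cP * R\<^sup>2" by linarith
          show "0 \<le> cQ * R\<^sup>2 + cP * R\<^sup>2" using cQ cP(1) by simp
          have "1 * (real n + 1) \<le> (2 * (real n + 1)) * (real n + 1)" by (intro mult_right_mono) auto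
          then show "real n + 1 \<le> 2 * (real n + 1)\<^sup>2" by (simp add: power2_eq_square)
        qed auto
        finally show ?thesis using nb by linarith
      qed
      have psi_pull: "\<psi> (pull n x) = \<psi> x * exp (s - p)"
      proof -
        have "- q (pull n x) / 2 = - q x / 2 + (s - p)" unfolding qpull s_def p_def
          by (simp add: diff_divide_distrib add_divide_distrib mult_ac)
        then show ?thesis unfolding \<psi>_def by (simp only: exp_add)
      qed
      have psi_err: "\<bar>\<psi> (pull n x) * (1 - s) - \<psi> x\<bar> \<le> ?N * (Cp / (real n + 1)\<^sup>2)"
      proof -
        have "\<psi> (pull n x) * (1 - s) - \<psi> x = \<psi> x * (exp (s - p) * (1 - s) - 1)"
          unfolding psi_pull by (simp add: algebra_simps)
        then have "\<bar>\<psi> (pull n x) * (1 - s) - \<psi> x\<bar> = \<psi> x * \<bar>exp (s - p) * (1 - s) - 1\<bar>"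
          by (simp add: abs_mult \<psi>_def)
        also have "\<dots> \<le> Mp * (6 * (\<bar>p\<bar> + s\<^sup>2))"
          using psi_le[OF x] Mp s0 s_half p_half by (intro mult_mono exp_times_one_minus) auto
        also have "\<bar>p\<bar> + s\<^sup>2 \<le> ?N * (R * (cP / 2 + cQ\<^sup>2 * R\<^sup>2 / 4)) / (real n + 1)\<^sup>2"
        proof -
          have NR: "?N\<^sup>2 \<le> ?N * R" using x N0 by (simp add: power2_eq_square mult_left_mono)
          have "s\<^sup>2 \<le> (cQ * ?N\<^sup>2 / (2 * (real n + 1)))\<^sup>2" using sb s0 by (intro power_mono) auto
          also have "\<dots> = (cQ\<^sup>2 / 4) * (?N\<^sup>2 * ?N\<^sup>2) / (real n + 1)\<^sup>2"
            unfolding power_divide power_mult_distrib by (simp add: power2_eq_square)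
          also have "\<dots> \<le> (cQ\<^sup>2 / 4) * (?N * R * R\<^sup>2) / (real n + 1)\<^sup>2"
            using NR x2(2) N0 R by (intro divide_right_mono mult_left_mono mult_mono) auto
          finally have 1: "s\<^sup>2 \<le> (cQ\<^sup>2 / 4) * (?N * R * R\<^sup>2) / (real n + 1)\<^sup>2" .
          have "\<bar>p\<bar> \<le> (cP / 2) * ?N\<^sup>2 / (real n + 1)\<^sup>2" using pb by simp
          also have "\<dots> \<le> (cP / 2) * (?N * R) / (real n + 1)\<^sup>2" using NR cP(1) by (intro divide_right_mono mult_left_mono) auto
          finally have 2: "\<bar>p\<bar> \<le> (cP / 2) * (?N * R) / (real n + 1)\<^sup>2" .
          have "(cP / 2) * (?N * R) / (real n + 1)\<^sup>2 + (cQ\<^sup>2 / 4) * (?N * R * R\<^sup>2) / (real n + 1)\<^sup>2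
             = ?N * (R * (cP / 2 + cQ\<^sup>2 * R\<^sup>2 / 4)) / (real n + 1)\<^sup>2"
            by (simp add: add_divide_distrib distrib_left mult_ac)
          with 1 2 show ?thesis by linarith
        qed
        finally show ?thesis using Mp by (simp add: Cp_def mult_ac)
      qed
      have cferr: "cmod (cf (Suc n) x - cf n (pull n x) * complex_of_real (1 - s)) \<le> ?N * ((2 * R * (\<integral>\<omega>. cov_err n \<omega> \<partial>M) + M3 * R\<^sup>2 / sqrt (real n + 1)) / (real n + 1))"
      proof -
        have "cmod (cf (Suc n) x - cf n (pull n x) * complex_of_real (1 - s)) \<le> 2 * (norm x)\<^sup>2 * (\<integral>\<omega>. cov_err n \<omega> \<partial>M) / (real n + 2)
           + M3 * norm x ^ 3 / ((real n + 2) * sqrt (real n + 2))"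
          unfolding s_def M3_def by (rule cf_Suc)
        also have "2 * (norm x)\<^sup>2 * (\<integral>\<omega>. cov_err n \<omega> \<partial>M) / (real n + 2) \<le> 2 * (?N * R) * (\<integral>\<omega>. cov_err n \<omega> \<partial>M) / (real n + 1)"
        proof (rule frac_le)
          have "(norm x)\<^sup>2 \<le> ?N * R" using x2(1) x N0 by (simp add: power2_eq_square) (meson mult_left_mono order_trans)
          then show "2 * (norm x)\<^sup>2 * (\<integral>\<omega>. cov_err n \<omega> \<partial>M) \<le> 2 * (?N * R) * (\<integral>\<omega>. cov_err n \<omega> \<partial>M)"
            using Ew[of n] by (intro mult_right_mono mult_left_mono) auto
        qed (use N0 R Ew[of n] in auto)
        also have "M3 * norm x ^ 3 / ((real n + 2) * sqrt (real n + 2)) \<le> M3 * (?N * R\<^sup>2) / ((real n + 1) * sqrt (real n + 1))"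
        proof (rule frac_le)
          have "norm x ^ 3 \<le> ?N ^ 3" using xN by (intro power_mono) auto
          also have "\<dots> = ?N * ?N\<^sup>2" by (simp add: power3_eq_cube power2_eq_square)
          also have "\<dots> \<le> ?N * R\<^sup>2" using x2(2) N0 by (intro mult_left_mono) auto
          finally show "M3 * norm x ^ 3 \<le> M3 * (?N * R\<^sup>2)" using M3 by (intro mult_left_mono) auto
          show "(real n + 1) * sqrt (real n + 1) \<le> (real n + 2) * sqrt (real n + 2)" by (intro mult_mono) auto
        qed (use M3 N0 in auto)
        also have "2 * (?N * R) * (\<integral>\<omega>. cov_err n \<omega> \<partial>M) / (real n + 1) + M3 * (?N * R\<^sup>2) / ((real n + 1) * sqrt (real n + 1))
          = ?N * ((2 * R * (\<integral>\<omega>. cov_err n \<omega> \<partial>M) + M3 * R\<^sup>2 / sqrt (real n + 1)) / (real n + 1))"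
          by (simp add: add_divide_distrib distrib_left mult_ac)
        finally show ?thesis by simp
      qed
      have "cf (Suc n) x - complex_of_real (\<psi> x) = (cf (Suc n) x - cf n (pull n x) * complex_of_real (1 - s))
         + (cf n (pull n x) - complex_of_real (\<psi> (pull n x))) * complex_of_real (1 - s)
         + complex_of_real (\<psi> (pull n x) * (1 - s) - \<psi> x)"
        by (simp add: algebra_simps)
      then have "cmod (cf (Suc n) x - complex_of_real (\<psi> x)) \<le> cmod (cf (Suc n) x - cf n (pull n x) * complex_of_real (1 - s))
         + cmod ((cf n (pull n x) - complex_of_real (\<psi> (pull n x))) * complex_of_real (1 - s))
         + cmod (complex_of_real (\<psi> (pull n x) * (1 - s) - \<psi> x))"
        by (metis (no_types, lifting) norm_triangle_mono norm_triangle_ineq order_refl)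
      also have "cmod ((cf n (pull n x) - complex_of_real (\<psi> (pull n x))) * complex_of_real (1 - s)) \<le> cmod (cf n (pull n x) - complex_of_real (\<psi> (pull n x))) * 1"
        unfolding norm_mult using s0 s_half by (intro mult_left_mono) (auto simp: norm_of_real simp del: of_real_diff)
      also have "cmod (complex_of_real (\<psi> (pull n x) * (1 - s) - \<psi> x)) \<le> ?N * (Cp / (real n + 1)\<^sup>2)"
        using psi_err by (simp only: norm_of_real)
      finally have "cmod (cf (Suc n) x - complex_of_real (\<psi> x)) \<le> cmod (cf n (pull n x) - complex_of_real (\<psi> (pull n x)))
        + (?N * ((2 * R * (\<integral>\<omega>. cov_err n \<omega> \<partial>M) + M3 * R\<^sup>2 / sqrt (real n + 1)) / (real n + 1)) + ?N * (Cp / (real n + 1)\<^sup>2))"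
        using cferr by linarith
      also have "?N * ((2 * R * (\<integral>\<omega>. cov_err n \<omega> \<partial>M) + M3 * R\<^sup>2 / sqrt (real n + 1)) / (real n + 1)) + ?N * (Cp / (real n + 1)\<^sup>2)
        = ?N * (e n / (real n + 1))"
        by (simp add: e_def add_divide_distrib distrib_left power2_eq_square)
      finally show ?thesis .
    qed
    \<comment> \<open>Lipschitz constants at the origin of \<open>cf start\<close> and, on the ball,
      of \<open>\<psi>\<close>.\<close>
    define d0 where "d0 = (\<integral>\<omega>. norm (scaled start \<omega>) \<partial>M) + cV * R * Mp"
    define d where "d = rec_nat d0 (\<lambda>k y. (1 - c / (real (start + k) + 1)) * y + e (start + k) / (real (start + k) + 1))"
    have d_0: "d 0 = d0" and d_Suc: "d (Suc k) = (1 - c / (real (start + k) + 1)) * d k + e (start + k) / (real (start + k) + 1)" for k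
      by (simp_all add: d_def)
    have c_le: "0 \<le> 1 - c / (real n + 1)" for n
    proof -
      have "c / (real n + 1) \<le> c / 1" using c by (intro divide_left_mono) auto
      then show ?thesis using c by simp
    qed
    have d0n: "0 \<le> d0" using cV(1) R Mp by (auto simp: d0_def intro!: add_nonneg_nonneg integral_nonneg_AE)
    have dn: "0 \<le> d k" for k
    proof (induction k)
      case (Suc k)
      then show ?case unfolding d_Suc using c_le[of "start + k"] e0[of "start + k"]
        by (intro add_nonneg_nonneg mult_nonneg_nonneg) auto
    qed (simp add: d_0 d0n)
    have base: "cmod (cf start x - complex_of_real (\<psi> x)) \<le> d 0 * form_norm b' x" if x: "form_norm b' x \<le> R" for x
    proof -
      let ?N = "form_norm b' x"
      have N0: "0 \<le> ?N" by (rule form_norm_nonneg[OF b'])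
      have xN: "norm x \<le> ?N" by (rule norm_le_form_norm[OF b'])
      have sc: "integrable M (\<lambda>\<omega>. norm (scaled start \<omega>))"
      proof -
        obtain D where D: "integrable M (\<lambda>\<omega>. b (xt start \<omega>) (xt start \<omega>))" using xt_second_moment by metis
        have "integrable M (\<lambda>\<omega>. (norm (scaled start \<omega>))\<^sup>2)"
        proof (rule Bochner_Integration.integrable_bound[OF D])
          have "(norm (scaled start \<omega>))\<^sup>2 \<le> b (xt start \<omega>) (xt start \<omega>)" for \<omega>
          proof -
            have "norm (scaled start \<omega>) \<le> norm (xt start \<omega>)" by (simp add: scaled_def divide_le_eq mult_right_le_one_le real_le_rsqrt mult_le_cancel_left1)
            then have "(norm (scaled start \<omega>))\<^sup>2 \<le> (norm (xt start \<omega>))\<^sup>2" by (intro power_mono) auto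
            then show ?thesis using inner_form_ge[OF b, of "xt start \<omega>"] by linarith
          qed
          then show "AE \<omega> in M. norm ((norm (scaled start \<omega>))\<^sup>2) \<le> norm (b (xt start \<omega>) (xt start \<omega>))"
            by (auto intro!: AE_I2 order_trans[OF _ abs_ge_self])
        qed simp
        from integrable_mult_L2[OF _ _ this, of "\<lambda>_. 1"] show ?thesis by simp
      qed
      have "cmod (cf start x - 1) \<le> ?N * (\<integral>\<omega>. norm (scaled start \<omega>) \<partial>M)"
      proof -
        have "cf start x - 1 = (CLINT \<omega>|M. iexp (x \<bullet> scaled start \<omega>) - 1)"
          unfolding cf_def
          by (subst Bochner_Integration.integral_diff) (auto simp: prob_space intro!: integrable_const_bound[where B=1])
        also have "cmod \<dots> \<le> (\<integral>\<omega>. ?N * norm (scaled start \<omega>) \<partial>M)"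
        proof (rule integral_cmod_le)
          show "integrable M (\<lambda>\<omega>. iexp (x \<bullet> scaled start \<omega>) - 1)"
            by (intro Bochner_Integration.integrable_diff) (auto intro!: integrable_const_bound[where B=1])
          show "integrable M (\<lambda>\<omega>. ?N * norm (scaled start \<omega>))" by (intro integrable_mult_right sc)
          fix \<omega>
          have "cmod (iexp (x \<bullet> scaled start \<omega>) - 1) \<le> \<bar>x \<bullet> scaled start \<omega>\<bar>"
            using iexp_approx1[of "x \<bullet> scaled start \<omega>" 0] by simp
          also have "\<dots> \<le> norm x * norm (scaled start \<omega>)" by (rule Cauchy_Schwarz_ineq2)
          also have "\<dots> \<le> ?N * norm (scaled start \<omega>)" by (intro mult_right_mono xN) auto
          finally show "cmod (iexp (x \<bullet> scaled start \<omega>) - 1) \<le> ?N * norm (scaled start \<omega>)" .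
        qed
        finally show ?thesis by simp
      qed
      moreover have "\<bar>\<psi> x - 1\<bar> \<le> ?N * (cV * R * Mp)"
      proof -
        define y where "y = - q x / 2"
        have x2: "(norm x)\<^sup>2 \<le> ?N * R" using xN x N0 by (simp add: power2_eq_square mult_mono)
        have qx: "\<bar>q x\<bar> \<le> cV * (?N * R)" using cV(2)[of x] mult_left_mono[OF x2 less_imp_le[OF cV(1)]] by linarith
        have "\<bar>exp y - 1\<bar> \<le> \<bar>y\<bar> * Mp"
        proof (cases "0 \<le> y")
          case True
          have "1 - y \<le> exp (- y)" using exp_ge_add_one_self[of "- y"] by simp
          then have "exp y * (1 - y) \<le> exp y * exp (- y)" by (intro mult_left_mono) auto
          then have "exp y - 1 \<le> y * exp y" by (simp add: exp_minus algebra_simps)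
          also have "\<dots> \<le> y * Mp" using psi_le[OF x] True by (intro mult_left_mono) (auto simp: \<psi>_def y_def)
          finally show ?thesis using True by simp
        next
          case False
          have "1 \<le> Mp" unfolding Mp_def using cV(1) by simp
          then have "\<bar>y\<bar> * 1 \<le> \<bar>y\<bar> * Mp" by (intro mult_left_mono) auto
          moreover have "exp y \<le> 1" using False by simp
          ultimately show ?thesis using exp_ge_add_one_self[of y] False by linarith
        qed
        also have "\<bar>y\<bar> * Mp \<le> (cV * (?N * R)) * Mp" using qx Mp by (intro mult_right_mono) (auto simp: y_def)
        finally show ?thesis by (simp add: \<psi>_def y_def mult_ac)
      qed
      moreover have "cmod (cf start x - complex_of_real (\<psi> x)) \<le> cmod (cf start x - 1) + \<bar>\<psi> x - 1\<bar>"
      proof -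
        have "cf start x - complex_of_real (\<psi> x) = (cf start x - 1) - complex_of_real (\<psi> x - 1)" by simp
        then show ?thesis by (metis norm_of_real norm_triangle_ineq4)
      qed
      moreover have "d 0 * ?N = ?N * (\<integral>\<omega>. norm (scaled start \<omega>) \<partial>M) + ?N * (cV * R * Mp)"
        unfolding d_0 d0_def distrib_right by (simp only: mult_ac)
      ultimately show ?thesis by linarith
    qed
    have all: "cmod (cf (start + k) x - complex_of_real (\<psi> x)) \<le> d k * form_norm b' x" if x: "form_norm b' x \<le> R" for k x
      using x
    proof (induction k arbitrary: x)
      case 0
      then show ?case using base by simp
    next
      case (Suc k)
      let ?n = "start + k"
      have N0: "0 \<le> form_norm b' x" by (rule form_norm_nonneg[OF b'])
      have pl: "form_norm b' (pull ?n x) \<le> (1 - c / (real ?n + 1)) * form_norm b' x" by (rule n1) (simp add: start_def)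
      also have "\<dots> \<le> 1 * form_norm b' x" using c N0 by (intro mult_right_mono) auto
      finally have plR: "form_norm b' (pull ?n x) \<le> R" using Suc.prems by simp
      have "cmod (cf (Suc ?n) x - complex_of_real (\<psi> x)) \<le> cmod (cf ?n (pull ?n x) - complex_of_real (\<psi> (pull ?n x))) + form_norm b' x * (e ?n / (real ?n + 1))"
        by (rule main_step) (use Suc.prems in auto)
      also have "cmod (cf ?n (pull ?n x) - complex_of_real (\<psi> (pull ?n x))) \<le> d k * form_norm b' (pull ?n x)" by (rule Suc.IH[OF plR])
      also have "d k * form_norm b' (pull ?n x) \<le> d k * ((1 - c / (real ?n + 1)) * form_norm b' x)" by (intro mult_left_mono pl dn)
      also have "d k * ((1 - c / (real ?n + 1)) * form_norm b' x) + form_norm b' x * (e ?n / (real ?n + 1)) = d (Suc k) * form_norm b' x"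
        unfolding d_Suc distrib_right by (simp only: mult_ac)
      finally show ?case by simp
    qed
    define y where "y n = (if n < start then 0 else d (n - start))" for n
    have "y \<longlonglongrightarrow> 0"
    proof (rule contraction_tendsto_0[OF c(1) _ elim0])
      show "0 \<le> y n" for n using dn by (simp add: y_def)
      show "y (Suc n) \<le> (1 - c / (real n + 1)) * y n + e n / (real n + 1)" if "start \<le> n" for n
        using that d_Suc[of "n - start"] by (simp add: y_def Suc_diff_le)
    qed
    then have y0: "(\<lambda>n. y n * form_norm b' t) \<longlonglongrightarrow> 0" using tendsto_mult_left_zero by blast
    have "(\<lambda>n. cf n t - complex_of_real (\<psi> t)) \<longlonglongrightarrow> 0"
    proof (rule Lim_null_comparison[OF _ y0], rule eventually_sequentiallyI[of start])
      fix n assume "start \<le> n"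
      then show "norm (cf n t - complex_of_real (\<psi> t)) \<le> y n * form_norm b' t"
        using all[of t "n - start"] by (simp add: y_def R_def)
    qed
    then show ?thesis by (rule LIM_zero_cancel)
  qed
  \<comment> \<open>Characteristic functions have modulus at most 1, so
    \<open>\<psi> t \<le> 1\<close>; positive semidefiniteness of \<open>V\<close> is read off from
    the limit.\<close>
  have "0 \<le> q t" for t
  proof -
    have "(\<lambda>n. cmod (cf n t)) \<longlonglongrightarrow> cmod (complex_of_real (\<psi> t))" by (intro tendsto_norm lim)
    moreover have "cmod (cf n t) \<le> 1" for n
    proof -
      have "cmod (cf n t) \<le> (\<integral>\<omega>. 1 \<partial>M)"
        unfolding cf_def by (rule integral_cmod_le) (auto intro!: integrable_const_bound[where B=1])
      then show ?thesis by (simp add: prob_space)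
    qed
    ultimately have "cmod (complex_of_real (\<psi> t)) \<le> 1" by (intro LIMSEQ_le_const2) auto
    then show ?thesis by (simp add: \<psi>_def)
  qed
  with V(1) lim show ?thesis unfolding \<psi>_def q_def by (intro that)
qed

end

text \<open>Slutsky's theorem for a perturbation that is small in truncated mean only.
  Characteristic functions tolerate this because \<open>cmod (iexp a - 1)\<close> is bounded both by
  2 and by the modulus of \<open>a\<close>; tightness of \<open>Y\<close> comes from Chebyshev's
  inequality for \<open>Z\<close> and a shift of the radius by 1.\<close>

lemma (in prob_space) converges_in_distribution_perturbed:
  fixes Y Z :: "nat \<Rightarrow> 'a \<Rightarrow> 'v::euclidean_space"
  assumes Y [measurable]: "\<And>n. Y n \<in> borel_measurable M" and Z [measurable]: "\<And>n. Z n \<in> borel_measurable M"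
    and N: "prob_space N" "sets N = sets borel"
    and Z_int: "\<And>n. integrable M (\<lambda>\<omega>. (norm (Z n \<omega>))\<^sup>2)" and Z_bound: "\<And>n. (\<integral>\<omega>. (norm (Z n \<omega>))\<^sup>2 \<partial>M) \<le> D"
    and Z_lim: "\<And>t. (\<lambda>n. CLINT \<omega>|M. iexp (t \<bullet> Z n \<omega>)) \<longlonglongrightarrow> (CLINT x|N. iexp (t \<bullet> x))"
    and diff: "(\<lambda>n. \<integral>\<omega>. min 1 (norm (Y n \<omega> - Z n \<omega>)) \<partial>M) \<longlonglongrightarrow> 0"
  shows "converges_in_distribution M Y N"
proof -
  let ?E = "\<lambda>n. \<integral>\<omega>. min 1 (norm (Y n \<omega> - Z n \<omega>)) \<partial>M"
  have Ei: "integrable M (\<lambda>\<omega>. min 1 (norm (Y n \<omega> - Z n \<omega>)))" for n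
    by (rule integrable_const_bound[where B=1]) auto
  have "0 \<le> (\<integral>\<omega>. (norm (Z 0 \<omega>))\<^sup>2 \<partial>M)" by (intro integral_nonneg_AE) auto
  then have D: "0 \<le> D" using Z_bound[of 0] by linarith
  have char: "(\<lambda>n. CLINT \<omega>|M. iexp (t \<bullet> Y n \<omega>)) \<longlonglongrightarrow> (CLINT x|N. iexp (t \<bullet> x))" for t
  proof -
    have ii: "integrable M (\<lambda>\<omega>. iexp (t \<bullet> W \<omega>))" if "W \<in> borel_measurable M" for W
      using that by (intro integrable_const_bound[where B=1]) auto
    have le: "cmod ((CLINT \<omega>|M. iexp (t \<bullet> Y n \<omega>)) - (CLINT \<omega>|M. iexp (t \<bullet> Z n \<omega>))) \<le> (2 + norm t) * ?E n" for n
    proof -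
      have "cmod (CLINT \<omega>|M. iexp (t \<bullet> Y n \<omega>) - iexp (t \<bullet> Z n \<omega>)) \<le> (\<integral>\<omega>. (2 + norm t) * min 1 (norm (Y n \<omega> - Z n \<omega>)) \<partial>M)"
      proof (rule integral_cmod_le)
        show "integrable M (\<lambda>\<omega>. iexp (t \<bullet> Y n \<omega>) - iexp (t \<bullet> Z n \<omega>))"
          by (intro Bochner_Integration.integrable_diff ii Y Z)
        show "integrable M (\<lambda>\<omega>. (2 + norm t) * min 1 (norm (Y n \<omega> - Z n \<omega>)))" by (intro integrable_mult_right Ei)
        fix \<omega>
        let ?a = "t \<bullet> (Y n \<omega> - Z n \<omega>)"
        have "iexp (t \<bullet> Y n \<omega>) - iexp (t \<bullet> Z n \<omega>) = iexp (t \<bullet> Z n \<omega>) * (iexp ?a - 1)"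
          by (simp add: inner_diff_right right_diff_distrib flip: exp_add)
        then have eq: "cmod (iexp (t \<bullet> Y n \<omega>) - iexp (t \<bullet> Z n \<omega>)) = cmod (iexp ?a - 1)" by (simp only: norm_mult norm_exp_i_times mult_1)
        have "cmod (iexp ?a - 1) \<le> 2" using norm_triangle_ineq4[of "iexp ?a" 1] by simp
        moreover have "cmod (iexp ?a - 1) \<le> norm t * norm (Y n \<omega> - Z n \<omega>)"
          using iexp_approx1[of ?a 0] Cauchy_Schwarz_ineq2[of t "Y n \<omega> - Z n \<omega>"] by simp
        ultimately show "cmod (iexp (t \<bullet> Y n \<omega>) - iexp (t \<bullet> Z n \<omega>)) \<le> (2 + norm t) * min 1 (norm (Y n \<omega> - Z n \<omega>))"
          unfolding eq by (auto simp: min_def distrib_right intro: order_trans)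
      qed
      then show ?thesis by (simp add: Bochner_Integration.integral_diff[OF ii ii] Y Z)
    qed
    have "(\<lambda>n. (2 + norm t) * ?E n) \<longlonglongrightarrow> 0" using tendsto_mult_right_zero[OF diff] .
    then have "(\<lambda>n. (CLINT \<omega>|M. iexp (t \<bullet> Y n \<omega>)) - (CLINT \<omega>|M. iexp (t \<bullet> Z n \<omega>))) \<longlonglongrightarrow> 0"
      by (rule Lim_null_comparison[rotated]) (use le in auto)
    from tendsto_add[OF this Z_lim[of t]] show ?thesis by simp
  qed
  have tight: "\<exists>R. \<forall>\<^sub>F n in sequentially. measure (distr M borel (Y n)) {x. R < norm x} \<le> e" if e: "e > 0" for e
  proof -
    \<comment> \<open>Chebyshev's radius for the level \<open>e / 2\<close>; the additional 1 keeps
      it positive when \<open>D = 0\<close>.\<close>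
    define R where "R = sqrt (2 * D / e) + 1"
    have R: "R > 0" using D e by (simp add: R_def add_nonneg_pos)
    have "measure (distr M borel (Y n)) {x. R + 1 < norm x} \<le> e / 2 + ?E n" for n
    proof -
      have "measure (distr M borel (Y n)) {x. R + 1 < norm x} = measure M {\<omega>\<in>space M. R + 1 < norm (Y n \<omega>)}"
        by (subst measure_distr) (auto intro!: arg_cong[where f="measure M"])
      also have "\<dots> = (\<integral>\<omega>. indicator {\<omega>\<in>space M. R + 1 < norm (Y n \<omega>)} \<omega> \<partial>M)" by simp
      also have "\<dots> \<le> (\<integral>\<omega>. (1 / R\<^sup>2) * (norm (Z n \<omega>))\<^sup>2 + min 1 (norm (Y n \<omega> - Z n \<omega>)) \<partial>M)"
      proof (rule integral_mono)
        show "integrable M (indicator {\<omega>\<in>space M. R + 1 < norm (Y n \<omega>)} :: 'a \<Rightarrow> real)"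
          by (rule integrable_const_bound[where B=1]) auto
        show "integrable M (\<lambda>\<omega>. (1 / R\<^sup>2) * (norm (Z n \<omega>))\<^sup>2 + min 1 (norm (Y n \<omega> - Z n \<omega>)))"
          by (intro Bochner_Integration.integrable_add integrable_mult_right Z_int Ei)
        fix \<omega> assume "\<omega> \<in> space M"
        have nn: "0 \<le> (1 / R\<^sup>2) * (norm (Z n \<omega>))\<^sup>2" by simp
        show "indicator {\<omega>\<in>space M. R + 1 < norm (Y n \<omega>)} \<omega> \<le> (1 / R\<^sup>2) * (norm (Z n \<omega>))\<^sup>2 + min 1 (norm (Y n \<omega> - Z n \<omega>))"
        proof (cases "R + 1 < norm (Y n \<omega>) \<and> norm (Y n \<omega> - Z n \<omega>) < 1")
          case True
          then have "R \<le> norm (Z n \<omega>)" using norm_triangle_ineq2[of "Y n \<omega>" "Z n \<omega>"] by linarith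
          then have "R\<^sup>2 \<le> (norm (Z n \<omega>))\<^sup>2" using R by (intro power_mono) auto
          then have "1 \<le> (1 / R\<^sup>2) * (norm (Z n \<omega>))\<^sup>2" using R by (simp add: le_divide_eq)
          moreover have "0 \<le> min 1 (norm (Y n \<omega> - Z n \<omega>))" by simp
          moreover have "indicator {\<omega>\<in>space M. R + 1 < norm (Y n \<omega>)} \<omega> \<le> (1::real)" by (simp add: indicator_def)
          ultimately show ?thesis by linarith
        next
          case False
          then show ?thesis using nn norm_ge_zero[of "Y n \<omega> - Z n \<omega>"] by (auto simp: indicator_def min_def simp del: norm_ge_zero)
        qed
      qed
      also have "\<dots> = (1 / R\<^sup>2) * (\<integral>\<omega>. (norm (Z n \<omega>))\<^sup>2 \<partial>M) + ?E n"
        by (subst Bochner_Integration.integral_add) (auto intro!: integrable_mult_right Z_int Ei)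
      also have "(1 / R\<^sup>2) * (\<integral>\<omega>. (norm (Z n \<omega>))\<^sup>2 \<partial>M) \<le> (1 / R\<^sup>2) * D" by (intro mult_left_mono Z_bound) simp
      also have "(1 / R\<^sup>2) * D \<le> e / 2"
      proof -
        have "2 * D / e = (sqrt (2 * D / e))\<^sup>2" using D e by simp
        also have "\<dots> \<le> R\<^sup>2" unfolding R_def using D e by (intro power_mono) auto
        finally have "2 * D \<le> e * R\<^sup>2" using e by (simp add: pos_divide_le_eq mult.commute)
        then show ?thesis using R by (simp add: pos_divide_le_eq)
      qed
      finally show ?thesis by simp
    qed
    moreover have "\<forall>\<^sub>F n in sequentially. ?E n < e / 2" using e by (intro order_tendstoD(2)[OF diff]) auto
    ultimately have "\<forall>\<^sub>F n in sequentially. measure (distr M borel (Y n)) {x. R + 1 < norm x} \<le> e"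
      by (auto elim!: eventually_mono) (smt (verit) field_sum_of_halves)
    then show ?thesis by blast
  qed
  show ?thesis unfolding converges_in_distribution_def
  proof (intro conjI allI impI Y, elim conjE)
    fix f :: "'v \<Rightarrow> real" assume f: "continuous_on UNIV f" "bounded (range f)"
    show "(\<lambda>n. \<integral>x. f x \<partial>distr M borel (Y n)) \<longlonglongrightarrow> (\<integral>x. f x \<partial>N)"
    proof (rule levy_continuity_euclidean[OF _ _ N _ tight f])
      show "prob_space (distr M borel (Y n))" for n by (rule prob_space_distr) simp
      show "(\<lambda>n. CLINT x|distr M borel (Y n). iexp (t \<bullet> x)) \<longlonglongrightarrow> (CLINT x|N. iexp (t \<bullet> x))" for t
        using char[of t] by (simp add: integral_distr)
    qed simp
  qed
qed

context algorithm_gap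
begin

text \<open>The normalised iterate is \<open>s\<close> times \<open>dev / sqrt (n + 1)\<close> with
  \<open>s = sqrt (n / (n + 1)) / T\<close>, and \<open>s\<close> tends to
  \<open>1 / \<gamma>\<close>. So the limit is that of \<open>scaled / \<gamma>\<close>, with
  covariance \<open>V0 / \<gamma>^2\<close>.\<close>

lemma central_limit:
  obtains V N where "covariance_matrix V" "multivariate_normal 0 V N"
    "converges_in_distribution M (\<lambda>n \<omega>. sqrt (real n) *\<^sub>R (muN n \<omega> - \<mu>)) N"
proof -
  have g1: "1 \<le> \<gamma>" by (rule gamma_ge_1)
  obtain V0 where V0: "transpose V0 = V0" "\<And>t. 0 \<le> t \<bullet> (V0 *v t)"
    and cf0: "\<And>t. (\<lambda>n. cf n t) \<longlonglongrightarrow> complex_of_real (exp (- (t \<bullet> (V0 *v t)) / 2))"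
    using cf_limit by blast
  define V where "V = (1 / \<gamma>\<^sup>2) *\<^sub>R V0"
  have Vt: "t \<bullet> (V *v t) = (1 / \<gamma>\<^sup>2) * (t \<bullet> (V0 *v t))" for t
    by (simp add: V_def scaleR_matrix_vector_assoc[symmetric])
  have V: "transpose V = V" "\<And>t. 0 \<le> t \<bullet> (V *v t)"
  proof -
    show "transpose V = V" using V0(1) by (simp add: V_def transpose_def vec_eq_iff)
    show "0 \<le> t \<bullet> (V *v t)" for t using V0(2)[of t] by (simp add: Vt)
  qed
  obtain N where N: "multivariate_normal 0 V N"
    "\<And>t. (CLINT x|N. iexp (t \<bullet> x)) = complex_of_real (exp (- (t \<bullet> (V *v t)) / 2))"
    using multivariate_normal_exists[OF V] by blast
  define Y where "Y n \<omega> = sqrt (real n) *\<^sub>R (muN n \<omega> - \<mu>)" for n \<omega>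
  define Z where "Z n \<omega> = (1 / \<gamma>) *\<^sub>R scaled n \<omega>" for n \<omega>
  have scaled_m [measurable]: "scaled n \<in> borel_measurable M" for n unfolding scaled_def[abs_def] by measurable
  obtain D where D: "0 \<le> D" "\<And>n. integrable M (\<lambda>\<omega>. b (xt n \<omega>) (xt n \<omega>))"
    "\<And>n. (\<integral>\<omega>. b (xt n \<omega>) (xt n \<omega>) \<partial>M) \<le> D * (real n + 1)" using xt_second_moment by blast
  have scaled_sq: "(norm (scaled n \<omega>))\<^sup>2 \<le> (1 / (real n + 1)) * b (xt n \<omega>) (xt n \<omega>)" for n \<omega>
    using inner_form_ge[OF b, of "xt n \<omega>"] by (simp add: scaled_def power_divide divide_right_mono)
  have si: "integrable M (\<lambda>\<omega>. (norm (scaled n \<omega>))\<^sup>2)" for n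
  proof (rule Bochner_Integration.integrable_bound[OF integrable_mult_right[OF D(2)]])
    show "AE \<omega> in M. norm ((norm (scaled n \<omega>))\<^sup>2) \<le> norm (1 / (real n + 1) * b (xt n \<omega>) (xt n \<omega>))"
      by (intro AE_I2) (simp only: real_norm_def abs_power2 order_trans[OF scaled_sq abs_ge_self])
  qed simp
  have sD: "(\<integral>\<omega>. (norm (scaled n \<omega>))\<^sup>2 \<partial>M) \<le> D" for n
  proof -
    have "(\<integral>\<omega>. (norm (scaled n \<omega>))\<^sup>2 \<partial>M) \<le> (\<integral>\<omega>. (1 / (real n + 1)) * b (xt n \<omega>) (xt n \<omega>) \<partial>M)"
      by (intro integral_mono si integrable_mult_right D(2) scaled_sq)
    also have "\<dots> = (1 / (real n + 1)) * (\<integral>\<omega>. b (xt n \<omega>) (xt n \<omega>) \<partial>M)" by simp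
    also have "\<dots> \<le> (1 / (real n + 1)) * (D * (real n + 1))" by (intro mult_left_mono D(3)) simp
    finally show ?thesis by simp
  qed
  \<comment> \<open>Bounds the distance of \<open>s\<close> from \<open>1 / \<gamma>\<close>: the
    rate error, plus \<open>1 / (n + 1)\<close> for the factor
    \<open>sqrt (n / (n + 1))\<close>.\<close>
  define r where "r n \<omega> = rate_err n \<omega> + 1 / (real n + 1)" for n \<omega>
  have r_m [measurable]: "r n \<in> borel_measurable M" for n unfolding r_def[abs_def] by measurable
  have r0: "0 \<le> r n \<omega>" for n \<omega> using rate_err_bounds by (simp add: r_def)
  have r2: "r n \<omega> \<le> 2" for n \<omega>
  proof -
    have "1 / (real n + 1) \<le> 1" by simp
    then show ?thesis using rate_err_bounds(2)[of n \<omega>] unfolding r_def by linarith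
  qed
  have ri: "integrable M (\<lambda>\<omega>. (r n \<omega>)\<^sup>2)" for n
  proof (rule integrable_const_bound[where B="2\<^sup>2"])
    show "AE \<omega> in M. norm ((r n \<omega>)\<^sup>2) \<le> 2\<^sup>2"
      unfolding real_norm_def abs_power2 by (intro AE_I2 power_mono r0 r2)
  qed measurable
  have r_lim: "(\<lambda>n. \<integral>\<omega>. (r n \<omega>)\<^sup>2 \<partial>M) \<longlonglongrightarrow> 0"
  proof -
    have i: "integrable M (\<lambda>\<omega>. (rate_err n \<omega>)\<^sup>2)" for n
      by (rule integrable_const_bound[where B=1]) (auto simp: rate_err_bounds power_le_one)
    have le: "(\<integral>\<omega>. (r n \<omega>)\<^sup>2 \<partial>M) \<le> 2 * (\<integral>\<omega>. (rate_err n \<omega>)\<^sup>2 \<partial>M) + 2 * (1 / (real n + 1))\<^sup>2" for n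
    proof -
      have "(\<integral>\<omega>. (r n \<omega>)\<^sup>2 \<partial>M) \<le> (\<integral>\<omega>. 2 * (rate_err n \<omega>)\<^sup>2 + 2 * (1 / (real n + 1))\<^sup>2 \<partial>M)"
      proof (rule integral_mono[OF ri])
        show "integrable M (\<lambda>\<omega>. 2 * (rate_err n \<omega>)\<^sup>2 + 2 * (1 / (real n + 1))\<^sup>2)"
          by (intro Bochner_Integration.integrable_add integrable_mult_right i) simp
        have "(x + y)\<^sup>2 \<le> 2 * x\<^sup>2 + 2 * y\<^sup>2" for x y :: real
          using sum_squares_bound[of x y] by (simp add: power2_sum)
        then show "(r n \<omega>)\<^sup>2 \<le> 2 * (rate_err n \<omega>)\<^sup>2 + 2 * (1 / (real n + 1))\<^sup>2" for \<omega>
          unfolding r_def by this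
      qed
      also have "\<dots> = 2 * (\<integral>\<omega>. (rate_err n \<omega>)\<^sup>2 \<partial>M) + 2 * (1 / (real n + 1))\<^sup>2"
        by (subst Bochner_Integration.integral_add) (auto intro!: integrable_mult_right i simp: prob_space)
      finally show ?thesis .
    qed
    have "(\<lambda>n. 2 * (1 / (real n + 1))\<^sup>2) \<longlonglongrightarrow> 0" by real_asymp
    then have "(\<lambda>n. 2 * (\<integral>\<omega>. (rate_err n \<omega>)\<^sup>2 \<partial>M) + 2 * (1 / (real n + 1))\<^sup>2) \<longlonglongrightarrow> 2 * 0 + 0"
      by (intro tendsto_add tendsto_mult_left rate_err_square_tendsto_0)
    then have lim: "(\<lambda>n. 2 * (\<integral>\<omega>. (rate_err n \<omega>)\<^sup>2 \<partial>M) + 2 * (1 / (real n + 1))\<^sup>2) \<longlonglongrightarrow> 0" by simp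
    have nn: "0 \<le> (\<integral>\<omega>. (r n \<omega>)\<^sup>2 \<partial>M)" for n by (intro integral_nonneg_AE AE_I2) simp
    show ?thesis
      by (rule tendsto_sandwich[OF always_eventually always_eventually tendsto_const lim]) (intro allI nn le)+
  qed
  let ?d = "\<lambda>n \<omega>. min 1 (norm (dev n \<omega> - xt n \<omega>) / sqrt (real n + 1))"
  have di: "integrable M (?d n)" for n by (rule integrable_const_bound[where B=1]) auto
  have pi: "integrable M (\<lambda>\<omega>. r n \<omega> * norm (scaled n \<omega>))" for n
    by (rule integrable_mult_L2[OF _ _ ri si]) measurable
  have close: "AE \<omega> in M. min 1 (norm (Y n \<omega> - Z n \<omega>)) \<le> ?d n \<omega> + r n \<omega> * norm (scaled n \<omega>)" for n
    using AE_tau_ge_1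
  proof eventually_elim
    case (elim \<omega>)
    define q where "q = sqrt (real n / (real n + 1))"
    define s where "s = q / TN n \<omega>"
    have T1: "1 \<le> TN n \<omega>" using SN_ge_Suc[OF elim, of n] by (simp add: iterate_eq(2))
    have q: "real n / (real n + 1) \<le> q" "q \<le> 1" "0 \<le> q"
    proof -
      have "(real n / (real n + 1))\<^sup>2 \<le> real n / (real n + 1)"
        unfolding power2_eq_square by (intro mult_left_le_one_le) auto
      then show "real n / (real n + 1) \<le> q" unfolding q_def by (intro real_le_rsqrt)
    qed (auto simp: q_def)
    have s: "0 \<le> s" "s \<le> 1" using q T1 by (auto simp: s_def divide_le_eq)
    have "\<bar>s - 1 / \<gamma>\<bar> \<le> r n \<omega>"
    proof -
      have "s - 1 / \<gamma> = (1 / TN n \<omega> - 1 / \<gamma>) - (1 - q) * (1 / TN n \<omega>)" by (simp add: s_def diff_divide_distrib)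
      moreover have "0 \<le> (1 - q) * (1 / TN n \<omega>)" using q T1 by simp
      moreover have "(1 - q) * (1 / TN n \<omega>) \<le> (1 - q) * 1" using q T1 by (intro mult_left_mono) auto
      moreover have "1 - q \<le> 1 / (real n + 1)"
      proof -
        have "1 - real n / (real n + 1) = 1 / (real n + 1)" by (simp add: field_simps)
        then show ?thesis using q(1) by linarith
      qed
      moreover have "\<bar>x - p\<bar> \<le> \<bar>x\<bar> + w" if "0 \<le> p" "p \<le> v * 1" "v \<le> w" for x p v w :: real using that by linarith
      ultimately show ?thesis unfolding r_def rate_err_eq[OF elim] by presburger
    qed
    then have sg: "\<bar>s - 1 / \<gamma>\<bar> * norm (scaled n \<omega>) \<le> r n \<omega> * norm (scaled n \<omega>)" by (intro mult_right_mono) auto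
    let ?v = "(1 / sqrt (real n + 1)) *\<^sub>R (dev n \<omega> - xt n \<omega>)"
    have "Y n \<omega> = s *\<^sub>R ((1 / sqrt (real n + 1)) *\<^sub>R dev n \<omega>)"
    proof -
      have "s * (1 / sqrt (real n + 1)) * SN n \<omega> = sqrt (real n)"
      proof -
        have S: "SN n \<omega> = (sqrt (real n + 1) * sqrt (real n + 1)) * TN n \<omega>" by (simp add: iterate_eq(2))
        have "a / w / T * (1 / w) * (w * w * T) = a" if "w > 0" "T > 0" for a w T :: real using that by simp
        from this[of "sqrt (real n + 1)" "TN n \<omega>" "sqrt (real n)"] show ?thesis
          unfolding S s_def q_def real_sqrt_divide using T1 by simp
      qed
      then show ?thesis unfolding Y_def dev_eq by (simp only: scaleR_scaleR mult.assoc)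
    qed
    then have "Y n \<omega> - Z n \<omega> = s *\<^sub>R ?v + (s - 1 / \<gamma>) *\<^sub>R scaled n \<omega>"
      unfolding Z_def scaled_def by (simp only: scaleR_diff_right scaleR_diff_left) simp
    then have "norm (Y n \<omega> - Z n \<omega>) \<le> \<bar>s\<bar> * norm ?v + \<bar>s - 1 / \<gamma>\<bar> * norm (scaled n \<omega>)"
      by (metis norm_scaleR norm_triangle_ineq)
    also have "\<bar>s\<bar> * norm ?v \<le> 1 * norm ?v" using s by (intro mult_right_mono) auto
    also have "1 * norm ?v = norm (dev n \<omega> - xt n \<omega>) / sqrt (real n + 1)" by simp
    finally have "norm (Y n \<omega> - Z n \<omega>) \<le> norm (dev n \<omega> - xt n \<omega>) / sqrt (real n + 1) + r n \<omega> * norm (scaled n \<omega>)"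
      using sg by linarith
    moreover have "0 \<le> r n \<omega> * norm (scaled n \<omega>)" using r0 by simp
    ultimately show ?case by linarith
  qed
  have Y_m [measurable]: "Y n \<in> borel_measurable M" for n unfolding Y_def[abs_def] by measurable
  have Z_m [measurable]: "Z n \<in> borel_measurable M" for n unfolding Z_def[abs_def] by measurable
  have "converges_in_distribution M Y N"
  proof (rule converges_in_distribution_perturbed[OF Y_m Z_m])
    show "prob_space N" "sets N = sets borel" using N(1) by (auto simp: multivariate_normal_def)
    have Zsq: "(norm (Z n \<omega>))\<^sup>2 = (1 / \<gamma>)\<^sup>2 * (norm (scaled n \<omega>))\<^sup>2" for n \<omega> by (simp add: Z_def power_divide)
    show "integrable M (\<lambda>\<omega>. (norm (Z n \<omega>))\<^sup>2)" for n unfolding Zsq by (intro integrable_mult_right si)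
    show "(\<integral>\<omega>. (norm (Z n \<omega>))\<^sup>2 \<partial>M) \<le> (1 / \<gamma>)\<^sup>2 * D" for n
      unfolding Zsq integral_mult_right_zero by (intro mult_left_mono sD) simp
    show "(\<lambda>n. CLINT \<omega>|M. iexp (t \<bullet> Z n \<omega>)) \<longlonglongrightarrow> (CLINT x|N. iexp (t \<bullet> x))" for t
    proof -
      have "(CLINT \<omega>|M. iexp (t \<bullet> Z n \<omega>)) = cf n ((1 / \<gamma>) *\<^sub>R t)" for n by (simp add: cf_def Z_def)
      moreover have "((1 / \<gamma>) *\<^sub>R t) \<bullet> (V0 *v ((1 / \<gamma>) *\<^sub>R t)) = t \<bullet> (V *v t)"
        unfolding Vt by (simp add: matrix_vector_mult_scaleR power2_eq_square)
      ultimately show ?thesis using cf0[of "(1 / \<gamma>) *\<^sub>R t"] by (simp only: N(2))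
    qed
    have le: "(\<integral>\<omega>. min 1 (norm (Y n \<omega> - Z n \<omega>)) \<partial>M) \<le> (\<integral>\<omega>. ?d n \<omega> \<partial>M) + sqrt (\<integral>\<omega>. (r n \<omega>)\<^sup>2 \<partial>M) * sqrt D" for n
    proof -
      have "(\<integral>\<omega>. min 1 (norm (Y n \<omega> - Z n \<omega>)) \<partial>M) \<le> (\<integral>\<omega>. ?d n \<omega> + r n \<omega> * norm (scaled n \<omega>) \<partial>M)"
        by (intro integral_mono_AE close Bochner_Integration.integrable_add di pi) (auto intro!: integrable_const_bound[where B=1])
      also have "\<dots> = (\<integral>\<omega>. ?d n \<omega> \<partial>M) + (\<integral>\<omega>. r n \<omega> * norm (scaled n \<omega>) \<partial>M)"
        by (rule Bochner_Integration.integral_add[OF di pi])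
      also have "(\<integral>\<omega>. r n \<omega> * norm (scaled n \<omega>) \<partial>M) \<le> sqrt (\<integral>\<omega>. (r n \<omega>)\<^sup>2 \<partial>M) * sqrt (\<integral>\<omega>. (norm (scaled n \<omega>))\<^sup>2 \<partial>M)"
        by (rule expectation_mult_le_sqrt[OF _ _ ri si]) measurable
      also have "\<dots> \<le> sqrt (\<integral>\<omega>. (r n \<omega>)\<^sup>2 \<partial>M) * sqrt D"
        by (intro mult_left_mono real_sqrt_le_mono sD) (auto intro!: integral_nonneg_AE)
      finally show ?thesis by simp
    qed
    have "(\<lambda>n. (\<integral>\<omega>. ?d n \<omega> \<partial>M) + sqrt (\<integral>\<omega>. (r n \<omega>)\<^sup>2 \<partial>M) * sqrt D) \<longlonglongrightarrow> 0 + sqrt 0 * sqrt D"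
      by (intro tendsto_intros dev_xt_tendsto_0 r_lim)
    then have lim: "(\<lambda>n. (\<integral>\<omega>. ?d n \<omega> \<partial>M) + sqrt (\<integral>\<omega>. (r n \<omega>)\<^sup>2 \<partial>M) * sqrt D) \<longlonglongrightarrow> 0" by simp
    have nn: "0 \<le> (\<integral>\<omega>. min 1 (norm (Y n \<omega> - Z n \<omega>)) \<partial>M)" for n by (intro integral_nonneg_AE AE_I2) simp
    show "(\<lambda>n. \<integral>\<omega>. min 1 (norm (Y n \<omega> - Z n \<omega>)) \<partial>M) \<longlonglongrightarrow> 0"
      by (rule tendsto_sandwich[OF always_eventually always_eventually tendsto_const lim]) (intro allI nn le)+
  qed
  moreover have "covariance_matrix V" using V by (simp add: covariance_matrix_def)
  ultimately show ?thesis using N(1) that unfolding Y_def[abs_def] by blast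
qed

end

theorem theorem3:
  fixes P :: "real^('t::finite + 'a::finite)^('t + 'a)"
    and \<mu>0 :: "real^'t" and T0 :: real
  assumes "irreducible_absorbing_chain P" and "prob_vector \<mu>0" and "T0 \<ge> 1"
  shows "let Q = transient_block P in \<exists>\<mu> lam.
    quasi_stationary Q \<mu> lam \<and>
    (\<forall>\<nu> \<kappa>. quasi_stationary Q \<nu> \<kappa> \<longrightarrow> \<nu> = \<mu> \<and> \<kappa> = lam) \<and>
    (\<forall>(M :: 'w measure) X. algorithm_run P \<mu>0 T0 M X \<longrightarrow>
      (AE \<omega> in M. (\<lambda>n. iterate (\<lambda>j k. X j k \<omega>) \<mu>0 T0 n) \<longlonglongrightarrow> (\<mu>, 1 / (1 - lam))) \<and>
      ((\<forall>z. complex_eigenvalue Q z \<and> z \<noteq> complex_of_real (principal_eigenvalue Q) \<longrightarrow>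
            Re (1 / (1 - z)) < 1 / 2 * (1 / (1 - principal_eigenvalue Q))) \<longrightarrow>
        (\<exists>V N. covariance_matrix V \<and> multivariate_normal 0 V N \<and>
          converges_in_distribution M
            (\<lambda>n \<omega>. sqrt (real n) *\<^sub>R (fst (iterate (\<lambda>j k. X j k \<omega>) \<mu>0 T0 n) - \<mu>)) N)))"
proof -
  define Q where "Q = transient_block P"
  have P: "0 \<le> P $ i $ j" "(\<Sum>j\<in>UNIV. P $ i $ j) = 1" for i j
    using assms(1) by (auto simp: irreducible_absorbing_chain_def stochastic_matrix_def)
  have le1: "(\<Sum>y\<in>UNIV. Q $ x $ y) \<le> 1" for x
  proof -
    have "(\<Sum>y\<in>UNIV. Q $ x $ y) = (\<Sum>j\<in>range Inl. P $ Inl x $ j)"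
      by (simp add: sum.reindex Q_def transient_block_def)
    also have "\<dots> \<le> (\<Sum>j\<in>UNIV. P $ Inl x $ j)" by (rule sum_mono2) (auto simp: P)
    finally show ?thesis by (simp add: P)
  qed
  obtain \<mu> u lam where k: "killed_chain Q \<mu> u lam"
    by (rule killed_chain_exists[of Q])
      (use assms(1) le1 P in \<open>auto simp: Q_def irreducible_absorbing_chain_def transient_block_def\<close>)
  \<comment> \<open>\<open>\<mu>\<close>, \<open>u\<close> and \<open>lam\<close> depend on
    \<open>P\<close> alone; runs and their probability spaces are introduced afterwards, so one pair
    serves them all.\<close>
  interpret killed_chain Q \<mu> u lam by (rule k)
  have run: "(AE \<omega> in M. (\<lambda>n. iterate (\<lambda>j k. X j k \<omega>) \<mu>0 T0 n) \<longlonglongrightarrow> (\<mu>, 1 / (1 - lam))) \<and>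
      ((\<forall>z. complex_eigenvalue Q z \<and> z \<noteq> complex_of_real (principal_eigenvalue Q) \<longrightarrow>
            Re (1 / (1 - z)) < 1 / 2 * (1 / (1 - principal_eigenvalue Q))) \<longrightarrow>
        (\<exists>V N. covariance_matrix V \<and> multivariate_normal 0 V N \<and>
          converges_in_distribution M
            (\<lambda>n \<omega>. sqrt (real n) *\<^sub>R (fst (iterate (\<lambda>j k. X j k \<omega>) \<mu>0 T0 n) - \<mu>)) N))"
    if r: "algorithm_run P \<mu>0 T0 M X" for M :: "'w measure" and X
  proof -
    interpret prob_space M using r by (simp add: algorithm_run_def)
    interpret algorithm Q \<mu> u lam M P \<mu>0 T0 X
      by unfold_locales (use assms r Q_def in auto)
    have it: "iterate (\<lambda>j k. X j k \<omega>) \<mu>0 T0 n = (muN n \<omega>, TN n \<omega>)" for n \<omega>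
      by (simp add: muN_def TN_def)
    show ?thesis
    proof (intro conjI impI)
      show "AE \<omega> in M. (\<lambda>n. iterate (\<lambda>j k. X j k \<omega>) \<mu>0 T0 n) \<longlonglongrightarrow> (\<mu>, 1 / (1 - lam))"
        using AE_muN_limit AE_T_limit[OF AE_muN_limit]
        by eventually_elim (simp add: it tendsto_Pair flip: \<gamma>_def)
      assume gap: "\<forall>z. complex_eigenvalue Q z \<and> z \<noteq> complex_of_real (principal_eigenvalue Q) \<longrightarrow>
            Re (1 / (1 - z)) < 1 / 2 * (1 / (1 - principal_eigenvalue Q))"
      have "Re (1 / (1 - z)) < \<gamma> / 2" if "complex_eigenvalue Q z" "z \<noteq> complex_of_real lam" for z
        using gap that by (simp add: principal_eigenvalue_eq \<gamma>_def algebra_simps)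
      then obtain b b' \<kappa> where f: "inner_form b" "inner_form b'" "\<kappa> < \<gamma> / 2" "0 \<le> \<kappa>"
        "\<And>x. b (x v* K) x \<le> \<kappa> * b x x" "\<And>x. b' (K *v x) x \<le> \<kappa> * b' x x"
        using K_forms_half by blast
      interpret algorithm_gap Q \<mu> u lam M P \<mu>0 T0 X b b' \<kappa>
        by unfold_locales (use f in auto)
      show "\<exists>V N. covariance_matrix V \<and> multivariate_normal 0 V N \<and>
          converges_in_distribution M
            (\<lambda>n \<omega>. sqrt (real n) *\<^sub>R (fst (iterate (\<lambda>j k. X j k \<omega>) \<mu>0 T0 n) - \<mu>)) N"
        using central_limit unfolding it fst_conv by blast
    qed
  qed
  have qs: "quasi_stationary Q \<mu> lam" using mu_prob mu_Q by (simp add: quasi_stationary_def)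
  show ?thesis unfolding Let_def Q_def[symmetric]
    by (intro exI[of _ \<mu>] exI[of _ lam] conjI allI impI qs run[THEN conjunct1] run[THEN conjunct2, rule_format])
       (use quasi_stationary_unique in auto)
qed

end
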